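(* Let $q\in\mathbb C^\times$ be not a root of unity. Let $\mathscr U$ be a non-principal ultrafilter on $\mathbb N$ and let $(K_k,q_k,\varkappa_k)_{k\in\mathbb N}$ together with a field isomorphism $\prod_{\mathscr U}K_k\cong\mathbb C$ be approximating data for $q$. Let $\mathcal A_\infty(q)$ be the full subcategory of $\prod_{\mathscr U}\mathcal A_{\varkappa_k-1}(K_k)$ generated by the object $X_1=\operatorname{ulim}_{k}L_1$ under tensor products, direct sums and direct summands. Then there exists a monoidal equivalence $E:\mathbf{TL}(q;\mathbb C)\to\mathcal A_\infty(q)$.
   Context: Temperley--Lieb category. For an algebraically closed field $K$ and $q\in K^\times$ put $[2]_q=q+q^{-1}$. Let $\widetilde{\mathbf{TL}}(q;K)$ be the strict $K$-linear monoidal category with objects $\underline 0,\underline 1,\underline 2,\dots$, $\underline m\otimes\underline n=\underline{m+n}$, unit $\underline 0$, whose morphisms are generated by $\mathrm{cup}:\underline 0\to\underline 2$ and $\mathrm{cap}:\underline 2\to\underline 0$ subject to $(\mathrm{cap}\otimes\mathrm{id}_{\underline 1})(\mathrm{id}_{\underline 1}\otimes\mathrm{cup})=\mathrm{id}_{\underline 1}=(\mathrm{id}_{\underline 1}\otimes\mathrm{cap})(\mathrm{cup}\otimes\mathrm{id}_{\underline 1})$ and $\mathrm{cap}\circ\mathrm{cup}=-[2]_q\,\mathrm{id}_{\underline 0}$. $\mathbf{TL}(q;K)$ is its Cauchy completion (formally adjoin finite direct sums, then split idempotents). It is spherical, with $\underline 1$ self-dual via $\mathrm{cup},\mathrm{cap}$.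 Put $T_0=\underline 0$, $T_1=\underline 1$, and for $n\ge2$ let $T_n$ be the unique indecomposable summand of $\underline n$ that is not a summand of $\underline{n-2}$. Fusion quotients. Let $\varkappa\ge3$ be an integer, $K$ algebraically closed with $\operatorname{char}K\ne2$, and $q$ a primitive root of unity of order $2\varkappa$ in $K$. $\mathcal A_{\varkappa-1}(K)$ is the semisimplification of $\mathbf{TL}(q;K)$, i.e. its quotient by the tensor ideal of negligible morphisms (those $f:X\to Y$ with $\operatorname{Tr}(g\circ f)=0$ for all $g:Y\to X$, where $\operatorname{Tr}$ is the quantum trace). It is a fusion category with simple objects $L_n$ = image of $T_n$, $0\le n\le\varkappa-2$. Ultraproducts. For sets $A_k$, $\prod_{\mathscr U}A_k$ is the product $\prod_kA_k$ modulo equality on a set of indices in $\mathscr U$; the class of $(a_k)$ is $\operatorname{ulim}_k a_k$. The ultraproduct of small monoidal categories has as objects and morphisms the classes of sequences of objects and morphisms, with all structure defined termwise; if the $k$-th category is $K_k$-linear, the ultraproduct is $(\prod_{\mathscr U}K_k)$-linear. Approximating data for $q$. If $q$ is transcendental over $\mathbb Q$: $K_k=\mathbb C$. If $q$ is algebraic: $K_k=\overline{\mathbb F}_{p_k}$ for pairwise distinct primes $p_k$. In both cases $q_k\in K_k$ is a root of unity of order $2\varkappa_k$ with $\varkappa_k\ge 3$ and $\varkappa_k\to\infty$, and the isomorphism $\prod_{\mathscr U}K_k\cong\mathbb C$ sends $\operatorname{ulim}_kq_k$ to $q$. $\mathcal A_{\varkappa_k-1}(K_k)$ is formed using $q_k$,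 and $\prod_{\mathscr U}\mathcal A_{\varkappa_k-1}(K_k)$ is regarded as $\mathbb C$-linear through the chosen isomorphism. *)

theory Defs
  imports "HOL-Algebra.Algebra" "HOL-Algebra.Algebraic_Closure_Type" Complex_Main
begin

no_notation Polynomials.var (\<open>X\<index>\<close>)

section \<open>Linear strict monoidal categories\<close>

text \<open>
  All monoidal categories below are strict: the diagrammatic Temperley--Lieb category is strict by
  definition, and its Cauchy completion (with lexicographically ordered tensor products of finite
  families), quotients by tensor ideals, ultraproducts and full monoidal subcategories inherit
  strictness.  The fields only matter on objects and on morphisms between objects;
  \<open>Comp C g f\<close> is "g after f".
\<close>

record ('k, 'o, 'm) lmcat =
  Ob :: "'o set"
  Hom :: "'o \<Rightarrow> 'o \<Rightarrow> 'm set"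
  Id :: "'o \<Rightarrow> 'm"
  Comp :: "'m \<Rightarrow> 'm \<Rightarrow> 'm" (infixl \<open>\<cdot>\<index>\<close> 70)
  Unt :: "'o"
  TOb :: "'o \<Rightarrow> 'o \<Rightarrow> 'o"
  TMor :: "'m \<Rightarrow> 'm \<Rightarrow> 'm" (infixl \<open>\<boxtimes>\<index>\<close> 75)
  HZero :: "'o \<Rightarrow> 'o \<Rightarrow> 'm"
  HAdd :: "'m \<Rightarrow> 'm \<Rightarrow> 'm"
  Scal :: "'k \<Rightarrow> 'm \<Rightarrow> 'm"

definition Arr :: "('k, 'o, 'm, 'z) lmcat_scheme \<Rightarrow> 'm set" where
  "Arr C = (\<Union>X\<in>Ob C. \<Union>Y\<in>Ob C. Hom C X Y)"

text \<open>The multiplicative fields of the module record are irrelevant for modules.\<close>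

definition hom_module :: "('k, 'o, 'm, 'z) lmcat_scheme \<Rightarrow> 'o \<Rightarrow> 'o \<Rightarrow> ('k, 'm) module" where
  "hom_module C X Y =
    \<lparr> carrier = Hom C X Y, monoid.mult = (\<lambda>_ _. undefined), one = undefined,
      ring.zero = HZero C X Y, add = HAdd C, module.smult = Scal C \<rparr>"

locale linear_monoidal_category =
  fixes R :: "('k, 'r) ring_scheme" and C :: "('k, 'o, 'm, 'z) lmcat_scheme"
  assumes unt_ob: "Unt C \<in> Ob C"
    and tob_ob: "\<lbrakk>X \<in> Ob C; Y \<in> Ob C\<rbrakk> \<Longrightarrow> TOb C X Y \<in> Ob C"
    and tob_assoc: "\<lbrakk>X \<in> Ob C; Y \<in> Ob C; Z \<in> Ob C\<rbrakk>
        \<Longrightarrow> TOb C (TOb C X Y) Z = TOb C X (TOb C Y Z)"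
    and tob_unt: "X \<in> Ob C \<Longrightarrow> TOb C (Unt C) X = X" "X \<in> Ob C \<Longrightarrow> TOb C X (Unt C) = X"
    and id_hom: "X \<in> Ob C \<Longrightarrow> Id C X \<in> Hom C X X"
    and comp_hom: "\<lbrakk>X \<in> Ob C; Y \<in> Ob C; Z \<in> Ob C; f \<in> Hom C X Y; g \<in> Hom C Y Z\<rbrakk>
        \<Longrightarrow> g \<cdot>\<^bsub>C\<^esub> f \<in> Hom C X Z"
    and comp_id: "\<lbrakk>X \<in> Ob C; Y \<in> Ob C; f \<in> Hom C X Y\<rbrakk> \<Longrightarrow> f \<cdot>\<^bsub>C\<^esub> Id C X = f"
        "\<lbrakk>X \<in> Ob C; Y \<in> Ob C; f \<in> Hom C X Y\<rbrakk> \<Longrightarrow> Id C Y \<cdot>\<^bsub>C\<^esub> f = f"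
    and comp_assoc: "\<lbrakk>W \<in> Ob C; X \<in> Ob C; Y \<in> Ob C; Z \<in> Ob C;
          f \<in> Hom C W X; g \<in> Hom C X Y; h \<in> Hom C Y Z\<rbrakk>
        \<Longrightarrow> h \<cdot>\<^bsub>C\<^esub> g \<cdot>\<^bsub>C\<^esub> f = h \<cdot>\<^bsub>C\<^esub> (g \<cdot>\<^bsub>C\<^esub> f)"
    and tmor_hom: "\<lbrakk>X \<in> Ob C; Y \<in> Ob C; X' \<in> Ob C; Y' \<in> Ob C; f \<in> Hom C X Y; f' \<in> Hom C X' Y'\<rbrakk>
        \<Longrightarrow> f \<boxtimes>\<^bsub>C\<^esub> f' \<in> Hom C (TOb C X X') (TOb C Y Y')"
    and tmor_id: "\<lbrakk>X \<in> Ob C; Y \<in> Ob C\<rbrakk> \<Longrightarrow> Id C X \<boxtimes>\<^bsub>C\<^esub> Id C Y = Id C (TOb C X Y)"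
    and interchange: "\<lbrakk>X \<in> Ob C; Y \<in> Ob C; Z \<in> Ob C; X' \<in> Ob C; Y' \<in> Ob C; Z' \<in> Ob C;
          f \<in> Hom C X Y; g \<in> Hom C Y Z; f' \<in> Hom C X' Y'; g' \<in> Hom C Y' Z'\<rbrakk>
        \<Longrightarrow> (g \<cdot>\<^bsub>C\<^esub> f) \<boxtimes>\<^bsub>C\<^esub> (g' \<cdot>\<^bsub>C\<^esub> f') = (g \<boxtimes>\<^bsub>C\<^esub> g') \<cdot>\<^bsub>C\<^esub> (f \<boxtimes>\<^bsub>C\<^esub> f')"
    and tmor_assoc: "\<lbrakk>X \<in> Ob C; Y \<in> Ob C; X' \<in> Ob C; Y' \<in> Ob C; X'' \<in> Ob C; Y'' \<in> Ob C;
          f \<in> Hom C X Y; f' \<in> Hom C X' Y'; f'' \<in> Hom C X'' Y''\<rbrakk>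
        \<Longrightarrow> f \<boxtimes>\<^bsub>C\<^esub> f' \<boxtimes>\<^bsub>C\<^esub> f'' = f \<boxtimes>\<^bsub>C\<^esub> (f' \<boxtimes>\<^bsub>C\<^esub> f'')"
    and tmor_unt: "\<lbrakk>X \<in> Ob C; Y \<in> Ob C; f \<in> Hom C X Y\<rbrakk> \<Longrightarrow> Id C (Unt C) \<boxtimes>\<^bsub>C\<^esub> f = f"
        "\<lbrakk>X \<in> Ob C; Y \<in> Ob C; f \<in> Hom C X Y\<rbrakk> \<Longrightarrow> f \<boxtimes>\<^bsub>C\<^esub> Id C (Unt C) = f"
    and hom_is_module: "\<lbrakk>X \<in> Ob C; Y \<in> Ob C\<rbrakk> \<Longrightarrow> module R (hom_module C X Y)"
    and comp_add: "\<lbrakk>X \<in> Ob C; Y \<in> Ob C; Z \<in> Ob C; f \<in> Hom C X Y; f' \<in> Hom C X Y; g \<in> Hom C Y Z\<rbrakk>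
        \<Longrightarrow> g \<cdot>\<^bsub>C\<^esub> HAdd C f f' = HAdd C (g \<cdot>\<^bsub>C\<^esub> f) (g \<cdot>\<^bsub>C\<^esub> f')"
        "\<lbrakk>X \<in> Ob C; Y \<in> Ob C; Z \<in> Ob C; f \<in> Hom C X Y; g \<in> Hom C Y Z; g' \<in> Hom C Y Z\<rbrakk>
        \<Longrightarrow> HAdd C g g' \<cdot>\<^bsub>C\<^esub> f = HAdd C (g \<cdot>\<^bsub>C\<^esub> f) (g' \<cdot>\<^bsub>C\<^esub> f)"
    and comp_scal: "\<lbrakk>X \<in> Ob C; Y \<in> Ob C; Z \<in> Ob C; c \<in> carrier R; f \<in> Hom C X Y; g \<in> Hom C Y Z\<rbrakk>
        \<Longrightarrow> g \<cdot>\<^bsub>C\<^esub> Scal C c f = Scal C c (g \<cdot>\<^bsub>C\<^esub> f)"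
        "\<lbrakk>X \<in> Ob C; Y \<in> Ob C; Z \<in> Ob C; c \<in> carrier R; f \<in> Hom C X Y; g \<in> Hom C Y Z\<rbrakk>
        \<Longrightarrow> Scal C c g \<cdot>\<^bsub>C\<^esub> f = Scal C c (g \<cdot>\<^bsub>C\<^esub> f)"
    and tmor_add: "\<lbrakk>X \<in> Ob C; Y \<in> Ob C; X' \<in> Ob C; Y' \<in> Ob C;
          f \<in> Hom C X Y; g \<in> Hom C X' Y'; g' \<in> Hom C X' Y'\<rbrakk>
        \<Longrightarrow> f \<boxtimes>\<^bsub>C\<^esub> HAdd C g g' = HAdd C (f \<boxtimes>\<^bsub>C\<^esub> g) (f \<boxtimes>\<^bsub>C\<^esub> g')"
        "\<lbrakk>X \<in> Ob C; Y \<in> Ob C; X' \<in> Ob C; Y' \<in> Ob C;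
          f \<in> Hom C X Y; f' \<in> Hom C X Y; g \<in> Hom C X' Y'\<rbrakk>
        \<Longrightarrow> HAdd C f f' \<boxtimes>\<^bsub>C\<^esub> g = HAdd C (f \<boxtimes>\<^bsub>C\<^esub> g) (f' \<boxtimes>\<^bsub>C\<^esub> g)"
    and tmor_scal: "\<lbrakk>X \<in> Ob C; Y \<in> Ob C; X' \<in> Ob C; Y' \<in> Ob C;
          c \<in> carrier R; f \<in> Hom C X Y; g \<in> Hom C X' Y'\<rbrakk>
        \<Longrightarrow> f \<boxtimes>\<^bsub>C\<^esub> Scal C c g = Scal C c (f \<boxtimes>\<^bsub>C\<^esub> g)"
        "\<lbrakk>X \<in> Ob C; Y \<in> Ob C; X' \<in> Ob C; Y' \<in> Ob C;
          c \<in> carrier R; f \<in> Hom C X Y; g \<in> Hom C X' Y'\<rbrakk>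
        \<Longrightarrow> Scal C c f \<boxtimes>\<^bsub>C\<^esub> g = Scal C c (f \<boxtimes>\<^bsub>C\<^esub> g)"


section \<open>Functors and monoidal equivalences\<close>

definition is_iso :: "('k, 'o, 'm, 'z) lmcat_scheme \<Rightarrow> 'o \<Rightarrow> 'o \<Rightarrow> 'm \<Rightarrow> bool" where
  "is_iso C X Y f \<longleftrightarrow> f \<in> Hom C X Y \<and>
     (\<exists>g\<in>Hom C Y X. g \<cdot>\<^bsub>C\<^esub> f = Id C X \<and> f \<cdot>\<^bsub>C\<^esub> g = Id C Y)"

text \<open>A functor is given by its actions \<open>F\<close> on objects and \<open>M\<close> on morphisms.\<close>

definition is_functor ::
  "('k, 'o, 'm, 'y) lmcat_scheme \<Rightarrow> ('l, 'p, 'n, 'z) lmcat_scheme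
    \<Rightarrow> ('o \<Rightarrow> 'p) \<Rightarrow> ('m \<Rightarrow> 'n) \<Rightarrow> bool" where
  "is_functor C D F M \<longleftrightarrow>
     (\<forall>X\<in>Ob C. F X \<in> Ob D) \<and>
     (\<forall>X\<in>Ob C. \<forall>Y\<in>Ob C. \<forall>f\<in>Hom C X Y. M f \<in> Hom D (F X) (F Y)) \<and>
     (\<forall>X\<in>Ob C. M (Id C X) = Id D (F X)) \<and>
     (\<forall>X\<in>Ob C. \<forall>Y\<in>Ob C. \<forall>Z\<in>Ob C. \<forall>f\<in>Hom C X Y. \<forall>g\<in>Hom C Y Z.
        M (g \<cdot>\<^bsub>C\<^esub> f) = M g \<cdot>\<^bsub>D\<^esub> M f)"

definition is_linear ::
  "('k, 'r) ring_scheme \<Rightarrow> ('k, 'o, 'm, 'y) lmcat_scheme \<Rightarrow> ('k, 'p, 'n, 'z) lmcat_scheme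
    \<Rightarrow> ('m \<Rightarrow> 'n) \<Rightarrow> bool" where
  "is_linear R C D M \<longleftrightarrow>
     (\<forall>X\<in>Ob C. \<forall>Y\<in>Ob C. \<forall>f\<in>Hom C X Y. \<forall>g\<in>Hom C X Y.
        M (HAdd C f g) = HAdd D (M f) (M g)) \<and>
     (\<forall>X\<in>Ob C. \<forall>Y\<in>Ob C. \<forall>c\<in>carrier R. \<forall>f\<in>Hom C X Y.
        M (Scal C c f) = Scal D c (M f))"

definition natural_iso ::
  "('k, 'o, 'm, 'y) lmcat_scheme \<Rightarrow> ('l, 'p, 'n, 'z) lmcat_scheme
    \<Rightarrow> ('o \<Rightarrow> 'p) \<Rightarrow> ('m \<Rightarrow> 'n) \<Rightarrow> ('o \<Rightarrow> 'p) \<Rightarrow> ('m \<Rightarrow> 'n) \<Rightarrow> ('o \<Rightarrow> 'n) \<Rightarrow> bool" where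
  "natural_iso C D F M F' M' \<eta> \<longleftrightarrow>
     (\<forall>X\<in>Ob C. is_iso D (F X) (F' X) (\<eta> X)) \<and>
     (\<forall>X\<in>Ob C. \<forall>Y\<in>Ob C. \<forall>f\<in>Hom C X Y. \<eta> Y \<cdot>\<^bsub>D\<^esub> M f = M' f \<cdot>\<^bsub>D\<^esub> \<eta> X)"

definition is_equivalence ::
  "('k, 'o, 'm, 'y) lmcat_scheme \<Rightarrow> ('l, 'p, 'n, 'z) lmcat_scheme
    \<Rightarrow> ('o \<Rightarrow> 'p) \<Rightarrow> ('m \<Rightarrow> 'n) \<Rightarrow> bool" where
  "is_equivalence C D F M \<longleftrightarrow> is_functor C D F M \<and>
     (\<exists>G N \<eta> \<epsilon>. is_functor D C G N \<and>
        natural_iso C C id id (G \<circ> F) (N \<circ> M) \<eta> \<and>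
        natural_iso D D (F \<circ> G) (M \<circ> N) id id \<epsilon>)"

text \<open>
  A (strong) monoidal functor carries coherent isomorphisms
  \<open>J X Y : F X \<otimes> F Y \<rightarrow> F (X \<otimes> Y)\<close> and \<open>u : 1 \<rightarrow> F 1\<close>;
  by strictness, associators and unitors in the coherence diagrams are identities.
\<close>

record ('o, 'm, 'p, 'n) monfun =
  FOb :: "'o \<Rightarrow> 'p"
  FMor :: "'m \<Rightarrow> 'n"
  FTens :: "'o \<Rightarrow> 'o \<Rightarrow> 'n"
  FUnt :: "'n"

definition monoidal_functor ::
  "('k, 'r) ring_scheme \<Rightarrow> ('k, 'o, 'm, 'y) lmcat_scheme \<Rightarrow> ('k, 'p, 'n, 'z) lmcat_scheme
    \<Rightarrow> ('o, 'm, 'p, 'n) monfun \<Rightarrow> bool" where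
  "monoidal_functor R C D E \<longleftrightarrow>
     (let F = FOb E; M = FMor E; J = FTens E; u = FUnt E in
     linear_monoidal_category R C \<and> linear_monoidal_category R D \<and>
     is_functor C D F M \<and> is_linear R C D M \<and>
     is_iso D (Unt D) (F (Unt C)) u \<and>
     (\<forall>X\<in>Ob C. \<forall>Y\<in>Ob C. is_iso D (TOb D (F X) (F Y)) (F (TOb C X Y)) (J X Y)) \<and>
     (\<forall>X\<in>Ob C. \<forall>X'\<in>Ob C. \<forall>Y\<in>Ob C. \<forall>Y'\<in>Ob C. \<forall>f\<in>Hom C X X'. \<forall>g\<in>Hom C Y Y'.
        M (f \<boxtimes>\<^bsub>C\<^esub> g) \<cdot>\<^bsub>D\<^esub> J X Y = J X' Y' \<cdot>\<^bsub>D\<^esub> (M f \<boxtimes>\<^bsub>D\<^esub> M g)) \<and>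
     (\<forall>X\<in>Ob C. \<forall>Y\<in>Ob C. \<forall>Z\<in>Ob C.
        J (TOb C X Y) Z \<cdot>\<^bsub>D\<^esub> (J X Y \<boxtimes>\<^bsub>D\<^esub> Id D (F Z)) =
        J X (TOb C Y Z) \<cdot>\<^bsub>D\<^esub> (Id D (F X) \<boxtimes>\<^bsub>D\<^esub> J Y Z)) \<and>
     (\<forall>X\<in>Ob C.
        J (Unt C) X \<cdot>\<^bsub>D\<^esub> (u \<boxtimes>\<^bsub>D\<^esub> Id D (F X)) = Id D (F X) \<and>
        J X (Unt C) \<cdot>\<^bsub>D\<^esub> (Id D (F X) \<boxtimes>\<^bsub>D\<^esub> u) = Id D (F X)))"

definition monoidal_equivalence ::
  "('k, 'r) ring_scheme \<Rightarrow> ('k, 'o, 'm, 'y) lmcat_scheme \<Rightarrow> ('k, 'p, 'n, 'z) lmcat_scheme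
    \<Rightarrow> ('o, 'm, 'p, 'n) monfun \<Rightarrow> bool" where
  "monoidal_equivalence R C D E \<longleftrightarrow>
     monoidal_functor R C D E \<and> is_equivalence C D (FOb E) (FMor E)"


section \<open>Quotients of categories and generated full subcategories\<close>

text \<open>The quotient by a congruence \<open>r\<close>, an equivalence relation between parallel morphisms.\<close>

definition quot_cat ::
  "('k, 'o, 'm, 'z) lmcat_scheme \<Rightarrow> ('m \<times> 'm) set \<Rightarrow> ('k, 'o, 'm set) lmcat" where
  "quot_cat C r =
    \<lparr> Ob = Ob C,
      Hom = (\<lambda>X Y. Hom C X Y // r),
      Id = (\<lambda>X. r `` {Id C X}),
      Comp = (\<lambda>G F. \<Union>g\<in>G. \<Union>f\<in>F. r `` {g \<cdot>\<^bsub>C\<^esub> f}),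
      Unt = Unt C,
      TOb = TOb C,
      TMor = (\<lambda>F G. \<Union>f\<in>F. \<Union>g\<in>G. r `` {f \<boxtimes>\<^bsub>C\<^esub> g}),
      HZero = (\<lambda>X Y. r `` {HZero C X Y}),
      HAdd = (\<lambda>F G. \<Union>f\<in>F. \<Union>g\<in>G. r `` {HAdd C f g}),
      Scal = (\<lambda>c F. \<Union>f\<in>F. r `` {Scal C c f}) \<rparr>"

definition is_direct_sum ::
  "('k, 'o, 'm, 'z) lmcat_scheme \<Rightarrow> 'o \<Rightarrow> 'o \<Rightarrow> 'o \<Rightarrow> bool" where
  "is_direct_sum C X Y Z \<longleftrightarrow>
     (\<exists>i\<in>Hom C X Z. \<exists>j\<in>Hom C Y Z. \<exists>p\<in>Hom C Z X. \<exists>q\<in>Hom C Z Y.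
        p \<cdot>\<^bsub>C\<^esub> i = Id C X \<and> q \<cdot>\<^bsub>C\<^esub> j = Id C Y \<and>
        p \<cdot>\<^bsub>C\<^esub> j = HZero C Y X \<and> q \<cdot>\<^bsub>C\<^esub> i = HZero C X Y \<and>
        HAdd C (i \<cdot>\<^bsub>C\<^esub> p) (j \<cdot>\<^bsub>C\<^esub> q) = Id C Z)"

text \<open>
  The unit is included as the empty tensor product.  The empty direct sum is covered by
  \<open>summand\<close>, and the set of objects is closed under isomorphism by \<open>summand\<close> as well
  (when the category has a zero object).
\<close>

inductive_set generated :: "('k, 'o, 'm, 'z) lmcat_scheme \<Rightarrow> 'o \<Rightarrow> 'o set"
  for C :: "('k, 'o, 'm, 'z) lmcat_scheme" and X :: 'o where
  gen: "X \<in> Ob C \<Longrightarrow> X \<in> generated C X"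
| unt: "Unt C \<in> generated C X"
| tens: "\<lbrakk>A \<in> generated C X; B \<in> generated C X\<rbrakk> \<Longrightarrow> TOb C A B \<in> generated C X"
| sum: "\<lbrakk>A \<in> generated C X; B \<in> generated C X; Z \<in> Ob C; is_direct_sum C A B Z\<rbrakk>
    \<Longrightarrow> Z \<in> generated C X"
| summand: "\<lbrakk>Z \<in> generated C X; A \<in> Ob C; B \<in> Ob C; is_direct_sum C A B Z\<rbrakk>
    \<Longrightarrow> A \<in> generated C X"

definition full_subcategory ::
  "('k, 'o, 'm, 'z) lmcat_scheme \<Rightarrow> 'o set \<Rightarrow> ('k, 'o, 'm, 'z) lmcat_scheme" where
  "full_subcategory C S = C\<lparr>Ob := S\<rparr>"


section \<open>Pivotal structure, quantum trace and semisimplification\<close>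

text \<open>
  Duality morphisms \<open>Coev X : 1 \<rightarrow> X \<otimes> X*\<close>, \<open>Ev X : X* \<otimes> X \<rightarrow> 1\<close>; the pivotal
  structure is recorded by \<open>PEv X : X \<otimes> X* \<rightarrow> 1\<close>.
\<close>

record ('k, 'o, 'm) pivcat = "('k, 'o, 'm) lmcat" +
  Dual :: "'o \<Rightarrow> 'o"
  Coev :: "'o \<Rightarrow> 'm"
  Ev :: "'o \<Rightarrow> 'm"
  PEv :: "'o \<Rightarrow> 'm"

definition transpose_mor ::
  "('k, 'o, 'm, 'z) pivcat_scheme \<Rightarrow> 'o \<Rightarrow> 'o \<Rightarrow> 'm \<Rightarrow> 'm" where
  "transpose_mor C X Y f =
     (Ev C Y \<boxtimes>\<^bsub>C\<^esub> Id C (Dual C X))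
     \<cdot>\<^bsub>C\<^esub> (Id C (Dual C Y) \<boxtimes>\<^bsub>C\<^esub> f \<boxtimes>\<^bsub>C\<^esub> Id C (Dual C X))
     \<cdot>\<^bsub>C\<^esub> (Id C (Dual C Y) \<boxtimes>\<^bsub>C\<^esub> Coev C X)"

definition qtrace :: "('k, 'o, 'm, 'z) pivcat_scheme \<Rightarrow> 'o \<Rightarrow> 'm \<Rightarrow> 'm" where
  "qtrace C X f = PEv C X \<cdot>\<^bsub>C\<^esub> (f \<boxtimes>\<^bsub>C\<^esub> Id C (Dual C X)) \<cdot>\<^bsub>C\<^esub> Coev C X"

definition negligible ::
  "('k, 'o, 'm, 'z) pivcat_scheme \<Rightarrow> 'o \<Rightarrow> 'o \<Rightarrow> 'm \<Rightarrow> bool" where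
  "negligible C X Y f \<longleftrightarrow> f \<in> Hom C X Y \<and>
     (\<forall>g\<in>Hom C Y X. qtrace C X (g \<cdot>\<^bsub>C\<^esub> f) = HZero C (Unt C) (Unt C))"

definition negligible_rel :: "('k, 'o, 'm, 'z) pivcat_scheme \<Rightarrow> ('m \<times> 'm) set" where
  "negligible_rel C =
     {(f, g). \<exists>X\<in>Ob C. \<exists>Y\<in>Ob C. f \<in> Hom C X Y \<and> g \<in> Hom C X Y \<and>
        negligible C X Y (f \<ominus>\<^bsub>hom_module C X Y\<^esub> g)}"

definition semisimplification ::
  "('k, 'o, 'm, 'z) pivcat_scheme \<Rightarrow> ('k, 'o, 'm set) lmcat" where
  "semisimplification C = quot_cat C (negligible_rel C)"


section \<open>Cauchy completion\<close>

subsection \<open>Adjoining finite direct sums\<close>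

text \<open>
  Objects are finite families; a morphism \<open>X \<rightarrow> Y\<close> is a triple \<open>(X, Y, f)\<close> with
  \<open>f i j : X ! j \<rightarrow> Y ! i\<close>, where \<open>f\<close> is \<open>undefined\<close> outside the index range so that
  equality of morphisms is equality of matrices.
\<close>

type_synonym ('o, 'm) matmor = "'o list \<times> 'o list \<times> (nat \<Rightarrow> nat \<Rightarrow> 'm)"

definition matrix :: "'o list \<Rightarrow> 'o list \<Rightarrow> (nat \<Rightarrow> nat \<Rightarrow> 'm) \<Rightarrow> ('o, 'm) matmor" where
  "matrix X Y f =
     (X, Y, \<lambda>i j. if i < length Y \<and> j < length X then f i j else undefined)"

primrec hom_sum ::
  "('k, 'o, 'm, 'z) lmcat_scheme \<Rightarrow> 'o \<Rightarrow> 'o \<Rightarrow> (nat \<Rightarrow> 'm) \<Rightarrow> nat \<Rightarrow> 'm" where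
  "hom_sum C X Y f 0 = HZero C X Y"
| "hom_sum C X Y f (Suc n) = HAdd C (hom_sum C X Y f n) (f n)"

definition list_tensor :: "('k, 'o, 'm, 'z) lmcat_scheme \<Rightarrow> 'o list \<Rightarrow> 'o list \<Rightarrow> 'o list" where
  "list_tensor C X Y = concat (map (\<lambda>x. map (TOb C x) Y) X)"

text \<open>
  Entry \<open>i * length Y + j\<close> of \<open>list_tensor C X Y\<close> is \<open>X ! i \<otimes> Y ! j\<close>, whence the
  \<open>div\<close>/\<open>mod\<close> indexing of Kronecker products.
\<close>

definition additive_envelope ::
  "('k, 'o, 'm, 'z) pivcat_scheme \<Rightarrow> ('k, 'o list, ('o, 'm) matmor) pivcat" where
  "additive_envelope C =
    \<lparr> Ob = {X. set X \<subseteq> Ob C},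
      Hom = (\<lambda>X Y. {matrix X Y f | f.
               \<forall>i<length Y. \<forall>j<length X. f i j \<in> Hom C (X ! j) (Y ! i)}),
      Id = (\<lambda>X. matrix X X (\<lambda>i j. if i = j then Id C (X ! i) else HZero C (X ! j) (X ! i))),
      Comp = (\<lambda>(Y', Z, g) (X, Y, f).
               matrix X Z (\<lambda>i j. hom_sum C (X ! j) (Z ! i) (\<lambda>k. g i k \<cdot>\<^bsub>C\<^esub> f k j) (length Y))),
      Unt = [Unt C],
      TOb = list_tensor C,
      TMor = (\<lambda>(X, Y, f) (X', Y', f').
               matrix (list_tensor C X X') (list_tensor C Y Y')
                 (\<lambda>i j. f (i div length Y') (j div length X')
                         \<boxtimes>\<^bsub>C\<^esub> f' (i mod length Y') (j mod length X'))),
      HZero = (\<lambda>X Y. matrix X Y (\<lambda>i j. HZero C (X ! j) (Y ! i))),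
      HAdd = (\<lambda>(X, Y, f) (X', Y', g). matrix X Y (\<lambda>i j. HAdd C (f i j) (g i j))),
      Scal = (\<lambda>c (X, Y, f). matrix X Y (\<lambda>i j. Scal C c (f i j))),
      Dual = map (Dual C),
      Coev = (\<lambda>X. let X' = map (Dual C) X in
               matrix [Unt C] (list_tensor C X X')
                 (\<lambda>r _. let i = r div length X; j = r mod length X in
                    if i = j then Coev C (X ! i) else HZero C (Unt C) (TOb C (X ! i) (X' ! j)))),
      Ev = (\<lambda>X. let X' = map (Dual C) X in
               matrix (list_tensor C X' X) [Unt C]
                 (\<lambda>_ r. let i = r div length X; j = r mod length X in
                    if i = j then Ev C (X ! i) else HZero C (TOb C (X' ! i) (X ! j)) (Unt C))),
      PEv = (\<lambda>X. let X' = map (Dual C) X in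
               matrix (list_tensor C X X') [Unt C]
                 (\<lambda>_ r. let i = r div length X; j = r mod length X in
                    if i = j then PEv C (X ! i) else HZero C (TOb C (X ! i) (X' ! j)) (Unt C))) \<rparr>"

subsection \<open>Splitting idempotents\<close>

text \<open>
  A morphism \<open>(X, e) \<rightarrow> (Y, e')\<close> is a morphism \<open>f : X \<rightarrow> Y\<close> with
  \<open>e' f = f = f e\<close>, tagged with its source and target.
\<close>

type_synonym ('o, 'm) karob = "'o \<times> 'm"
type_synonym ('o, 'm) karmor = "('o, 'm) karob \<times> ('o, 'm) karob \<times> 'm"

definition kar_tensor ::
  "('k, 'o, 'm, 'z) lmcat_scheme \<Rightarrow> ('o, 'm) karob \<Rightarrow> ('o, 'm) karob \<Rightarrow> ('o, 'm) karob" where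
  "kar_tensor C A B = (TOb C (fst A) (fst B), snd A \<boxtimes>\<^bsub>C\<^esub> snd B)"

definition kar_dual :: "('k, 'o, 'm, 'z) pivcat_scheme \<Rightarrow> ('o, 'm) karob \<Rightarrow> ('o, 'm) karob" where
  "kar_dual C A = (Dual C (fst A), transpose_mor C (fst A) (fst A) (snd A))"

definition idempotent_completion ::
  "('k, 'o, 'm, 'z) pivcat_scheme \<Rightarrow> ('k, ('o, 'm) karob, ('o, 'm) karmor) pivcat" where
  "idempotent_completion C =
    (let I = (Unt C, Id C (Unt C)) in
    \<lparr> Ob = {(X, e). X \<in> Ob C \<and> e \<in> Hom C X X \<and> e \<cdot>\<^bsub>C\<^esub> e = e},
      Hom = (\<lambda>A B. {(A, B, f) | f. f \<in> Hom C (fst A) (fst B) \<and>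
               snd B \<cdot>\<^bsub>C\<^esub> f = f \<and> f \<cdot>\<^bsub>C\<^esub> snd A = f}),
      Id = (\<lambda>A. (A, A, snd A)),
      Comp = (\<lambda>(B', D, g) (A, B, f). (A, D, g \<cdot>\<^bsub>C\<^esub> f)),
      Unt = I,
      TOb = kar_tensor C,
      TMor = (\<lambda>(A, B, f) (A', B', f'). (kar_tensor C A A', kar_tensor C B B', f \<boxtimes>\<^bsub>C\<^esub> f')),
      HZero = (\<lambda>A B. (A, B, HZero C (fst A) (fst B))),
      HAdd = (\<lambda>(A, B, f) (A', B', g). (A, B, HAdd C f g)),
      Scal = (\<lambda>c (A, B, f). (A, B, Scal C c f)),
      Dual = kar_dual C,
      Coev = (\<lambda>A. (I, kar_tensor C A (kar_dual C A),
               snd (kar_tensor C A (kar_dual C A)) \<cdot>\<^bsub>C\<^esub> Coev C (fst A))),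
      Ev = (\<lambda>A. (kar_tensor C (kar_dual C A) A, I,
               Ev C (fst A) \<cdot>\<^bsub>C\<^esub> snd (kar_tensor C (kar_dual C A) A))),
      PEv = (\<lambda>A. (kar_tensor C A (kar_dual C A), I,
               PEv C (fst A) \<cdot>\<^bsub>C\<^esub> snd (kar_tensor C A (kar_dual C A)))) \<rparr>)"

definition cauchy_completion ::
  "('k, 'o, 'm, 'z) pivcat_scheme
    \<Rightarrow> ('k, ('o list, ('o, 'm) matmor) karob, ('o list, ('o, 'm) matmor) karmor) pivcat" where
  "cauchy_completion C = idempotent_completion (additive_envelope C)"

definition cauchy_embed ::
  "('k, 'o, 'm, 'z) pivcat_scheme \<Rightarrow> 'o \<Rightarrow> ('o list, ('o, 'm) matmor) karob" where
  "cauchy_embed C x = ([x], Id (additive_envelope C) [x])"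


section \<open>The Temperley--Lieb category\<close>

datatype 'k tl_term =
    TId nat
  | TCup
  | TCap
  | TComp "'k tl_term" "'k tl_term"
  | TTens "'k tl_term" "'k tl_term"
  | TZero nat nat
  | TAdd "'k tl_term" "'k tl_term"
  | TScal 'k "'k tl_term"

inductive tl_hom :: "('k, 'r) ring_scheme \<Rightarrow> 'k tl_term \<Rightarrow> nat \<Rightarrow> nat \<Rightarrow> bool"
  for K :: "('k, 'r) ring_scheme" where
  "tl_hom K (TId n) n n"
| "tl_hom K TCup 0 2"
| "tl_hom K TCap 2 0"
| "\<lbrakk>tl_hom K g m n; tl_hom K f l m\<rbrakk> \<Longrightarrow> tl_hom K (TComp g f) l n"
| "\<lbrakk>tl_hom K f m n; tl_hom K g m' n'\<rbrakk> \<Longrightarrow> tl_hom K (TTens f g) (m + m') (n + n')"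
| "tl_hom K (TZero m n) m n"
| "\<lbrakk>tl_hom K f m n; tl_hom K g m n\<rbrakk> \<Longrightarrow> tl_hom K (TAdd f g) m n"
| "\<lbrakk>c \<in> carrier K; tl_hom K f m n\<rbrakk> \<Longrightarrow> tl_hom K (TScal c f) m n"

text \<open>
  The least congruence containing the axioms of a strict \<open>K\<close>-linear monoidal category
  and the Temperley--Lieb relations (\<open>zigzag1\<close>, \<open>zigzag2\<close>, \<open>loop\<close>).
\<close>

inductive tl_eq :: "('k, 'r) ring_scheme \<Rightarrow> 'k \<Rightarrow> 'k tl_term \<Rightarrow> 'k tl_term \<Rightarrow> bool"
  for K :: "('k, 'r) ring_scheme" and q :: 'k where
  refl: "tl_hom K f m n \<Longrightarrow> tl_eq K q f f"
| sym: "tl_eq K q f g \<Longrightarrow> tl_eq K q g f"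
| trans: "\<lbrakk>tl_eq K q f g; tl_eq K q g h\<rbrakk> \<Longrightarrow> tl_eq K q f h"
| cong_comp: "\<lbrakk>tl_hom K g m n; tl_hom K f l m; tl_eq K q g g'; tl_eq K q f f'\<rbrakk>
    \<Longrightarrow> tl_eq K q (TComp g f) (TComp g' f')"
| cong_tens: "\<lbrakk>tl_eq K q f f'; tl_eq K q g g'\<rbrakk> \<Longrightarrow> tl_eq K q (TTens f g) (TTens f' g')"
| cong_add: "\<lbrakk>tl_hom K f m n; tl_hom K g m n; tl_eq K q f f'; tl_eq K q g g'\<rbrakk>
    \<Longrightarrow> tl_eq K q (TAdd f g) (TAdd f' g')"
| cong_scal: "\<lbrakk>c \<in> carrier K; tl_eq K q f f'\<rbrakk> \<Longrightarrow> tl_eq K q (TScal c f) (TScal c f')"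
| comp_id_left: "tl_hom K f m n \<Longrightarrow> tl_eq K q (TComp (TId n) f) f"
| comp_id_right: "tl_hom K f m n \<Longrightarrow> tl_eq K q (TComp f (TId m)) f"
| comp_assoc: "\<lbrakk>tl_hom K f k l; tl_hom K g l m; tl_hom K h m n\<rbrakk>
    \<Longrightarrow> tl_eq K q (TComp (TComp h g) f) (TComp h (TComp g f))"
| tens_id: "tl_eq K q (TTens (TId m) (TId n)) (TId (m + n))"
| interchange: "\<lbrakk>tl_hom K f l m; tl_hom K g m n; tl_hom K f' l' m'; tl_hom K g' m' n'\<rbrakk>
    \<Longrightarrow> tl_eq K q (TTens (TComp g f) (TComp g' f')) (TComp (TTens g g') (TTens f f'))"
| tens_assoc: "\<lbrakk>tl_hom K f m n; tl_hom K g m' n'; tl_hom K h m'' n''\<rbrakk>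
    \<Longrightarrow> tl_eq K q (TTens (TTens f g) h) (TTens f (TTens g h))"
| tens_unit_left: "tl_hom K f m n \<Longrightarrow> tl_eq K q (TTens (TId 0) f) f"
| tens_unit_right: "tl_hom K f m n \<Longrightarrow> tl_eq K q (TTens f (TId 0)) f"
| add_assoc: "\<lbrakk>tl_hom K f m n; tl_hom K g m n; tl_hom K h m n\<rbrakk>
    \<Longrightarrow> tl_eq K q (TAdd (TAdd f g) h) (TAdd f (TAdd g h))"
| add_comm: "\<lbrakk>tl_hom K f m n; tl_hom K g m n\<rbrakk> \<Longrightarrow> tl_eq K q (TAdd f g) (TAdd g f)"
| add_zero: "tl_hom K f m n \<Longrightarrow> tl_eq K q (TAdd (TZero m n) f) f"
| scal_zero: "tl_hom K f m n \<Longrightarrow> tl_eq K q (TScal \<zero>\<^bsub>K\<^esub> f) (TZero m n)"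
| scal_one: "tl_hom K f m n \<Longrightarrow> tl_eq K q (TScal \<one>\<^bsub>K\<^esub> f) f"
| scal_mult: "\<lbrakk>a \<in> carrier K; b \<in> carrier K; tl_hom K f m n\<rbrakk>
    \<Longrightarrow> tl_eq K q (TScal (a \<otimes>\<^bsub>K\<^esub> b) f) (TScal a (TScal b f))"
| scal_add_left: "\<lbrakk>a \<in> carrier K; b \<in> carrier K; tl_hom K f m n\<rbrakk>
    \<Longrightarrow> tl_eq K q (TScal (a \<oplus>\<^bsub>K\<^esub> b) f) (TAdd (TScal a f) (TScal b f))"
| scal_add_right: "\<lbrakk>a \<in> carrier K; tl_hom K f m n; tl_hom K g m n\<rbrakk>
    \<Longrightarrow> tl_eq K q (TScal a (TAdd f g)) (TAdd (TScal a f) (TScal a g))"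
| comp_add_left: "\<lbrakk>tl_hom K f l m; tl_hom K g m n; tl_hom K g' m n\<rbrakk>
    \<Longrightarrow> tl_eq K q (TComp (TAdd g g') f) (TAdd (TComp g f) (TComp g' f))"
| comp_add_right: "\<lbrakk>tl_hom K f l m; tl_hom K f' l m; tl_hom K g m n\<rbrakk>
    \<Longrightarrow> tl_eq K q (TComp g (TAdd f f')) (TAdd (TComp g f) (TComp g f'))"
| comp_scal_left: "\<lbrakk>a \<in> carrier K; tl_hom K f l m; tl_hom K g m n\<rbrakk>
    \<Longrightarrow> tl_eq K q (TComp (TScal a g) f) (TScal a (TComp g f))"
| comp_scal_right: "\<lbrakk>a \<in> carrier K; tl_hom K f l m; tl_hom K g m n\<rbrakk>
    \<Longrightarrow> tl_eq K q (TComp g (TScal a f)) (TScal a (TComp g f))"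
| tens_add_left: "\<lbrakk>tl_hom K f m n; tl_hom K f' m n; tl_hom K g m' n'\<rbrakk>
    \<Longrightarrow> tl_eq K q (TTens (TAdd f f') g) (TAdd (TTens f g) (TTens f' g))"
| tens_add_right: "\<lbrakk>tl_hom K f m n; tl_hom K g m' n'; tl_hom K g' m' n'\<rbrakk>
    \<Longrightarrow> tl_eq K q (TTens f (TAdd g g')) (TAdd (TTens f g) (TTens f g'))"
| tens_scal_left: "\<lbrakk>a \<in> carrier K; tl_hom K f m n; tl_hom K g m' n'\<rbrakk>
    \<Longrightarrow> tl_eq K q (TTens (TScal a f) g) (TScal a (TTens f g))"
| tens_scal_right: "\<lbrakk>a \<in> carrier K; tl_hom K f m n; tl_hom K g m' n'\<rbrakk>
    \<Longrightarrow> tl_eq K q (TTens f (TScal a g)) (TScal a (TTens f g))"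
| zigzag1: "tl_eq K q (TComp (TTens TCap (TId 1)) (TTens (TId 1) TCup)) (TId 1)"
| zigzag2: "tl_eq K q (TComp (TTens (TId 1) TCap) (TTens TCup (TId 1))) (TId 1)"
| loop: "tl_eq K q (TComp TCap TCup) (TScal (\<ominus>\<^bsub>K\<^esub> (q \<oplus>\<^bsub>K\<^esub> inv\<^bsub>K\<^esub> q)) (TId 0))"

definition tl_raw :: "('k, 'r) ring_scheme \<Rightarrow> ('k, nat, 'k tl_term) lmcat" where
  "tl_raw K =
    \<lparr> Ob = UNIV, Hom = (\<lambda>m n. {f. tl_hom K f m n}), Id = TId, Comp = TComp,
      Unt = 0, TOb = (+), TMor = TTens, HZero = TZero, HAdd = TAdd, Scal = TScal \<rparr>"

text \<open>Nested cups \<open>0 \<rightarrow> n + n\<close> and caps \<open>n + n \<rightarrow> 0\<close>, which make \<open>n\<close> self-dual.\<close>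

primrec cups :: "nat \<Rightarrow> 'k tl_term" where
  "cups 0 = TId 0"
| "cups (Suc n) = TComp (TTens (TTens (TId n) TCup) (TId n)) (cups n)"

primrec caps :: "nat \<Rightarrow> 'k tl_term" where
  "caps 0 = TId 0"
| "caps (Suc n) = TComp (caps n) (TTens (TTens (TId n) TCap) (TId n))"

definition tl_tilde :: "('k, 'r) ring_scheme \<Rightarrow> 'k \<Rightarrow> ('k, nat, 'k tl_term set) pivcat" where
  "tl_tilde K q =
    (let r = {(f, g). tl_eq K q f g} in
     lmcat.extend (quot_cat (tl_raw K) r)
       (pivcat.fields (\<lambda>n. n) (\<lambda>n. r `` {cups n}) (\<lambda>n. r `` {caps n}) (\<lambda>n. r `` {caps n})))"

type_synonym 'k tlob = "(nat list, (nat, 'k tl_term set) matmor) karob"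
type_synonym 'k tlmor = "(nat list, (nat, 'k tl_term set) matmor) karmor"

definition TL :: "('k, 'r) ring_scheme \<Rightarrow> 'k \<Rightarrow> ('k, 'k tlob, 'k tlmor) pivcat" where
  "TL K q = cauchy_completion (tl_tilde K q)"

text \<open>\<open>fusion_quotient K q\<close> is \<open>A_{\<kappa>-1}(K)\<close> when \<open>q\<close> has order \<open>2 \<kappa>\<close>; its objects
  are those of \<open>TL K q\<close>, and \<open>L_1\<close> is the image of \<open>T_1\<close>, the object \<open>1\<close>.\<close>

definition fusion_quotient ::
  "('k, 'r) ring_scheme \<Rightarrow> 'k \<Rightarrow> ('k, 'k tlob, 'k tlmor set) lmcat" where
  "fusion_quotient K q = semisimplification (TL K q)"

definition L1 :: "('k, 'r) ring_scheme \<Rightarrow> 'k \<Rightarrow> 'k tlob" where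
  "L1 K q = cauchy_embed (tl_tilde K q) 1"


section \<open>Ultraproducts\<close>

definition nonprincipal_ultrafilter :: "'i filter \<Rightarrow> bool" where
  "nonprincipal_ultrafilter U \<longleftrightarrow> U \<noteq> bot \<and>
     (\<forall>P. eventually P U \<or> eventually (\<lambda>k. \<not> P k) U) \<and>
     (\<forall>n. \<not> eventually (\<lambda>k. k = n) U)"

text \<open>
  The class of \<open>a\<close> in the product of the sets \<open>A k\<close>; it suffices that \<open>a k \<in> A k\<close>
  for \<open>U\<close>-almost all \<open>k\<close>, provided that no \<open>A k\<close> is empty.
\<close>

definition ulim :: "'i filter \<Rightarrow> ('i \<Rightarrow> 'a set) \<Rightarrow> ('i \<Rightarrow> 'a) \<Rightarrow> ('i \<Rightarrow> 'a) set" where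
  "ulim U A a = {b. (\<forall>k. b k \<in> A k) \<and> eventually (\<lambda>k. b k = a k) U}"

definition ultraproduct :: "'i filter \<Rightarrow> ('i \<Rightarrow> 'a set) \<Rightarrow> ('i \<Rightarrow> 'a) set set" where
  "ultraproduct U A = {ulim U A a | a. \<forall>k. a k \<in> A k}"

definition umap1 ::
  "'i filter \<Rightarrow> ('i \<Rightarrow> 'b set) \<Rightarrow> ('i \<Rightarrow> 'a \<Rightarrow> 'b) \<Rightarrow> ('i \<Rightarrow> 'a) set \<Rightarrow> ('i \<Rightarrow> 'b) set" where
  "umap1 U B h P = (\<Union>a\<in>P. ulim U B (\<lambda>k. h k (a k)))"

definition umap2 ::
  "'i filter \<Rightarrow> ('i \<Rightarrow> 'c set) \<Rightarrow> ('i \<Rightarrow> 'a \<Rightarrow> 'b \<Rightarrow> 'c)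
    \<Rightarrow> ('i \<Rightarrow> 'a) set \<Rightarrow> ('i \<Rightarrow> 'b) set \<Rightarrow> ('i \<Rightarrow> 'c) set" where
  "umap2 U B h P Q = (\<Union>a\<in>P. \<Union>b\<in>Q. ulim U B (\<lambda>k. h k (a k) (b k)))"

definition ultraproduct_ring ::
  "'i filter \<Rightarrow> ('i \<Rightarrow> ('a, 'r) ring_scheme) \<Rightarrow> ('i \<Rightarrow> 'a) set ring" where
  "ultraproduct_ring U K =
    (let A = (\<lambda>k. carrier (K k)) in
    \<lparr> carrier = ultraproduct U A,
      monoid.mult = umap2 U A (\<lambda>k. monoid.mult (K k)),
      one = ulim U A (\<lambda>k. \<one>\<^bsub>K k\<^esub>),
      ring.zero = ulim U A (\<lambda>k. \<zero>\<^bsub>K k\<^esub>),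
      add = umap2 U A (\<lambda>k. ring.add (K k)) \<rparr>)"

definition ultraproduct_cat ::
  "'i filter \<Rightarrow> ('i \<Rightarrow> ('k, 'o, 'm, 'z) lmcat_scheme)
    \<Rightarrow> (('i \<Rightarrow> 'k) set, ('i \<Rightarrow> 'o) set, ('i \<Rightarrow> 'm) set) lmcat" where
  "ultraproduct_cat U C =
    (let O' = (\<lambda>k. Ob (C k)); A = (\<lambda>k. Arr (C k)) in
    \<lparr> Ob = ultraproduct U O',
      Hom = (\<lambda>P Q. {ulim U A f | f. (\<forall>k. f k \<in> A k) \<and>
               (\<exists>X\<in>P. \<exists>Y\<in>Q. eventually (\<lambda>k. f k \<in> Hom (C k) (X k) (Y k)) U)}),
      Id = umap1 U A (\<lambda>k. Id (C k)),
      Comp = umap2 U A (\<lambda>k. Comp (C k)),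
      Unt = ulim U O' (\<lambda>k. Unt (C k)),
      TOb = umap2 U O' (\<lambda>k. TOb (C k)),
      TMor = umap2 U A (\<lambda>k. TMor (C k)),
      HZero = umap2 U A (\<lambda>k. HZero (C k)),
      HAdd = umap2 U A (\<lambda>k. HAdd (C k)),
      Scal = umap2 U A (\<lambda>k. Scal (C k)) \<rparr>)"

definition change_scalars ::
  "('l \<Rightarrow> 'k) \<Rightarrow> ('k, 'o, 'm) lmcat \<Rightarrow> ('l, 'o, 'm) lmcat" where
  "change_scalars \<psi> C =
    \<lparr> Ob = Ob C, Hom = Hom C, Id = Id C, Comp = Comp C, Unt = Unt C, TOb = TOb C,
      TMor = TMor C, HZero = HZero C, HAdd = HAdd C, Scal = (\<lambda>c. Scal C (\<psi> c)) \<rparr>"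


section \<open>Approximating data\<close>

abbreviation complex_field :: "complex ring" where
  "complex_field \<equiv> ring_of_type_algebra"

text \<open>An algebraic closure of the field with \<open>p\<close> elements.\<close>

definition is_closure_of_prime_field :: "nat \<Rightarrow> ('a, 'r) ring_scheme \<Rightarrow> bool" where
  "is_closure_of_prime_field p L \<longleftrightarrow>
     Factorial_Ring.prime p \<and> (\<exists>F. algebraic_closure L F \<and> card F = p)"

text \<open>
  The fields \<open>K k\<close> live on subsets of a common type \<open>'a\<close>, so \<open>K_k = \<complex>\<close> is read up to
  isomorphism.
\<close>

locale approximating_data =
  fixes q :: complex and U :: "nat filter" and K :: "nat \<Rightarrow> 'a ring"
    and qs :: "nat \<Rightarrow> 'a" and \<kappa> :: "nat \<Rightarrow> nat" and \<phi> :: "(nat \<Rightarrow> 'a) set \<Rightarrow> complex"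
  assumes transcendental_case: "\<not> algebraic q \<Longrightarrow> field (K k) \<and> K k \<simeq> complex_field"
    and algebraic_case: "algebraic q \<Longrightarrow>
          \<exists>p :: nat \<Rightarrow> nat. inj p \<and> (\<forall>k. is_closure_of_prime_field (p k) (K k))"
    and root_of_unity: "qs k \<in> Units (K k)" "group.ord (units_of (K k)) (qs k) = 2 * \<kappa> k"
    and kappa_ge: "\<kappa> k \<ge> 3"
    and kappa_lim: "filterlim \<kappa> at_top sequentially"
    and iso: "\<phi> \<in> ring_iso (ultraproduct_ring U K) complex_field"
    and iso_q: "\<phi> (ulim U (\<lambda>k. carrier (K k)) qs) = q"

text \<open>The ultraproduct of the fusion quotients, made complex-linear through \<open>\<phi>\<close>.\<close>

definition fusion_ultraproduct ::
  "nat filter \<Rightarrow> (nat \<Rightarrow> 'a ring) \<Rightarrow> (nat \<Rightarrow> 'a) \<Rightarrow> ((nat \<Rightarrow> 'a) set \<Rightarrow> complex)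
    \<Rightarrow> (complex, (nat \<Rightarrow> 'a tlob) set, (nat \<Rightarrow> 'a tlmor set) set) lmcat" where
  "fusion_ultraproduct U K qs \<phi> =
     change_scalars (inv_into (carrier (ultraproduct_ring U K)) \<phi>)
       (ultraproduct_cat U (\<lambda>k. fusion_quotient (K k) (qs k)))"

definition X1 ::
  "nat filter \<Rightarrow> (nat \<Rightarrow> 'a ring) \<Rightarrow> (nat \<Rightarrow> 'a) \<Rightarrow> (nat \<Rightarrow> 'a tlob) set" where
  "X1 U K qs = ulim U (\<lambda>k. Ob (fusion_quotient (K k) (qs k))) (\<lambda>k. L1 (K k) (qs k))"

definition A_infinity ::
  "nat filter \<Rightarrow> (nat \<Rightarrow> 'a ring) \<Rightarrow> (nat \<Rightarrow> 'a) \<Rightarrow> ((nat \<Rightarrow> 'a) set \<Rightarrow> complex)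
    \<Rightarrow> (complex, (nat \<Rightarrow> 'a tlob) set, (nat \<Rightarrow> 'a tlmor set) set) lmcat" where
  "A_infinity U K qs \<phi> =
     full_subcategory (fusion_ultraproduct U K qs \<phi>)
       (generated (fusion_ultraproduct U K qs \<phi>) (X1 U K qs))"

end

theory Submission
  imports Defs "HOL-Library.Stream"
begin

text \<open>
  A complex scalar is a sequence of scalars of the fields \<open>K k\<close> up to null sets, so every
  Temperley--Lieb diagram over the complex numbers lifts to diagrams with parameters \<open>qs k\<close>, and every
  defining relation holds for almost all \<open>k\<close>.  This gives a strict monoidal functor \<open>E\<close> to the ultraproduct
  of the fusion quotients, the identity on words and a sequence of idempotents on Karoubi objects.  Morphism spaces
  between words are spanned by a number of diagrams that does not depend on the parameter, so \<open>E\<close> is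
  full.  If \<open>E f = 0\<close>, then \<open>f\<close> is negligible for almost all \<open>k\<close>; traces are scalars, and
  the ultraproduct detects whether a scalar vanishes, so \<open>f\<close> is negligible at \<open>q\<close>.  As \<open>q\<close> is not
  a root of unity, the Jones--Wenzl projectors exist and have nonzero traces, so no nonzero morphism is negligible and \<open>E\<close>
  is faithful.  The image of \<open>E\<close> contains \<open>X1\<close> and is closed under tensor products and direct sums; it is closed
  under summands since idempotents lift by fullness and faithfulness and split in the Cauchy completion.
\<close>

text \<open>A category given by generators and relations comes with no basis of its morphism spaces,
  and the argument is arranged so that none is needed. Fullness uses only that cap diagrams span,
  with coefficients picked separately for each \<open>k\<close> and then lifted. Faithfulness is
  reduced to endomorphisms of \<open>0\<close>, where the relations might still have identified
  different scalars; an explicit action on functions of bit streams excludes this at every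
  \<open>qs k\<close>. Projectors appear only at \<open>q\<close>: at a root of unity their
  recursion divides by zero at some stage. This is harmless because negligibility travels in one
  direction, from almost all \<open>qs k\<close> to \<open>q\<close>, and is tested there by traces
  with morphisms that themselves come from \<open>q\<close>. A lifted relation or idempotent
  equation holds only off a set of indices that depends on the derivation used. No single index is
  good for all morphisms at once, so facts about lifted data are stated with
  \<open>eventually\<close>, and combining them is always a matter of finitely many
  conditions.\<close>

no_notation ideal_prod (infixl \<open>\<cdot>\<index>\<close> 80)

section \<open>Linear strict monoidal categories\<close>

lemma hom_module_sel [simp]:
  "carrier (hom_module C X Y) = Hom C X Y"
  "ring.zero (hom_module C X Y) = HZero C X Y"
  "add (hom_module C X Y) = HAdd C"
  "module.smult (hom_module C X Y) = Scal C"
  by (simp_all add: hom_module_def)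

context linear_monoidal_category
begin

lemma cring_R: "cring R"
  using hom_is_module[OF unt_ob unt_ob] by (simp add: module_def)

context
  fixes X Y assumes X [simp]: "X \<in> Ob C" and Y [simp]: "Y \<in> Ob C"
begin

interpretation hm: module R "hom_module C X Y"
  by (simp add: hom_is_module)

lemma hzero_hom [simp]: "HZero C X Y \<in> Hom C X Y"
  using hm.zero_closed by simp

lemma hadd_hom [simp]: "\<lbrakk>f \<in> Hom C X Y; g \<in> Hom C X Y\<rbrakk> \<Longrightarrow> HAdd C f g \<in> Hom C X Y"
  using hm.a_closed by simp

lemma scal_hom [simp]: "\<lbrakk>c \<in> carrier R; f \<in> Hom C X Y\<rbrakk> \<Longrightarrow> Scal C c f \<in> Hom C X Y"
  using hm.smult_closed by simp

lemma hadd_assoc: "\<lbrakk>f \<in> Hom C X Y; g \<in> Hom C X Y; h \<in> Hom C X Y\<rbrakk>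
    \<Longrightarrow> HAdd C (HAdd C f g) h = HAdd C f (HAdd C g h)"
  using hm.a_assoc by simp

lemma hadd_comm: "\<lbrakk>f \<in> Hom C X Y; g \<in> Hom C X Y\<rbrakk> \<Longrightarrow> HAdd C f g = HAdd C g f"
  using hm.a_comm by simp

lemma hadd_lcomm: "\<lbrakk>f \<in> Hom C X Y; g \<in> Hom C X Y; h \<in> Hom C X Y\<rbrakk>
    \<Longrightarrow> HAdd C f (HAdd C g h) = HAdd C g (HAdd C f h)"
  using hm.a_lcomm by simp

lemma hzero_add: "f \<in> Hom C X Y \<Longrightarrow> HAdd C (HZero C X Y) f = f"
    "f \<in> Hom C X Y \<Longrightarrow> HAdd C f (HZero C X Y) = f"
  using hm.l_zero hm.r_zero by simp_all

lemma scal_one: "f \<in> Hom C X Y \<Longrightarrow> Scal C \<one>\<^bsub>R\<^esub> f = f"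
  using hm.smult_one by simp

lemma scal_mult: "\<lbrakk>a \<in> carrier R; b \<in> carrier R; f \<in> Hom C X Y\<rbrakk>
    \<Longrightarrow> Scal C (a \<otimes>\<^bsub>R\<^esub> b) f = Scal C a (Scal C b f)"
  using hm.smult_assoc1 by simp

lemma scal_zero: "f \<in> Hom C X Y \<Longrightarrow> Scal C \<zero>\<^bsub>R\<^esub> f = HZero C X Y"
  using hm.smult_l_null by simp

lemma scal_hzero: "a \<in> carrier R \<Longrightarrow> Scal C a (HZero C X Y) = HZero C X Y"
  using hm.smult_r_null by simp

lemma scal_add_left: "\<lbrakk>a \<in> carrier R; b \<in> carrier R; f \<in> Hom C X Y\<rbrakk>
    \<Longrightarrow> Scal C (a \<oplus>\<^bsub>R\<^esub> b) f = HAdd C (Scal C a f) (Scal C b f)"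
  using hm.smult_l_distr by simp

lemma scal_add_right: "\<lbrakk>a \<in> carrier R; f \<in> Hom C X Y; g \<in> Hom C X Y\<rbrakk>
    \<Longrightarrow> Scal C a (HAdd C f g) = HAdd C (Scal C a f) (Scal C a g)"
  using hm.smult_r_distr by simp

lemma hminus: "\<lbrakk>f \<in> Hom C X Y; g \<in> Hom C X Y\<rbrakk>
    \<Longrightarrow> f \<ominus>\<^bsub>hom_module C X Y\<^esub> g = HAdd C f (Scal C (\<ominus>\<^bsub>R\<^esub> \<one>\<^bsub>R\<^esub>) g)"
  using hm.smult_l_minus[of "\<one>\<^bsub>R\<^esub>" g] by (simp add: a_minus_def scal_one)

lemma hadd_neg: "f \<in> Hom C X Y \<Longrightarrow> HAdd C f (Scal C (\<ominus>\<^bsub>R\<^esub> \<one>\<^bsub>R\<^esub>) f) = HZero C X Y"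
  using hm.r_neg[of f] hm.smult_l_minus[of "\<one>\<^bsub>R\<^esub>" f] by (simp add: scal_one)

lemma hdiff_zero: "\<lbrakk>f \<in> Hom C X Y; g \<in> Hom C X Y;
    HAdd C f (Scal C (\<ominus>\<^bsub>R\<^esub> \<one>\<^bsub>R\<^esub>) g) = HZero C X Y\<rbrakk> \<Longrightarrow> f = g"
  using hm.smult_l_minus[of "\<one>\<^bsub>R\<^esub>" g] hm.minus_minus[of g]
    hm.minus_equality[of f "\<ominus>\<^bsub>hom_module C X Y\<^esub> g"] hm.a_inv_closed[of g]
  by (simp add: scal_one)

end

text \<open>Compatibility with zero is not an axiom of the locale. It follows from scalar linearity
  because a zero morphism is \<open>0\<close> times itself.\<close>

lemma comp_hzero:
  assumes [simp]: "X \<in> Ob C" "Y \<in> Ob C" "Z \<in> Ob C"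
  shows "f \<in> Hom C X Y \<Longrightarrow> HZero C Y Z \<cdot>\<^bsub>C\<^esub> f = HZero C X Z"
    and "g \<in> Hom C Y Z \<Longrightarrow> g \<cdot>\<^bsub>C\<^esub> HZero C X Y = HZero C X Z"
proof -
  interpret R: cring R by (rule cring_R)
  show "HZero C Y Z \<cdot>\<^bsub>C\<^esub> f = HZero C X Z" if f: "f \<in> Hom C X Y"
  proof -
    have "Scal C \<zero>\<^bsub>R\<^esub> (HZero C Y Z) \<cdot>\<^bsub>C\<^esub> f = Scal C \<zero>\<^bsub>R\<^esub> (HZero C Y Z \<cdot>\<^bsub>C\<^esub> f)"
      using f by (intro comp_scal[of X Y Z]) auto
    then show ?thesis using f comp_hom[of X Y Z f "HZero C Y Z"] by (simp add: scal_hzero scal_zero[of X Z])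
  qed
  show "g \<cdot>\<^bsub>C\<^esub> HZero C X Y = HZero C X Z" if g: "g \<in> Hom C Y Z"
  proof -
    have "g \<cdot>\<^bsub>C\<^esub> Scal C \<zero>\<^bsub>R\<^esub> (HZero C X Y) = Scal C \<zero>\<^bsub>R\<^esub> (g \<cdot>\<^bsub>C\<^esub> HZero C X Y)"
      using g by (intro comp_scal[of X Y Z]) auto
    then show ?thesis using g comp_hom[of X Y Z "HZero C X Y" g] by (simp add: scal_hzero scal_zero[of X Z])
  qed
qed

lemma tmor_hzero:
  assumes [simp]: "X \<in> Ob C" "Y \<in> Ob C" "X' \<in> Ob C" "Y' \<in> Ob C"
  shows "f \<in> Hom C X Y \<Longrightarrow> f \<boxtimes>\<^bsub>C\<^esub> HZero C X' Y' = HZero C (TOb C X X') (TOb C Y Y')"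
    and "g \<in> Hom C X' Y' \<Longrightarrow> HZero C X Y \<boxtimes>\<^bsub>C\<^esub> g = HZero C (TOb C X X') (TOb C Y Y')"
proof -
  interpret R: cring R by (rule cring_R)
  show "f \<boxtimes>\<^bsub>C\<^esub> HZero C X' Y' = HZero C (TOb C X X') (TOb C Y Y')" if f: "f \<in> Hom C X Y"
  proof -
    have "f \<boxtimes>\<^bsub>C\<^esub> Scal C \<zero>\<^bsub>R\<^esub> (HZero C X' Y') = Scal C \<zero>\<^bsub>R\<^esub> (f \<boxtimes>\<^bsub>C\<^esub> HZero C X' Y')"
      using f by (intro tmor_scal[of X Y X' Y']) auto
    then show ?thesis using f tmor_hom[of X Y X' Y' f "HZero C X' Y'"]
      by (simp add: scal_hzero scal_zero[of "TOb C X X'" "TOb C Y Y'"] tob_ob)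
  qed
  show "HZero C X Y \<boxtimes>\<^bsub>C\<^esub> g = HZero C (TOb C X X') (TOb C Y Y')" if g: "g \<in> Hom C X' Y'"
  proof -
    have "Scal C \<zero>\<^bsub>R\<^esub> (HZero C X Y) \<boxtimes>\<^bsub>C\<^esub> g = Scal C \<zero>\<^bsub>R\<^esub> (HZero C X Y \<boxtimes>\<^bsub>C\<^esub> g)"
      using g by (intro tmor_scal[of X Y X' Y']) auto
    then show ?thesis using g tmor_hom[of X Y X' Y' "HZero C X Y" g]
      by (simp add: scal_hzero scal_zero[of "TOb C X X'" "TOb C Y Y'"] tob_ob)
  qed
qed

end

text \<open>Additive inverses need not be supplied: multiplication by \<open>-1\<close> produces
  them from the scalar laws.\<close>

lemma hom_moduleI:
  assumes "cring R"
    and zero: "HZero C X Y \<in> Hom C X Y"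
    and add: "\<And>f g. \<lbrakk>f \<in> Hom C X Y; g \<in> Hom C X Y\<rbrakk> \<Longrightarrow> HAdd C f g \<in> Hom C X Y"
    and scal: "\<And>c f. \<lbrakk>c \<in> carrier R; f \<in> Hom C X Y\<rbrakk> \<Longrightarrow> Scal C c f \<in> Hom C X Y"
    and assoc: "\<And>f g h. \<lbrakk>f \<in> Hom C X Y; g \<in> Hom C X Y; h \<in> Hom C X Y\<rbrakk>
      \<Longrightarrow> HAdd C (HAdd C f g) h = HAdd C f (HAdd C g h)"
    and comm: "\<And>f g. \<lbrakk>f \<in> Hom C X Y; g \<in> Hom C X Y\<rbrakk> \<Longrightarrow> HAdd C f g = HAdd C g f"
    and zadd: "\<And>f. f \<in> Hom C X Y \<Longrightarrow> HAdd C (HZero C X Y) f = f"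
    and s0: "\<And>f. f \<in> Hom C X Y \<Longrightarrow> Scal C \<zero>\<^bsub>R\<^esub> f = HZero C X Y"
    and s1: "\<And>f. f \<in> Hom C X Y \<Longrightarrow> Scal C \<one>\<^bsub>R\<^esub> f = f"
    and smult: "\<And>a b f. \<lbrakk>a \<in> carrier R; b \<in> carrier R; f \<in> Hom C X Y\<rbrakk>
      \<Longrightarrow> Scal C (a \<otimes>\<^bsub>R\<^esub> b) f = Scal C a (Scal C b f)"
    and sl: "\<And>a b f. \<lbrakk>a \<in> carrier R; b \<in> carrier R; f \<in> Hom C X Y\<rbrakk>
      \<Longrightarrow> Scal C (a \<oplus>\<^bsub>R\<^esub> b) f = HAdd C (Scal C a f) (Scal C b f)"
    and sr: "\<And>a f g. \<lbrakk>a \<in> carrier R; f \<in> Hom C X Y; g \<in> Hom C X Y\<rbrakk>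
      \<Longrightarrow> Scal C a (HAdd C f g) = HAdd C (Scal C a f) (Scal C a g)"
  shows "module R (hom_module C X Y)"
proof -
  interpret R: cring R by fact
  show ?thesis
  proof (rule moduleI)
    show "cring R" by fact
    show "abelian_group (hom_module C X Y)"
    proof (rule abelian_groupI)
      fix x assume "x \<in> carrier (hom_module C X Y)"
      then have x: "x \<in> Hom C X Y" by simp
      have "HAdd C (Scal C (\<ominus>\<^bsub>R\<^esub> \<one>\<^bsub>R\<^esub>) x) x = HAdd C (Scal C (\<ominus>\<^bsub>R\<^esub> \<one>\<^bsub>R\<^esub>) x) (Scal C \<one>\<^bsub>R\<^esub> x)"
        using x by (simp add: s1)
      also have "\<dots> = HZero C X Y"
        using x by (subst sl[symmetric]) (auto simp: R.l_neg s0)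
      finally show "\<exists>y\<in>carrier (hom_module C X Y).
          y \<oplus>\<^bsub>hom_module C X Y\<^esub> x = \<zero>\<^bsub>hom_module C X Y\<^esub>"
        using x scal by (intro bexI[of _ "Scal C (\<ominus>\<^bsub>R\<^esub> \<one>\<^bsub>R\<^esub>) x"]) auto
    qed (use zero add assoc comm zadd in auto)
  qed (use scal smult sl sr s1 in auto)
qed

lemma linear_monoidal_category_extend:
  assumes "linear_monoidal_category R C"
  shows "linear_monoidal_category R (lmcat.extend C x)"
proof -
  have sel: "Ob (lmcat.extend C x) = Ob C" "Hom (lmcat.extend C x) = Hom C"
    "Id (lmcat.extend C x) = Id C" "Comp (lmcat.extend C x) = Comp C"
    "Unt (lmcat.extend C x) = Unt C" "TOb (lmcat.extend C x) = TOb C"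
    "TMor (lmcat.extend C x) = TMor C" "HZero (lmcat.extend C x) = HZero C"
    "HAdd (lmcat.extend C x) = HAdd C" "Scal (lmcat.extend C x) = Scal C"
    by (simp_all add: lmcat.extend_def)
  show ?thesis
    unfolding linear_monoidal_category_def hom_module_def sel
    by (rule assms[unfolded linear_monoidal_category_def hom_module_def])
qed

text \<open>Disjoint hom sets make source and target functions of the morphism, so typing conditions
  become equations that rewriting can discharge, with no objects to instantiate. Only typing of the
  operations is assumed and no law, because raw terms satisfy the laws for morphisms only up to a
  congruence.\<close>

locale typed_ops =
  fixes R :: "('k, 'r) ring_scheme" and C :: "('k, 'o, 'm, 'z) lmcat_scheme" (structure)
  assumes t_unt: "Unt C \<in> Ob C"
    and t_tob: "\<lbrakk>X \<in> Ob C; Y \<in> Ob C\<rbrakk> \<Longrightarrow> TOb C X Y \<in> Ob C"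
    and t_id: "X \<in> Ob C \<Longrightarrow> Id C X \<in> Hom C X X"
    and t_comp: "\<lbrakk>X \<in> Ob C; Y \<in> Ob C; Z \<in> Ob C; f \<in> Hom C X Y; g \<in> Hom C Y Z\<rbrakk>
        \<Longrightarrow> g \<cdot> f \<in> Hom C X Z"
    and t_tmor: "\<lbrakk>X \<in> Ob C; Y \<in> Ob C; X' \<in> Ob C; Y' \<in> Ob C; f \<in> Hom C X Y; f' \<in> Hom C X' Y'\<rbrakk>
        \<Longrightarrow> f \<boxtimes> f' \<in> Hom C (TOb C X X') (TOb C Y Y')"
    and t_zero: "\<lbrakk>X \<in> Ob C; Y \<in> Ob C\<rbrakk> \<Longrightarrow> HZero C X Y \<in> Hom C X Y"
    and t_add: "\<lbrakk>X \<in> Ob C; Y \<in> Ob C; f \<in> Hom C X Y; g \<in> Hom C X Y\<rbrakk> \<Longrightarrow> HAdd C f g \<in> Hom C X Y"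
    and t_scal: "\<lbrakk>X \<in> Ob C; Y \<in> Ob C; c \<in> carrier R; f \<in> Hom C X Y\<rbrakk> \<Longrightarrow> Scal C c f \<in> Hom C X Y"
    and hom_disjoint: "\<lbrakk>X \<in> Ob C; Y \<in> Ob C; X' \<in> Ob C; Y' \<in> Ob C; f \<in> Hom C X Y; f \<in> Hom C X' Y'\<rbrakk>
        \<Longrightarrow> X = X' \<and> Y = Y'"
begin

definition arr :: "'m \<Rightarrow> bool" where
  "arr f \<longleftrightarrow> (\<exists>X\<in>Ob C. \<exists>Y\<in>Ob C. f \<in> Hom C X Y)"

definition dm :: "'m \<Rightarrow> 'o" where
  "dm f = (THE X. X \<in> Ob C \<and> (\<exists>Y\<in>Ob C. f \<in> Hom C X Y))"

definition cd :: "'m \<Rightarrow> 'o" where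
  "cd f = (THE Y. Y \<in> Ob C \<and> (\<exists>X\<in>Ob C. f \<in> Hom C X Y))"

lemma homD: "\<lbrakk>f \<in> Hom C X Y; X \<in> Ob C; Y \<in> Ob C\<rbrakk> \<Longrightarrow> arr f \<and> dm f = X \<and> cd f = Y"
  unfolding arr_def dm_def cd_def
  by (intro conjI the_equality) (blast dest: hom_disjoint)+

lemma hom_iff: "\<lbrakk>X \<in> Ob C; Y \<in> Ob C\<rbrakk> \<Longrightarrow> f \<in> Hom C X Y \<longleftrightarrow> arr f \<and> dm f = X \<and> cd f = Y"
  using homD by (auto simp: arr_def)

lemma arrD: "arr f \<Longrightarrow> f \<in> Hom C (dm f) (cd f)" "arr f \<Longrightarrow> dm f \<in> Ob C" "arr f \<Longrightarrow> cd f \<in> Ob C"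
  using homD by (auto simp: arr_def)

lemmas [simp] = arrD(2,3) t_unt t_tob

lemma arr_id [simp]: "X \<in> Ob C \<Longrightarrow> arr (Id C X)" "X \<in> Ob C \<Longrightarrow> dm (Id C X) = X"
    "X \<in> Ob C \<Longrightarrow> cd (Id C X) = X"
  using homD[OF t_id] by auto

lemma arr_comp [simp]: assumes "arr f" "arr g" "cd f = dm g"
  shows "arr (g \<cdot> f)" "dm (g \<cdot> f) = dm f" "cd (g \<cdot> f) = cd g"
  using homD[OF t_comp[of "dm f" "cd f" "cd g" f g]] arrD(1)[OF assms(1)] arrD(1)[OF assms(2)] assms by simp_all

lemma arr_tmor [simp]: assumes "arr f" "arr g"
  shows "arr (f \<boxtimes> g)" "dm (f \<boxtimes> g) = TOb C (dm f) (dm g)" "cd (f \<boxtimes> g) = TOb C (cd f) (cd g)"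
  using homD[OF t_tmor[of "dm f" "cd f" "dm g" "cd g" f g]] arrD(1)[OF assms(1)] arrD(1)[OF assms(2)] assms by simp_all

lemma arr_zero [simp]: assumes "X \<in> Ob C" "Y \<in> Ob C"
  shows "arr (HZero C X Y)" "dm (HZero C X Y) = X" "cd (HZero C X Y) = Y"
  using homD[OF t_zero[OF assms]] assms by auto

lemma arr_add [simp]: assumes "arr f" "arr g" "dm g = dm f" "cd g = cd f"
  shows "arr (HAdd C f g)" "dm (HAdd C f g) = dm f" "cd (HAdd C f g) = cd f"
  using homD[OF t_add[of "dm f" "cd f" f g]] arrD(1)[OF assms(1)] arrD(1)[OF assms(2)] assms by simp_all

lemma arr_scal [simp]: assumes "c \<in> carrier R" "arr f"
  shows "arr (Scal C c f)" "dm (Scal C c f) = dm f" "cd (Scal C c f) = cd f"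
  using homD[OF t_scal[of "dm f" "cd f" c f]] arrD(1)[OF assms(2)] assms by simp_all

end

section \<open>Quotients by monoidal congruences\<close>

text \<open>Operations on quotients and on ultraproducts are unions over all representatives; such a
  union collapses as soon as its members agree.\<close>

lemma UN2_const: "\<lbrakk>a \<in> A; b \<in> B; \<And>x y. \<lbrakk>x \<in> A; y \<in> B\<rbrakk> \<Longrightarrow> h x y = c\<rbrakk>
    \<Longrightarrow> (\<Union>x\<in>A. \<Union>y\<in>B. h x y) = c"
  by (intro UN_constant_eq[of a] UN_constant_eq[of b]) auto

text \<open>The laws for morphisms are required only modulo \<open>r\<close>. One construction
  therefore serves twice: for raw terms modulo the generated congruence, and for the quotient of a
  genuine linear monoidal category by negligible morphisms.\<close>

locale monoidal_congruence = typed_ops R C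
  for R :: "('k, 'r) ring_scheme" and C :: "('k, 'o, 'm, 'z) lmcat_scheme" (structure) +
  fixes r :: "('m \<times> 'm) set"
  assumes cring_R: "cring R"
    and tob_assoc: "\<lbrakk>X \<in> Ob C; Y \<in> Ob C; Z \<in> Ob C\<rbrakk>
        \<Longrightarrow> TOb C (TOb C X Y) Z = TOb C X (TOb C Y Z)"
    and tob_unt: "X \<in> Ob C \<Longrightarrow> TOb C (Unt C) X = X" "X \<in> Ob C \<Longrightarrow> TOb C X (Unt C) = X"
    and r_refl: "arr f \<Longrightarrow> (f, f) \<in> r"
    and r_sym: "(f, g) \<in> r \<Longrightarrow> (g, f) \<in> r"
    and r_trans: "\<lbrakk>(f, g) \<in> r; (g, h) \<in> r\<rbrakk> \<Longrightarrow> (f, h) \<in> r"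
    and r_arr: "(f, g) \<in> r \<Longrightarrow> arr f \<and> arr g \<and> dm f = dm g \<and> cd f = cd g"
    and r_comp: "\<lbrakk>(f, f') \<in> r; (g, g') \<in> r; cd f = dm g\<rbrakk> \<Longrightarrow> (g \<cdot> f, g' \<cdot> f') \<in> r"
    and r_tmor: "\<lbrakk>(f, f') \<in> r; (g, g') \<in> r\<rbrakk> \<Longrightarrow> (f \<boxtimes> g, f' \<boxtimes> g') \<in> r"
    and r_add: "\<lbrakk>(f, f') \<in> r; (g, g') \<in> r; dm f = dm g; cd f = cd g\<rbrakk>
        \<Longrightarrow> (HAdd C f g, HAdd C f' g') \<in> r"
    and r_scal: "\<lbrakk>c \<in> carrier R; (f, f') \<in> r\<rbrakk> \<Longrightarrow> (Scal C c f, Scal C c f') \<in> r"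
    and r_comp_id: "arr f \<Longrightarrow> (f \<cdot> Id C (dm f), f) \<in> r" "arr f \<Longrightarrow> (Id C (cd f) \<cdot> f, f) \<in> r"
    and r_comp_assoc: "\<lbrakk>arr f; arr g; arr h; cd f = dm g; cd g = dm h\<rbrakk>
        \<Longrightarrow> (h \<cdot> g \<cdot> f, h \<cdot> (g \<cdot> f)) \<in> r"
    and r_tmor_id: "\<lbrakk>X \<in> Ob C; Y \<in> Ob C\<rbrakk> \<Longrightarrow> (Id C X \<boxtimes> Id C Y, Id C (TOb C X Y)) \<in> r"
    and r_interchange: "\<lbrakk>arr f; arr g; arr f'; arr g'; cd f = dm g; cd f' = dm g'\<rbrakk>
        \<Longrightarrow> ((g \<cdot> f) \<boxtimes> (g' \<cdot> f'), (g \<boxtimes> g') \<cdot> (f \<boxtimes> f')) \<in> r"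
    and r_tmor_assoc: "\<lbrakk>arr f; arr g; arr h\<rbrakk> \<Longrightarrow> (f \<boxtimes> g \<boxtimes> h, f \<boxtimes> (g \<boxtimes> h)) \<in> r"
    and r_tmor_unt: "arr f \<Longrightarrow> (Id C (Unt C) \<boxtimes> f, f) \<in> r" "arr f \<Longrightarrow> (f \<boxtimes> Id C (Unt C), f) \<in> r"
    and r_hadd_assoc: "\<lbrakk>arr f; arr g; arr h; dm g = dm f; dm h = dm f; cd g = cd f; cd h = cd f\<rbrakk>
        \<Longrightarrow> (HAdd C (HAdd C f g) h, HAdd C f (HAdd C g h)) \<in> r"
    and r_hadd_comm: "\<lbrakk>arr f; arr g; dm g = dm f; cd g = cd f\<rbrakk> \<Longrightarrow> (HAdd C f g, HAdd C g f) \<in> r"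
    and r_hadd_zero: "arr f \<Longrightarrow> (HAdd C (HZero C (dm f) (cd f)) f, f) \<in> r"
    and r_scal_zero: "arr f \<Longrightarrow> (Scal C \<zero>\<^bsub>R\<^esub> f, HZero C (dm f) (cd f)) \<in> r"
    and r_scal_one: "arr f \<Longrightarrow> (Scal C \<one>\<^bsub>R\<^esub> f, f) \<in> r"
    and r_scal_mult: "\<lbrakk>a \<in> carrier R; b \<in> carrier R; arr f\<rbrakk>
        \<Longrightarrow> (Scal C (a \<otimes>\<^bsub>R\<^esub> b) f, Scal C a (Scal C b f)) \<in> r"
    and r_scal_add_left: "\<lbrakk>a \<in> carrier R; b \<in> carrier R; arr f\<rbrakk>
        \<Longrightarrow> (Scal C (a \<oplus>\<^bsub>R\<^esub> b) f, HAdd C (Scal C a f) (Scal C b f)) \<in> r"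
    and r_scal_add_right: "\<lbrakk>a \<in> carrier R; arr f; arr g; dm g = dm f; cd g = cd f\<rbrakk>
        \<Longrightarrow> (Scal C a (HAdd C f g), HAdd C (Scal C a f) (Scal C a g)) \<in> r"
    and r_comp_add: "\<lbrakk>arr f; arr f'; arr g; dm f' = dm f; cd f' = cd f; cd f = dm g\<rbrakk>
        \<Longrightarrow> (g \<cdot> HAdd C f f', HAdd C (g \<cdot> f) (g \<cdot> f')) \<in> r"
        "\<lbrakk>arr f; arr g; arr g'; dm g' = dm g; cd g' = cd g; cd f = dm g\<rbrakk>
        \<Longrightarrow> (HAdd C g g' \<cdot> f, HAdd C (g \<cdot> f) (g' \<cdot> f)) \<in> r"
    and r_comp_scal: "\<lbrakk>c \<in> carrier R; arr f; arr g; cd f = dm g\<rbrakk>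
        \<Longrightarrow> (g \<cdot> Scal C c f, Scal C c (g \<cdot> f)) \<in> r"
        "\<lbrakk>c \<in> carrier R; arr f; arr g; cd f = dm g\<rbrakk>
        \<Longrightarrow> (Scal C c g \<cdot> f, Scal C c (g \<cdot> f)) \<in> r"
    and r_tmor_add: "\<lbrakk>arr f; arr g; arr g'; dm g' = dm g; cd g' = cd g\<rbrakk>
        \<Longrightarrow> (f \<boxtimes> HAdd C g g', HAdd C (f \<boxtimes> g) (f \<boxtimes> g')) \<in> r"
        "\<lbrakk>arr f; arr f'; arr g; dm f' = dm f; cd f' = cd f\<rbrakk>
        \<Longrightarrow> (HAdd C f f' \<boxtimes> g, HAdd C (f \<boxtimes> g) (f' \<boxtimes> g)) \<in> r"
    and r_tmor_scal: "\<lbrakk>c \<in> carrier R; arr f; arr g\<rbrakk> \<Longrightarrow> (f \<boxtimes> Scal C c g, Scal C c (f \<boxtimes> g)) \<in> r"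
        "\<lbrakk>c \<in> carrier R; arr f; arr g\<rbrakk> \<Longrightarrow> (Scal C c f \<boxtimes> g, Scal C c (f \<boxtimes> g)) \<in> r"
begin

abbreviation Q where "Q \<equiv> quot_cat C r"

abbreviation cls where "cls f \<equiv> r `` {f}"

lemma cls_eq: "(f, g) \<in> r \<Longrightarrow> cls f = cls g"
  using r_sym r_trans by blast

lemma cls_eq_iff: "arr f \<or> arr g \<Longrightarrow> cls f = cls g \<longleftrightarrow> (f, g) \<in> r"
  using cls_eq r_refl r_sym by blast

lemma quot_sel [simp]:
  "Ob Q = Ob C" "Unt Q = Unt C" "TOb Q = TOb C" "Id Q X = cls (Id C X)"
  "HZero Q X Y = cls (HZero C X Y)"
  by (simp_all add: quot_cat_def)

lemma quot_homE:
  assumes "F \<in> Hom Q X Y" "X \<in> Ob C" "Y \<in> Ob C"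
  obtains f where "F = cls f" "arr f" "dm f = X" "cd f = Y"
  using assms homD by (fastforce simp: quot_cat_def quotient_def)

lemma quot_homI: "\<lbrakk>arr f; dm f = X; cd f = Y\<rbrakk> \<Longrightarrow> cls f \<in> Hom Q X Y"
  using arrD(1) by (auto simp: quot_cat_def intro: quotientI)

lemma quot_comp [simp]:
  assumes "arr f" "arr g" "cd f = dm g"
  shows "Comp Q (cls g) (cls f) = cls (g \<cdot> f)"
proof -
  have "Comp Q (cls g) (cls f) = (\<Union>x\<in>cls g. \<Union>y\<in>cls f. cls (x \<cdot> y))"
    by (simp add: quot_cat_def)
  also have "\<dots> = cls (g \<cdot> f)"
    using r_refl[OF assms(1)] r_refl[OF assms(2)]
    by (intro UN2_const[of g _ f]) (auto intro!: cls_eq[symmetric] r_comp assms(3) simp del: Image_singleton)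
  finally show ?thesis .
qed

lemma quot_tmor [simp]:
  assumes "arr f" "arr g"
  shows "TMor Q (cls f) (cls g) = cls (f \<boxtimes> g)"
proof -
  have "TMor Q (cls f) (cls g) = (\<Union>x\<in>cls f. \<Union>y\<in>cls g. cls (x \<boxtimes> y))"
    by (simp add: quot_cat_def)
  also have "\<dots> = cls (f \<boxtimes> g)"
    using r_refl[OF assms(1)] r_refl[OF assms(2)]
    by (intro UN2_const[of f _ g]) (auto intro!: cls_eq[symmetric] r_tmor simp del: Image_singleton)
  finally show ?thesis .
qed

lemma quot_add [simp]:
  assumes "arr f" "arr g" "dm g = dm f" "cd g = cd f"
  shows "HAdd Q (cls f) (cls g) = cls (HAdd C f g)"
proof -
  have "HAdd Q (cls f) (cls g) = (\<Union>x\<in>cls f. \<Union>y\<in>cls g. cls (HAdd C x y))"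
    by (simp add: quot_cat_def)
  also have "\<dots> = cls (HAdd C f g)"
    using r_refl[OF assms(1)] r_refl[OF assms(2)]
    by (intro UN2_const[of f _ g])
      (auto intro!: cls_eq[symmetric] r_add assms(3,4)[symmetric] simp del: Image_singleton)
  finally show ?thesis .
qed

lemma quot_scal [simp]:
  assumes "c \<in> carrier R" "arr f"
  shows "Scal Q c (cls f) = cls (Scal C c f)"
proof -
  have "Scal Q c (cls f) = (\<Union>x\<in>cls f. cls (Scal C c x))"
    by (simp add: quot_cat_def)
  also have "\<dots> = cls (Scal C c f)"
    using r_refl[OF assms(2)]
    by (intro UN_constant_eq[of f]) (auto intro!: cls_eq[symmetric] r_scal assms(1) simp del: Image_singleton)
  finally show ?thesis .
qed

lemma quot_homD:
  "\<lbrakk>F \<in> Hom Q X Y; X \<in> Ob C; Y \<in> Ob C\<rbrakk> \<Longrightarrow> \<exists>f. F = cls f \<and> arr f \<and> dm f = X \<and> cd f = Y"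
  by (blast elim: quot_homE)

lemma quot_module:
  assumes ob: "X \<in> Ob C" "Y \<in> Ob C"
  shows "module R (hom_module Q X Y)"
proof -
  interpret R: cring R by (rule cring_R)
  note D = quot_homD[OF _ ob]
  show ?thesis
  proof (rule hom_moduleI[OF cring_R])
    show "HZero Q X Y \<in> Hom Q X Y" using ob by (simp add: quot_homI)
    show "HAdd Q (HZero Q X Y) f = f" if "f \<in> Hom Q X Y" for f
      using D[OF that] ob by (clarsimp, intro cls_eq r_hadd_zero)
    show "Scal Q \<zero>\<^bsub>R\<^esub> f = HZero Q X Y" if "f \<in> Hom Q X Y" for f
      using D[OF that] ob by (clarsimp, intro cls_eq r_scal_zero)
  qed (drule D; (drule D)?; (drule D)?; clarsimp simp: quot_homI;
      (rule cls_eq, rule r_hadd_assoc r_hadd_comm r_scal_one r_scal_mult r_scal_add_left r_scal_add_right; simp))+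
qed

lemma quot_lmc: "linear_monoidal_category R Q"
  by (rule linear_monoidal_category.intro; (simp only: quot_sel)?)
    ((simp add: quot_module quot_homI tob_assoc tob_unt)?;
     ((drule (2) quot_homD)+)?;
     (clarsimp simp: quot_homI)?;
     rule cls_eq,
     rule r_comp_id r_comp_assoc r_tmor_id r_interchange r_tmor_assoc r_tmor_unt
       r_comp_add r_comp_scal r_tmor_add r_tmor_scal;
     simp)+

lemma quot_disjoint:
  "\<lbrakk>X \<in> Ob Q; Y \<in> Ob Q; X' \<in> Ob Q; Y' \<in> Ob Q; f \<in> Hom Q X Y; f \<in> Hom Q X' Y'\<rbrakk>
    \<Longrightarrow> X = X' \<and> Y = Y'"
  by (elim quot_homE) (auto simp: cls_eq_iff dest!: r_arr)

end

locale typed_lmc = linear_monoidal_category R C + typed_ops R C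
  for R :: "('k, 'r) ring_scheme" and C :: "('k, 'o, 'm, 'z) lmcat_scheme" (structure)

lemma typed_lmcI:
  assumes "linear_monoidal_category R C"
    and "\<And>X Y X' Y' f. \<lbrakk>X \<in> Ob C; Y \<in> Ob C; X' \<in> Ob C; Y' \<in> Ob C; f \<in> Hom C X Y; f \<in> Hom C X' Y'\<rbrakk>
        \<Longrightarrow> X = X' \<and> Y = Y'"
  shows "typed_lmc R C"
proof -
  interpret linear_monoidal_category R C by fact
  show ?thesis
    by unfold_locales (use assms(2) in \<open>auto simp: unt_ob tob_ob id_hom intro: comp_hom tmor_hom\<close>)
qed

section \<open>Laws without explicit objects, and tensor ideals\<close>

context typed_lmc
begin

definition hdiff :: "'m \<Rightarrow> 'm \<Rightarrow> 'm" where
  "hdiff f g = HAdd C f (Scal C (\<ominus>\<^bsub>R\<^esub> \<one>\<^bsub>R\<^esub>) g)"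

lemma R_minus_one [simp]: "\<ominus>\<^bsub>R\<^esub> \<one>\<^bsub>R\<^esub> \<in> carrier R"
  using cring_R by (simp add: abelian_group.a_inv_closed cring_def ring.is_abelian_group ring.ring_simprules(6))

lemma a_comp_id [simp]: "\<lbrakk>arr f; dm f = X\<rbrakk> \<Longrightarrow> f \<cdot> Id C X = f" "\<lbrakk>arr f; cd f = X\<rbrakk> \<Longrightarrow> Id C X \<cdot> f = f"
  using comp_id[of "dm f" "cd f" f] arrD by auto

lemma a_comp_assoc: "\<lbrakk>arr f; arr g; arr h; cd f = dm g; cd g = dm h\<rbrakk> \<Longrightarrow> h \<cdot> g \<cdot> f = h \<cdot> (g \<cdot> f)"
  by (rule comp_assoc[of "dm f" "cd f" "cd g" "cd h"]) (simp_all add: hom_iff)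

lemma a_tmor_id: "\<lbrakk>X \<in> Ob C; Y \<in> Ob C\<rbrakk> \<Longrightarrow> Id C X \<boxtimes> Id C Y = Id C (TOb C X Y)"
  by (rule tmor_id)

lemma a_interchange: "\<lbrakk>arr f; arr g; arr f'; arr g'; cd f = dm g; cd f' = dm g'\<rbrakk>
    \<Longrightarrow> (g \<boxtimes> g') \<cdot> (f \<boxtimes> f') = (g \<cdot> f) \<boxtimes> (g' \<cdot> f')"
  by (rule interchange[of "dm f" "cd f" "cd g" "dm f'" "cd f'" "cd g'", symmetric])
    (simp_all add: hom_iff)

lemma a_tmor_assoc: "\<lbrakk>arr f; arr g; arr h\<rbrakk> \<Longrightarrow> f \<boxtimes> g \<boxtimes> h = f \<boxtimes> (g \<boxtimes> h)"
  by (rule tmor_assoc[of "dm f" "cd f" "dm g" "cd g" "dm h" "cd h"]) (simp_all add: hom_iff)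

lemma a_tmor_unt [simp]: "arr f \<Longrightarrow> Id C (Unt C) \<boxtimes> f = f" "arr f \<Longrightarrow> f \<boxtimes> Id C (Unt C) = f"
  using tmor_unt[of "dm f" "cd f" f] arrD by auto

lemma a_hadd_assoc: "\<lbrakk>arr f; arr g; arr h; dm g = dm f; dm h = dm f; cd g = cd f; cd h = cd f\<rbrakk>
    \<Longrightarrow> HAdd C (HAdd C f g) h = HAdd C f (HAdd C g h)"
  by (rule hadd_assoc[of "dm f" "cd f"]) (simp_all add: hom_iff)

lemma a_hadd_comm: "\<lbrakk>arr f; arr g; dm g = dm f; cd g = cd f\<rbrakk> \<Longrightarrow> HAdd C f g = HAdd C g f"
  by (rule hadd_comm[of "dm f" "cd f"]) (simp_all add: hom_iff)

lemma a_hadd_lcomm: "\<lbrakk>arr f; arr g; arr h; dm g = dm f; dm h = dm f; cd g = cd f; cd h = cd f\<rbrakk>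
    \<Longrightarrow> HAdd C f (HAdd C g h) = HAdd C g (HAdd C f h)"
  by (rule hadd_lcomm[of "dm f" "cd f"]) (simp_all add: hom_iff)

lemmas a_hadd_ac = a_hadd_assoc a_hadd_comm a_hadd_lcomm

lemma a_hadd_zero [simp]: "\<lbrakk>arr f; dm f = X; cd f = Y\<rbrakk> \<Longrightarrow> HAdd C (HZero C X Y) f = f"
    "\<lbrakk>arr f; dm f = X; cd f = Y\<rbrakk> \<Longrightarrow> HAdd C f (HZero C X Y) = f"
  using hzero_add[of X Y f] by (auto simp: hom_iff)

lemma a_scal_zero [simp]: "arr f \<Longrightarrow> Scal C \<zero>\<^bsub>R\<^esub> f = HZero C (dm f) (cd f)"
  using scal_zero[of "dm f" "cd f" f] by (simp add: hom_iff)

lemma a_scal_one [simp]: "arr f \<Longrightarrow> Scal C \<one>\<^bsub>R\<^esub> f = f"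
  using scal_one[of "dm f" "cd f" f] by (simp add: hom_iff)

lemma a_scal_hzero [simp]: "\<lbrakk>a \<in> carrier R; X \<in> Ob C; Y \<in> Ob C\<rbrakk> \<Longrightarrow> Scal C a (HZero C X Y) = HZero C X Y"
  by (rule scal_hzero)

lemma a_scal_mult: "\<lbrakk>a \<in> carrier R; b \<in> carrier R; arr f\<rbrakk>
    \<Longrightarrow> Scal C (a \<otimes>\<^bsub>R\<^esub> b) f = Scal C a (Scal C b f)"
  by (rule scal_mult[of "dm f" "cd f"]) (simp_all add: hom_iff)

lemma a_scal_add_left: "\<lbrakk>a \<in> carrier R; b \<in> carrier R; arr f\<rbrakk>
    \<Longrightarrow> Scal C (a \<oplus>\<^bsub>R\<^esub> b) f = HAdd C (Scal C a f) (Scal C b f)"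
  by (rule scal_add_left[of "dm f" "cd f"]) (simp_all add: hom_iff)

lemma a_scal_add_right: "\<lbrakk>a \<in> carrier R; arr f; arr g; dm g = dm f; cd g = cd f\<rbrakk>
    \<Longrightarrow> Scal C a (HAdd C f g) = HAdd C (Scal C a f) (Scal C a g)"
  by (rule scal_add_right[of "dm f" "cd f"]) (simp_all add: hom_iff)

lemma a_comp_add:
  "\<lbrakk>arr f; arr f'; arr g; dm f' = dm f; cd f' = cd f; cd f = dm g\<rbrakk>
    \<Longrightarrow> g \<cdot> HAdd C f f' = HAdd C (g \<cdot> f) (g \<cdot> f')"
  "\<lbrakk>arr f; arr g; arr g'; dm g' = dm g; cd g' = cd g; cd f = dm g\<rbrakk>
    \<Longrightarrow> HAdd C g g' \<cdot> f = HAdd C (g \<cdot> f) (g' \<cdot> f)"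
  by (rule comp_add[of "dm f" "cd f" "cd g"]; simp add: hom_iff)+

lemma a_comp_scal:
  "\<lbrakk>c \<in> carrier R; arr f; arr g; cd f = dm g\<rbrakk> \<Longrightarrow> g \<cdot> Scal C c f = Scal C c (g \<cdot> f)"
  "\<lbrakk>c \<in> carrier R; arr f; arr g; cd f = dm g\<rbrakk> \<Longrightarrow> Scal C c g \<cdot> f = Scal C c (g \<cdot> f)"
  by (rule comp_scal[of "dm f" "cd f" "cd g"]; simp add: hom_iff)+

lemma a_tmor_add:
  "\<lbrakk>arr f; arr g; arr g'; dm g' = dm g; cd g' = cd g\<rbrakk> \<Longrightarrow> f \<boxtimes> HAdd C g g' = HAdd C (f \<boxtimes> g) (f \<boxtimes> g')"
  "\<lbrakk>arr f; arr f'; arr g; dm f' = dm f; cd f' = cd f\<rbrakk> \<Longrightarrow> HAdd C f f' \<boxtimes> g = HAdd C (f \<boxtimes> g) (f' \<boxtimes> g)"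
  by (rule tmor_add[of "dm f" "cd f" "dm g" "cd g"]; simp add: hom_iff)+

lemma a_tmor_scal:
  "\<lbrakk>c \<in> carrier R; arr f; arr g\<rbrakk> \<Longrightarrow> f \<boxtimes> Scal C c g = Scal C c (f \<boxtimes> g)"
  "\<lbrakk>c \<in> carrier R; arr f; arr g\<rbrakk> \<Longrightarrow> Scal C c f \<boxtimes> g = Scal C c (f \<boxtimes> g)"
  by (rule tmor_scal[of "dm f" "cd f" "dm g" "cd g"]; simp add: hom_iff)+

lemma a_comp_zero [simp]:
  "\<lbrakk>arr f; cd f = Y; Z \<in> Ob C\<rbrakk> \<Longrightarrow> HZero C Y Z \<cdot> f = HZero C (dm f) Z"
  "\<lbrakk>arr g; dm g = Y; X \<in> Ob C\<rbrakk> \<Longrightarrow> g \<cdot> HZero C X Y = HZero C X (cd g)"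
  using comp_hzero(1)[of "dm f" "cd f" Z f] comp_hzero(2)[of X "dm g" "cd g" g] arrD by auto

lemma a_tmor_zero [simp]:
  "\<lbrakk>arr f; X \<in> Ob C; Y \<in> Ob C\<rbrakk> \<Longrightarrow> f \<boxtimes> HZero C X Y = HZero C (TOb C (dm f) X) (TOb C (cd f) Y)"
  "\<lbrakk>arr f; X \<in> Ob C; Y \<in> Ob C\<rbrakk> \<Longrightarrow> HZero C X Y \<boxtimes> f = HZero C (TOb C X (dm f)) (TOb C Y (cd f))"
  using tmor_hzero(1)[of "dm f" "cd f" X Y f] tmor_hzero(2)[of X Y "dm f" "cd f" f] arrD by auto

lemma hdiff_arr [simp]: "\<lbrakk>arr f; arr g; dm g = dm f; cd g = cd f\<rbrakk> \<Longrightarrow> arr (hdiff f g)"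
  "\<lbrakk>arr f; arr g; dm g = dm f; cd g = cd f\<rbrakk> \<Longrightarrow> dm (hdiff f g) = dm f"
  "\<lbrakk>arr f; arr g; dm g = dm f; cd g = cd f\<rbrakk> \<Longrightarrow> cd (hdiff f g) = cd f"
  by (simp_all add: hdiff_def)

lemma a_hminus: "\<lbrakk>arr f; arr g; dm f = X; cd f = Y; dm g = X; cd g = Y\<rbrakk>
    \<Longrightarrow> f \<ominus>\<^bsub>hom_module C X Y\<^esub> g = hdiff f g"
  unfolding hdiff_def by (rule hminus) (auto simp: hom_iff)

lemma hdiff_self [simp]: "arr f \<Longrightarrow> hdiff f f = HZero C (dm f) (cd f)"
  unfolding hdiff_def using hadd_neg[of "dm f" "cd f" f] by (simp add: hom_iff)

lemma hdiff_eqD: "\<lbrakk>hdiff f g = HZero C (dm f) (cd f); arr f; arr g; dm g = dm f; cd g = cd f\<rbrakk> \<Longrightarrow> f = g"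
  unfolding hdiff_def by (rule hdiff_zero[of "dm f" "cd f"]) (auto simp: hom_iff)

lemma scal_minus_one_twice: "arr f \<Longrightarrow> Scal C (\<ominus>\<^bsub>R\<^esub> \<one>\<^bsub>R\<^esub>) (Scal C (\<ominus>\<^bsub>R\<^esub> \<one>\<^bsub>R\<^esub>) f) = f"
proof -
  assume f: "arr f"
  interpret R: cring R by (rule cring_R)
  have "\<ominus>\<^bsub>R\<^esub> \<one>\<^bsub>R\<^esub> \<otimes>\<^bsub>R\<^esub> \<ominus>\<^bsub>R\<^esub> \<one>\<^bsub>R\<^esub> = \<one>\<^bsub>R\<^esub>"
    by (simp add: R.l_minus)
  then show ?thesis using f by (simp flip: a_scal_mult)
qed

lemma hdiff_sym: "\<lbrakk>arr f; arr g; dm g = dm f; cd g = cd f\<rbrakk>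
    \<Longrightarrow> hdiff g f = Scal C (\<ominus>\<^bsub>R\<^esub> \<one>\<^bsub>R\<^esub>) (hdiff f g)"
  by (simp add: hdiff_def a_scal_add_right scal_minus_one_twice a_hadd_comm)

lemma hdiff_trans: "\<lbrakk>arr f; arr g; arr h; dm g = dm f; cd g = cd f; dm h = dm f; cd h = cd f\<rbrakk>
    \<Longrightarrow> hdiff f h = HAdd C (hdiff f g) (hdiff g h)"
proof -
  assume *: "arr f" "arr g" "arr h" "dm g = dm f" "cd g = cd f" "dm h = dm f" "cd h = cd f"
  have "HAdd C (hdiff f g) (hdiff g h) = HAdd C (hdiff f h) (hdiff g g)"
    unfolding hdiff_def using * by (simp add: a_hadd_ac)
  then show ?thesis using * by simp
qed

lemma hdiff_add: "\<lbrakk>arr f; arr g; arr f'; arr g'; dm g = dm f; cd g = cd f; dm f' = dm f; cd f' = cd f;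
      dm g' = dm f; cd g' = cd f\<rbrakk>
    \<Longrightarrow> hdiff (HAdd C f g) (HAdd C f' g') = HAdd C (hdiff f f') (hdiff g g')"
  by (simp add: hdiff_def a_scal_add_right a_hadd_ac)

lemma hdiff_scal: "\<lbrakk>c \<in> carrier R; arr f; arr g; dm g = dm f; cd g = cd f\<rbrakk>
    \<Longrightarrow> hdiff (Scal C c f) (Scal C c g) = Scal C c (hdiff f g)"
proof -
  interpret R: cring R by (rule cring_R)
  show "\<lbrakk>c \<in> carrier R; arr f; arr g; dm g = dm f; cd g = cd f\<rbrakk>
    \<Longrightarrow> hdiff (Scal C c f) (Scal C c g) = Scal C c (hdiff f g)"
    by (simp add: hdiff_def a_scal_add_right R.m_comm flip: a_scal_mult)
qed

text \<open>The usual telescoping through the mixed composite of \<open>g\<close> and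
  \<open>f'\<close>. Together with its tensor analogue it converts closure of an ideal under the
  operations into compatibility of the associated congruence.\<close>

lemma hdiff_comp: "\<lbrakk>arr f; arr f'; arr g; arr g'; dm f' = dm f; cd f' = cd f; dm g' = dm g; cd g' = cd g; cd f = dm g\<rbrakk>
    \<Longrightarrow> hdiff (g \<cdot> f) (g' \<cdot> f') = HAdd C (g \<cdot> hdiff f f') (hdiff g g' \<cdot> f')"
  by (subst hdiff_trans[of _ "g \<cdot> f'"]) (simp_all add: hdiff_def a_comp_add a_comp_scal)

lemma hdiff_tmor: "\<lbrakk>arr f; arr f'; arr g; arr g'; dm f' = dm f; cd f' = cd f; dm g' = dm g; cd g' = cd g\<rbrakk>
    \<Longrightarrow> hdiff (g \<boxtimes> f) (g' \<boxtimes> f') = HAdd C (g \<boxtimes> hdiff f f') (hdiff g g' \<boxtimes> f')"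
  by (subst hdiff_trans[of _ "g \<boxtimes> f'"]) (simp_all add: hdiff_def a_tmor_add a_tmor_scal)

lemma ideal_congruence:
  assumes N_arr: "\<And>f. N f \<Longrightarrow> arr f"
    and N_zero: "\<And>X Y. \<lbrakk>X \<in> Ob C; Y \<in> Ob C\<rbrakk> \<Longrightarrow> N (HZero C X Y)"
    and N_add: "\<And>f g. \<lbrakk>N f; N g; dm g = dm f; cd g = cd f\<rbrakk> \<Longrightarrow> N (HAdd C f g)"
    and N_scal: "\<And>c f. \<lbrakk>c \<in> carrier R; N f\<rbrakk> \<Longrightarrow> N (Scal C c f)"
    and N_comp: "\<And>f g. \<lbrakk>N f; arr g; cd f = dm g\<rbrakk> \<Longrightarrow> N (g \<cdot> f)"
      "\<And>f g. \<lbrakk>arr f; N g; cd f = dm g\<rbrakk> \<Longrightarrow> N (g \<cdot> f)"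
    and N_tmor: "\<And>f g. \<lbrakk>N f; arr g\<rbrakk> \<Longrightarrow> N (f \<boxtimes> g)" "\<And>f g. \<lbrakk>arr f; N g\<rbrakk> \<Longrightarrow> N (f \<boxtimes> g)"
  shows "monoidal_congruence R C {(f, g). arr f \<and> arr g \<and> dm g = dm f \<and> cd g = cd f \<and> N (hdiff f g)}"
    (is "monoidal_congruence R C ?r")
proof -
  have refl: "(f, g) \<in> ?r" if "f = g" "arr f" for f g
    using that N_zero by simp
  show ?thesis
  proof (intro monoidal_congruence.intro typed_ops_axioms monoidal_congruence_axioms.intro)
    show "cring R" by (rule cring_R)
    show "(f, g) \<in> ?r \<Longrightarrow> (g, f) \<in> ?r" for f g
      using hdiff_sym[of f g] N_scal by auto
    show "(f, h) \<in> ?r" if "(f, g) \<in> ?r" "(g, h) \<in> ?r" for f g h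
      using hdiff_trans[of f g h] N_add that by auto
    show "(g \<cdot> f, g' \<cdot> f') \<in> ?r" if "(f, f') \<in> ?r" "(g, g') \<in> ?r" "cd f = dm g" for f f' g g'
      using hdiff_comp[of f f' g g'] N_add N_comp that by auto
    show "(f \<boxtimes> g, f' \<boxtimes> g') \<in> ?r" if "(f, f') \<in> ?r" "(g, g') \<in> ?r" for f f' g g'
      using hdiff_tmor[of g g' f f'] N_add N_tmor that by auto
    show "(HAdd C f g, HAdd C f' g') \<in> ?r" if "(f, f') \<in> ?r" "(g, g') \<in> ?r" "dm f = dm g" "cd f = cd g"
      for f f' g g'
      using hdiff_add[of f g f' g'] N_add that by auto
    show "(Scal C c f, Scal C c f') \<in> ?r" if "c \<in> carrier R" "(f, f') \<in> ?r" for c f f'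
      using hdiff_scal[of c f f'] N_scal that by auto
    show "(HAdd C f g, HAdd C g f) \<in> ?r" if "arr f" "arr g" "dm g = dm f" "cd g = cd f" for f g
      using that by (intro refl a_hadd_comm) auto
  qed (simp_all add: tob_assoc tob_unt refl a_comp_assoc a_tmor_id a_interchange a_tmor_assoc a_hadd_assoc
      a_scal_mult a_scal_add_left a_scal_add_right a_comp_add a_comp_scal a_tmor_add a_tmor_scal N_zero)
qed

end

section \<open>Finite sums of morphisms\<close>

lemma div_less_index: "r < a * b \<Longrightarrow> r div b < (a::nat)"
  by (rule less_mult_imp_div_less)

lemma mod_less_index: "r < a * b \<Longrightarrow> r mod b < (b::nat)"
  by (cases b) auto

context typed_lmc
begin

lemma hsum_cong: "(\<And>k. k < n \<Longrightarrow> f k = g k) \<Longrightarrow> hom_sum C X Y f n = hom_sum C X Y g n"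
  by (induction n) auto

lemma hsum_cong': "\<lbrakk>X = X'; Y = Y'; n = n'; \<And>k. k < n' \<Longrightarrow> f k = g k\<rbrakk>
    \<Longrightarrow> hom_sum C X Y f n = hom_sum C X' Y' g n'"
  by (simp only:, rule hsum_cong)

lemma hsum_arr [simp]:
  assumes "X \<in> Ob C" "Y \<in> Ob C" "\<And>k. k < n \<Longrightarrow> arr (f k)" "\<And>k. k < n \<Longrightarrow> dm (f k) = X"
    "\<And>k. k < n \<Longrightarrow> cd (f k) = Y"
  shows "arr (hom_sum C X Y f n)" "dm (hom_sum C X Y f n) = X" "cd (hom_sum C X Y f n) = Y"
proof -
  have "arr (hom_sum C X Y f n) \<and> dm (hom_sum C X Y f n) = X \<and> cd (hom_sum C X Y f n) = Y"
    using assms by (induction n) auto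
  then show "arr (hom_sum C X Y f n)" "dm (hom_sum C X Y f n) = X" "cd (hom_sum C X Y f n) = Y"
    by auto
qed

context
  fixes X Y assumes ob [simp]: "X \<in> Ob C" "Y \<in> Ob C"
begin

lemma hsum_zero [simp]: "hom_sum C X Y (\<lambda>k. HZero C X Y) n = HZero C X Y"
  by (induction n) auto

lemma hsum_add:
  assumes "\<And>k. k < n \<Longrightarrow> arr (f k)" "\<And>k. k < n \<Longrightarrow> dm (f k) = X" "\<And>k. k < n \<Longrightarrow> cd (f k) = Y"
    "\<And>k. k < n \<Longrightarrow> arr (g k)" "\<And>k. k < n \<Longrightarrow> dm (g k) = X" "\<And>k. k < n \<Longrightarrow> cd (g k) = Y"
  shows "hom_sum C X Y (\<lambda>k. HAdd C (f k) (g k)) n = HAdd C (hom_sum C X Y f n) (hom_sum C X Y g n)"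
  using assms by (induction n) (simp_all add: a_hadd_ac)

lemma hsum_scal:
  assumes "c \<in> carrier R"
    "\<And>k. k < n \<Longrightarrow> arr (f k)" "\<And>k. k < n \<Longrightarrow> dm (f k) = X" "\<And>k. k < n \<Longrightarrow> cd (f k) = Y"
  shows "Scal C c (hom_sum C X Y f n) = hom_sum C X Y (\<lambda>k. Scal C c (f k)) n"
  using assms by (induction n) (simp_all add: a_scal_add_right)

lemma hsum_comp_left:
  assumes "\<And>k. k < n \<Longrightarrow> arr (f k)" "\<And>k. k < n \<Longrightarrow> dm (f k) = X" "\<And>k. k < n \<Longrightarrow> cd (f k) = Y"
    and "arr g" "dm g = Y" "cd g = Z"
  shows "g \<cdot> hom_sum C X Y f n = hom_sum C X Z (\<lambda>k. g \<cdot> f k) n"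
  using assms(1-3) by (induction n) (use assms(4-) in \<open>auto simp: a_comp_add\<close>)

lemma hsum_comp_right:
  assumes "\<And>k. k < n \<Longrightarrow> arr (f k)" "\<And>k. k < n \<Longrightarrow> dm (f k) = X" "\<And>k. k < n \<Longrightarrow> cd (f k) = Y"
    and "arr g" "cd g = X" "dm g = W"
  shows "hom_sum C X Y f n \<cdot> g = hom_sum C W Y (\<lambda>k. f k \<cdot> g) n"
  using assms(1-3) by (induction n) (use assms(4-) in \<open>auto simp: a_comp_add\<close>)

lemma hsum_tmor_left:
  assumes "\<And>k. k < n \<Longrightarrow> arr (f k)" "\<And>k. k < n \<Longrightarrow> dm (f k) = X" "\<And>k. k < n \<Longrightarrow> cd (f k) = Y"
    and "arr g" "dm g = X'" "cd g = Y'"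
  shows "g \<boxtimes> hom_sum C X Y f n = hom_sum C (TOb C X' X) (TOb C Y' Y) (\<lambda>k. g \<boxtimes> f k) n"
  using assms(1-3) by (induction n) (use assms(4-) in \<open>auto simp: a_tmor_add\<close>)

lemma hsum_tmor_right:
  assumes "\<And>k. k < n \<Longrightarrow> arr (f k)" "\<And>k. k < n \<Longrightarrow> dm (f k) = X" "\<And>k. k < n \<Longrightarrow> cd (f k) = Y"
    and "arr g" "dm g = X'" "cd g = Y'"
  shows "hom_sum C X Y f n \<boxtimes> g = hom_sum C (TOb C X X') (TOb C Y Y') (\<lambda>k. f k \<boxtimes> g) n"
  using assms(1-3) by (induction n) (use assms(4-) in \<open>auto simp: a_tmor_add\<close>)

lemma hsum_swap:
  assumes "\<And>i j. \<lbrakk>i < n; j < m\<rbrakk> \<Longrightarrow> arr (f i j)" "\<And>i j. \<lbrakk>i < n; j < m\<rbrakk> \<Longrightarrow> dm (f i j) = X"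
    "\<And>i j. \<lbrakk>i < n; j < m\<rbrakk> \<Longrightarrow> cd (f i j) = Y"
  shows "hom_sum C X Y (\<lambda>i. hom_sum C X Y (\<lambda>j. f i j) m) n =
    hom_sum C X Y (\<lambda>j. hom_sum C X Y (\<lambda>i. f i j) n) m"
  using assms by (induction n) (simp_all add: hsum_add)

lemma hsum_append:
  assumes "\<And>k. k < n + m \<Longrightarrow> arr (f k)" "\<And>k. k < n + m \<Longrightarrow> dm (f k) = X" "\<And>k. k < n + m \<Longrightarrow> cd (f k) = Y"
  shows "hom_sum C X Y f (n + m) = HAdd C (hom_sum C X Y f n) (hom_sum C X Y (\<lambda>k. f (n + k)) m)"
  using assms by (induction m) (simp_all add: a_hadd_assoc)

text \<open>Flattens a double sum in the row-major order of \<open>list_tensor\<close>, which is how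
  products of Kronecker matrices are summed.\<close>

lemma hsum_prod:
  assumes "\<And>i j. \<lbrakk>i < n; j < m\<rbrakk> \<Longrightarrow> arr (f i j)" "\<And>i j. \<lbrakk>i < n; j < m\<rbrakk> \<Longrightarrow> dm (f i j) = X"
    "\<And>i j. \<lbrakk>i < n; j < m\<rbrakk> \<Longrightarrow> cd (f i j) = Y"
  shows "hom_sum C X Y (\<lambda>r. f (r div m) (r mod m)) (n * m) =
    hom_sum C X Y (\<lambda>i. hom_sum C X Y (\<lambda>j. f i j) m) n"
  using assms
proof (induction n)
  case (Suc n)
  have *: "r div m < Suc n" "r mod m < m" if "r < n * m + m" for r
    using div_less_index[of r "Suc n" m] mod_less_index[of r "Suc n" m] that by (auto simp: add.commute)
  have "hom_sum C X Y (\<lambda>r. f (r div m) (r mod m)) (n * m + m) =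
    HAdd C (hom_sum C X Y (\<lambda>r. f (r div m) (r mod m)) (n * m))
      (hom_sum C X Y (\<lambda>k. f ((n * m + k) div m) ((n * m + k) mod m)) m)"
    using * Suc.prems by (intro hsum_append) auto
  also have "hom_sum C X Y (\<lambda>k. f ((n * m + k) div m) ((n * m + k) mod m)) m = hom_sum C X Y (f n) m"
    by (intro hsum_cong) auto
  finally show ?case using Suc by (simp add: add.commute)
qed simp

lemma hsum_single:
  assumes "l < n" "\<And>k. \<lbrakk>k < n; k \<noteq> l\<rbrakk> \<Longrightarrow> f k = HZero C X Y"
    and "arr (f l)" "dm (f l) = X" "cd (f l) = Y"
  shows "hom_sum C X Y f n = f l"
  using assms(1,2)
proof (induction n)
  case (Suc n)
  show ?case
  proof (cases "n = l")
    case True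
    have "hom_sum C X Y f n = hom_sum C X Y (\<lambda>k. HZero C X Y) n"
      using Suc.prems True by (intro hsum_cong) auto
    then show ?thesis using True assms by simp
  next
    case False
    then show ?thesis using Suc assms by simp
  qed
qed simp

end

end

section \<open>The additive envelope\<close>

lemma matrix_eq_iff: "matrix X Y f = matrix X' Y' g \<longleftrightarrow>
    X = X' \<and> Y = Y' \<and> (\<forall>i<length Y. \<forall>j<length X. f i j = g i j)"
  by (auto simp: matrix_def fun_eq_iff)

lemma list_tensor_simps [simp]:
  "list_tensor C [] Y = []"
  "list_tensor C (x # X) Y = map (TOb C x) Y @ list_tensor C X Y"
  "list_tensor C (X @ X') Y = list_tensor C X Y @ list_tensor C X' Y"
  by (simp_all add: list_tensor_def)

lemma length_list_tensor [simp]: "length (list_tensor C X Y) = length X * length Y"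
  by (induction X) simp_all

lemma nth_list_tensor [simp]: "r < length X * length Y \<Longrightarrow>
    list_tensor C X Y ! r = TOb C (X ! (r div length Y)) (Y ! (r mod length Y))"
proof (induction X arbitrary: r)
  case (Cons x X)
  show ?case
  proof (cases "r < length Y")
    case False
    moreover have "0 < length Y" using Cons.prems by (cases Y) auto
    ultimately have "r div length Y = Suc ((r - length Y) div length Y)"
      "(r - length Y) mod length Y = r mod length Y"
      by (simp_all add: le_div_geq le_mod_geq)
    then show ?thesis using False Cons by (simp add: nth_append)
  qed (simp add: nth_append)
qed simp

locale typed_piv = typed_lmc R C
  for R :: "('k, 'r) ring_scheme" and C :: "('k, 'o, 'm, 'z) pivcat_scheme" (structure)
begin

abbreviation AE where "AE \<equiv> additive_envelope C"

definition mtp :: "'o list \<Rightarrow> 'o list \<Rightarrow> (nat \<Rightarrow> nat \<Rightarrow> 'm) \<Rightarrow> bool" where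
  "mtp X Y f \<longleftrightarrow> (\<forall>i<length Y. \<forall>j<length X. arr (f i j) \<and> dm (f i j) = X ! j \<and> cd (f i j) = Y ! i)"

lemma AE_ob [simp]: "X \<in> Ob AE \<longleftrightarrow> set X \<subseteq> Ob C"
  by (simp add: additive_envelope_def)

lemma AE_sel [simp]: "Unt AE = [Unt C]" "TOb AE = list_tensor C"
  by (simp_all add: additive_envelope_def)

lemma nth_ob [simp]: "\<lbrakk>set X \<subseteq> Ob C; j < length X\<rbrakk> \<Longrightarrow> X ! j \<in> Ob C"
  by auto

lemma AE_hom: "Hom AE X Y = {matrix X Y f | f. \<forall>i<length Y. \<forall>j<length X. f i j \<in> Hom C (X ! j) (Y ! i)}"
  by (simp add: additive_envelope_def)

lemma mtp_iff: "\<lbrakk>set X \<subseteq> Ob C; set Y \<subseteq> Ob C\<rbrakk>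
    \<Longrightarrow> (\<forall>i<length Y. \<forall>j<length X. f i j \<in> Hom C (X ! j) (Y ! i)) \<longleftrightarrow> mtp X Y f"
  by (simp add: mtp_def hom_iff)

lemma AE_homD: "\<lbrakk>F \<in> Hom AE X Y; set X \<subseteq> Ob C; set Y \<subseteq> Ob C\<rbrakk> \<Longrightarrow> \<exists>f. F = matrix X Y f \<and> mtp X Y f"
  by (simp add: AE_hom mtp_iff)

lemma AE_homI: "\<lbrakk>mtp X Y f; set X \<subseteq> Ob C; set Y \<subseteq> Ob C\<rbrakk> \<Longrightarrow> matrix X Y f \<in> Hom AE X Y"
  by (auto simp: AE_hom mtp_iff)

lemma AE_id: "Id AE X = matrix X X (\<lambda>i j. if i = j then Id C (X ! i) else HZero C (X ! j) (X ! i))"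
  by (simp add: additive_envelope_def)

lemma AE_zero: "HZero AE X Y = matrix X Y (\<lambda>i j. HZero C (X ! j) (Y ! i))"
  by (simp add: additive_envelope_def)

lemma AE_comp: "Comp AE (matrix Y Z g) (matrix X Y f) =
    matrix X Z (\<lambda>i j. hom_sum C (X ! j) (Z ! i) (\<lambda>k. g i k \<cdot> f k j) (length Y))"
  by (auto simp: additive_envelope_def matrix_eq_iff matrix_def[of Y Z g] matrix_def[of X Y f] intro: hsum_cong)

lemma AE_add: "HAdd AE (matrix X Y f) (matrix X Y g) = matrix X Y (\<lambda>i j. HAdd C (f i j) (g i j))"
  by (auto simp: additive_envelope_def matrix_eq_iff matrix_def[of X Y g] matrix_def[of X Y f])

lemma AE_scal: "Scal AE c (matrix X Y f) = matrix X Y (\<lambda>i j. Scal C c (f i j))"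
  by (auto simp: additive_envelope_def matrix_eq_iff matrix_def[of X Y f])

lemma AE_tmor: "TMor AE (matrix X Y f) (matrix X' Y' f') =
    matrix (list_tensor C X X') (list_tensor C Y Y')
      (\<lambda>i j. f (i div length Y') (j div length X') \<boxtimes> f' (i mod length Y') (j mod length X'))"
  by (auto simp: additive_envelope_def matrix_eq_iff matrix_def[of X' Y' f'] matrix_def[of X Y f]
      div_less_index mod_less_index)

lemmas AE_ops = AE_id AE_zero AE_comp AE_add AE_scal AE_tmor

lemma set_list_tensor: "\<lbrakk>set X \<subseteq> Ob C; set Y \<subseteq> Ob C\<rbrakk> \<Longrightarrow> set (list_tensor C X Y) \<subseteq> Ob C"
  by (auto simp: list_tensor_def t_tob subset_iff)

lemma list_tensor_map: "\<lbrakk>x \<in> Ob C; set Y \<subseteq> Ob C; set Z \<subseteq> Ob C\<rbrakk>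
    \<Longrightarrow> list_tensor C (map (TOb C x) Y) Z = map (TOb C x) (list_tensor C Y Z)"
  by (induction Y) (auto simp: tob_assoc)

lemma list_tensor_assoc: "\<lbrakk>set X \<subseteq> Ob C; set Y \<subseteq> Ob C; set Z \<subseteq> Ob C\<rbrakk>
    \<Longrightarrow> list_tensor C (list_tensor C X Y) Z = list_tensor C X (list_tensor C Y Z)"
  by (induction X) (auto simp: list_tensor_map)

lemma list_tensor_unit: "set X \<subseteq> Ob C \<Longrightarrow> list_tensor C [Unt C] X = X"
    "set X \<subseteq> Ob C \<Longrightarrow> list_tensor C X [Unt C] = X"
  by (induction X) (auto simp: tob_unt)

lemma mtpD: "\<lbrakk>mtp X Y f; i < length Y; j < length X\<rbrakk> \<Longrightarrow> arr (f i j) \<and> dm (f i j) = X ! j \<and> cd (f i j) = Y ! i"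
  by (simp add: mtp_def)

lemma AE_module:
  assumes [simp]: "set X \<subseteq> Ob C" "set Y \<subseteq> Ob C"
  shows "module R (hom_module AE X Y)"
proof -
  interpret R: cring R by (rule cring_R)
  note D = AE_homD[OF _ assms]
  show ?thesis
  proof (rule hom_moduleI[OF cring_R])
    show "HZero AE X Y \<in> Hom AE X Y" by (simp add: AE_zero AE_homI mtp_def)
  qed (drule D; (drule D)?; (drule D)?; elim exE conjE;
      simp add: AE_ops matrix_eq_iff mtp_def a_hadd_assoc a_scal_mult a_scal_add_left a_scal_add_right;
      (rule AE_homI)?; (simp add: mtp_def a_hadd_comm)?)+
qed

lemma AE_lmc: "linear_monoidal_category R AE"
proof (rule linear_monoidal_category.intro; (simp only: AE_ob AE_sel)?)
  show "module R (hom_module AE X Y)" if "set X \<subseteq> Ob C" "set Y \<subseteq> Ob C" for X Y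
    using that by (rule AE_module)
  show "Comp AE (Comp AE H G) F = Comp AE H (Comp AE G F)"
    if *: "set W \<subseteq> Ob C" "set X \<subseteq> Ob C" "set Y \<subseteq> Ob C" "set Z \<subseteq> Ob C"
      "F \<in> Hom AE W X" "G \<in> Hom AE X Y" "H \<in> Hom AE Y Z" for W X Y Z F G H
  proof -
    obtain f g h where [simp]: "F = matrix W X f" "G = matrix X Y g" "H = matrix Y Z h"
      and t: "mtp W X f" "mtp X Y g" "mtp Y Z h"
      using * AE_homD by metis
    have "hom_sum C (W ! j) (Z ! i) (\<lambda>k. hom_sum C (X ! k) (Z ! i) (\<lambda>l. h i l \<cdot> g l k) (length Y) \<cdot> f k j) (length X) =
      hom_sum C (W ! j) (Z ! i) (\<lambda>l. h i l \<cdot> hom_sum C (W ! j) (Y ! l) (\<lambda>k. g l k \<cdot> f k j) (length X)) (length Y)"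
      if ij: "i < length Z" "j < length W" for i j
    proof -
      have "hom_sum C (W ! j) (Z ! i) (\<lambda>k. hom_sum C (X ! k) (Z ! i) (\<lambda>l. h i l \<cdot> g l k) (length Y) \<cdot> f k j) (length X) =
        hom_sum C (W ! j) (Z ! i) (\<lambda>k. hom_sum C (W ! j) (Z ! i) (\<lambda>l. h i l \<cdot> (g l k \<cdot> f k j)) (length Y)) (length X)"
        using * ij t unfolding mtp_def
        by (intro hsum_cong) (subst hsum_comp_right[where W = "W ! j"], auto simp: a_comp_assoc intro!: hsum_cong)
      also have "\<dots> = hom_sum C (W ! j) (Z ! i) (\<lambda>l. hom_sum C (W ! j) (Z ! i) (\<lambda>k. h i l \<cdot> (g l k \<cdot> f k j)) (length X)) (length Y)"
        using * ij t unfolding mtp_def by (intro hsum_swap) auto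
      also have "\<dots> = hom_sum C (W ! j) (Z ! i) (\<lambda>l. h i l \<cdot> hom_sum C (W ! j) (Y ! l) (\<lambda>k. g l k \<cdot> f k j) (length X)) (length Y)"
        using * ij t unfolding mtp_def
        by (intro hsum_cong, subst hsum_comp_left[where Z = "Z ! i"]) auto
      finally show ?thesis .
    qed
    then show ?thesis by (simp add: AE_comp matrix_eq_iff)
  qed
  show "TMor AE (Comp AE G F) (Comp AE G' F') = Comp AE (TMor AE G G') (TMor AE F F')"
    if *: "set X \<subseteq> Ob C" "set Y \<subseteq> Ob C" "set Z \<subseteq> Ob C" "set X' \<subseteq> Ob C" "set Y' \<subseteq> Ob C" "set Z' \<subseteq> Ob C"
      "F \<in> Hom AE X Y" "G \<in> Hom AE Y Z" "F' \<in> Hom AE X' Y'" "G' \<in> Hom AE Y' Z'"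
    for X Y Z X' Y' Z' F G F' G'
  proof -
    obtain f g f' g' where [simp]: "F = matrix X Y f" "G = matrix Y Z g" "F' = matrix X' Y' f'" "G' = matrix Y' Z' g'"
      and t: "mtp X Y f" "mtp Y Z g" "mtp X' Y' f'" "mtp Y' Z' g'"
      using * AE_homD by metis
    have "hom_sum C (X ! j) (Z ! i) (\<lambda>k. g i k \<cdot> f k j) (length Y) \<boxtimes>
        hom_sum C (X' ! j') (Z' ! i') (\<lambda>k. g' i' k \<cdot> f' k j') (length Y') =
      hom_sum C (TOb C (X ! j) (X' ! j')) (TOb C (Z ! i) (Z' ! i'))
        (\<lambda>r. (g i (r div length Y') \<boxtimes> g' i' (r mod length Y')) \<cdot>
             (f (r div length Y') j \<boxtimes> f' (r mod length Y') j')) (length Y * length Y')"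
      if ij: "i < length Z" "j < length X" "i' < length Z'" "j' < length X'" for i j i' j'
    proof -
      have "hom_sum C (X ! j) (Z ! i) (\<lambda>k. g i k \<cdot> f k j) (length Y) \<boxtimes>
          hom_sum C (X' ! j') (Z' ! i') (\<lambda>k. g' i' k \<cdot> f' k j') (length Y') =
        hom_sum C (TOb C (X ! j) (X' ! j')) (TOb C (Z ! i) (Z' ! i'))
          (\<lambda>k. (g i k \<cdot> f k j) \<boxtimes> hom_sum C (X' ! j') (Z' ! i') (\<lambda>k. g' i' k \<cdot> f' k j') (length Y')) (length Y)"
        using * ij t unfolding mtp_def by (intro hsum_tmor_right) auto
      also have "\<dots> = hom_sum C (TOb C (X ! j) (X' ! j')) (TOb C (Z ! i) (Z' ! i'))
          (\<lambda>k. hom_sum C (TOb C (X ! j) (X' ! j')) (TOb C (Z ! i) (Z' ! i'))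
            (\<lambda>l. (g i k \<cdot> f k j) \<boxtimes> (g' i' l \<cdot> f' l j')) (length Y')) (length Y)"
        using * ij t unfolding mtp_def by (intro hsum_cong hsum_tmor_left) auto
      also have "\<dots> = hom_sum C (TOb C (X ! j) (X' ! j')) (TOb C (Z ! i) (Z' ! i'))
          (\<lambda>k. hom_sum C (TOb C (X ! j) (X' ! j')) (TOb C (Z ! i) (Z' ! i'))
            (\<lambda>l. (g i k \<boxtimes> g' i' l) \<cdot> (f k j \<boxtimes> f' l j')) (length Y')) (length Y)"
        using * ij t unfolding mtp_def by (intro hsum_cong) (simp add: a_interchange)
      also have "\<dots> = hom_sum C (TOb C (X ! j) (X' ! j')) (TOb C (Z ! i) (Z' ! i'))
        (\<lambda>r. (g i (r div length Y') \<boxtimes> g' i' (r mod length Y')) \<cdot>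
             (f (r div length Y') j \<boxtimes> f' (r mod length Y') j')) (length Y * length Y')"
        using * ij t unfolding mtp_def by (intro hsum_prod[symmetric]) auto
      finally show ?thesis .
    qed
    then show ?thesis
      by (simp add: AE_comp AE_tmor matrix_eq_iff div_less_index mod_less_index cong: hsum_cong')
  qed
  show "Comp AE F (Id AE X) = F" if *: "set X \<subseteq> Ob C" "set Y \<subseteq> Ob C" "F \<in> Hom AE X Y" for X Y F
  proof -
    obtain f where [simp]: "F = matrix X Y f" and t: "mtp X Y f" using * AE_homD by metis
    have "hom_sum C (X ! j) (Y ! i) (\<lambda>k. f i k \<cdot> (if k = j then Id C (X ! k) else HZero C (X ! j) (X ! k)))
        (length X) = f i j" if "i < length Y" "j < length X" for i j
      using that t * by (subst hsum_single[where l = j]) (auto simp: mtp_def)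
    then show ?thesis by (simp add: AE_comp AE_id matrix_eq_iff)
  qed
  show "Comp AE (Id AE Y) F = F" if *: "set X \<subseteq> Ob C" "set Y \<subseteq> Ob C" "F \<in> Hom AE X Y" for X Y F
  proof -
    obtain f where [simp]: "F = matrix X Y f" and t: "mtp X Y f" using * AE_homD by metis
    have "hom_sum C (X ! j) (Y ! i) (\<lambda>k. (if i = k then Id C (Y ! i) else HZero C (Y ! k) (Y ! i)) \<cdot> f k j)
        (length Y) = f i j" if "i < length Y" "j < length X" for i j
      using that t * by (subst hsum_single[where l = i]) (auto simp: mtp_def)
    then show ?thesis by (simp add: AE_comp AE_id matrix_eq_iff)
  qed
  show "TMor AE (Id AE X) (Id AE Y) = Id AE (list_tensor C X Y)"
    if *: "set X \<subseteq> Ob C" "set Y \<subseteq> Ob C" for X Y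
  proof -
    let ?n = "length Y"
    have "(if r div ?n = s div ?n then Id C (X ! (r div ?n)) else HZero C (X ! (s div ?n)) (X ! (r div ?n))) \<boxtimes>
        (if r mod ?n = s mod ?n then Id C (Y ! (r mod ?n)) else HZero C (Y ! (s mod ?n)) (Y ! (r mod ?n))) =
      (if r = s then Id C (list_tensor C X Y ! r) else HZero C (list_tensor C X Y ! s) (list_tensor C X Y ! r))"
      if "r < length X * ?n" "s < length X * ?n" for r s
    proof -
      have ob: "X ! (r div ?n) \<in> Ob C" "Y ! (r mod ?n) \<in> Ob C" "X ! (s div ?n) \<in> Ob C" "Y ! (s mod ?n) \<in> Ob C"
        using that * by (auto simp: div_less_index mod_less_index)
      \<comment> \<open>Different flat indices differ in the quotient or in the remainder, so one of
        the two tensor factors is a zero morphism.\<close>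
      have "r div ?n \<noteq> s div ?n \<or> r mod ?n \<noteq> s mod ?n" if "r \<noteq> s"
        using that by (metis div_mult_mod_eq)
      then show ?thesis using that ob by (cases "r = s") (auto simp: a_tmor_id)
    qed
    then show ?thesis by (simp add: AE_id AE_tmor matrix_eq_iff)
  qed
  show "TMor AE (TMor AE F G) H = TMor AE F (TMor AE G H)"
    if *: "set X \<subseteq> Ob C" "set Y \<subseteq> Ob C" "set X' \<subseteq> Ob C" "set Y' \<subseteq> Ob C" "set X'' \<subseteq> Ob C" "set Y'' \<subseteq> Ob C"
      "F \<in> Hom AE X Y" "G \<in> Hom AE X' Y'" "H \<in> Hom AE X'' Y''" for X Y X' Y' X'' Y'' F G H
  proof -
    obtain f g h where [simp]: "F = matrix X Y f" "G = matrix X' Y' g" "H = matrix X'' Y'' h"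
      and t: "mtp X Y f" "mtp X' Y' g" "mtp X'' Y'' h"
      using * AE_homD by metis
    have "f (i div c div b) (j div c' div b') \<boxtimes> g (i div c mod b) (j div c' mod b') \<boxtimes> h (i mod c) (j mod c') =
        f (i div (b * c)) (j div (b' * c')) \<boxtimes>
          (g (i mod (b * c) div c) (j mod (b' * c') div c') \<boxtimes> h (i mod (b * c) mod c) (j mod (b' * c') mod c'))"
      if "i < length Y * (b * c)" "j < length X * (b' * c')" "b = length Y'" "c = length Y''" "b' = length X'" "c' = length X''"
      for i j b c b' c'
    proof -
      \<comment> \<open>An index of a triple product has three mixed-radix digits; splitting off the
        first or the last digit first leads to the same three.\<close>
      have ic: "i div c div b = i div (b * c)" "i div c mod b = i mod (b * c) div c" "i mod (b * c) mod c = i mod c"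
        "j div c' div b' = j div (b' * c')" "j div c' mod b' = j mod (b' * c') div c'" "j mod (b' * c') mod c' = j mod c'"
        using mod_mult2_eq[of i c b] mod_mult2_eq[of j c' b']
        by (cases "c = 0"; cases "c' = 0"; simp add: div_mult2_eq[symmetric] mult.commute)+
      have "i div (b * c) < length Y" "j div (b' * c') < length X" "i mod c < c" "j mod c' < c'"
        "i mod (b * c) div c < b" "j mod (b' * c') div c' < b'"
        using that(1,2) mod_less_index[of i "length Y * b" c] mod_less_index[of j "length X * b'" c']
          div_less_index[OF that(1)] div_less_index[OF that(2)]
          div_less_index[OF mod_less_index[OF that(1)]] div_less_index[OF mod_less_index[OF that(2)]]
        by (simp_all add: mult.assoc)
      then show ?thesis using t that(3-) unfolding ic by (intro a_tmor_assoc) (auto simp: mtp_def)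
    qed
    then show ?thesis using * by (simp add: AE_tmor matrix_eq_iff list_tensor_assoc mult.assoc)
  qed
  show "TMor AE (Id AE [Unt C]) F = F" "TMor AE F (Id AE [Unt C]) = F"
    if *: "set X \<subseteq> Ob C" "set Y \<subseteq> Ob C" "F \<in> Hom AE X Y" for X Y F
  proof -
    obtain f where [simp]: "F = matrix X Y f" and t: "mtp X Y f" using * AE_homD by metis
    show "TMor AE (Id AE [Unt C]) F = F" "TMor AE F (Id AE [Unt C]) = F"
      using t * by (simp_all add: AE_tmor AE_id list_tensor_unit matrix_eq_iff mtp_def del: list_tensor_simps)
  qed
qed (((drule (2) AE_homD)+)?, (elim exE conjE)?,
    (erule (2) list_tensor_assoc | erule list_tensor_unit | erule (1) set_list_tensor
     | (simp add: AE_ops; (rule AE_homI)?; simp add: matrix_eq_iff set_list_tensor mtp_def a_comp_add a_comp_scal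
       a_tmor_add a_tmor_scal hsum_add hsum_scal div_less_index mod_less_index t_unt cong: hsum_cong')))+

lemma AE_disjoint: "\<lbrakk>F \<in> Hom AE X Y; F \<in> Hom AE X' Y'\<rbrakk> \<Longrightarrow> X = X' \<and> Y = Y'"
  by (auto simp: AE_hom matrix_eq_iff)

lemma AE_typed: "typed_piv R AE"
  unfolding typed_piv_def using AE_disjoint by (intro typed_lmcI AE_lmc) blast

end

section \<open>The idempotent completion\<close>

context typed_piv
begin

abbreviation KC where "KC \<equiv> idempotent_completion C"

lemma KC_ob: "A \<in> Ob KC \<longleftrightarrow> fst A \<in> Ob C \<and> arr (snd A) \<and> dm (snd A) = fst A \<and> cd (snd A) = fst A \<and>
    snd A \<cdot> snd A = snd A"
  by (cases A) (auto simp: idempotent_completion_def Let_def hom_iff)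

lemma KC_sel [simp]: "Unt KC = (Unt C, Id C (Unt C))" "TOb KC = kar_tensor C"
    "Id KC A = (A, A, snd A)" "HZero KC A B = (A, B, HZero C (fst A) (fst B))"
  by (simp_all add: idempotent_completion_def Let_def)

lemma KC_hom: "\<lbrakk>A \<in> Ob KC; B \<in> Ob KC\<rbrakk> \<Longrightarrow> F \<in> Hom KC A B \<longleftrightarrow>
    (\<exists>f. F = (A, B, f) \<and> arr f \<and> dm f = fst A \<and> cd f = fst B \<and> snd B \<cdot> f = f \<and> f \<cdot> snd A = f)"
  by (auto simp: idempotent_completion_def Let_def hom_iff)

lemma KC_ops: "Comp KC (B', D, g) (A, B, f) = (A, D, g \<cdot> f)"
    "TMor KC (A, B, f) (A', B', g) = (kar_tensor C A A', kar_tensor C B B', f \<boxtimes> g)"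
    "HAdd KC (A, B, f) (A', B', g) = (A, B, HAdd C f g)"
    "Scal KC c (A, B, f) = (A, B, Scal C c f)"
  by (simp_all add: idempotent_completion_def Let_def)

lemma absorb: "\<lbrakk>e \<cdot> g = g; arr e; arr g; arr f; cd f = dm g; cd g = dm e\<rbrakk> \<Longrightarrow> e \<cdot> (g \<cdot> f) = g \<cdot> f"
    "\<lbrakk>f \<cdot> e = f; arr e; arr g; arr f; cd f = dm g; cd e = dm f\<rbrakk> \<Longrightarrow> g \<cdot> f \<cdot> e = g \<cdot> f"
  by (simp_all flip: a_comp_assoc) (simp add: a_comp_assoc)

lemma KC_module:
  assumes "A \<in> Ob KC" "B \<in> Ob KC"
  shows "module R (hom_module KC A B)"
proof -
  interpret R: cring R by (rule cring_R)
  note A = assms[unfolded KC_ob]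
  have H: "F \<in> Hom KC A B \<Longrightarrow> \<exists>f. F = (A, B, f) \<and> arr f \<and> dm f = fst A \<and> cd f = fst B \<and>
      snd B \<cdot> f = f \<and> f \<cdot> snd A = f" for F
    by (simp add: KC_hom[OF assms])
  have HI: "\<lbrakk>arr f; dm f = fst A; cd f = fst B; snd B \<cdot> f = f; f \<cdot> snd A = f\<rbrakk> \<Longrightarrow> (A, B, f) \<in> Hom KC A B" for f
    by (simp add: KC_hom[OF assms])
  show ?thesis
    apply (rule hom_moduleI[OF cring_R]; (drule H)?; (drule H)?; (drule H)?; (elim exE conjE)?; (simp only: KC_ops KC_sel)?)
    apply (rule HI; use A in \<open>simp add: a_comp_add\<close>)
    apply (rule HI; use A in \<open>simp add: a_comp_add\<close>)
    apply (rule HI; use A in \<open>simp add: a_comp_scal\<close>)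
    apply (simp_all add: a_hadd_assoc a_scal_mult a_scal_add_left a_scal_add_right)
    apply (simp add: a_hadd_comm)
    done
qed

lemma KC_tensor_ob: "\<lbrakk>A \<in> Ob KC; B \<in> Ob KC\<rbrakk> \<Longrightarrow> kar_tensor C A B \<in> Ob KC"
  by (simp add: KC_ob kar_tensor_def a_interchange)

lemma KC_lmc: "linear_monoidal_category R KC"
  by (rule linear_monoidal_category.intro; (simp only: KC_sel)?; (elim KC_module; assumption)?)
    ((simp add: KC_hom KC_tensor_ob)?; (elim exE conjE)?;
   simp add: KC_ob KC_ops kar_tensor_def tob_assoc tob_unt a_tmor_assoc a_comp_assoc a_interchange a_comp_add a_comp_scal
    a_tmor_add a_tmor_scal a_tmor_id absorb)+

lemma KC_disjoint: "\<lbrakk>F \<in> Hom KC A B; F \<in> Hom KC A' B'\<rbrakk> \<Longrightarrow> A = A' \<and> B = B'"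
  by (auto simp: idempotent_completion_def Let_def)

lemma KC_typed: "typed_piv R KC"
  unfolding typed_piv_def using KC_disjoint by (intro typed_lmcI KC_lmc) blast

end

section \<open>Traces in Cauchy completions\<close>

locale rigid_piv = typed_piv R C
  for R :: "('k, 'r) ring_scheme" and C :: "('k, 'o, 'm, 'z) pivcat_scheme" (structure) +
  assumes dual_ob [simp]: "X \<in> Ob C \<Longrightarrow> Dual C X \<in> Ob C"
    and coev_hom: "X \<in> Ob C \<Longrightarrow> Coev C X \<in> Hom C (Unt C) (TOb C X (Dual C X))"
    and ev_hom: "X \<in> Ob C \<Longrightarrow> Ev C X \<in> Hom C (TOb C (Dual C X) X) (Unt C)"
    and pev_hom: "X \<in> Ob C \<Longrightarrow> PEv C X \<in> Hom C (TOb C X (Dual C X)) (Unt C)"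
    and zigzag: "X \<in> Ob C \<Longrightarrow> (Id C X \<boxtimes> Ev C X) \<cdot> (Coev C X \<boxtimes> Id C X) = Id C X"
begin

lemma coev_arr [simp]: assumes "X \<in> Ob C"
  shows "arr (Coev C X)" "dm (Coev C X) = Unt C" "cd (Coev C X) = TOb C X (Dual C X)"
    "arr (Ev C X)" "dm (Ev C X) = TOb C (Dual C X) X" "cd (Ev C X) = Unt C"
    "arr (PEv C X)" "dm (PEv C X) = TOb C X (Dual C X)" "cd (PEv C X) = Unt C"
  using homD[OF coev_hom] homD[OF ev_hom] homD[OF pev_hom] assms by auto

lemma transpose_arr [simp]: assumes "arr f" "dm f = X" "cd f = Y"
  shows "arr (transpose_mor C X Y f)" "dm (transpose_mor C X Y f) = Dual C Y" "cd (transpose_mor C X Y f) = Dual C X"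
proof -
  have "X \<in> Ob C" "Y \<in> Ob C" using assms by auto
  then show "arr (transpose_mor C X Y f)" "dm (transpose_mor C X Y f) = Dual C Y" "cd (transpose_mor C X Y f) = Dual C X"
    using assms by (simp_all add: transpose_mor_def tob_assoc tob_unt)
qed

text \<open>The cup of \<open>X\<close> is slid past the cup of \<open>Y\<close> by interchange;
  then the zigzag straightens the bent strand of \<open>Y\<close> and \<open>f\<close> is left on
  the first leg of the cup of \<open>X\<close>.\<close>

lemma transpose_slide:
  assumes "arr f" "dm f = X" "cd f = Y"
  shows "(Id C Y \<boxtimes> transpose_mor C X Y f) \<cdot> Coev C Y = (f \<boxtimes> Id C (Dual C X)) \<cdot> Coev C X"
proof -
  have [simp]: "X \<in> Ob C" "Y \<in> Ob C" using assms by auto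
  note [simp] = assms tob_assoc tob_unt
  let ?X' = "Dual C X" and ?Y' = "Dual C Y"
  have "(Id C Y \<boxtimes> transpose_mor C X Y f) \<cdot> Coev C Y =
    (Id C Y \<boxtimes> ((Ev C Y \<boxtimes> Id C ?X') \<cdot> (Id C ?Y' \<boxtimes> f \<boxtimes> Id C ?X'))) \<cdot>
      ((Id C Y \<boxtimes> (Id C ?Y' \<boxtimes> Coev C X)) \<cdot> Coev C Y)"
    by (simp add: transpose_mor_def a_interchange flip: a_comp_assoc)
  also have "(Id C Y \<boxtimes> (Id C ?Y' \<boxtimes> Coev C X)) \<cdot> Coev C Y = (Coev C Y \<boxtimes> (Id C X \<boxtimes> Id C ?X')) \<cdot> Coev C X"
  proof -
    have "(Id C (TOb C Y ?Y') \<boxtimes> Coev C X) \<cdot> (Coev C Y \<boxtimes> Id C (Unt C)) =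
      (Coev C Y \<boxtimes> Id C (TOb C X ?X')) \<cdot> (Id C (Unt C) \<boxtimes> Coev C X)"
      by (subst (1 2) a_interchange) simp_all
    then show ?thesis by (simp add: a_tmor_assoc flip: a_tmor_id)
  qed
  also have "(Id C Y \<boxtimes> ((Ev C Y \<boxtimes> Id C ?X') \<cdot> (Id C ?Y' \<boxtimes> f \<boxtimes> Id C ?X'))) \<cdot>
      ((Coev C Y \<boxtimes> (Id C X \<boxtimes> Id C ?X')) \<cdot> Coev C X) =
    (Id C Y \<boxtimes> (Ev C Y \<boxtimes> Id C ?X')) \<cdot> ((Id C Y \<boxtimes> Id C ?Y' \<boxtimes> (f \<boxtimes> Id C ?X')) \<cdot>
      (Coev C Y \<boxtimes> (Id C X \<boxtimes> Id C ?X')) \<cdot> Coev C X)"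
    by (simp add: a_interchange a_tmor_assoc flip: a_comp_assoc)
  also have "(Id C Y \<boxtimes> Id C ?Y' \<boxtimes> (f \<boxtimes> Id C ?X')) \<cdot> (Coev C Y \<boxtimes> (Id C X \<boxtimes> Id C ?X')) =
      (Coev C Y \<boxtimes> (Id C Y \<boxtimes> Id C ?X')) \<cdot> (Id C (Unt C) \<boxtimes> (f \<boxtimes> Id C ?X'))"
    by (subst (1 2) a_interchange) (simp_all add: a_interchange a_tmor_id)
  also have "(Id C Y \<boxtimes> (Ev C Y \<boxtimes> Id C ?X')) \<cdot> ((Coev C Y \<boxtimes> (Id C Y \<boxtimes> Id C ?X')) \<cdot>
      (Id C (Unt C) \<boxtimes> (f \<boxtimes> Id C ?X')) \<cdot> Coev C X) =
    (((Id C Y \<boxtimes> Ev C Y) \<cdot> (Coev C Y \<boxtimes> Id C Y)) \<boxtimes> Id C ?X') \<cdot> ((f \<boxtimes> Id C ?X') \<cdot> Coev C X)"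
    by (simp add: a_interchange[symmetric] a_tmor_assoc a_comp_assoc del: a_comp_id)
      (simp add: a_interchange zigzag flip: a_comp_assoc a_tmor_assoc)
  also have "\<dots> = (f \<boxtimes> Id C ?X') \<cdot> Coev C X"
    by (simp add: zigzag a_tmor_id)
  finally show ?thesis .
qed

text \<open>The duality of the completion inserts copies of the idempotent and of its transpose. The
  transposes slide along \<open>Coev\<close> and become the idempotent itself, which
  \<open>f\<close> absorbs.\<close>

lemma KC_trace:
  assumes A: "A \<in> Ob KC" and f: "arr f" "dm f = fst A" "cd f = fst A" "snd A \<cdot> f = f" "f \<cdot> snd A = f"
  shows "qtrace KC A (A, A, f) = (Unt KC, Unt KC, qtrace C (fst A) f)"
proof -
  obtain X e where [simp]: "A = (X, e)" by (cases A)
  have [simp]: "X \<in> Ob C" "arr e" "dm e = X" "cd e = X" "e \<cdot> e = e" using A by (auto simp: KC_ob)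
  note [simp] = f[simplified]
  let ?t = "transpose_mor C X X e" and ?I = "Id C (Dual C X)"
  have slide: "(g \<boxtimes> ?t) \<cdot> Coev C X = ((g \<cdot> e) \<boxtimes> ?I) \<cdot> Coev C X" if "arr g" "dm g = X" for g
  proof -
    have "(g \<boxtimes> ?t) \<cdot> Coev C X = (g \<boxtimes> ?I) \<cdot> ((Id C X \<boxtimes> ?t) \<cdot> Coev C X)"
      using that by (simp add: a_interchange flip: a_comp_assoc)
    also have "\<dots> = ((g \<cdot> e) \<boxtimes> ?I) \<cdot> Coev C X"
      using that by (simp add: transpose_slide a_interchange flip: a_comp_assoc)
    finally show ?thesis .
  qed
  have "(f \<boxtimes> ?t) \<cdot> ((e \<boxtimes> ?t) \<cdot> Coev C X) = (f \<boxtimes> ?t) \<cdot> Coev C X"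
    by (simp add: slide) (simp add: a_interchange slide flip: a_comp_assoc)
  then have 1: "(f \<boxtimes> ?t) \<cdot> ((e \<boxtimes> ?t) \<cdot> Coev C X) = (f \<boxtimes> ?I) \<cdot> Coev C X"
    by (simp add: slide)
  have 2: "(e \<boxtimes> ?t) \<cdot> ((f \<boxtimes> ?I) \<cdot> Coev C X) = (f \<boxtimes> ?I) \<cdot> Coev C X"
    by (simp add: a_interchange slide flip: a_comp_assoc)
  have "PEv C X \<cdot> (e \<boxtimes> ?t) \<cdot> (f \<boxtimes> ?t) \<cdot> ((e \<boxtimes> ?t) \<cdot> Coev C X) = PEv C X \<cdot> (f \<boxtimes> ?I) \<cdot> Coev C X"
    by (simp add: a_comp_assoc 1 2)
  then show ?thesis
    by (simp add: qtrace_def idempotent_completion_def Let_def kar_tensor_def kar_dual_def)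
qed

section \<open>Duality and traces for matrices\<close>

lemma AE_piv:
  shows "Dual AE X = map (Dual C) X"
    "Coev AE X = matrix [Unt C] (list_tensor C X (map (Dual C) X))
      (\<lambda>r s. if r div length X = r mod length X then Coev C (X ! (r div length X))
        else HZero C (Unt C) (list_tensor C X (map (Dual C) X) ! r))"
    "Ev AE X = matrix (list_tensor C (map (Dual C) X) X) [Unt C]
      (\<lambda>s r. if r div length X = r mod length X then Ev C (X ! (r div length X))
        else HZero C (list_tensor C (map (Dual C) X) X ! r) (Unt C))"
    "PEv AE X = matrix (list_tensor C X (map (Dual C) X)) [Unt C]
      (\<lambda>s r. if r div length X = r mod length X then PEv C (X ! (r div length X))
        else HZero C (list_tensor C X (map (Dual C) X) ! r) (Unt C))"
  by (simp_all add: additive_envelope_def Let_def matrix_eq_iff div_less_index mod_less_index)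

text \<open>The three digits of \<open>r\<close> in base \<open>n\<close>: a flat index into the
  triple tensor product of lists of length \<open>n\<close>, bracketed either way.\<close>

lemma index3:
  fixes n :: nat
  assumes "r < n * n * n"
  shows "r div (n * n) < n" "r mod n < n" "r div n < n * n" "r mod (n * n) < n * n"
    "(r mod (n * n)) div n = (r div n) mod n" "(r mod (n * n)) mod n = r mod n"
    "(r div n) div n = r div (n * n)" "(r div n) mod n < n" "r = (r div (n * n) * n + r div n mod n) * n + r mod n"
proof -
  have n: "0 < n" using assms by (cases n) auto
  have m: "r mod (n * n) = n * (r div n mod n) + r mod n" by (rule mod_mult2_eq)
  show "(r mod (n * n)) div n = (r div n) mod n" "(r mod (n * n)) mod n = r mod n"
    using n by (simp_all add: m)
  show "r div (n * n) < n" "r mod n < n" "r div n < n * n" "r mod (n * n) < n * n" "(r div n) mod n < n"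
    using n assms div_less_index[of r n "n * n"] div_less_index[of r "n * n" n] by (simp_all add: mult.assoc)
  show "(r div n) div n = r div (n * n)" by (simp add: div_mult2_eq)
  show "r = (r div (n * n) * n + r div n mod n) * n + r mod n"
    by (metis div_mult2_eq div_mult_mod_eq)
qed

lemma index3_diag:
  fixes n :: nat
  assumes "j < n"
  shows "(j * n + j) div n = j" "(j * n + j) mod n = j" "((j * n + j) * n + j) div n = j * n + j"
    "((j * n + j) * n + j) mod n = j" "((j * n + j) * n + j) div (n * n) = j"
    "((j * n + j) * n + j) mod (n * n) = j * n + j" "(j * n + j) * n + j < n * n * n"
proof -
  have n: "0 < n" using assms by simp
  show 1: "(j * n + j) div n = j" "(j * n + j) mod n = j" and 2: "((j * n + j) * n + j) div n = j * n + j"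
    "((j * n + j) * n + j) mod n = j"
    using assms n by (simp_all add: div_add1_eq)
  show "((j * n + j) * n + j) div (n * n) = j" by (simp add: div_mult2_eq 1 2)
  show "((j * n + j) * n + j) mod (n * n) = j * n + j"
    by (simp only: mod_mult2_eq 1 2) (simp add: mult.commute)
  have "j * n + j < j * n + n" using assms by simp
  also have "\<dots> \<le> n * n" using assms mult_le_mono1[of "Suc j" n n] by simp
  finally have "Suc (j * n + j) * n \<le> n * n * n" by (intro mult_le_mono1) simp
  then show "(j * n + j) * n + j < n * n * n" using assms by simp
qed

lemma AE_zigzag:
  assumes X: "set X \<subseteq> Ob C"
  shows "Comp AE (TMor AE (Id AE X) (Ev AE X)) (TMor AE (Coev AE X) (Id AE X)) = Id AE X"
proof -
  let ?n = "length X" and ?X' = "map (Dual C) X"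
  have X': "set ?X' \<subseteq> Ob C" using X by auto
  let ?id = "\<lambda>i j. if i = j then Id C (X ! i) else HZero C (X ! j) (X ! i)"
  let ?ev = "\<lambda>r. if r div ?n = r mod ?n then Ev C (X ! (r div ?n)) else HZero C (list_tensor C ?X' X ! r) (Unt C)"
  let ?coev = "\<lambda>r. if r div ?n = r mod ?n then Coev C (X ! (r div ?n)) else HZero C (Unt C) (list_tensor C X ?X' ! r)"
  let ?g = "\<lambda>i j r. (?id i (r div (?n * ?n)) \<boxtimes> ?ev (r mod (?n * ?n))) \<cdot> (?coev (r div ?n) \<boxtimes> ?id (r mod ?n) j)"
  have "hom_sum C (X ! j) (X ! i) (?g i j) (?n * ?n * ?n) = ?id i j" if ij: "i < ?n" "j < ?n" for i j
  proof -
    have idx: "r div (?n * ?n) < ?n" "r mod ?n < ?n" "r div ?n < ?n * ?n" "r mod (?n * ?n) < ?n * ?n"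
      "(r mod (?n * ?n)) div ?n = (r div ?n) mod ?n" "(r mod (?n * ?n)) mod ?n = r mod ?n"
      "(r div ?n) div ?n = r div (?n * ?n)" "(r div ?n) mod ?n < ?n"
      if "r < ?n * ?n * ?n" for r
      using index3[OF that] by auto
    have ob: "X ! a \<in> Ob C" if "a < ?n" for a using that X by auto
    \<comment> \<open>A nonzero term needs all four factors to be diagonal: the identities give
      \<open>i\<close> equal to the first digit and the last digit equal to \<open>j\<close>, while
      \<open>Ev\<close> and \<open>Coev\<close> force adjacent digits to agree.\<close>
    have zero: "?g i j r = HZero C (X ! j) (X ! i)"
      if r: "r < ?n * ?n * ?n" and ne: "\<not> (i = j \<and> r = (j * ?n + j) * ?n + j)" for r
    proof -
      note index3(9)[OF r]
      then have "\<not> (i = r div (?n * ?n) \<and> r div ?n mod ?n = r mod ?n \<and> r div (?n * ?n) = r div ?n mod ?n \<and> r mod ?n = j)"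
        using ne by auto
      then show ?thesis
        using idx[OF r] ob ij by (auto simp: tob_assoc tob_unt)
    qed
    show ?thesis
    proof (cases "i = j")
      case True
      \<comment> \<open>The index all of whose digits are \<open>j\<close>; there the sum reduces to
        the zigzag of the single object \<open>X ! j\<close>.\<close>
      let ?l = "(j * ?n + j) * ?n + j"
      have l: "?g j j ?l = Id C (X ! j)" using zigzag[OF ob[OF ij(2)]] by (simp add: index3_diag[OF ij(2)] ij)
      have lt: "?l < ?n * ?n * ?n" by (rule index3_diag[OF ij(2)])
      have "hom_sum C (X ! j) (X ! j) (?g j j) (?n * ?n * ?n) = ?g j j ?l"
      proof (rule hsum_single[where f = "?g j j" and l = ?l])
        show "?g j j r = HZero C (X ! j) (X ! j)" if "r < ?n * ?n * ?n" "r \<noteq> ?l" for r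
          using zero[of r, unfolded True] that by blast
        show "arr (?g j j ?l)" "dm (?g j j ?l) = X ! j" "cd (?g j j ?l) = X ! j"
          unfolding l using ob[OF ij(2)] by simp_all
      qed (rule ob[OF ij(2)] lt)+
      then show ?thesis unfolding True using l by simp
    next
      case False
      then have "hom_sum C (X ! j) (X ! i) (?g i j) (?n * ?n * ?n) =
          hom_sum C (X ! j) (X ! i) (\<lambda>r. HZero C (X ! j) (X ! i)) (?n * ?n * ?n)"
        by (intro hsum_cong zero) auto
      then show ?thesis using ij ob False by simp
    qed
  qed
  note key = this
  have "Comp AE (TMor AE (Id AE X) (Ev AE X)) (TMor AE (Coev AE X) (Id AE X)) =
      matrix X X (\<lambda>i j. hom_sum C (X ! j) (X ! i) (?g i j) (?n * ?n * ?n))"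
    using X X' by (simp add: AE_piv AE_id AE_tmor AE_comp list_tensor_assoc list_tensor_unit matrix_eq_iff
        mult.assoc del: list_tensor_simps nth_list_tensor cong: hsum_cong' if_cong)
  also have "\<dots> = matrix X X ?id"
    unfolding matrix_eq_iff using key by simp
  finally show ?thesis by (simp only: AE_id)
qed

lemma AE_rigid: "rigid_piv R AE"
proof -
  interpret AE: typed_piv R AE by (rule AE_typed)
  have dual: "set (map (Dual C) X) \<subseteq> Ob C" if "set X \<subseteq> Ob C" for X
    using that by auto
  note [simp] = set_list_tensor[OF dual] set_list_tensor[OF _ dual]
  show ?thesis
  proof (intro rigid_piv.intro AE_typed rigid_piv_axioms.intro; (simp only: AE_ob AE_sel)?)
    fix X assume X: "set X \<subseteq> Ob C"
    then show "set (Dual AE X) \<subseteq> Ob C" by (auto simp: AE_piv)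
    show "Comp AE (TMor AE (Id AE X) (Ev AE X)) (TMor AE (Coev AE X) (Id AE X)) = Id AE X"
      using X by (rule AE_zigzag)
  qed (simp only: AE_piv, rule AE_homI;
      simp add: mtp_def set_list_tensor dual t_unt div_less_index mod_less_index del: set_map list_tensor_simps)+
qed

text \<open>\<open>Coev\<close> and \<open>PEv\<close> are supported on flat indices with equal
  digits, and the identity on the dual factor keeps the second digit fixed. Hence only diagonal
  entries of the matrix survive.\<close>

lemma AE_trace:
  assumes X: "set X \<subseteq> Ob C" and f: "mtp X X f"
  shows "qtrace AE X (matrix X X f) = matrix [Unt C] [Unt C]
    (\<lambda>_ _. hom_sum C (Unt C) (Unt C) (\<lambda>i. qtrace C (X ! i) (f i i)) (length X))"
proof -
  let ?n = "length X" and ?X' = "map (Dual C) X" and ?U = "Unt C"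
  have X': "set ?X' \<subseteq> Ob C" using X by auto
  have ob: "X ! a \<in> Ob C" if "a < ?n" for a using that X by auto
  let ?id = "\<lambda>i j. if i = j then Id C (?X' ! i) else HZero C (?X' ! j) (?X' ! i)"
  let ?L = "list_tensor C X ?X'"
  let ?pev = "\<lambda>r. if r div ?n = r mod ?n then PEv C (X ! (r div ?n)) else HZero C (?L ! r) ?U"
  let ?coev = "\<lambda>r. if r div ?n = r mod ?n then Coev C (X ! (r div ?n)) else HZero C ?U (?L ! r)"
  let ?F = "\<lambda>r s. f (r div ?n) (s div ?n) \<boxtimes> ?id (r mod ?n) (s mod ?n)"
  let ?q = "\<lambda>i. qtrace C (X ! i) (f i i)"
  note F = mtpD[OF f]
  have q: "arr (?q i)" "dm (?q i) = ?U" "cd (?q i) = ?U" if "i < ?n" for i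
    using that ob[OF that] F[OF that that] by (simp_all add: qtrace_def)
  have inner: "hom_sum C (?L ! s) ?U (\<lambda>r. ?pev r \<cdot> ?F r s) (?n * ?n) \<cdot> ?coev s =
      (if s div ?n = s mod ?n then ?q (s div ?n) else HZero C ?U ?U)" if s: "s < ?n * ?n" for s
  proof -
    have si: "s div ?n < ?n" "s mod ?n < ?n" using s by (auto simp: div_less_index mod_less_index)
    have a: "arr (?pev r \<cdot> ?F r s)" "dm (?pev r \<cdot> ?F r s) = ?L ! s" "cd (?pev r \<cdot> ?F r s) = ?U"
      if "r < ?n * ?n" for r
      using that si s ob F[of "r div ?n" "s div ?n"] by (auto simp: div_less_index mod_less_index)
    have L: "?L ! s \<in> Ob C" using s ob si by auto
    show ?thesis
    proof (cases "s div ?n = s mod ?n")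
      case True
      have "hom_sum C (?L ! s) ?U (\<lambda>r. ?pev r \<cdot> ?F r s) (?n * ?n) = ?pev s \<cdot> ?F s s"
      proof (rule hsum_single[where l = s and f = "\<lambda>r. ?pev r \<cdot> ?F r s"])
        fix r assume r: "r < ?n * ?n" "r \<noteq> s"
        then have "r div ?n \<noteq> r mod ?n \<or> r mod ?n \<noteq> s mod ?n"
          using True by (metis div_mult_mod_eq)
        then show "?pev r \<cdot> ?F r s = HZero C (?L ! s) ?U"
          using r si s ob F[of "r div ?n" "s div ?n"] by (auto simp: div_less_index mod_less_index)
      qed (rule L t_unt s a[OF s])+
      then show ?thesis using True si ob by (simp add: qtrace_def)
    next
      case False
      then show ?thesis using a L by (simp add: t_unt)
    qed
  qed
  have "hom_sum C ?U ?U (\<lambda>s. hom_sum C (?L ! s) ?U (\<lambda>r. ?pev r \<cdot> ?F r s) (?n * ?n) \<cdot> ?coev s) (?n * ?n) =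
    hom_sum C ?U ?U (\<lambda>s. (\<lambda>i j. if i = j then ?q i else HZero C ?U ?U) (s div ?n) (s mod ?n)) (?n * ?n)"
    by (rule hsum_cong) (rule inner)
  also have "\<dots> = hom_sum C ?U ?U (\<lambda>i. hom_sum C ?U ?U (\<lambda>j. if i = j then ?q i else HZero C ?U ?U) ?n) ?n"
    using q by (intro hsum_prod) auto
  also have "\<dots> = hom_sum C ?U ?U ?q ?n"
    using q by (intro hsum_cong, subst hsum_single) auto
  finally have *: "hom_sum C ?U ?U (\<lambda>s. hom_sum C (?L ! s) ?U (\<lambda>r. ?pev r \<cdot> ?F r s) (?n * ?n) \<cdot> ?coev s) (?n * ?n) =
    hom_sum C ?U ?U ?q ?n" .
  show ?thesis unfolding qtrace_def[of AE]
    using * by (simp add: AE_piv AE_id AE_tmor AE_comp matrix_eq_iff del: list_tensor_simps nth_list_tensor cong: hsum_cong' if_cong)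
qed

end

section \<open>Diagram calculus in the Temperley--Lieb category\<close>

text \<open>\<open>tl_induct\<close> says that every morphism is built from cup and cap by the
  operations. This describes an arbitrary quotient of the diagram category rather than a free one,
  so nothing proved here can rest on linear independence of diagrams.\<close>

locale tl_cat = typed_lmc R C
  for R :: "('k, 'r) ring_scheme" and C :: "('k, nat, 'm, 'z) lmcat_scheme" (structure) +
  fixes cup cap :: 'm and \<delta> :: 'k
  assumes ob_nat [simp]: "Ob C = UNIV"
    and tob_nat [simp]: "TOb C X Y = X + Y"
    and unt_nat [simp]: "Unt C = 0"
    and cup_hom: "cup \<in> Hom C 0 2"
    and cap_hom: "cap \<in> Hom C 2 0"
    and loop_scalar [simp]: "\<delta> \<in> carrier R"
    and zig1: "(cap \<boxtimes> Id C 1) \<cdot> (Id C 1 \<boxtimes> cup) = Id C 1"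
    and zig2: "(Id C 1 \<boxtimes> cap) \<cdot> (cup \<boxtimes> Id C 1) = Id C 1"
    and loop: "cap \<cdot> cup = Scal C \<delta> (Id C 0)"
    and tl_induct: "\<And>P f. \<lbrakk>arr f; \<And>n. P (Id C n); P cup; P cap;
        \<And>f g. \<lbrakk>arr f; arr g; cd f = dm g; P f; P g\<rbrakk> \<Longrightarrow> P (g \<cdot> f);
        \<And>f g. \<lbrakk>arr f; arr g; P f; P g\<rbrakk> \<Longrightarrow> P (f \<boxtimes> g);
        \<And>m n. P (HZero C m n);
        \<And>f g. \<lbrakk>arr f; arr g; dm g = dm f; cd g = cd f; P f; P g\<rbrakk> \<Longrightarrow> P (HAdd C f g);
        \<And>c f. \<lbrakk>c \<in> carrier R; arr f; P f\<rbrakk> \<Longrightarrow> P (Scal C c f)\<rbrakk> \<Longrightarrow> P f"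
begin

lemmas tl_ind = tl_induct[consumes 1, case_names Id cup cap comp tmor zero add scal]

abbreviation I where "I n \<equiv> Id C n"

text \<open>Whiskering by identity strands. Diagrams are rewritten as composites of whiskered
  morphisms, and interchange then takes the form of the sliding move \<open>wh_slide\<close> for
  morphisms at disjoint positions.\<close>

definition wh :: "nat \<Rightarrow> 'm \<Rightarrow> nat \<Rightarrow> 'm" where
  "wh a f b = I a \<boxtimes> f \<boxtimes> I b"

lemma cup_cap_arr [simp]: "arr cup" "dm cup = 0" "cd cup = 2" "arr cap" "dm cap = 2" "cd cap = 0"
  using homD[OF cup_hom] homD[OF cap_hom] by auto

lemma a_unt0 [simp]: "arr f \<Longrightarrow> I 0 \<boxtimes> f = f" "arr f \<Longrightarrow> f \<boxtimes> I 0 = f"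
  using a_tmor_unt by auto

lemma a_id_id [simp]: "I m \<boxtimes> I n = I (m + n)"
  using a_tmor_id[of m n] by simp

lemma wh_arr [simp]: "arr f \<Longrightarrow> arr (wh a f b)" "arr f \<Longrightarrow> dm (wh a f b) = a + dm f + b"
    "arr f \<Longrightarrow> cd (wh a f b) = a + cd f + b"
  by (simp_all add: wh_def)

lemma wh_comp: "\<lbrakk>arr f; arr g; cd f = dm g\<rbrakk> \<Longrightarrow> wh a (g \<cdot> f) b = wh a g b \<cdot> wh a f b"
  by (simp add: wh_def a_interchange)

lemma wh_wh: "arr f \<Longrightarrow> wh a (wh c f d) b = wh (a + c) f (d + b)"
  unfolding wh_def by (simp add: a_tmor_assoc flip: a_tmor_assoc[of "I a" "I c"])

lemma wh_id [simp]: "wh a (I n) b = I (a + n + b)"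
  by (simp add: wh_def)

lemma wh_0 [simp]: "arr f \<Longrightarrow> wh 0 f 0 = f"
  by (simp add: wh_def)

lemma wh_left: "arr f \<Longrightarrow> I a \<boxtimes> f = wh a f 0"
  by (simp add: wh_def)

lemma wh_right: "arr f \<Longrightarrow> f \<boxtimes> I b = wh 0 f b"
  by (simp add: wh_def)

lemma tmor_wh: "\<lbrakk>arr f; arr g\<rbrakk> \<Longrightarrow> f \<boxtimes> g = wh 0 f (cd g) \<cdot> wh (dm f) g 0"
    "\<lbrakk>arr f; arr g\<rbrakk> \<Longrightarrow> f \<boxtimes> g = wh (cd f) g 0 \<cdot> wh 0 f (dm g)"
  by (simp_all add: wh_def a_interchange)

lemma wh_add: "\<lbrakk>arr f; arr g; dm g = dm f; cd g = cd f\<rbrakk> \<Longrightarrow> wh a (HAdd C f g) b = HAdd C (wh a f b) (wh a g b)"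
  by (simp add: wh_def a_tmor_add)

lemma wh_scal: "\<lbrakk>c \<in> carrier R; arr f\<rbrakk> \<Longrightarrow> wh a (Scal C c f) b = Scal C c (wh a f b)"
  by (simp add: wh_def a_tmor_scal)

lemma wh_zero [simp]: "wh a (HZero C m n) b = HZero C (a + m + b) (a + n + b)"
  by (simp add: wh_def)

lemma wh_slide:
  assumes "arr f" "arr g"
  shows "wh a f (b + cd g + c) \<cdot> wh (a + dm f + b) g c = wh (a + cd f + b) g c \<cdot> wh a f (b + dm g + c)"
proof -
  have 1: "wh a f (b + x + c) = I a \<boxtimes> (f \<boxtimes> I b \<boxtimes> I x) \<boxtimes> I c" for x
    using assms by (simp add: wh_def a_tmor_assoc)
  have 2: "wh (a + x + b) g c = I a \<boxtimes> (I x \<boxtimes> I b \<boxtimes> g) \<boxtimes> I c" for x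
    using assms by (simp add: wh_def add.assoc flip: a_tmor_assoc)
  show ?thesis unfolding 1 2 using assms by (simp add: a_interchange)
qed

lemma wh_zig1: "wh a cap (1 + b) \<cdot> wh (a + 1) cup b = I (a + 1 + b)"
proof -
  have "wh a ((cap \<boxtimes> I 1) \<cdot> (I 1 \<boxtimes> cup)) b = wh a cap (1 + b) \<cdot> wh (a + 1) cup b"
    by (simp add: wh_comp wh_left wh_right wh_wh)
  then show ?thesis by (simp only: zig1 wh_id)
qed

lemma wh_zig2: "wh (a + 1) cap b \<cdot> wh a cup (1 + b) = I (a + 1 + b)"
proof -
  have "wh a ((I 1 \<boxtimes> cap) \<cdot> (cup \<boxtimes> I 1)) b = wh (a + 1) cap b \<cdot> wh a cup (1 + b)"
    by (simp add: wh_comp wh_left wh_right wh_wh)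
  then show ?thesis by (simp only: zig2 wh_id)
qed

lemma wh_loop: "wh a cap b \<cdot> wh a cup b = Scal C \<delta> (I (a + b))"
  using wh_comp[of cup cap a b] by (simp add: loop wh_scal)

section \<open>Nested cups and caps\<close>

primrec cupn :: "nat \<Rightarrow> 'm" where
  "cupn 0 = I 0"
| "cupn (Suc n) = (I n \<boxtimes> cup \<boxtimes> I n) \<cdot> cupn n"

primrec capn :: "nat \<Rightarrow> 'm" where
  "capn 0 = I 0"
| "capn (Suc n) = capn n \<cdot> (I n \<boxtimes> cap \<boxtimes> I n)"

lemma cupn_arr [simp]: "arr (cupn n)" "dm (cupn n) = 0" "cd (cupn n) = n + n"
proof -
  have "arr (cupn n) \<and> dm (cupn n) = 0 \<and> cd (cupn n) = n + n" by (induction n) auto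
  then show "arr (cupn n)" "dm (cupn n) = 0" "cd (cupn n) = n + n" by auto
qed

lemma capn_arr [simp]: "arr (capn n)" "cd (capn n) = 0" "dm (capn n) = n + n"
proof -
  have "arr (capn n) \<and> cd (capn n) = 0 \<and> dm (capn n) = n + n" by (induction n) auto
  then show "arr (capn n)" "cd (capn n) = 0" "dm (capn n) = n + n" by auto
qed

lemma cupn_Suc: "cupn (Suc n) = wh n cup n \<cdot> cupn n"
  by (simp add: wh_def)

lemma capn_Suc: "capn (Suc n) = capn n \<cdot> wh n cap n"
  by (simp add: wh_def)

lemma cupn_1 [simp]: "cupn (Suc 0) = cup" and capn_1 [simp]: "capn (Suc 0) = cap"
  by (simp_all add: cupn_Suc capn_Suc del: cupn.simps(2) capn.simps(2))

declare cupn.simps(2) [simp del] capn.simps(2) [simp del]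

text \<open>The recursion inserts new cups on the inside. This splitting, used with
  \<open>m = 1\<close>, exposes the outermost cup instead.\<close>

lemma cupn_add: "cupn (m + n) = wh m (cupn n) m \<cdot> cupn m"
proof (induction n)
  case (Suc n)
  have "cupn (m + Suc n) = wh (m + n) cup (n + m) \<cdot> (wh m (cupn n) m \<cdot> cupn m)"
    using Suc by (simp add: cupn_Suc add.commute)
  then show ?case by (simp add: cupn_Suc wh_comp wh_wh a_comp_assoc)
qed simp

lemma capn_add: "capn (m + n) = capn m \<cdot> wh m (capn n) m"
proof (induction n)
  case (Suc n)
  have "capn (m + Suc n) = capn m \<cdot> wh m (capn n) m \<cdot> wh (m + n) cap (n + m)"
    using Suc by (simp add: capn_Suc add.commute)
  then show ?case by (simp add: capn_Suc wh_comp wh_wh a_comp_assoc)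
qed simp

text \<open>The innermost cap meets the outermost cup. Once the remaining cups have slid past this
  cap, the two straighten one strand, and the rest is the induction hypothesis with a strand
  added.\<close>

lemma zigzag_right: "wh n (capn n) 0 \<cdot> wh 0 (cupn n) n = I n"
proof (induction n)
  case (Suc n)
  have "cupn (Suc n) = wh 1 (cupn n) 1 \<cdot> cup"
    using cupn_add[of 1 n] by simp
  then have "wh (Suc n) (capn (Suc n)) 0 \<cdot> wh 0 (cupn (Suc n)) (Suc n) =
    wh (Suc n) (capn n) 0 \<cdot> wh (Suc n + n) cap n \<cdot> (wh 1 (cupn n) (1 + Suc n) \<cdot> wh 0 cup (Suc n))"
    by (simp add: capn_Suc wh_comp wh_wh)
  also have "\<dots> = wh (Suc n) (capn n) 0 \<cdot> (wh (Suc n + n) cap n \<cdot> wh 1 (cupn n) (1 + Suc n)) \<cdot> wh 0 cup (Suc n)"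
    by (simp add: a_comp_assoc)
  also have "wh (Suc n + n) cap n \<cdot> wh 1 (cupn n) (1 + Suc n) = wh 1 (cupn n) n \<cdot> wh 1 cap n"
    using wh_slide[of "cupn n" cap 1 0 n] by simp
  also have "wh (Suc n) (capn n) 0 \<cdot> (wh 1 (cupn n) n \<cdot> wh 1 cap n) \<cdot> wh 0 cup (Suc n) =
     wh 1 (wh n (capn n) 0 \<cdot> wh 0 (cupn n) n) 0 \<cdot> (wh 1 cap n \<cdot> wh 0 cup (Suc n))"
    by (simp add: wh_comp wh_wh a_comp_assoc)
  finally show ?case using Suc wh_zig2[of 0 n] by simp
qed simp

lemma zigzag_left: "wh 0 (capn n) n \<cdot> wh n (cupn n) 0 = I n"
proof (induction n)
  case (Suc n)
  have "cupn (Suc n) = wh 1 (cupn n) 1 \<cdot> cup"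
    using cupn_add[of 1 n] by simp
  then have "wh 0 (capn (Suc n)) (Suc n) \<cdot> wh (Suc n) (cupn (Suc n)) 0 =
    wh 0 (capn n) (Suc n) \<cdot> wh n cap (n + Suc n) \<cdot> (wh (Suc n + 1) (cupn n) 1 \<cdot> wh (Suc n) cup 0)"
    by (simp add: capn_Suc wh_comp wh_wh)
  also have "\<dots> = wh 0 (capn n) (Suc n) \<cdot> (wh n cap (n + Suc n) \<cdot> wh (Suc n + 1) (cupn n) 1) \<cdot> wh (Suc n) cup 0"
    by (simp add: a_comp_assoc)
  also have "wh n cap (n + Suc n) \<cdot> wh (Suc n + 1) (cupn n) 1 = wh n (cupn n) 1 \<cdot> wh n cap 1"
    using wh_slide[of cap "cupn n" n 0 1] by simp
  also have "wh 0 (capn n) (Suc n) \<cdot> (wh n (cupn n) 1 \<cdot> wh n cap 1) \<cdot> wh (Suc n) cup 0 =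
     wh 0 (wh 0 (capn n) n \<cdot> wh n (cupn n) 0) 1 \<cdot> (wh n cap 1 \<cdot> wh (Suc n) cup 0)"
    by (simp add: wh_comp wh_wh a_comp_assoc)
  finally show ?case using Suc wh_zig1[of n 0] by simp
qed simp

text \<open>\<open>f'\<close> is the half-turn rotation of \<open>f\<close>: it is what \<open>f\<close> becomes when slid around nested cups
  and, simultaneously, around nested caps.\<close>

definition rot :: "'m \<Rightarrow> 'm \<Rightarrow> bool" where
  "rot f f' \<longleftrightarrow> arr f \<and> arr f' \<and> dm f' = cd f \<and> cd f' = dm f \<and>
    wh 0 f (dm f) \<cdot> cupn (dm f) = wh (cd f) f' 0 \<cdot> cupn (cd f) \<and>
    capn (cd f) \<cdot> wh 0 f (cd f) = capn (dm f) \<cdot> wh (dm f) f' 0"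

text \<open>After \<open>f\<close> has been turned into \<open>f'\<close>, it sits on the other leg
  of the cups and commutes with \<open>g\<close> there; then \<open>g\<close> is turned. This is why
  the order of the factors is reversed.\<close>

lemma rot_comp:
  assumes f: "rot f f'" and g: "rot g g'" and fg: "cd f = dm g"
  shows "rot (g \<cdot> f) (f' \<cdot> g')"
proof -
  note [simp] = f[unfolded rot_def, THEN conjunct1] g[unfolded rot_def, THEN conjunct1]
  have [simp]: "arr f'" "dm f' = cd f" "cd f' = dm f" "arr g'" "dm g' = cd g" "cd g' = dm g" "cd f = dm g"
    using f g fg by (auto simp: rot_def)
  have "wh 0 (g \<cdot> f) (dm f) \<cdot> cupn (dm f) = wh 0 g (dm f) \<cdot> (wh 0 f (dm f) \<cdot> cupn (dm f))"
    by (simp add: wh_comp a_comp_assoc)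
  also have "\<dots> = wh 0 g (dm f) \<cdot> wh (dm g) f' 0 \<cdot> cupn (dm g)"
    using f by (simp add: rot_def a_comp_assoc)
  also have "wh 0 g (dm f) \<cdot> wh (dm g) f' 0 = wh (cd g) f' 0 \<cdot> wh 0 g (dm g)"
    using wh_slide[of g f' 0 0 0] by simp
  also have "wh (cd g) f' 0 \<cdot> wh 0 g (dm g) \<cdot> cupn (dm g) = wh (cd g) f' 0 \<cdot> (wh (cd g) g' 0 \<cdot> cupn (cd g))"
    using g by (simp add: rot_def a_comp_assoc)
  finally have 1: "wh 0 (g \<cdot> f) (dm f) \<cdot> cupn (dm f) = wh (cd g) (f' \<cdot> g') 0 \<cdot> cupn (cd g)"
    by (simp add: wh_comp a_comp_assoc)
  have "capn (cd g) \<cdot> wh 0 (g \<cdot> f) (cd g) = capn (cd g) \<cdot> wh 0 g (cd g) \<cdot> wh 0 f (cd g)"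
    by (simp add: wh_comp a_comp_assoc)
  also have "\<dots> = capn (dm g) \<cdot> (wh (dm g) g' 0 \<cdot> wh 0 f (cd g))"
    using g by (simp add: rot_def a_comp_assoc)
  also have "wh (dm g) g' 0 \<cdot> wh 0 f (cd g) = wh 0 f (dm g) \<cdot> wh (dm f) g' 0"
    using wh_slide[of f g' 0 0 0] by simp
  also have "capn (dm g) \<cdot> (wh 0 f (dm g) \<cdot> wh (dm f) g' 0) = capn (dm f) \<cdot> wh (dm f) f' 0 \<cdot> wh (dm f) g' 0"
    using f by (simp add: rot_def flip: a_comp_assoc)
  finally show ?thesis using 1 by (simp add: rot_def wh_comp a_comp_assoc)
qed

text \<open>In the nested cups for \<open>m + k\<close> strands the factor \<open>f\<close> runs
  over the outer \<open>m\<close> and \<open>g\<close> over the inner \<open>k\<close>, so the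
  tensor factors change places when rotated.\<close>

lemma rot_tmor:
  assumes f: "rot f f'" and g: "rot g g'"
  shows "rot (f \<boxtimes> g) (g' \<boxtimes> f')"
proof -
  note [simp] = f[unfolded rot_def, THEN conjunct1] g[unfolded rot_def, THEN conjunct1]
  have [simp]: "arr f'" "dm f' = cd f" "cd f' = dm f" "arr g'" "dm g' = cd g" "cd g' = dm g"
    using f g by (auto simp: rot_def)
  obtain m n k l where [simp]: "dm f = m" "cd f = n" "dm g = k" "cd g = l" by blast
  have fc: "wh 0 f m \<cdot> cupn m = wh n f' 0 \<cdot> cupn n" "capn n \<cdot> wh 0 f n = capn m \<cdot> wh m f' 0"
    and gc: "wh 0 g k \<cdot> cupn k = wh l g' 0 \<cdot> cupn l" "capn l \<cdot> wh 0 g l = capn k \<cdot> wh k g' 0"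
    using f g by (auto simp: rot_def)
  have "wh 0 (f \<boxtimes> g) (k + m) \<cdot> cupn (m + k) =
      wh n g (k + m) \<cdot> (wh 0 f (k + k + m) \<cdot> wh m (cupn k) m) \<cdot> cupn m"
    by (simp add: tmor_wh(2) wh_comp wh_wh cupn_add a_comp_assoc add.assoc)
  also have "wh 0 f (k + k + m) \<cdot> wh m (cupn k) m = wh n (cupn k) m \<cdot> wh 0 f m"
    using wh_slide[of f "cupn k" 0 0 m] by (simp add: add.assoc)
  also have "wh n g (k + m) \<cdot> (wh n (cupn k) m \<cdot> wh 0 f m) \<cdot> cupn m =
      wh n (wh 0 g k \<cdot> cupn k) m \<cdot> (wh 0 f m \<cdot> cupn m)"
    by (simp add: wh_comp wh_wh a_comp_assoc add.assoc)
  also have "\<dots> = wh (n + l) g' m \<cdot> (wh n (cupn l) m \<cdot> wh n f' 0) \<cdot> cupn n"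
    by (simp add: fc gc wh_comp wh_wh a_comp_assoc add.assoc)
  also have "wh n (cupn l) m \<cdot> wh n f' 0 = wh (n + l + l) f' 0 \<cdot> wh n (cupn l) n"
    using wh_slide[of "cupn l" f' n 0 0] by (simp add: add.assoc)
  also have "wh (n + l) g' m \<cdot> (wh (n + l + l) f' 0 \<cdot> wh n (cupn l) n) \<cdot> cupn n =
      wh (n + l) (g' \<boxtimes> f') 0 \<cdot> cupn (n + l)"
    by (simp add: tmor_wh(1) wh_comp wh_wh cupn_add a_comp_assoc add.assoc)
  finally have 1: "wh 0 (f \<boxtimes> g) (k + m) \<cdot> cupn (m + k) = wh (n + l) (g' \<boxtimes> f') 0 \<cdot> cupn (n + l)" .
  have "capn (n + l) \<cdot> wh 0 (f \<boxtimes> g) (l + n) =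
      capn n \<cdot> (wh n (capn l) n \<cdot> wh 0 f (l + l + n)) \<cdot> wh m g (l + n)"
    by (simp add: tmor_wh(1) wh_comp wh_wh capn_add a_comp_assoc add.assoc)
  also have "wh n (capn l) n \<cdot> wh 0 f (l + l + n) = wh 0 f n \<cdot> wh m (capn l) n"
    using wh_slide[of f "capn l" 0 0 n] by (simp add: add.assoc)
  also have "capn n \<cdot> (wh 0 f n \<cdot> wh m (capn l) n) \<cdot> wh m g (l + n) =
      capn n \<cdot> wh 0 f n \<cdot> wh m (capn l \<cdot> wh 0 g l) n"
    by (simp add: wh_comp wh_wh a_comp_assoc add.assoc)
  also have "\<dots> = capn m \<cdot> (wh m f' 0 \<cdot> wh m (capn k) n) \<cdot> wh (m + k) g' n"
    by (simp add: fc gc wh_comp wh_wh a_comp_assoc add.assoc)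
  also have "wh m f' 0 \<cdot> wh m (capn k) n = wh m (capn k) m \<cdot> wh (m + k + k) f' 0"
    using wh_slide[of "capn k" f' m 0 0] by (simp add: add.assoc)
  also have "capn m \<cdot> (wh m (capn k) m \<cdot> wh (m + k + k) f' 0) \<cdot> wh (m + k) g' n =
      capn (m + k) \<cdot> wh (m + k) (g' \<boxtimes> f') 0"
    by (simp add: tmor_wh(2) wh_comp wh_wh capn_add a_comp_assoc add.assoc)
  finally show ?thesis using 1 by (simp add: rot_def add.commute)
qed

text \<open>Requiring one and the same \<open>f'\<close> at cups and at caps says that left and
  right transposes agree. It holds for cup and cap, which rotation exchanges, and every operation
  preserves it, so no formula for the rotation is needed.\<close>

lemma rot_exists: "arr f \<Longrightarrow> \<exists>f'. rot f f'"
proof (induction f rule: tl_ind)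
  case (Id n)
  have "rot (I n) (I n)" by (simp add: rot_def)
  then show ?case ..
next
  case cup
  have "wh 2 cap 0 \<cdot> cupn 2 = wh 2 cap 0 \<cdot> (wh 1 cup 1 \<cdot> cup)"
    using cupn_add[of 1 1] by (simp add: numeral_2_eq_2)
  also have "\<dots> = wh 1 (wh 1 cap 0 \<cdot> wh 0 cup 1) 0 \<cdot> cup"
    by (simp add: wh_comp wh_wh a_comp_assoc numeral_2_eq_2)
  finally have 1: "wh 2 cap 0 \<cdot> cupn 2 = cup" using wh_zig2[of 0 0] by simp
  have "capn 2 \<cdot> wh 0 cup 2 = cap \<cdot> wh 1 cap 1 \<cdot> wh 0 cup 2"
    using capn_add[of 1 1] by (simp add: numeral_2_eq_2)
  also have "\<dots> = cap \<cdot> wh 0 (wh 1 cap 0 \<cdot> wh 0 cup 1) 1"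
    by (simp add: wh_comp wh_wh a_comp_assoc numeral_2_eq_2)
  finally have "capn 2 \<cdot> wh 0 cup 2 = cap" using wh_zig2[of 0 0] by simp
  then have "rot cup cap" using 1 by (simp add: rot_def)
  then show ?case ..
next
  case cap
  have "wh 0 cap 2 \<cdot> cupn 2 = wh 0 cap 2 \<cdot> (wh 1 cup 1 \<cdot> cup)"
    using cupn_add[of 1 1] by (simp add: numeral_2_eq_2)
  also have "\<dots> = wh 0 (wh 0 cap 1 \<cdot> wh 1 cup 0) 1 \<cdot> cup"
    by (simp add: wh_comp wh_wh a_comp_assoc numeral_2_eq_2)
  finally have 1: "wh 0 cap 2 \<cdot> cupn 2 = cup" using wh_zig1[of 0 0] by simp
  have "capn 2 \<cdot> wh 2 cup 0 = cap \<cdot> wh 1 cap 1 \<cdot> wh 2 cup 0"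
    using capn_add[of 1 1] by (simp add: numeral_2_eq_2)
  also have "\<dots> = cap \<cdot> wh 1 (wh 0 cap 1 \<cdot> wh 1 cup 0) 0"
    by (simp add: wh_comp wh_wh a_comp_assoc numeral_2_eq_2)
  finally have "capn 2 \<cdot> wh 2 cup 0 = cap" using wh_zig1[of 0 0] by simp
  then have "rot cap cup" using 1 by (simp add: rot_def)
  then show ?case ..
next
  case (comp f g)
  then show ?case using rot_comp by blast
next
  case (tmor f g)
  then show ?case using rot_tmor by blast
next
  case (zero m n)
  have "rot (HZero C m n) (HZero C n m)" by (simp add: rot_def)
  then show ?case ..
next
  case (add f g)
  then obtain f' g' where fg: "rot f f'" "rot g g'" by blast
  then have [simp]: "arr f'" "dm f' = cd f" "cd f' = dm f" "arr g'" "dm g' = cd f" "cd g' = dm f"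
    using add by (auto simp: rot_def)
  have "rot (HAdd C f g) (HAdd C f' g')"
    using fg add(1-4) by (simp add: rot_def wh_add a_comp_add)
  then show ?case ..
next
  case (scal c f)
  then obtain f' where f: "rot f f'" by blast
  then have [simp]: "arr f'" "dm f' = cd f" "cd f' = dm f"
    by (auto simp: rot_def)
  have "rot (Scal C c f) (Scal C c f')"
    using f scal(1,2) by (simp add: rot_def wh_scal a_comp_scal)
  then show ?case ..
qed

section \<open>The trace\<close>

definition tr :: "nat \<Rightarrow> 'm \<Rightarrow> 'm" where
  "tr n f = capn n \<cdot> wh 0 f n \<cdot> cupn n"

lemma tr_arr [simp]: "\<lbrakk>arr f; dm f = n; cd f = n\<rbrakk> \<Longrightarrow> arr (tr n f)" "\<lbrakk>arr f; dm f = n; cd f = n\<rbrakk> \<Longrightarrow> dm (tr n f) = 0"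
    "\<lbrakk>arr f; dm f = n; cd f = n\<rbrakk> \<Longrightarrow> cd (tr n f) = 0"
  by (simp_all add: tr_def)

text \<open>\<open>f\<close> travels once around the closed diagram: over the cups as its rotation,
  past \<open>g\<close> on the other side, and back over the caps.\<close>

lemma tr_cyclic:
  assumes "arr f" "dm f = m" "cd f = n" "arr g" "dm g = n" "cd g = m"
  shows "tr m (g \<cdot> f) = tr n (f \<cdot> g)"
proof -
  note [simp] = assms
  obtain f' where f': "rot f f'" using rot_exists assms by blast
  then have [simp]: "arr f'" "dm f' = n" "cd f' = m" by (auto simp: rot_def)
  have "tr m (g \<cdot> f) = capn m \<cdot> wh 0 g m \<cdot> (wh 0 f m \<cdot> cupn m)"
    by (simp add: tr_def wh_comp a_comp_assoc)
  also have "\<dots> = capn m \<cdot> (wh 0 g m \<cdot> wh n f' 0) \<cdot> cupn n"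
    using f' by (simp add: rot_def a_comp_assoc)
  also have "wh 0 g m \<cdot> wh n f' 0 = wh m f' 0 \<cdot> wh 0 g n"
    using wh_slide[of g f' 0 0 0] by simp
  also have "capn m \<cdot> (wh m f' 0 \<cdot> wh 0 g n) \<cdot> cupn n = capn n \<cdot> wh 0 f n \<cdot> wh 0 g n \<cdot> cupn n"
    using f' by (simp add: rot_def flip: a_comp_assoc)
  finally show ?thesis by (simp add: tr_def wh_comp a_comp_assoc)
qed

text \<open>The linear span of diagrams made of caps alone, where each step adds a cap at the
  inputs. Cups and general composites are kept out of the rules and shown to stay inside the span,
  so that later inductions meet only caps.\<close>

inductive cspan :: "nat \<Rightarrow> 'm \<Rightarrow> bool" where
  cspan_id: "cspan 0 (I 0)"
| cspan_zero: "cspan n (HZero C n 0)"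
| cspan_add: "\<lbrakk>cspan n f; cspan n g\<rbrakk> \<Longrightarrow> cspan n (HAdd C f g)"
| cspan_scal: "\<lbrakk>c \<in> carrier R; cspan n f\<rbrakk> \<Longrightarrow> cspan n (Scal C c f)"
| cspan_cap: "\<lbrakk>cspan n f; n = p + r\<rbrakk> \<Longrightarrow> cspan (Suc (Suc n)) (f \<cdot> wh p cap r)"

lemma cspan_arr: "cspan n f \<Longrightarrow> arr f \<and> dm f = n \<and> cd f = 0"
  by (induction rule: cspan.induct) auto

text \<open>Compare the cup with the cap next to it. Equal positions give a loop and adjacent ones a
  zigzag; otherwise the two commute and the cup meets a diagram with fewer caps.\<close>

lemma cspan_cup: "\<lbrakk>cspan n f; n = Suc (Suc (a + b))\<rbrakk> \<Longrightarrow> cspan (a + b) (f \<cdot> wh a cup b)"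
proof (induction arbitrary: a b rule: cspan.induct)
  case (cspan_zero n)
  then show ?case by (simp add: cspan.cspan_zero)
next
  case (cspan_add n f g)
  then show ?case using cspan_arr[of n f] cspan_arr[of n g]
    by (simp add: a_comp_add cspan.cspan_add)
next
  case (cspan_scal c n f)
  then show ?case using cspan_arr[of n f]
    by (simp add: a_comp_scal cspan.cspan_scal)
next
  case (cspan_cap n f p r)
  have [simp]: "arr f" "dm f = p + r" "cd f = 0" using cspan_arr[OF cspan_cap(1)] cspan_cap(2) by auto
  have sum: "a + b = p + r" using cspan_cap by simp
  have fas: "f \<cdot> wh p cap r \<cdot> wh a cup b = f \<cdot> (wh p cap r \<cdot> wh a cup b)"
    using sum by (simp add: a_comp_assoc)
  consider (eq) "p = a" "r = b" | (right) "p = a + 1" "b = r + 1" | (left) "a = p + 1" "r = b + 1"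
    | (far_right) c where "a = p + 2 + c" "r = c + 2 + b"
    | (far_left) c where "p = a + 2 + c" "b = c + 2 + r"
  proof -
    have "p = a \<or> p = a + 1 \<or> a = p + 1 \<or> p + 2 \<le> a \<or> a + 2 \<le> p" by linarith
    then show thesis
    proof (elim disjE)
      assume "p + 2 \<le> a"
      then obtain c where "a = p + 2 + c" using le_Suc_ex by blast
      then show thesis using sum far_right[of c] by simp
    next
      assume "a + 2 \<le> p"
      then obtain c where "p = a + 2 + c" using le_Suc_ex by blast
      then show thesis using sum far_left[of c] by simp
    qed (use sum eq right left in auto)
  qed
  then show ?case
  proof cases
    case eq
    then have "f \<cdot> (wh p cap r \<cdot> wh a cup b) = Scal C \<delta> f"
      by (simp add: wh_loop a_comp_scal)
    then show ?thesis using cspan_cap sum by (simp add: fas cspan.cspan_scal)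
  next
    case right
    then have "f \<cdot> (wh p cap r \<cdot> wh a cup b) = f"
      using wh_zig2[of a r] by simp
    then show ?thesis using cspan_cap sum by (simp add: fas)
  next
    case left
    then have "f \<cdot> (wh p cap r \<cdot> wh a cup b) = f"
      using wh_zig1[of p b] by simp
    then show ?thesis using cspan_cap sum by (simp add: fas)
  next
    case (far_right c)
    have "wh p cap r \<cdot> wh a cup b = wh (p + c) cup b \<cdot> wh p cap (c + b)"
      using wh_slide[of cap cup p c b] far_right by (simp add: add.assoc)
    then have "f \<cdot> (wh p cap r \<cdot> wh a cup b) = f \<cdot> wh (p + c) cup b \<cdot> wh p cap (c + b)"
      using far_right by (simp add: a_comp_assoc)
    moreover have "cspan (p + c + b) (f \<cdot> wh (p + c) cup b)"
      using cspan_cap far_right by simp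
    ultimately show ?thesis
      using cspan.cspan_cap[of "p + c + b" "f \<cdot> wh (p + c) cup b" p "c + b"] far_right fas by (simp add: add.assoc)
  next
    case (far_left c)
    have "wh p cap r \<cdot> wh a cup b = wh a cup (c + r) \<cdot> wh (a + c) cap r"
      using wh_slide[of cup cap a c r] far_left by (simp add: add.assoc)
    then have "f \<cdot> (wh p cap r \<cdot> wh a cup b) = f \<cdot> wh a cup (c + r) \<cdot> wh (a + c) cap r"
      using far_left by (simp add: a_comp_assoc)
    moreover have "cspan (a + (c + r)) (f \<cdot> wh a cup (c + r))"
      using cspan_cap far_left by simp
    ultimately show ?thesis
      using cspan.cspan_cap[of "a + c + r" "f \<cdot> wh a cup (c + r)" "a + c" r] far_left fas by (simp add: add.assoc)
  qed
qed simp

text \<open>The whiskers \<open>a\<close>, \<open>b\<close> and the arbitrary \<open>s\<close> are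
  there for the tensor case, where the two factors are composed with \<open>s\<close> one after the
  other at different positions.\<close>

lemma cspan_comp: "\<lbrakk>arr t; cspan (a + cd t + b) s\<rbrakk> \<Longrightarrow> cspan (a + dm t + b) (s \<cdot> wh a t b)"
proof (induction t arbitrary: a b s rule: tl_ind)
  case (Id n)
  then show ?case using cspan_arr[OF Id] by simp
next
  case cup
  then show ?case using cspan_cup[of "a + 2 + b" s a b] by simp
next
  case cap
  then show ?case using cspan_cap[of "a + b" s a b] by simp
next
  case (comp f g)
  then have "cspan (a + dm f + b) (s \<cdot> wh a g b \<cdot> wh a f b)" by simp
  then show ?case using comp cspan_arr[OF comp.prems] by (simp add: wh_comp a_comp_assoc)
next
  case (tmor f g)
  then have "cspan (a + cd f + dm g + b) (s \<cdot> wh (a + cd f) g b)"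
    using tmor.IH(2)[of "a + cd f" b s] by (simp add: add.assoc)
  then have "cspan (a + dm f + (dm g + b)) (s \<cdot> wh (a + cd f) g b \<cdot> wh a f (dm g + b))"
    using tmor by (simp add: add.assoc)
  then show ?case using tmor cspan_arr[OF tmor.prems]
    by (simp add: tmor_wh(2) wh_comp wh_wh a_comp_assoc add.assoc)
next
  case (zero m n)
  then show ?case using cspan_arr[OF zero] cspan_zero by simp
next
  case (add f g)
  then show ?case using cspan_arr[of _ s] by (simp add: wh_add a_comp_add cspan_add)
next
  case (scal c f)
  then show ?case using cspan_arr[of _ s] by (simp add: wh_scal a_comp_scal cspan_scal)
qed

lemma cspan_all: "\<lbrakk>arr f; cd f = 0\<rbrakk> \<Longrightarrow> cspan (dm f) f"
  using cspan_comp[of f 0 0 "I 0"] cspan_id by simp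

text \<open>A cap has at least two inputs, so at source \<open>0\<close> the span contains only
  multiples of the identity. This is what makes every trace a scalar.\<close>

lemma hom_0_0: "\<lbrakk>arr f; dm f = 0; cd f = 0\<rbrakk> \<Longrightarrow> \<exists>c\<in>carrier R. f = Scal C c (I 0)"
proof -
  interpret R: cring R by (rule cring_R)
  have "cspan n f \<Longrightarrow> n = 0 \<Longrightarrow> \<exists>c\<in>carrier R. f = Scal C c (I 0)" for n f
  proof (induction rule: cspan.induct)
    case cspan_id
    show ?case by (rule bexI[of _ "\<one>\<^bsub>R\<^esub>"]) auto
  next
    case (cspan_zero n)
    then show ?case by (intro bexI[of _ "\<zero>\<^bsub>R\<^esub>"]) auto
  next
    case (cspan_add n f g)
    then obtain c d where "c \<in> carrier R" "d \<in> carrier R" "f = Scal C c (I 0)" "g = Scal C d (I 0)" by blast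
    then show ?case by (intro bexI[of _ "c \<oplus>\<^bsub>R\<^esub> d"]) (auto simp: a_scal_add_left)
  next
    case (cspan_scal a n f)
    then obtain c where "c \<in> carrier R" "f = Scal C c (I 0)" by blast
    then show ?case using cspan_scal by (intro bexI[of _ "a \<otimes>\<^bsub>R\<^esub> c"]) (auto simp: a_scal_mult)
  qed simp
  then show "\<lbrakk>arr f; dm f = 0; cd f = 0\<rbrakk> \<Longrightarrow> ?thesis" using cspan_all[of f] by simp
qed

lemma hom_1_0: "\<lbrakk>arr f; dm f = 1; cd f = 0\<rbrakk> \<Longrightarrow> f = HZero C 1 0"
proof -
  have "cspan n f \<Longrightarrow> n = 1 \<Longrightarrow> f = HZero C 1 0" for n f
    by (induction rule: cspan.induct) auto
  then show "\<lbrakk>arr f; dm f = 1; cd f = 0\<rbrakk> \<Longrightarrow> ?thesis" using cspan_all[of f] by simp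
qed

text \<open>Summands are grouped by the position of the cap nearest the inputs. Two features are
  exploited later: the number of summands is independent of the parameter, and each of them begins
  with a cap, which projectors annihilate.\<close>

lemma hom_SS_0:
  assumes "arr f" "dm f = Suc (Suc m)" "cd f = 0"
  shows "\<exists>s. (\<forall>p\<le>m. arr (s p) \<and> dm (s p) = m \<and> cd (s p) = 0) \<and>
    f = hom_sum C (Suc (Suc m)) 0 (\<lambda>p. s p \<cdot> wh p cap (m - p)) (Suc m)"
proof -
  have "cspan n f \<Longrightarrow> n = Suc (Suc m) \<Longrightarrow> \<exists>s. (\<forall>p\<le>m. arr (s p) \<and> dm (s p) = m \<and> cd (s p) = 0) \<and>
    f = hom_sum C (Suc (Suc m)) 0 (\<lambda>p. s p \<cdot> wh p cap (m - p)) (Suc m)" for n f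
  proof (induction rule: cspan.induct)
    case (cspan_zero n)
    have "hom_sum C (Suc (Suc m)) 0 (\<lambda>p. HZero C m 0 \<cdot> wh p cap (m - p)) (Suc m) =
      hom_sum C (Suc (Suc m)) 0 (\<lambda>p. HZero C (Suc (Suc m)) 0) (Suc m)"
      by (rule hsum_cong) simp
    then show ?case using cspan_zero by (intro exI[of _ "\<lambda>_. HZero C m 0"]) (simp del: hom_sum.simps)
  next
    case (cspan_add n f g)
    then obtain s t where s: "\<forall>p\<le>m. arr (s p) \<and> dm (s p) = m \<and> cd (s p) = 0"
        "f = hom_sum C (Suc (Suc m)) 0 (\<lambda>p. s p \<cdot> wh p cap (m - p)) (Suc m)"
      and t: "\<forall>p\<le>m. arr (t p) \<and> dm (t p) = m \<and> cd (t p) = 0"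
        "g = hom_sum C (Suc (Suc m)) 0 (\<lambda>p. t p \<cdot> wh p cap (m - p)) (Suc m)"
      by blast
    have "hom_sum C (Suc (Suc m)) 0 (\<lambda>p. HAdd C (s p) (t p) \<cdot> wh p cap (m - p)) (Suc m) =
      hom_sum C (Suc (Suc m)) 0 (\<lambda>p. HAdd C (s p \<cdot> wh p cap (m - p)) (t p \<cdot> wh p cap (m - p))) (Suc m)"
      using s t by (intro hsum_cong) (simp add: a_comp_add)
    also have "\<dots> = HAdd C f g"
      unfolding s(2) t(2) using s(1) t(1) by (intro hsum_add) auto
    finally show ?case using s(1) t(1) by (intro exI[of _ "\<lambda>p. HAdd C (s p) (t p)"]) (simp del: hom_sum.simps)
  next
    case (cspan_scal c n f)
    then obtain s where s: "\<forall>p\<le>m. arr (s p) \<and> dm (s p) = m \<and> cd (s p) = 0"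
        "f = hom_sum C (Suc (Suc m)) 0 (\<lambda>p. s p \<cdot> wh p cap (m - p)) (Suc m)" by blast
    have "Scal C c f = hom_sum C (Suc (Suc m)) 0 (\<lambda>p. Scal C c (s p \<cdot> wh p cap (m - p))) (Suc m)"
      unfolding s(2) using s(1) cspan_scal by (intro hsum_scal) auto
    also have "\<dots> = hom_sum C (Suc (Suc m)) 0 (\<lambda>p. Scal C c (s p) \<cdot> wh p cap (m - p)) (Suc m)"
      using s(1) cspan_scal by (intro hsum_cong) (simp add: a_comp_scal)
    finally show ?case using s(1) cspan_scal by (intro exI[of _ "\<lambda>p. Scal C c (s p)"]) (simp del: hom_sum.simps)
  next
    case (cspan_cap n f p r)
    let ?s = "\<lambda>q. if q = p then f else HZero C m 0"
    have f: "arr f" "dm f = m" "cd f = 0" "m = p + r" using cspan_arr[OF cspan_cap(1)] cspan_cap by auto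
    have "hom_sum C (Suc (Suc m)) 0 (\<lambda>q. ?s q \<cdot> wh q cap (m - q)) (Suc m) = ?s p \<cdot> wh p cap (m - p)"
      using f by (intro hsum_single[where l = p and f = "\<lambda>q. ?s q \<cdot> wh q cap (m - q)"]) auto
    then show ?case using f by (intro exI[of _ ?s]) (simp del: hom_sum.simps)
  qed simp
  then show ?thesis using cspan_all[of f] assms by simp
qed

definition bend :: "nat \<Rightarrow> 'm \<Rightarrow> 'm" where
  "bend n f = capn n \<cdot> wh 0 f n"

definition unbend :: "nat \<Rightarrow> nat \<Rightarrow> 'm \<Rightarrow> 'm" where
  "unbend m n h = wh 0 h n \<cdot> wh m (cupn n) 0"

lemma bend_arr [simp]: "\<lbrakk>arr f; cd f = n\<rbrakk> \<Longrightarrow> arr (bend n f)" "\<lbrakk>arr f; cd f = n\<rbrakk> \<Longrightarrow> dm (bend n f) = dm f + n"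
    "\<lbrakk>arr f; cd f = n\<rbrakk> \<Longrightarrow> cd (bend n f) = 0"
  by (simp_all add: bend_def)

lemma unbend_arr [simp]: assumes "arr h" "dm h = m + n" "cd h = 0"
  shows "arr (unbend m n h)" "dm (unbend m n h) = m" "cd (unbend m n h) = n"
  using assms by (simp_all add: unbend_def)

text \<open>A morphism is recovered from its bent form by the zigzag for nested cups, so every hom
  space embeds into one with target \<open>0\<close>, where the span by caps is available.\<close>

lemma unbend_bend: "\<lbrakk>arr f; dm f = m; cd f = n\<rbrakk> \<Longrightarrow> unbend m n (bend n f) = f"
proof -
  assume [simp]: "arr f" "dm f = m" "cd f = n"
  have "unbend m n (bend n f) = wh 0 (capn n) n \<cdot> (wh 0 f (n + n) \<cdot> wh m (cupn n) 0)"
    by (simp add: unbend_def bend_def wh_comp wh_wh a_comp_assoc add.assoc)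
  also have "wh 0 f (n + n) \<cdot> wh m (cupn n) 0 = wh n (cupn n) 0 \<cdot> f"
    using wh_slide[of f "cupn n" 0 0 0] by simp
  also have "wh 0 (capn n) n \<cdot> (wh n (cupn n) 0 \<cdot> f) = f"
    by (simp add: zigzag_left flip: a_comp_assoc)
  finally show ?thesis .
qed

text \<open>Bending turns \<open>h\<close> into a morphism from \<open>2\<close> to
  \<open>0\<close>, hence into a multiple of the cap, and the unbent cap is the identity.\<close>

lemma hom_1_1:
  assumes "arr h" "dm h = 1" "cd h = 1"
  shows "\<exists>c\<in>carrier R. h = Scal C c (I 1)"
proof -
  have "arr (bend 1 h)" "dm (bend 1 h) = Suc (Suc 0)" "cd (bend 1 h) = 0" using assms by auto
  from hom_SS_0[OF this] obtain s where s: "arr (s 0)" "dm (s 0) = 0" "cd (s 0) = 0" "bend 1 h = s 0 \<cdot> cap"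
    by auto
  then obtain c where c: "c \<in> carrier R" "s 0 = Scal C c (I 0)" using hom_0_0 by blast
  have "h = unbend 1 1 (s 0 \<cdot> cap)" using s(4) unbend_bend[of h 1 1] assms by simp
  also have "\<dots> = Scal C c (unbend 1 1 cap)"
    using c by (simp add: unbend_def a_comp_scal wh_scal)
  also have "unbend 1 1 cap = I 1" using wh_zig1[of 0 0] by (simp add: unbend_def)
  finally show ?thesis using c by blast
qed

end

section \<open>The ideal of negligible diagrams\<close>

context tl_cat
begin

lemma tr_zero [simp]: "tr n (HZero C n n) = HZero C 0 0"
  by (simp add: tr_def)

lemma tr_add: "\<lbrakk>arr f; arr g; dm f = n; cd f = n; dm g = n; cd g = n\<rbrakk>
    \<Longrightarrow> tr n (HAdd C f g) = HAdd C (tr n f) (tr n g)"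
  by (simp add: tr_def wh_add a_comp_add)

lemma tr_scal: "\<lbrakk>c \<in> carrier R; arr f; dm f = n; cd f = n\<rbrakk> \<Longrightarrow> tr n (Scal C c f) = Scal C c (tr n f)"
  by (simp add: tr_def wh_scal a_comp_scal)

definition tneg :: "'m \<Rightarrow> bool" where
  "tneg f \<longleftrightarrow> arr f \<and> (\<forall>g. arr g \<longrightarrow> dm g = cd f \<longrightarrow> cd g = dm f \<longrightarrow> tr (dm f) (g \<cdot> f) = HZero C 0 0)"

lemma tneg_arr: "tneg f \<Longrightarrow> arr f"
  by (simp add: tneg_def)

lemma tneg_zero: "tneg (HZero C m n)"
  by (simp add: tneg_def)

lemma tneg_add: "\<lbrakk>tneg f; tneg g; dm g = dm f; cd g = cd f\<rbrakk> \<Longrightarrow> tneg (HAdd C f g)"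
  by (simp add: tneg_def a_comp_add tr_add)

lemma tneg_scal: "\<lbrakk>c \<in> carrier R; tneg f\<rbrakk> \<Longrightarrow> tneg (Scal C c f)"
  by (simp add: tneg_def a_comp_scal tr_scal)

lemma tneg_comp_left: "\<lbrakk>tneg f; arr g; cd f = dm g\<rbrakk> \<Longrightarrow> tneg (g \<cdot> f)"
  by (simp add: tneg_def flip: a_comp_assoc)

text \<open>The definition places the test morphism after \<open>f\<close>, so closure under
  composition on the other side needs cyclicity of the trace to carry \<open>f\<close>
  across.\<close>

lemma tneg_comp_right:
  assumes "arr f" "tneg g" "cd f = dm g"
  shows "tneg (g \<cdot> f)"
proof -
  have [simp]: "arr g" using assms tneg_arr by blast
  have "tr (dm f) (h \<cdot> (g \<cdot> f)) = HZero C 0 0" if [simp]: "arr h" "dm h = cd g" "cd h = dm f" for h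
  proof -
    have "tr (dm f) (h \<cdot> g \<cdot> f) = tr (dm g) (f \<cdot> (h \<cdot> g))"
      using assms by (intro tr_cyclic) auto
    also have "\<dots> = tr (dm g) (f \<cdot> h \<cdot> g)" using assms by (simp add: a_comp_assoc)
    also have "\<dots> = HZero C 0 0" using assms by (simp add: tneg_def)
    finally show ?thesis using assms by (simp add: a_comp_assoc)
  qed
  then show ?thesis using assms by (simp add: tneg_def)
qed

lemma tr_Suc:
  assumes "arr k" "dm k = Suc m" "cd k = Suc m"
  shows "tr (Suc m) k = tr m (wh m cap 0 \<cdot> wh 0 k 1 \<cdot> wh m cup 0)"
  using assms by (simp add: tr_def cupn_Suc capn_Suc wh_comp wh_wh a_comp_assoc)

text \<open>Sphericality enters here: the endomorphisms of the generating object are scalars, so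
  the left and right traces on it agree.\<close>

lemma tr_Suc_left:
  assumes k: "arr k" "dm k = Suc m" "cd k = Suc m"
  shows "tr (Suc m) k = tr m (wh 0 cap m \<cdot> wh 1 k 0 \<cdot> wh 0 cup m)"
proof -
  note [simp] = k
  let ?x = "wh 1 (capn m) 0 \<cdot> wh 0 k m \<cdot> wh 1 (cupn m) 0"
  obtain c where c: "c \<in> carrier R" "?x = Scal C c (I 1)"
    using hom_1_1[of ?x] by auto
  have cup: "cupn (Suc m) = wh 1 (cupn m) 1 \<cdot> cup" and cap: "capn (Suc m) = cap \<cdot> wh 1 (capn m) 1"
    using cupn_add[of 1 m] capn_add[of 1 m] by simp_all
  have "tr (Suc m) k = cap \<cdot> wh 0 ?x 1 \<cdot> cup"
    by (simp add: tr_def cup cap wh_comp wh_wh a_comp_assoc)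
  also have "\<dots> = cap \<cdot> wh 1 ?x 0 \<cdot> cup"
    unfolding c(2) using c(1) by (simp add: wh_scal)
  also have "\<dots> = (cap \<cdot> wh (Suc (Suc 0)) (capn m) 0) \<cdot> wh 1 k m \<cdot> (wh (Suc (Suc 0)) (cupn m) 0 \<cdot> cup)"
    by (simp add: wh_comp wh_wh a_comp_assoc)
  also have "cap \<cdot> wh (Suc (Suc 0)) (capn m) 0 = capn m \<cdot> wh 0 cap (m + m)"
    using wh_slide[of cap "capn m" 0 0 0] by simp
  also have "wh (Suc (Suc 0)) (cupn m) 0 \<cdot> cup = wh 0 cup (m + m) \<cdot> cupn m"
    using wh_slide[of cup "cupn m" 0 0 0] by simp
  finally show ?thesis
    by (simp add: tr_def wh_comp wh_wh a_comp_assoc)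
qed

text \<open>Closing the last strand turns a test morphism for the widened diagram into one for
  \<open>f\<close>, because the cup slides past \<open>f\<close>. The mirror image closes the first
  strand and therefore rests on \<open>tr_Suc_left\<close>.\<close>

lemma tneg_wh_right:
  assumes "tneg f"
  shows "tneg (wh 0 f 1)"
proof -
  have [simp]: "arr f" using assms tneg_arr by blast
  obtain m n where [simp]: "dm f = m" "cd f = n" by blast
  have "tr (Suc m) (h \<cdot> wh 0 f 1) = HZero C 0 0" if [simp]: "arr h" "dm h = Suc n" "cd h = Suc m" for h
  proof -
    have "wh m cap 0 \<cdot> wh 0 (h \<cdot> wh 0 f 1) 1 \<cdot> wh m cup 0 =
        wh m cap 0 \<cdot> wh 0 h 1 \<cdot> (wh 0 f (Suc (Suc 0)) \<cdot> wh m cup 0)"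
      by (simp add: wh_comp wh_wh a_comp_assoc)
    also have "wh 0 f (Suc (Suc 0)) \<cdot> wh m cup 0 = wh n cup 0 \<cdot> f"
      using wh_slide[of f cup 0 0 0] by simp
    finally have "tr (Suc m) (h \<cdot> wh 0 f 1) = tr m ((wh m cap 0 \<cdot> wh 0 h 1 \<cdot> wh n cup 0) \<cdot> f)"
      by (simp add: tr_Suc a_comp_assoc)
    then show ?thesis using assms by (simp add: tneg_def)
  qed
  then show ?thesis by (simp add: tneg_def)
qed

lemma tneg_wh_left:
  assumes "tneg f"
  shows "tneg (wh 1 f 0)"
proof -
  have [simp]: "arr f" using assms tneg_arr by blast
  obtain m n where [simp]: "dm f = m" "cd f = n" by blast
  have "tr (Suc m) (h \<cdot> wh 1 f 0) = HZero C 0 0" if [simp]: "arr h" "dm h = Suc n" "cd h = Suc m" for h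
  proof -
    have "wh 0 cap m \<cdot> wh 1 (h \<cdot> wh 1 f 0) 0 \<cdot> wh 0 cup m =
        wh 0 cap m \<cdot> wh 1 h 0 \<cdot> (wh (Suc (Suc 0)) f 0 \<cdot> wh 0 cup m)"
      by (simp add: wh_comp wh_wh a_comp_assoc)
    also have "wh (Suc (Suc 0)) f 0 \<cdot> wh 0 cup m = wh 0 cup n \<cdot> f"
      using wh_slide[of cup f 0 0 0] by simp
    finally have "tr (Suc m) (h \<cdot> wh 1 f 0) = tr m ((wh 0 cap m \<cdot> wh 1 h 0 \<cdot> wh 0 cup n) \<cdot> f)"
      by (simp add: tr_Suc_left a_comp_assoc)
    then show ?thesis using assms by (simp add: tneg_def)
  qed
  then show ?thesis by (simp add: tneg_def)
qed

lemma tneg_wh: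
  assumes "tneg f"
  shows "tneg (wh a f b)"
proof -
  have l: "tneg (wh a f 0)" for a
  proof (induction a)
    case (Suc a)
    have "wh (Suc a) f 0 = wh 1 (wh a f 0) 0"
      using assms by (simp add: wh_wh tneg_arr)
    then show ?case using Suc tneg_wh_left by simp
  qed (use assms tneg_arr in simp)
  show ?thesis
  proof (induction b)
    case (Suc b)
    have "wh a f (Suc b) = wh 0 (wh a f b) 1"
      using assms by (simp add: wh_wh tneg_arr)
    then show ?case using Suc tneg_wh_right by simp
  qed (rule l)
qed

lemma tneg_tmor: "\<lbrakk>tneg f; arr g\<rbrakk> \<Longrightarrow> tneg (f \<boxtimes> g)" "\<lbrakk>arr f; tneg g\<rbrakk> \<Longrightarrow> tneg (f \<boxtimes> g)"
proof -
  show "tneg (f \<boxtimes> g)" if "tneg f" "arr g"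
    using that tneg_arr[OF that(1)] tneg_comp_right[of "wh (dm f) g 0" "wh 0 f (cd g)"]
    by (simp add: tmor_wh(1) tneg_wh)
  show "tneg (f \<boxtimes> g)" if "arr f" "tneg g"
    using that tneg_arr[OF that(2)] tneg_comp_left[of "wh (dm f) g 0" "wh 0 f (cd g)"]
    by (simp add: tmor_wh(1) tneg_wh)
qed

end

section \<open>Jones--Wenzl projectors\<close>

text \<open>\<open>x n\<close> is the ratio \<open>\<Delta>\<^sub>n\<^sub>+\<^sub>1 / \<Delta>\<^sub>n\<close> of the loop values of consecutive projectors, and \<open>y n\<close> is its
  inverse.\<close>

locale tl_generic = tl_cat R C cup cap \<delta>
  for R :: "('k, 'r) ring_scheme" and C :: "('k, nat, 'm, 'z) lmcat_scheme" (structure)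
    and cup cap :: 'm and \<delta> :: 'k +
  fixes x y :: "nat \<Rightarrow> 'k"
  assumes x_carrier [simp]: "x n \<in> carrier R" and y_carrier [simp]: "y n \<in> carrier R"
    and yx: "y n \<otimes>\<^bsub>R\<^esub> x n = \<one>\<^bsub>R\<^esub>"
    and x_0: "x 0 = \<delta>" and x_Suc: "x (Suc n) = \<delta> \<oplus>\<^bsub>R\<^esub> (\<ominus>\<^bsub>R\<^esub> y n)"
begin

lemma minus_y [simp]: "\<ominus>\<^bsub>R\<^esub> y n \<in> carrier R"
  using cring_R by (simp add: abelian_group.a_inv_closed cring_def ring.is_abelian_group)

text \<open>Wenzl's recursion, started at one strand: index \<open>n\<close> belongs to the
  projector on \<open>n + 1\<close> strands, and \<open>jw\<close> undoes the shift and adds the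
  empty case.\<close>

primrec jw_Suc :: "nat \<Rightarrow> 'm" where
  "jw_Suc 0 = I (Suc 0)"
| "jw_Suc (Suc n) = HAdd C (wh 0 (jw_Suc n) (Suc 0))
    (Scal C (\<ominus>\<^bsub>R\<^esub> y n) (wh 0 (jw_Suc n) (Suc 0) \<cdot> (wh n cup 0 \<cdot> wh n cap 0 \<cdot> wh 0 (jw_Suc n) (Suc 0))))"

definition jw :: "nat \<Rightarrow> 'm" where
  "jw n = (case n of 0 \<Rightarrow> I 0 | Suc m \<Rightarrow> jw_Suc m)"

lemma jw_simps: "jw 0 = I 0" "jw (Suc n) = jw_Suc n"
  by (simp_all add: jw_def)

lemma jw_Suc_arr [simp]: "arr (jw_Suc n)" "dm (jw_Suc n) = Suc n" "cd (jw_Suc n) = Suc n"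
proof -
  have "arr (jw_Suc n) \<and> dm (jw_Suc n) = Suc n \<and> cd (jw_Suc n) = Suc n"
    by (induction n) auto
  then show "arr (jw_Suc n)" "dm (jw_Suc n) = Suc n" "cd (jw_Suc n) = Suc n" by auto
qed

lemma jw_arr [simp]: "arr (jw n)" "dm (jw n) = n" "cd (jw n) = n"
  by (cases n; simp add: jw_simps)+

lemma add_neg_scal: "\<lbrakk>arr f; c \<in> carrier R\<rbrakk>
    \<Longrightarrow> HAdd C (Scal C c f) (Scal C (\<ominus>\<^bsub>R\<^esub> c) f) = HZero C (dm f) (cd f)"
proof -
  interpret R: cring R by (rule cring_R)
  show "\<lbrakk>arr f; c \<in> carrier R\<rbrakk>
    \<Longrightarrow> HAdd C (Scal C c f) (Scal C (\<ominus>\<^bsub>R\<^esub> c) f) = HZero C (dm f) (cd f)"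
    by (simp add: R.r_neg flip: a_scal_add_left)
qed

text \<open>The four claims support each other. Absorption and the partial trace, through
  \<open>y n\<close> times \<open>x n\<close> being \<open>1\<close>, make the last cap kill the
  next projector; being killed by that cap makes it idempotent; and its partial trace has
  coefficient \<open>\<delta>\<close> minus \<open>y n\<close>, which is
  \<open>x (Suc n)\<close>.\<close>

lemma jw_properties:
  "(\<forall>i r. Suc (i + r) = n \<longrightarrow> wh i cap r \<cdot> jw_Suc n = HZero C (Suc n) (i + r)) \<and>
   jw_Suc n \<cdot> jw_Suc n = jw_Suc n \<and>
   wh 0 (jw n) (Suc 0) \<cdot> jw_Suc n = jw_Suc n \<and>
   wh n cap 0 \<cdot> wh 0 (jw_Suc n) (Suc 0) \<cdot> wh n cup 0 = Scal C (x n) (jw n)"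
proof (induction n)
  case 0
  show ?case using wh_loop[of 0 0] by (simp add: jw_simps x_0)
next
  case (Suc n)
  interpret R: cring R by (rule cring_R)
  let ?q = "jw_Suc n" and ?q' = "jw_Suc (Suc n)" and ?p = "jw n"
  let ?A = "wh 0 ?q (Suc 0)" and ?u = "wh n cup 0" and ?c = "wh n cap 0"
  have IH: "\<And>i r. Suc (i + r) = n \<Longrightarrow> wh i cap r \<cdot> ?q = HZero C (Suc n) (i + r)"
    "?q \<cdot> ?q = ?q" "wh 0 ?p (Suc 0) \<cdot> ?q = ?q" "?c \<cdot> (?A \<cdot> ?u) = Scal C (x n) ?p"
    using Suc by (auto simp: a_comp_assoc)
  have q': "?q' = HAdd C ?A (Scal C (\<ominus>\<^bsub>R\<^esub> y n) (?A \<cdot> (?u \<cdot> (?c \<cdot> ?A))))"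
    by (simp add: a_comp_assoc)
  have AA: "?A \<cdot> ?A = ?A" using IH(2) by (simp flip: wh_comp)
  have Aq: "?A \<cdot> ?q' = ?q'"
    unfolding q' by (simp add: a_comp_add a_comp_scal AA flip: a_comp_assoc)
  have pc: "?p \<cdot> (?c \<cdot> ?A) = ?c \<cdot> ?A"
  proof -
    have "?p \<cdot> (?c \<cdot> ?A) = ?p \<cdot> ?c \<cdot> ?A" by (simp add: a_comp_assoc)
    also have "?p \<cdot> ?c = ?c \<cdot> wh 0 ?p (Suc (Suc 0))"
      using wh_slide[of ?p cap 0 0 0] by simp
    also have "?c \<cdot> wh 0 ?p (Suc (Suc 0)) \<cdot> ?A = ?c \<cdot> wh 0 (wh 0 ?p 1 \<cdot> ?q) (Suc 0)"
      by (simp add: wh_comp wh_wh a_comp_assoc)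
    finally show ?thesis by (simp add: IH(3))
  qed
  have cq: "?c \<cdot> ?q' = HZero C (Suc (Suc n)) n"
  proof -
    have "?c \<cdot> ?q' = HAdd C (?c \<cdot> ?A) (Scal C (\<ominus>\<^bsub>R\<^esub> y n) (?c \<cdot> (?A \<cdot> ?u) \<cdot> (?c \<cdot> ?A)))"
      unfolding q' by (simp add: a_comp_add a_comp_scal a_comp_assoc)
    also have "?c \<cdot> (?A \<cdot> ?u) \<cdot> (?c \<cdot> ?A) = Scal C (x n) (?c \<cdot> ?A)"
      by (simp add: IH(4) a_comp_scal pc)
    also have "Scal C (\<ominus>\<^bsub>R\<^esub> y n) (Scal C (x n) (?c \<cdot> ?A)) = Scal C (\<ominus>\<^bsub>R\<^esub> \<one>\<^bsub>R\<^esub>) (?c \<cdot> ?A)"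
      using yx[of n] by (simp add: R.l_minus flip: a_scal_mult)
    finally show ?thesis using add_neg_scal[of "?c \<cdot> ?A" "\<one>\<^bsub>R\<^esub>"] by simp
  qed
  have "wh i cap r \<cdot> ?q' = HZero C (Suc (Suc n)) (i + r)" if ir: "i + r = n" for i r
  proof (cases r)
    case 0
    then show ?thesis using cq ir by simp
  next
    case (Suc r')
    \<comment> \<open>A cap that avoids the last strand can be moved onto the previous projector,
      which \<open>?q'\<close> absorbs.\<close>
    have "wh i cap r \<cdot> ?q' = wh i cap r \<cdot> ?A \<cdot> ?q'"
      using ir by (simp add: Aq a_comp_assoc del: jw_Suc.simps)
    also have "wh i cap r \<cdot> ?A = wh 0 (wh i cap r' \<cdot> ?q) (Suc 0)"
      using ir Suc by (simp add: wh_comp wh_wh)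
    finally show ?thesis using IH(1)[of i r'] ir Suc by (simp del: jw_Suc.simps)
  qed
  moreover have "?q' \<cdot> ?q' = ?q'"
  proof -
    have "?q' \<cdot> ?q' = HAdd C (?A \<cdot> ?q') (Scal C (\<ominus>\<^bsub>R\<^esub> y n) (?A \<cdot> (?u \<cdot> (?c \<cdot> (?A \<cdot> ?q')))))"
      by (subst (1) q') (simp add: a_comp_add a_comp_scal a_comp_assoc del: jw_Suc.simps)
    then show ?thesis by (simp add: Aq cq del: jw_Suc.simps)
  qed
  moreover have "wh (Suc n) cap 0 \<cdot> (wh 0 ?q' (Suc 0) \<cdot> wh (Suc n) cup 0) = Scal C (x (Suc n)) ?q"
  proof -
    let ?c' = "wh (Suc n) cap 0" and ?u' = "wh (Suc n) cup 0" and ?A' = "wh 0 ?q (Suc (Suc 0))"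
    have cA: "?c' \<cdot> ?A' = ?q \<cdot> ?c'" using wh_slide[of ?q cap 0 0 0] by simp
    have Au: "?A' \<cdot> ?u' = ?u' \<cdot> ?q" using wh_slide[of ?q cup 0 0 0] by simp
    have q2: "wh 0 ?q' (Suc 0) = HAdd C ?A' (Scal C (\<ominus>\<^bsub>R\<^esub> y n) (?A' \<cdot> (wh n cup (Suc 0) \<cdot> (wh n cap (Suc 0) \<cdot> ?A'))))"
      unfolding q' by (simp add: wh_add wh_scal wh_comp wh_wh)
    have "?c' \<cdot> (?A' \<cdot> ?u') = Scal C \<delta> ?q"
    proof -
      have "?c' \<cdot> (?A' \<cdot> ?u') = ?c' \<cdot> ?u' \<cdot> ?q" by (simp add: Au a_comp_assoc)
      then show ?thesis using wh_loop[of "Suc n" 0] by (simp add: a_comp_scal)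
    qed
    \<comment> \<open>The inner cup and cap form zigzags with the outer cap and cup; both
      straighten, and two copies of \<open>?q\<close> remain.\<close>
    moreover have "?c' \<cdot> (?A' \<cdot> (wh n cup (Suc 0) \<cdot> (wh n cap (Suc 0) \<cdot> ?A')) \<cdot> ?u') = ?q"
    proof -
      have "?c' \<cdot> (?A' \<cdot> (wh n cup (Suc 0) \<cdot> (wh n cap (Suc 0) \<cdot> ?A')) \<cdot> ?u') =
          ?c' \<cdot> ?A' \<cdot> (wh n cup (Suc 0) \<cdot> (wh n cap (Suc 0) \<cdot> (?A' \<cdot> ?u')))"
        by (simp add: a_comp_assoc)
      also have "\<dots> = ?q \<cdot> (?c' \<cdot> wh n cup (Suc 0)) \<cdot> (wh n cap (Suc 0) \<cdot> ?u') \<cdot> ?q"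
        by (simp add: cA Au a_comp_assoc)
      also have "\<dots> = ?q"
        using wh_zig2[of n 0] wh_zig1[of n 0] IH(2) by simp
      finally show ?thesis .
    qed
    ultimately show ?thesis
      unfolding q2 by (simp add: a_comp_add a_comp_scal x_Suc a_scal_add_left)
  qed
  ultimately show ?case using Aq by (simp add: jw_simps a_comp_assoc del: jw_Suc.simps)
qed

lemma jw_cap: "Suc (Suc (i + r)) = n \<Longrightarrow> wh i cap r \<cdot> jw n = HZero C n (i + r)"
  using jw_properties[of "n - 1"] by (cases n) (auto simp: jw_simps)

text \<open>Sums of endomorphisms that factor through projectors. That the identity is such a sum,
  \<open>jspan_id\<close>, is the form in which semisimplicity at \<open>q\<close> is used.\<close>

inductive jspan :: "nat \<Rightarrow> 'm \<Rightarrow> bool" where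
  "jspan n (HZero C n n)"
| "\<lbrakk>jspan n f; jspan n g\<rbrakk> \<Longrightarrow> jspan n (HAdd C f g)"
| "\<lbrakk>arr a; dm a = k; cd a = n; arr b; dm b = n; cd b = k\<rbrakk> \<Longrightarrow> jspan n (a \<cdot> (jw k \<cdot> b))"

lemma jspan_arr: "jspan n f \<Longrightarrow> arr f \<and> dm f = n \<and> cd f = n"
  by (induction rule: jspan.induct) auto

text \<open>Wenzl's recursion is solved for the projector with a strand added: it equals the next
  projector plus a term that factors through \<open>jw m\<close>, where
  \<open>k = Suc m\<close>.\<close>

lemma jspan_tensor: "jspan n f \<Longrightarrow> jspan (Suc n) (wh 0 f (Suc 0))"
proof (induction rule: jspan.induct)
  case (1 n)
  then show ?case using jspan.intros(1)[of "Suc n"] by simp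
next
  case (2 n f g)
  then show ?case using jspan_arr[of n f] jspan_arr[of n g] by (simp add: wh_add jspan.intros)
next
  case (3 a k n b)
  note [simp] = 3
  have w: "wh 0 (a \<cdot> (jw k \<cdot> b)) (Suc 0) = wh 0 a (Suc 0) \<cdot> (wh 0 (jw k) (Suc 0) \<cdot> wh 0 b (Suc 0))"
    by (simp add: wh_comp)
  show ?case
  proof (cases k)
    case 0
    then have "wh 0 (jw k) (Suc 0) = jw 1" by (simp add: jw_simps)
    then show ?thesis unfolding w using 0 jspan.intros(3)[of "wh 0 a (Suc 0)" 1 "Suc n" "wh 0 b (Suc 0)"] by simp
  next
    case (Suc m)
    interpret R: cring R by (rule cring_R)
    let ?q = "jw_Suc m" and ?q' = "jw_Suc (Suc m)" and ?p = "jw m"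
    let ?A = "wh 0 ?q (Suc 0)" and ?u = "wh m cup 0" and ?c = "wh m cap 0"
    have pc: "?p \<cdot> (?c \<cdot> ?A) = ?c \<cdot> ?A"
    proof -
      have "?p \<cdot> (?c \<cdot> ?A) = ?p \<cdot> ?c \<cdot> ?A" by (simp add: a_comp_assoc)
      also have "?p \<cdot> ?c = ?c \<cdot> wh 0 ?p (Suc (Suc 0))"
        using wh_slide[of ?p cap 0 0 0] by simp
      also have "?c \<cdot> wh 0 ?p (Suc (Suc 0)) \<cdot> ?A = ?c \<cdot> wh 0 (wh 0 ?p 1 \<cdot> ?q) (Suc 0)"
        by (simp add: wh_comp wh_wh a_comp_assoc)
      finally show ?thesis using jw_properties[of m] by simp
    qed
    have z: "HAdd C (Scal C (y m) (?A \<cdot> (?u \<cdot> (?c \<cdot> ?A)))) (Scal C (\<ominus>\<^bsub>R\<^esub> y m) (?A \<cdot> (?u \<cdot> (?c \<cdot> ?A)))) =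
        HZero C (Suc (Suc m)) (Suc (Suc m))"
      using add_neg_scal[of "?A \<cdot> (?u \<cdot> (?c \<cdot> ?A))" "y m"] by simp
    \<comment> \<open>The correction term is added and subtracted, so that one half completes
      \<open>?A\<close> to the next projector.\<close>
    have "?A = HAdd C ?A (HAdd C (Scal C (\<ominus>\<^bsub>R\<^esub> y m) (?A \<cdot> (?u \<cdot> (?c \<cdot> ?A))))
        (Scal C (y m) (?A \<cdot> (?u \<cdot> (?c \<cdot> ?A)))))"
      by (subst a_hadd_comm[of "Scal C (\<ominus>\<^bsub>R\<^esub> y m) (?A \<cdot> (?u \<cdot> (?c \<cdot> ?A)))"]) (simp_all add: z)
    then have "?A = HAdd C ?q' (Scal C (y m) (?A \<cdot> (?u \<cdot> (?c \<cdot> ?A))))"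
      by (simp add: a_comp_assoc a_hadd_assoc)
    also have "?A \<cdot> (?u \<cdot> (?c \<cdot> ?A)) = ?A \<cdot> ?u \<cdot> (?p \<cdot> (?c \<cdot> ?A))"
      by (simp add: pc a_comp_assoc)
    finally have A: "?A = HAdd C ?q' (Scal C (y m) (?A \<cdot> ?u \<cdot> (?p \<cdot> (?c \<cdot> ?A))))" .
    have "wh 0 (a \<cdot> (jw k \<cdot> b)) (Suc 0) = wh 0 a (Suc 0) \<cdot> (HAdd C ?q' (Scal C (y m) (?A \<cdot> ?u \<cdot> (?p \<cdot> (?c \<cdot> ?A)))) \<cdot> wh 0 b (Suc 0))"
      unfolding w using A Suc by (simp add: jw_simps del: jw_Suc.simps)
    also have "\<dots> = HAdd C (wh 0 a (Suc 0) \<cdot> (jw (Suc (Suc m)) \<cdot> wh 0 b (Suc 0)))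
        (Scal C (y m) (wh 0 a (Suc 0) \<cdot> (?A \<cdot> ?u)) \<cdot> (jw m \<cdot> (?c \<cdot> ?A \<cdot> wh 0 b (Suc 0))))"
      using Suc by (simp add: jw_simps a_comp_add a_comp_scal a_comp_assoc del: jw_Suc.simps)
    finally show ?thesis using Suc by (simp add: jspan.intros(2,3))
  qed
qed

lemma jspan_id: "jspan n (I n)"
proof (induction n)
  case 0
  then show ?case using jspan.intros(3)[of "I 0" 0 0 "I 0"] by (simp add: jw_simps)
next
  case (Suc n)
  then show ?case using jspan_tensor[of n "I n"] by simp
qed

lemma hom_0_jw:
  assumes "arr h" "dm h = k" "cd h = 0" "0 < k"
  shows "h \<cdot> jw k = HZero C k 0"
proof (cases "k = 1")
  case True
  then show ?thesis using hom_1_0[of h] assms by simp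
next
  case False
  then obtain m where k: "k = Suc (Suc m)" using assms by (cases k; cases "k - 1") auto
  then obtain s where s: "\<forall>p\<le>m. arr (s p) \<and> dm (s p) = m \<and> cd (s p) = 0"
    "h = hom_sum C (Suc (Suc m)) 0 (\<lambda>p. s p \<cdot> wh p cap (m - p)) (Suc m)"
    using hom_SS_0[of h m] assms by auto
  have "h \<cdot> jw k = hom_sum C (Suc (Suc m)) 0 (\<lambda>p. s p \<cdot> wh p cap (m - p) \<cdot> jw k) (Suc m)"
    unfolding s(2) using s(1) k by (intro hsum_comp_right) auto
  also have "\<dots> = hom_sum C (Suc (Suc m)) 0 (\<lambda>p. HZero C (Suc (Suc m)) 0) (Suc m)"
    using s(1) k by (intro hsum_cong) (simp add: a_comp_assoc jw_cap)
  finally show ?thesis using k by (simp del: hom_sum.simps)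
qed

text \<open>Insert the identity of the source, written through projectors. For \<open>k > 0\<close>
  the composite of \<open>h\<close> and \<open>a\<close> is a morphism to \<open>0\<close> and dies
  on the projector; for \<open>k = 0\<close> it is a pairing, zero by assumption.\<close>

lemma hom_0_nondegenerate:
  assumes h: "arr h" "cd h = 0" and zero: "\<And>u. \<lbrakk>arr u; dm u = 0; cd u = dm h\<rbrakk> \<Longrightarrow> h \<cdot> u = HZero C 0 0"
  shows "h = HZero C (dm h) 0"
proof -
  have "jspan n f \<Longrightarrow> n = dm h \<Longrightarrow> h \<cdot> f = HZero C n 0" for n f
  proof (induction rule: jspan.induct)
    case (2 n f g)
    then show ?case using jspan_arr[of n f] jspan_arr[of n g] h by (simp add: a_comp_add)
  next
    case (3 a k n b)
    have "h \<cdot> (a \<cdot> (jw k \<cdot> b)) = h \<cdot> a \<cdot> jw k \<cdot> b" using 3 h by (simp add: a_comp_assoc)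
    also have "h \<cdot> a \<cdot> jw k = HZero C k 0"
    proof (cases "k = 0")
      case True
      then show ?thesis using 3 h zero[of a] by (simp add: jw_simps)
    qed (use 3 h in \<open>simp add: hom_0_jw\<close>)
    finally show ?case using 3 by simp
  qed (use h in simp)
  from this[OF jspan_id] show ?thesis using h by simp
qed

text \<open>Pairings of the bent morphism with morphisms from \<open>0\<close> are traces of
  \<open>f\<close> against test morphisms, so negligibility is degeneracy of a pairing that the
  projectors show to be nondegenerate.\<close>

lemma tneg_eq_zero:
  assumes "tneg f"
  shows "f = HZero C (dm f) (cd f)"
proof -
  have [simp]: "arr f" using assms tneg_arr by blast
  obtain m n where [simp]: "dm f = m" "cd f = n" by blast
  have "bend n f \<cdot> u = HZero C 0 0" if [simp]: "arr u" "dm u = 0" "cd u = m + n" for u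
  proof -
    \<comment> \<open>The test morphism is \<open>u\<close> with its last \<open>n\<close> outputs
      bent round to become inputs.\<close>
    let ?g = "wh m (capn n) 0 \<cdot> wh 0 u n"
    have "wh 0 ?g n \<cdot> cupn n = wh m (capn n) n \<cdot> (wh 0 u (n + n) \<cdot> cupn n)"
      by (simp add: wh_comp wh_wh a_comp_assoc)
    also have "wh 0 u (n + n) \<cdot> cupn n = wh (m + n) (cupn n) 0 \<cdot> u"
      using wh_slide[of u "cupn n" 0 0 0] by simp
    also have "wh m (capn n) n \<cdot> (wh (m + n) (cupn n) 0 \<cdot> u) =
        wh m (wh 0 (capn n) n \<cdot> wh n (cupn n) 0) 0 \<cdot> u"
      by (simp add: wh_comp wh_wh a_comp_assoc)
    finally have "wh 0 ?g n \<cdot> cupn n = u" by (simp add: zigzag_left)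
    then have "bend n f \<cdot> u = tr n (f \<cdot> ?g)"
      by (simp add: bend_def tr_def wh_comp a_comp_assoc)
    also have "\<dots> = tr m (?g \<cdot> f)" by (rule tr_cyclic[symmetric]) simp_all
    finally show ?thesis using assms by (simp add: tneg_def)
  qed
  then have "bend n f = HZero C (m + n) 0"
    using hom_0_nondegenerate[of "bend n f"] by simp
  then have "f = unbend m n (HZero C (m + n) 0)"
    using unbend_bend[of f m n] by simp
  then show ?thesis by (simp add: unbend_def)
qed

end

section \<open>The diagrammatic category\<close>

inductive_cases tl_hom_elims:
  "tl_hom K (TId k) m n" "tl_hom K TCup m n" "tl_hom K TCap m n" "tl_hom K (TComp g f) m n"
  "tl_hom K (TTens f g) m n" "tl_hom K (TZero k l) m n" "tl_hom K (TAdd f g) m n" "tl_hom K (TScal c f) m n"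

lemma tl_hom_unique: "\<lbrakk>tl_hom K f m n; tl_hom K f m' n'\<rbrakk> \<Longrightarrow> m = m' \<and> n = n'"
proof (induction arbitrary: m' n' rule: tl_hom.induct)
  case (4 g m n f l)
  from 4(5) show ?case by (rule tl_hom_elims) (use 4(3,4) in blast)
next
  case (5 f m n g m2 n2)
  from 5(5) show ?case by (rule tl_hom_elims) (use 5(3,4) in blast)
qed (blast elim: tl_hom_elims)+

definition tl_class :: "('k, 'r) ring_scheme \<Rightarrow> 'k \<Rightarrow> 'k tl_term \<Rightarrow> 'k tl_term set" where
  "tl_class K q f = {(f, g). tl_eq K q f g} `` {f}"

locale tl_param = K: cring K for K :: "('k, 'r) ring_scheme" (structure) +
  fixes q :: 'k
  assumes q_unit: "q \<in> Units K"
begin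

lemma q_closed [simp]: "q \<in> carrier K" "inv q \<in> carrier K" "inv q \<otimes> q = \<one>" "q \<otimes> inv q = \<one>"
  using q_unit by (auto intro: K.Units_closed)

text \<open>Several congruence rules type only the left-hand terms, or none, so the types of the
  other side have to be recovered from uniqueness of typing.\<close>

lemma tl_eq_hom: "tl_eq K q f g \<Longrightarrow> \<exists>m n. tl_hom K f m n \<and> tl_hom K g m n"
proof (induction rule: tl_eq.induct)
  case (trans f g h)
  then show ?case using tl_hom_unique by metis
next
  case (cong_comp g m n f l g' f')
  then show ?case using tl_hom_unique by (metis tl_hom.intros(4))
next
  case (cong_add f m n g f' g')
  then show ?case using tl_hom_unique by (metis tl_hom.intros(7))
next
  case zigzag1
  have "tl_hom K (TTens TCap (TId 1)) (2 + 1) (0 + 1)" "tl_hom K (TTens (TId 1) TCup) (1 + 0) (1 + 2)"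
    by (intro tl_hom.intros)+
  then have "tl_hom K (TComp (TTens TCap (TId 1)) (TTens (TId 1) TCup)) 1 1"
    by (intro tl_hom.intros(4)[of _ _ 3]) (simp_all add: eval_nat_numeral)
  then show ?case using tl_hom.intros(1)[of K 1] by (intro exI[of _ 1] conjI)
next
  case zigzag2
  have "tl_hom K (TTens (TId 1) TCap) (1 + 2) (1 + 0)" "tl_hom K (TTens TCup (TId 1)) (0 + 1) (2 + 1)"
    by (intro tl_hom.intros)+
  then have "tl_hom K (TComp (TTens (TId 1) TCap) (TTens TCup (TId 1))) 1 1"
    by (intro tl_hom.intros(4)[of _ _ 3]) (simp_all add: eval_nat_numeral)
  then show ?case using tl_hom.intros(1)[of K 1] by (intro exI[of _ 1] conjI)
next
  case (interchange f l m g n f' l' m' g' n')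
  then show ?case by (blast intro: tl_hom.intros)
next
  case (tens_unit_left f m n)
  then show ?case using tl_hom.intros(5)[OF tl_hom.intros(1)[of K 0], of f m n] by (intro exI[of _ m] exI[of _ n]) simp
next
  case (tens_unit_right f m n)
  then show ?case using tl_hom.intros(5)[OF _ tl_hom.intros(1)[of K 0], of f m n] by (intro exI[of _ m] exI[of _ n]) simp
next
  case (tens_assoc f m n g m' n' h m'' n'')
  have "tl_hom K (TTens (TTens f g) h) (m + m' + m'') (n + n' + n'')"
    by (intro tl_hom.intros tens_assoc)
  moreover have "tl_hom K (TTens f (TTens g h)) (m + (m' + m'')) (n + (n' + n''))"
    by (intro tl_hom.intros tens_assoc)
  ultimately show ?case by (metis add.assoc)
qed (blast intro: tl_hom.intros K.a_closed K.m_closed K.a_inv_closed q_closed)+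

abbreviation tl_rel where "tl_rel \<equiv> {(f, g). tl_eq K q f g}"

sublocale raw: typed_ops K "tl_raw K"
  by unfold_locales
    (auto simp: tl_raw_def tl_hom_unique intro: tl_hom.intros dest: tl_hom_unique)

lemma raw_hom: "tl_hom K f m n \<longleftrightarrow> raw.arr f \<and> raw.dm f = m \<and> raw.cd f = n"
  using raw.hom_iff[of m n f] by (simp add: tl_raw_def)

lemma raw_sel [simp]: "Id (tl_raw K) = TId" "Comp (tl_raw K) = TComp" "TMor (tl_raw K) = TTens"
  "HZero (tl_raw K) = TZero" "HAdd (tl_raw K) = TAdd" "Scal (tl_raw K) = TScal" "Ob (tl_raw K) = UNIV"
  "Unt (tl_raw K) = 0" "TOb (tl_raw K) = (+)"
  by (simp_all add: tl_raw_def)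

sublocale raw: monoidal_congruence K "tl_raw K" tl_rel
proof (intro monoidal_congruence.intro monoidal_congruence_axioms.intro raw.typed_ops_axioms;
    (simp only: raw_sel mem_Collect_eq prod.case)?)
  show "cring K" by (rule K.is_cring)
  show "raw.arr f \<and> raw.arr g \<and> raw.dm f = raw.dm g \<and> raw.cd f = raw.cd g" if "tl_eq K q f g" for f g
    using tl_eq_hom[OF that] by (auto simp: raw_hom)
  show "tl_eq K q (TComp g f) (TComp g' f')" if "tl_eq K q f f'" "tl_eq K q g g'" "raw.cd f = raw.dm g" for f f' g g'
    using tl_eq_hom[OF that(1)] tl_eq_hom[OF that(2)] that
    by (intro tl_eq.cong_comp[of K g "raw.dm g" "raw.cd g" f "raw.dm f"]) (auto simp: raw_hom)
  show "tl_eq K q (TAdd f g) (TAdd f' g')" if "tl_eq K q f f'" "tl_eq K q g g'" "raw.dm f = raw.dm g" "raw.cd f = raw.cd g" for f f' g g'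
    using tl_eq_hom[OF that(1)] tl_eq_hom[OF that(2)] that
    by (intro tl_eq.cong_add[of K f "raw.dm f" "raw.cd f" g]) (auto simp: raw_hom)
  show "tl_eq K q f h" if "tl_eq K q f g" "tl_eq K q g h" for f g h using that by (rule tl_eq.trans)
  show "tl_eq K q g f" if "tl_eq K q f g" for f g using that by (rule tl_eq.sym)
  show "tl_eq K q (TTens f g) (TTens f' g')" if "tl_eq K q f f'" "tl_eq K q g g'" for f f' g g'
    using that by (rule tl_eq.cong_tens)
  show "tl_eq K q (TScal c f) (TScal c f')" if "c \<in> carrier K" "tl_eq K q f f'" for c f f'
    using that by (rule tl_eq.cong_scal)
qed ((simp only: add.assoc add_0 add_0_right; fail)
    | (rule tl_eq.refl tl_eq.comp_id_left tl_eq.comp_id_right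
      tl_eq.comp_assoc tl_eq.tens_id tl_eq.interchange tl_eq.tens_assoc tl_eq.tens_unit_left tl_eq.tens_unit_right
      tl_eq.add_assoc tl_eq.add_comm tl_eq.add_zero tl_eq.scal_zero tl_eq.scal_one tl_eq.scal_mult
      tl_eq.scal_add_left tl_eq.scal_add_right tl_eq.comp_add_left tl_eq.comp_add_right
      tl_eq.comp_scal_left tl_eq.comp_scal_right tl_eq.tens_add_left tl_eq.tens_add_right
      tl_eq.tens_scal_left tl_eq.tens_scal_right; (simp only: raw_hom)?; simp))+

abbreviation T where "T \<equiv> tl_tilde K q"

abbreviation cl where "cl \<equiv> tl_class K q"

lemma cl_eq: "tl_eq K q f g \<Longrightarrow> cl f = cl g"
  unfolding tl_class_def by (rule raw.cls_eq) simp

lemma cl_eq_iff: "tl_hom K f m n \<Longrightarrow> cl f = cl g \<longleftrightarrow> tl_eq K q f g"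
  unfolding tl_class_def using raw.cls_eq_iff[of f g] by (simp add: raw_hom del: Image_singleton)

lemma cl_self: "tl_hom K f m n \<Longrightarrow> f \<in> cl f"
  by (auto simp: tl_class_def intro: tl_eq.refl)

lemma mem_cl: "g \<in> cl f \<longleftrightarrow> tl_eq K q f g"
  by (simp add: tl_class_def)

lemma T_sel [simp]: "Ob T = UNIV" "Unt T = 0" "TOb T = (+)" "Id T n = cl (TId n)"
  "HZero T m n = cl (TZero m n)" "Dual T = (\<lambda>n. n)" "Coev T n = cl (cups n)"
  "Ev T n = cl (caps n)" "PEv T n = cl (caps n)"
  by (simp_all add: tl_tilde_def Let_def lmcat.extend_def pivcat.fields_def quot_cat_def tl_raw_def tl_class_def)

lemma T_quot: "Hom T = Hom (quot_cat (tl_raw K) tl_rel)" "Comp T = Comp (quot_cat (tl_raw K) tl_rel)"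
  "TMor T = TMor (quot_cat (tl_raw K) tl_rel)" "HAdd T = HAdd (quot_cat (tl_raw K) tl_rel)"
  "Scal T = Scal (quot_cat (tl_raw K) tl_rel)"
  by (simp_all add: tl_tilde_def Let_def lmcat.extend_def)

lemma T_lmc: "linear_monoidal_category K T"
  unfolding tl_tilde_def Let_def by (rule linear_monoidal_category_extend) (rule raw.quot_lmc)

sublocale T: typed_lmc K T
proof (rule typed_lmcI[OF T_lmc])
  fix X Y X' Y' F
  assume "F \<in> Hom T X Y" "F \<in> Hom T X' Y'"
  then show "X = X' \<and> Y = Y'"
    using raw.quot_disjoint[of X Y X' Y' F] by (simp add: T_quot)
qed

lemma T_homI: "tl_hom K f m n \<Longrightarrow> cl f \<in> Hom T m n"
  unfolding T_quot tl_class_def by (rule raw.quot_homI) (auto simp: raw_hom)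

lemma T_homE: assumes "F \<in> Hom T m n" obtains f where "F = cl f" "tl_hom K f m n"
  using raw.quot_homE[of F m n] assms by (simp only: T_quot raw_hom tl_class_def raw_sel UNIV_I simp_thms) blast

lemma T_arr_cls: "tl_hom K f m n \<Longrightarrow> T.arr (cl f) \<and> T.dm (cl f) = m \<and> T.cd (cl f) = n"
  using T.homD[OF T_homI] by simp

lemma T_arrE: assumes "T.arr F" obtains f where "F = cl f" "tl_hom K f (T.dm F) (T.cd F)"
  using T_homE[OF T.arrD(1)[OF assms]] by blast

lemma T_ops:
  "\<lbrakk>tl_hom K f l m; tl_hom K g m n\<rbrakk> \<Longrightarrow> Comp T (cl g) (cl f) = cl (TComp g f)"
  "\<lbrakk>tl_hom K f m n; tl_hom K g m' n'\<rbrakk> \<Longrightarrow> TMor T (cl f) (cl g) = cl (TTens f g)"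
  "\<lbrakk>tl_hom K f m n; tl_hom K g m n\<rbrakk> \<Longrightarrow> HAdd T (cl f) (cl g) = cl (TAdd f g)"
  "\<lbrakk>c \<in> carrier K; tl_hom K f m n\<rbrakk> \<Longrightarrow> Scal T c (cl f) = cl (TScal c f)"
  unfolding T_quot tl_class_def raw_hom
  by (rule raw.quot_comp[unfolded raw_sel] raw.quot_tmor[unfolded raw_sel] raw.quot_add[unfolded raw_sel]
      raw.quot_scal[unfolded raw_sel]; simp)+

lemma T_induct:
  assumes "T.arr F" and Id: "\<And>n. P (Id T n)" and cup: "P (cl TCup)" and cap: "P (cl TCap)"
    and comp: "\<And>f g. \<lbrakk>T.arr f; T.arr g; T.cd f = T.dm g; P f; P g\<rbrakk> \<Longrightarrow> P (Comp T g f)"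
    and tmor: "\<And>f g. \<lbrakk>T.arr f; T.arr g; P f; P g\<rbrakk> \<Longrightarrow> P (TMor T f g)"
    and zero: "\<And>m n. P (HZero T m n)"
    and add: "\<And>f g. \<lbrakk>T.arr f; T.arr g; T.dm g = T.dm f; T.cd g = T.cd f; P f; P g\<rbrakk> \<Longrightarrow> P (HAdd T f g)"
    and scal: "\<And>c f. \<lbrakk>c \<in> carrier K; T.arr f; P f\<rbrakk> \<Longrightarrow> P (Scal T c f)"
  shows "P F"
proof -
  have "tl_hom K f m n \<Longrightarrow> P (cl f)" for f m n
  proof (induction rule: tl_hom.induct)
    case (1 n)
    then show ?case using Id by simp
  next
    case (4 g m n f l)
    then show ?case using comp[of "cl f" "cl g"] T_arr_cls by (simp add: T_ops)
  next
    case (5 f m n g m' n')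
    then show ?case using tmor[of "cl f" "cl g"] T_arr_cls by (simp add: T_ops)
  next
    case (6 m n)
    then show ?case using zero by simp
  next
    case (7 f m n g)
    then show ?case using add[of "cl f" "cl g"] T_arr_cls by (simp add: T_ops)
  next
    case (8 c f m n)
    then show ?case using scal[of c "cl f"] T_arr_cls by (simp add: T_ops)
  qed (use cup cap in auto)
  then show ?thesis using T_arrE[OF assms(1)] by metis
qed

lemma loop_carrier [simp]: "\<ominus> (q \<oplus> inv q) \<in> carrier K"
  by simp

sublocale T: tl_cat K T "cl TCup" "cl TCap" "\<ominus> (q \<oplus> inv q)"
proof
  note h = tl_hom.intros(1-3)[where K = K]
  have h12: "tl_hom K (TTens TCap (TId 1)) 3 1" "tl_hom K (TTens (TId 1) TCup) 1 3"
    "tl_hom K (TTens (TId 1) TCap) 3 1" "tl_hom K (TTens TCup (TId 1)) 1 3"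
    using tl_hom.intros(5)[OF h(3) h(1)[of 1]] tl_hom.intros(5)[OF h(1)[of 1] h(2)]
      tl_hom.intros(5)[OF h(1)[of 1] h(3)] tl_hom.intros(5)[OF h(2) h(1)[of 1]]
    by (simp_all add: eval_nat_numeral)
  show "cl TCup \<in> Hom T 0 2" "cl TCap \<in> Hom T 2 0"
    by (auto intro!: T_homI h)
  show "Comp T (TMor T (cl TCap) (Id T 1)) (TMor T (Id T 1) (cl TCup)) = Id T 1"
    using tl_eq.zigzag1 by (simp only: T_sel T_ops(2)[OF h(3) h(1)] T_ops(2)[OF h(1) h(2)] T_ops(1)[OF h12(2,1)])
      (rule cl_eq)
  show "Comp T (TMor T (Id T 1) (cl TCap)) (TMor T (cl TCup) (Id T 1)) = Id T 1"
    using tl_eq.zigzag2 by (simp only: T_sel T_ops(2)[OF h(1) h(3)] T_ops(2)[OF h(2) h(1)] T_ops(1)[OF h12(4,3)])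
      (rule cl_eq)
  show "Comp T (cl TCap) (cl TCup) = Scal T (\<ominus> (q \<oplus> inv q)) (Id T 0)"
    using tl_eq.loop by (simp only: T_sel T_ops(1)[OF h(2,3)] T_ops(4)[OF loop_carrier h(1)])
      (rule cl_eq)
qed (simp_all only: T_sel loop_carrier T_induct)

lemma tl_hom_cups: "tl_hom K (cups n) 0 (n + n)"
proof (induction n)
  case (Suc n)
  then have "tl_hom K (TTens (TTens (TId n) TCup) (TId n)) (n + 0 + n) (n + 2 + n)"
    by (intro tl_hom.intros)
  then show ?case using Suc tl_hom.intros(4)[of K _ "n + n" "n + 2 + n"] by simp
qed (use tl_hom.intros(1)[of K 0] in simp)

lemma tl_hom_caps: "tl_hom K (caps n) (n + n) 0"
proof (induction n)
  case (Suc n)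
  then have "tl_hom K (TTens (TTens (TId n) TCap) (TId n)) (n + 2 + n) (n + 0 + n)"
    by (intro tl_hom.intros)
  then show ?case using Suc tl_hom.intros(4)[of K _ "n + n" 0 _ "n + 2 + n"] by simp
qed (use tl_hom.intros(1)[of K 0] in simp)

lemma T_cupn: "cl (cups n) = T.cupn n"
proof (induction n)
  case (Suc n)
  have h: "tl_hom K (TTens (TId n) TCup) (n + 0) (n + 2)" by (intro tl_hom.intros)
  have h': "tl_hom K (TTens (TTens (TId n) TCup) (TId n)) (n + n) (n + 2 + n)"
    using tl_hom.intros(5)[OF h tl_hom.intros(1)[of K n]] by simp
  show ?case
    unfolding T.cupn.simps Suc[symmetric] T_sel
    by (simp only: T_ops(2)[OF tl_hom.intros(1) tl_hom.intros(2)] T_ops(2)[OF h tl_hom.intros(1)]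
        T_ops(1)[OF tl_hom_cups h'] cups.simps)
qed simp

lemma T_capn: "cl (caps n) = T.capn n"
proof (induction n)
  case (Suc n)
  have h: "tl_hom K (TTens (TId n) TCap) (n + 2) (n + 0)" by (intro tl_hom.intros)
  have h': "tl_hom K (TTens (TTens (TId n) TCap) (TId n)) (n + 2 + n) (n + n)"
    using tl_hom.intros(5)[OF h tl_hom.intros(1)[of K n]] by simp
  show ?case
    unfolding T.capn.simps Suc[symmetric] T_sel
    by (simp only: T_ops(2)[OF tl_hom.intros(1) tl_hom.intros(3)] T_ops(2)[OF h tl_hom.intros(1)]
        T_ops(1)[OF h' tl_hom_caps] caps.simps)
qed simp

sublocale T: rigid_piv K T
proof (intro rigid_piv.intro typed_piv.intro rigid_piv_axioms.intro T.typed_lmc_axioms)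
  fix n
  show "Coev T n \<in> Hom T (Unt T) (TOb T n (Dual T n))" using T_homI[OF tl_hom_cups] by simp
  show "Ev T n \<in> Hom T (TOb T (Dual T n) n) (Unt T)" using T_homI[OF tl_hom_caps] by simp
  show "PEv T n \<in> Hom T (TOb T n (Dual T n)) (Unt T)" using T_homI[OF tl_hom_caps] by simp
  have "Comp T (TMor T (Id T n) (T.capn n)) (TMor T (T.cupn n) (Id T n)) = Id T n"
    using T.zigzag_right[of n] T.wh_left[of "T.capn n" n] T.wh_right[of "T.cupn n" n] by simp
  then show "Comp T (TMor T (Id T n) (Ev T n)) (TMor T (Coev T n) (Id T n)) = Id T n"
    by (simp only: T_sel T_cupn T_capn)
qed simp

lemma T_qtrace: "T.arr f \<Longrightarrow> qtrace T n f = T.tr n f"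
  unfolding qtrace_def T.tr_def by (simp only: T_sel(6-9) T_cupn T_capn T.wh_right)

end

section \<open>A nonzero model\<close>

text \<open>Terms act on functions of bit streams: a term \<open>m \<rightarrow> n\<close> turns functions that are read after a
  prefix of length \<open>m\<close> into functions that are read after a prefix of length \<open>n\<close>.  Infinite
  words make the identity strands to the right implicit, and no sums over basis vectors are needed.
  The cap is the bilinear form with matrix \<open>((0, 1), (- q, 0))\<close>, the cup its inverse.\<close>

primrec tl_dom :: "'k tl_term \<Rightarrow> nat" where
  "tl_dom (TId n) = n"
| "tl_dom TCup = 0"
| "tl_dom TCap = 2"
| "tl_dom (TComp g f) = tl_dom f"
| "tl_dom (TTens f g) = tl_dom f + tl_dom g"
| "tl_dom (TZero m n) = m"
| "tl_dom (TAdd f g) = tl_dom f"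
| "tl_dom (TScal c f) = tl_dom f"

lemma tl_dom: "tl_hom K f m n \<Longrightarrow> tl_dom f = m"
  by (induction rule: tl_hom.induct) auto

type_synonym 'k bitfun = "bool stream \<Rightarrow> 'k"

definition after_prefix :: "nat \<Rightarrow> ('k bitfun \<Rightarrow> 'k bitfun) \<Rightarrow> 'k bitfun \<Rightarrow> 'k bitfun" where
  "after_prefix m G v = (\<lambda>s. G (\<lambda>w. v (stake m s @- w)) (sdrop m s))"

lemma after_prefix_0 [simp]: "after_prefix 0 G v = G v"
  by (simp add: after_prefix_def fun_eq_iff)

lemma after_prefix_comp: "after_prefix m A (after_prefix m B v) = after_prefix m (\<lambda>v. A (B v)) v"
  by (simp add: after_prefix_def stake_shift sdrop_shift)

lemma after_prefix_add: "after_prefix (m + n) G v = after_prefix m (after_prefix n G) v"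
  by (simp add: after_prefix_def flip: shift_append)

lemma after_prefix_id: "after_prefix m (\<lambda>v. v) v = v"
  by (simp add: after_prefix_def stake_sdrop)

context tl_param
begin

text \<open>In a tensor product \<open>g\<close> acts first, while the inputs of \<open>f\<close>
  are still in front of it; hence the offset \<open>tl_dom f\<close>, computed from the term. The
  coefficients of the cup are dictated by the zigzags, and the loop then evaluates to
  \<open>- inv q - q\<close>.\<close>

primrec act :: "'k tl_term \<Rightarrow> 'k bitfun \<Rightarrow> 'k bitfun" where
  "act (TId n) v = v"
| "act TCup v = (\<lambda>s. (if shd s = shd (stl s) then \<zero> else if shd s then \<one> else \<ominus> (inv q)) \<otimes> v (sdrop 2 s))"
| "act TCap v = (\<lambda>s. v (False ## True ## s) \<oplus> (\<ominus> q) \<otimes> v (True ## False ## s))"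
| "act (TComp g f) v = act g (act f v)"
| "act (TTens f g) v = act f (after_prefix (tl_dom f) (act g) v)"
| "act (TZero m n) v = (\<lambda>s. \<zero>)"
| "act (TAdd f g) v = (\<lambda>s. act f v s \<oplus> act g v s)"
| "act (TScal c f) v = (\<lambda>s. c \<otimes> act f v s)"

lemma act_comp: "act (TComp g f) = (\<lambda>v. act g (act f v))"
    "act (TTens f g) = (\<lambda>v. act f (after_prefix (tl_dom f) (act g) v))"
    "act (TId n) = (\<lambda>v. v)"
  by (simp_all add: fun_eq_iff)

abbreviation vec :: "'k bitfun \<Rightarrow> bool" where
  "vec v \<equiv> \<forall>s. v s \<in> carrier K"

definition linop :: "('k bitfun \<Rightarrow> 'k bitfun) \<Rightarrow> bool" where
  "linop G \<longleftrightarrow> (\<forall>v. vec v \<longrightarrow> vec (G v)) \<and>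
    (\<forall>v w. vec v \<longrightarrow> vec w \<longrightarrow> G (\<lambda>s. v s \<oplus> w s) = (\<lambda>s. G v s \<oplus> G w s)) \<and>
    (\<forall>c v. c \<in> carrier K \<longrightarrow> vec v \<longrightarrow> G (\<lambda>s. c \<otimes> v s) = (\<lambda>s. c \<otimes> G v s))"

lemma linopD: assumes "linop G"
  shows "vec v \<Longrightarrow> G v s \<in> carrier K"
    "\<lbrakk>vec v; vec w\<rbrakk> \<Longrightarrow> G (\<lambda>s. v s \<oplus> w s) = (\<lambda>s. G v s \<oplus> G w s)"
    "\<lbrakk>c \<in> carrier K; vec v\<rbrakk> \<Longrightarrow> G (\<lambda>s. c \<otimes> v s) = (\<lambda>s. c \<otimes> G v s)"
  using assms unfolding linop_def by blast+

lemma linop_zero: assumes "linop G" shows "G (\<lambda>s. \<zero>) = (\<lambda>s. \<zero>)"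
  using linopD(3)[OF assms, of \<zero> "\<lambda>s. \<zero>"] linopD(1)[OF assms, of "\<lambda>s. \<zero>"] by simp

lemma after_prefix_vec: "\<lbrakk>linop G; vec v\<rbrakk> \<Longrightarrow> vec (after_prefix m G v)"
  by (simp add: after_prefix_def linopD(1))

lemma linop_after_prefix: "linop G \<Longrightarrow> linop (after_prefix m G)"
  unfolding linop_def by (auto simp: after_prefix_def)

lemma linop_act: "tl_hom K f m n \<Longrightarrow> linop (act f)"
proof (induction rule: tl_hom.induct)
  case (4 g m n f l)
  then show ?case unfolding linop_def by auto
next
  case (5 f m n g m' n')
  then show ?case using linop_after_prefix[of "act g" "tl_dom f"] unfolding linop_def by auto
next
  case (7 f m n g)
  show ?case unfolding linop_def
    by (simp add: linopD[OF 7(3)] linopD[OF 7(4)] K.r_distr K.add.m_ac)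
next
  case (8 c f m n)
  show ?case unfolding linop_def
    using 8(1) by (simp add: linopD[OF 8(3)] K.r_distr K.m_lcomm)
qed (auto simp: linop_def K.r_distr K.m_lcomm K.add.m_ac)

text \<open>\<open>act f\<close> touches only the letters in front, so an operator behind them may
  be applied before or after it, at the offset valid at that moment. Linearity of \<open>G\<close>
  lets it pass the coefficients and sums in \<open>act f\<close>. This is interchange in the
  model.\<close>

lemma act_local:
  "\<lbrakk>tl_hom K f m n; linop G; vec v\<rbrakk> \<Longrightarrow> after_prefix n G (act f v) = act f (after_prefix m G v)"
proof (induction arbitrary: G v rule: tl_hom.induct)
  case 2
  then show ?case
    by (auto simp: after_prefix_def numeral_2_eq_2 linopD linop_zero fun_eq_iff)
next
  case 3
  have A: "vec (\<lambda>w. v (False ## True ## w))" "vec (\<lambda>w. v (True ## False ## w))"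
    "vec (\<lambda>w. (\<ominus> q) \<otimes> v (True ## False ## w))"
    using 3 by auto
  show ?case
    using linopD(2)[OF 3(1) A(1,3)] linopD(3)[OF 3(1) _ A(2), of "\<ominus> q"]
    by (simp add: after_prefix_def numeral_2_eq_2 fun_eq_iff)
next
  case (4 g m n f l)
  then show ?case using linop_act[OF 4(2)] by (simp add: linopD(1))
next
  case (5 f m n g m' n')
  let ?W = "after_prefix m (act g) v"
  have W: "vec ?W" using linop_act[OF 5(2)] 5(6) by (rule after_prefix_vec)
  have "after_prefix (n + n') G (act f ?W) = act f (after_prefix m (after_prefix n' G) ?W)"
    using 5(3)[OF linop_after_prefix[OF 5(5)] W] by (simp add: after_prefix_add)
  also have "after_prefix m (after_prefix n' G) ?W = after_prefix m (\<lambda>v. after_prefix n' G (act g v)) v"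
    by (rule after_prefix_comp)
  also have "\<dots> = after_prefix m (\<lambda>v. act g (after_prefix m' G v)) v"
    using 5(4)[OF 5(5)] 5(6) by (simp add: after_prefix_def)
  also have "\<dots> = after_prefix m (act g) (after_prefix (m + m') G v)"
    by (simp add: after_prefix_add flip: after_prefix_comp)
  finally show ?case using tl_dom[OF 5(1)] by simp
next
  case (6 m n)
  then show ?case using linop_zero by (auto simp: after_prefix_def)
next
  case (7 f m n g)
  have "vec (act f v)" "vec (act g v)"
    using linopD(1)[OF linop_act[OF 7(1)]] linopD(1)[OF linop_act[OF 7(2)]] 7(6) by auto
  then have "after_prefix n G (\<lambda>s. act f v s \<oplus> act g v s) =
      (\<lambda>s. after_prefix n G (act f v) s \<oplus> after_prefix n G (act g v) s)"
    using linopD(2)[OF linop_after_prefix[OF 7(5)]] by blast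
  then show ?case using 7 by simp
next
  case (8 c f m n)
  have "vec (act f v)"
    using linopD(1)[OF linop_act[OF 8(2)]] 8(5) by auto
  then have "after_prefix n G (\<lambda>s. c \<otimes> act f v s) = (\<lambda>s. c \<otimes> after_prefix n G (act f v) s)"
    using linopD(3)[OF linop_after_prefix[OF 8(4)]] 8(1) by blast
  then show ?case using 8 by simp
qed (auto simp: after_prefix_def)

lemma act_sound: "\<lbrakk>tl_eq K q f g; vec v\<rbrakk> \<Longrightarrow> act f v = act g v"
proof (induction arbitrary: v rule: tl_eq.induct)
  case (trans f g h)
  then show ?case by metis
next
  case (cong_comp g m n f l g' f')
  have "vec (act f v)" using linopD(1)[OF linop_act[OF cong_comp(2)]] cong_comp.prems by auto
  then show ?case using cong_comp by simp
next
  case (cong_tens f f' g g')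
  obtain m n m' n' where h: "tl_hom K f m n" "tl_hom K f' m n" "tl_hom K g m' n'"
    using tl_eq_hom[OF cong_tens(1)] tl_eq_hom[OF cong_tens(2)] by blast
  have "vec (after_prefix m (act g) v)"
    by (rule after_prefix_vec[OF linop_act[OF h(3)] cong_tens.prems])
  moreover have "after_prefix m (act g) v = after_prefix m (act g') v"
    using cong_tens by (simp add: after_prefix_def)
  ultimately show ?case using cong_tens tl_dom[OF h(1)] tl_dom[OF h(2)] by simp
next
  case (interchange f l m g n f' l' m' g' n')
  \<comment> \<open>\<open>g'\<close> acts behind the outputs of \<open>f\<close>. By locality it
    may act before \<open>f\<close>, behind its inputs, right after \<open>f'\<close>.\<close>
  have "after_prefix m (act g') (act f (after_prefix l (act f') v)) =
      act f (after_prefix l (act g') (after_prefix l (act f') v))"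
    using interchange linop_act by (intro act_local after_prefix_vec) blast+
  then show ?case using tl_dom[OF interchange(1)] tl_dom[OF interchange(2)]
    by (simp add: after_prefix_comp act_comp)
next
  case (tens_assoc f m n g m' n' h m'' n'')
  then show ?case using tl_dom[OF tens_assoc(1)] tl_dom[OF tens_assoc(2)]
    by (simp add: after_prefix_comp after_prefix_add act_comp)
next
  case (add_assoc f m n g h)
  then show ?case using linopD(1)[OF linop_act] by (auto simp: fun_eq_iff intro!: K.a_assoc)
next
  case (add_comm f m n g)
  then show ?case using linopD(1)[OF linop_act] by (auto simp: fun_eq_iff intro!: K.a_comm)
next
  case (add_zero f m n)
  then show ?case using linopD(1)[OF linop_act[OF add_zero(1)]] by (auto simp: fun_eq_iff)
next
  case (scal_zero f m n)
  then show ?case using linopD(1)[OF linop_act[OF scal_zero(1)]] by (auto simp: fun_eq_iff)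
next
  case (scal_one f m n)
  then show ?case using linopD(1)[OF linop_act[OF scal_one(1)]] by (auto simp: fun_eq_iff)
next
  case (scal_mult a b f m n)
  then show ?case using linopD(1)[OF linop_act[OF scal_mult(3)]] by (auto simp: fun_eq_iff K.m_assoc)
next
  case (scal_add_left a b f m n)
  then show ?case using linopD(1)[OF linop_act[OF scal_add_left(3)]] by (auto simp: fun_eq_iff K.l_distr)
next
  case (scal_add_right a f m n g)
  then show ?case using linopD(1)[OF linop_act[OF scal_add_right(2)]] linopD(1)[OF linop_act[OF scal_add_right(3)]]
    by (auto simp: fun_eq_iff K.r_distr)
next
  case (comp_add_right f l m f' g n)
  then show ?case using linopD(1)[OF linop_act[OF comp_add_right(1)]] linopD(1)[OF linop_act[OF comp_add_right(2)]]
    linopD(2)[OF linop_act[OF comp_add_right(3)]] by simp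
next
  case (comp_scal_right a f l m g n)
  then show ?case using linopD(1)[OF linop_act[OF comp_scal_right(2)]]
    linopD(3)[OF linop_act[OF comp_scal_right(3)]] by simp
next
  case (tens_add_left f m n f' g m' n')
  then show ?case using tl_dom[OF tens_add_left(1)] tl_dom[OF tens_add_left(2)] by simp
next
  case (tens_add_right f m n g m' n' g')
  have "vec (after_prefix m (act g) v)" "vec (after_prefix m (act g') v)"
    using tens_add_right linop_act by (intro after_prefix_vec; blast)+
  moreover have "after_prefix m (act (TAdd g g')) v = (\<lambda>s. after_prefix m (act g) v s \<oplus> after_prefix m (act g') v s)"
    by (simp add: after_prefix_def)
  ultimately show ?case using tl_dom[OF tens_add_right(1)] linopD(2)[OF linop_act[OF tens_add_right(1)]]
    by (simp del: act.simps(7) add: act.simps(7)[of f])  (simp add: after_prefix_def)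
next
  case (tens_scal_right a f m n g m' n')
  have "vec (after_prefix m (act g) v)"
    using tens_scal_right linop_act by (intro after_prefix_vec; blast)+
  moreover have "after_prefix m (act (TScal a g)) v = (\<lambda>s. a \<otimes> after_prefix m (act g) v s)"
    by (simp add: after_prefix_def)
  ultimately show ?case using tl_dom[OF tens_scal_right(2)] linopD(3)[OF linop_act[OF tens_scal_right(2)]] tens_scal_right(1)
    by simp
next
  case zigzag1
  then show ?case
    by (auto simp: after_prefix_def numeral_2_eq_2 fun_eq_iff K.l_minus K.r_minus simp flip: K.m_assoc)
      (metis (full_types) stream.collapse)+
next
  case zigzag2
  then show ?case
    by (auto simp: after_prefix_def numeral_2_eq_2 fun_eq_iff K.l_minus K.r_minus simp flip: K.m_assoc)
      (metis (full_types) stream.collapse)+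
next
  case loop
  then show ?case
    by (auto simp: numeral_2_eq_2 fun_eq_iff K.l_minus K.minus_add K.l_distr K.a_comm)
qed (auto simp: after_prefix_id act_comp(3))

text \<open>The term \<open>TScal a (TId 0)\<close> sends the constant function \<open>1\<close> to
  the constant function \<open>a\<close>, so the scalar can be read off in the model. Without this
  the relations could have made every trace vanish.\<close>

lemma scal_id0_zero:
  assumes "a \<in> carrier K" "Scal T a (Id T 0) = HZero T 0 0"
  shows "a = \<zero>"
proof -
  have h: "tl_hom K (TScal a (TId 0)) 0 0" using assms by (intro tl_hom.intros)
  have "cl (TScal a (TId 0)) = cl (TZero 0 0)"
    using assms by (simp add: T_ops(4)[OF _ tl_hom.intros(1)])
  then have "tl_eq K q (TScal a (TId 0)) (TZero 0 0)" using cl_eq_iff[OF h] by blast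
  from act_sound[OF this, of "\<lambda>_. \<one>"] have "(\<lambda>s::bool stream. a \<otimes> \<one>) = (\<lambda>s. \<zero>)" by simp
  then show ?thesis using assms(1) by (metis K.r_one)
qed

end

section \<open>Negligible morphisms of the Cauchy completion\<close>

context tl_param
begin

sublocale A: rigid_piv K "additive_envelope T"
  by (rule T.AE_rigid)

lemma TL_eq: "TL K q = idempotent_completion (additive_envelope T)"
  by (simp add: TL_def cauchy_completion_def)

sublocale L: typed_piv K "TL K q"
  unfolding TL_eq by (rule A.KC_typed)

declare T_sel(4,5) [simp del]

abbreviation AE where "AE \<equiv> additive_envelope T"
abbreviation L where "L \<equiv> TL K q"

lemma AE_arrE:
  assumes "A.arr F" obtains f where "F = matrix (A.dm F) (A.cd F) f" "T.mtp (A.dm F) (A.cd F) f"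
  using T.AE_homD[OF A.arrD(1)[OF assms]] by auto

lemma AE_arr_ex: "\<lbrakk>A.arr F; A.dm F = X; A.cd F = Y\<rbrakk> \<Longrightarrow> \<exists>f. F = matrix X Y f \<and> T.mtp X Y f"
  by (erule AE_arrE) blast

lemma AE_arrI: "T.mtp X Y f \<Longrightarrow> A.arr (matrix X Y f) \<and> A.dm (matrix X Y f) = X \<and> A.cd (matrix X Y f) = Y"
  using A.homD[OF T.AE_homI] by simp

lemma AE_arr_iff: "A.arr (matrix X Y f) \<longleftrightarrow> T.mtp X Y f"
proof
  assume *: "A.arr (matrix X Y f)"
  then obtain g where g: "matrix X Y f = matrix (A.dm (matrix X Y f)) (A.cd (matrix X Y f)) g"
    "T.mtp (A.dm (matrix X Y f)) (A.cd (matrix X Y f)) g" by (rule AE_arrE)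
  then have "A.dm (matrix X Y f) = X" "A.cd (matrix X Y f) = Y" "\<forall>i<length Y. \<forall>j<length X. f i j = g i j"
    by (simp_all add: matrix_eq_iff)
  then show "T.mtp X Y f" using g(2) by (simp add: T.mtp_def)
qed (simp add: AE_arrI)

lemma TL_homE:
  assumes "F \<in> Hom L A B" "A \<in> Ob L" "B \<in> Ob L"
  obtains f where "F = (A, B, matrix (fst A) (fst B) f)" "T.mtp (fst A) (fst B) f"
    "Comp AE (snd B) (matrix (fst A) (fst B) f) = matrix (fst A) (fst B) f"
    "Comp AE (matrix (fst A) (fst B) f) (snd A) = matrix (fst A) (fst B) f"
proof -
  obtain M where M: "F = (A, B, M)" "A.arr M" "A.dm M = fst A" "A.cd M = fst B"
    "Comp AE (snd B) M = M" "Comp AE M (snd A) = M"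
    using assms A.KC_hom unfolding TL_eq by blast
  then show thesis using that AE_arrE[OF M(2)] by metis
qed

definition mtr :: "nat list \<Rightarrow> (nat \<Rightarrow> nat \<Rightarrow> 'k tl_term set) \<Rightarrow> 'k tl_term set" where
  "mtr X f = hom_sum T 0 0 (\<lambda>i. T.tr (X ! i) (f i i)) (length X)"

lemma mtp_arr: "\<lbrakk>T.mtp X Y f; i < length Y; j < length X\<rbrakk> \<Longrightarrow> T.arr (f i j)"
  "\<lbrakk>T.mtp X Y f; i < length Y; j < length X\<rbrakk> \<Longrightarrow> T.dm (f i j) = X ! j"
  "\<lbrakk>T.mtp X Y f; i < length Y; j < length X\<rbrakk> \<Longrightarrow> T.cd (f i j) = Y ! i"
  by (simp_all add: T.mtp_def)

lemma AE_qtrace: "T.mtp X X f \<Longrightarrow> qtrace AE X (matrix X X f) = matrix [0] [0] (\<lambda>_ _. mtr X f)"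
  by (simp add: T.AE_trace matrix_eq_iff mtr_def T_qtrace mtp_arr cong: T.hsum_cong')

text \<open>\<open>KC_trace\<close> strips the Karoubi structure from the trace, so the condition
  concerns matrices only. Test matrices must still respect the two idempotents.\<close>

lemma L_negligible_iff:
  assumes A: "A \<in> Ob L" and B: "B \<in> Ob L"
  shows "negligible L A B F \<longleftrightarrow> F \<in> Hom L A B \<and> (\<forall>g. T.mtp (fst B) (fst A) g \<longrightarrow>
      (A.arr (matrix (fst B) (fst A) g) \<and> (B, A, matrix (fst B) (fst A) g) \<in> Hom L B A) \<longrightarrow>
      qtrace AE (fst A) (Comp AE (matrix (fst B) (fst A) g) (snd (snd F))) = matrix [0] [0] (\<lambda>_ _. HZero T 0 0))"
    (is "_ \<longleftrightarrow> ?rhs")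
proof -
  have zero: "HZero L (Unt L) (Unt L) = (Unt L, Unt L, matrix [0] [0] (\<lambda>_ _. HZero T 0 0))"
    unfolding TL_eq by (simp add: T.AE_zero matrix_eq_iff)
  have tr: "qtrace L A (Comp L G F) = HZero L (Unt L) (Unt L) \<longleftrightarrow>
      qtrace AE (fst A) (Comp AE g (snd (snd F))) = matrix [0] [0] (\<lambda>_ _. HZero T 0 0)"
    if F: "F \<in> Hom L A B" and G: "G \<in> Hom L B A" "G = (B, A, g)" for G g
  proof -
    have A': "A \<in> Ob A.KC" and B': "B \<in> Ob A.KC" using A B by (simp_all add: TL_eq)
    obtain f where f: "F = (A, B, f)" "A.arr f" "A.dm f = fst A" "A.cd f = fst B"
      "Comp AE (snd B) f = f" "Comp AE f (snd A) = f"
      using F A.KC_hom[OF A' B'] unfolding TL_eq by blast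
    have g: "A.arr g" "A.dm g = fst B" "A.cd g = fst A" "Comp AE (snd A) g = g" "Comp AE g (snd B) = g"
      using G A.KC_hom[OF B' A'] unfolding TL_eq by auto
    have ob: "A.arr (snd A)" "A.dm (snd A) = fst A" "A.cd (snd A) = fst A"
      using A' A.KC_ob by auto
    have "qtrace L A (Comp L G F) = (Unt L, Unt L, qtrace AE (fst A) (Comp AE g f))"
      unfolding TL_eq f(1) G(2) A.KC_ops
      by (rule A.KC_trace[OF A']) (use f g ob in \<open>simp_all add: A.absorb\<close>)
    then show ?thesis unfolding zero by (simp add: f(1))
  qed
  show ?thesis
  proof
    assume n: "negligible L A B F"
    then show ?rhs using tr by (auto simp: negligible_def)
  next
    assume r: ?rhs
    have "qtrace L A (Comp L G F) = HZero L (Unt L) (Unt L)" if G: "G \<in> Hom L B A" for G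
    proof -
      obtain g where g: "G = (B, A, matrix (fst B) (fst A) g)" "T.mtp (fst B) (fst A) g"
        by (rule TL_homE[OF G B A])
      then show ?thesis using r tr[of G "matrix (fst B) (fst A) g"] G by (simp add: AE_arr_iff)
    qed
    then show "negligible L A B F" using r by (simp add: negligible_def)
  qed
qed

lemma tneg_tr: "\<lbrakk>T.tneg f; T.dm f = n; T.cd f = n\<rbrakk> \<Longrightarrow> T.tr n f = HZero T 0 0"
  using T.tneg_arr[of f] unfolding T.tneg_def by (metis T.a_comp_id(2) T.arr_id T.arrD(3) T.ob_nat UNIV_I)

lemma tneg_hsum:
  assumes "\<And>k. k < n \<Longrightarrow> T.tneg (f k)" "\<And>k. k < n \<Longrightarrow> T.dm (f k) = a" "\<And>k. k < n \<Longrightarrow> T.cd (f k) = b"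
  shows "T.tneg (hom_sum T a b f n)"
  using assms
proof (induction n)
  case 0
  then show ?case using T.tneg_zero by simp
next
  case (Suc n)
  have "T.arr (f k)" if "k < Suc n" for k using Suc.prems(1)[OF that] by (rule T.tneg_arr)
  then show ?case using Suc by (simp add: T.tneg_add)
qed

definition mneg :: "nat list \<Rightarrow> nat list \<Rightarrow> (nat \<Rightarrow> nat \<Rightarrow> 'k tl_term set) \<Rightarrow> bool" where
  "mneg X Y f \<longleftrightarrow> (\<forall>i<length Y. \<forall>j<length X. T.tneg (f i j))"

lemma mtr_mneg: "\<lbrakk>T.mtp X X f; mneg X X f\<rbrakk> \<Longrightarrow> mtr X f = HZero T 0 0"
  unfolding mtr_def
  by (subst T.hsum_cong[of _ _ "\<lambda>i. HZero T 0 0"]) (simp_all add: tneg_tr mneg_def mtp_arr)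

lemma mneg_comp_left:
  assumes f: "T.mtp X Y f" "mneg X Y f" and g: "T.mtp Y Z g"
  shows "mneg X Z (\<lambda>i j. hom_sum T (X ! j) (Z ! i) (\<lambda>k. Comp T (g i k) (f k j)) (length Y))"
  unfolding mneg_def
proof (intro allI impI tneg_hsum)
  fix i j k assume *: "i < length Z" "j < length X" "k < length Y"
  show "T.tneg (Comp T (g i k) (f k j))"
    using * f(2) mtp_arr[OF f(1) *(3,2)] mtp_arr[OF g *(1,3)] by (intro T.tneg_comp_left) (auto simp: mneg_def)
qed (use mtp_arr[OF f(1)] mtp_arr[OF g] in auto)

lemma mneg_comp_right:
  assumes f: "T.mtp X Y f" and g: "T.mtp Y Z g" "mneg Y Z g"
  shows "mneg X Z (\<lambda>i j. hom_sum T (X ! j) (Z ! i) (\<lambda>k. Comp T (g i k) (f k j)) (length Y))"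
  unfolding mneg_def
proof (intro allI impI tneg_hsum)
  fix i j k assume *: "i < length Z" "j < length X" "k < length Y"
  show "T.tneg (Comp T (g i k) (f k j))"
    using * g(2) mtp_arr[OF f *(3,2)] mtp_arr[OF g(1) *(1,3)] by (intro T.tneg_comp_right) (auto simp: mneg_def)
qed (use mtp_arr[OF f] mtp_arr[OF g(1)] in auto)

lemma mtp_comp:
  assumes f: "T.mtp X Y f" and g: "T.mtp Y Z g"
  shows "T.mtp X Z (\<lambda>i j. hom_sum T (X ! j) (Z ! i) (\<lambda>k. Comp T (g i k) (f k j)) (length Y))"
  using f g by (auto simp: T.mtp_def)

lemma tr_hsum:
  assumes "\<And>k. k < n \<Longrightarrow> T.arr (f k)" "\<And>k. k < n \<Longrightarrow> T.dm (f k) = a" "\<And>k. k < n \<Longrightarrow> T.cd (f k) = a"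
  shows "T.tr a (hom_sum T a a f n) = hom_sum T 0 0 (\<lambda>k. T.tr a (f k)) n"
  using assms
proof (induction n)
  case 0
  then show ?case using T.tr_zero[of a] by simp
qed (simp add: T.tr_add)

lemma mtr_cyclic:
  assumes f: "T.mtp X Y f" and g: "T.mtp Y X g"
  shows "mtr X (\<lambda>i j. hom_sum T (X ! j) (X ! i) (\<lambda>k. Comp T (g i k) (f k j)) (length Y)) =
    mtr Y (\<lambda>i j. hom_sum T (Y ! j) (Y ! i) (\<lambda>k. Comp T (f i k) (g k j)) (length X))"
proof -
  note ff = mtp_arr[OF f] and gg = mtp_arr[OF g]
  have "mtr X (\<lambda>i j. hom_sum T (X ! j) (X ! i) (\<lambda>k. Comp T (g i k) (f k j)) (length Y)) =
      hom_sum T 0 0 (\<lambda>i. hom_sum T 0 0 (\<lambda>k. T.tr (X ! i) (Comp T (g i k) (f k i))) (length Y)) (length X)"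
    unfolding mtr_def using ff gg by (intro T.hsum_cong tr_hsum) auto
  also have "\<dots> = hom_sum T 0 0 (\<lambda>i. hom_sum T 0 0 (\<lambda>k. T.tr (Y ! k) (Comp T (f k i) (g i k))) (length Y)) (length X)"
    using ff gg by (intro T.hsum_cong T.tr_cyclic) auto
  also have "\<dots> = hom_sum T 0 0 (\<lambda>k. hom_sum T 0 0 (\<lambda>i. T.tr (Y ! k) (Comp T (f k i) (g i k))) (length X)) (length Y)"
    using ff gg by (intro T.hsum_swap) auto
  also have "\<dots> = mtr Y (\<lambda>i j. hom_sum T (Y ! j) (Y ! i) (\<lambda>k. Comp T (f i k) (g k j)) (length X))"
    unfolding mtr_def using ff gg by (intro T.hsum_cong tr_hsum[symmetric]) auto
  finally show ?thesis .
qed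

lemma matrix_inj: "matrix X Y f = matrix X Y g \<Longrightarrow> i < length Y \<Longrightarrow> j < length X \<Longrightarrow> f i j = g i j"
  by (simp add: matrix_eq_iff)

text \<open>Passing to the completion creates no new negligible morphisms: negligibility can be
  checked entry by entry, with no reference to the idempotents, because \<open>f\<close> already
  absorbs them.\<close>

lemma negligible_mneg:
  assumes A: "A \<in> Ob L" and B: "B \<in> Ob L"
    and F: "(A, B, matrix (fst A) (fst B) f) \<in> Hom L A B" "T.mtp (fst A) (fst B) f"
  shows "negligible L A B (A, B, matrix (fst A) (fst B) f) \<longleftrightarrow> mneg (fst A) (fst B) f"
proof -
  let ?X = "fst A" and ?Y = "fst B"
  let ?F = "matrix ?X ?Y f"
  have A': "A \<in> Ob A.KC" and B': "B \<in> Ob A.KC" using A B by (simp_all add: TL_eq)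
  show ?thesis
  proof
    assume n: "mneg ?X ?Y f"
    have "qtrace AE ?X (Comp AE (matrix ?Y ?X g) ?F) = matrix [0] [0] (\<lambda>_ _. HZero T 0 0)"
      if g: "T.mtp ?Y ?X g" for g
      using mtr_mneg[OF mtp_comp[OF F(2) g] mneg_comp_left[OF F(2) n g]]
      by (simp only: T.AE_comp AE_qtrace[OF mtp_comp[OF F(2) g]])
    then show "negligible L A B (A, B, ?F)"
      unfolding L_negligible_iff[OF A B] using F by simp
  next
    assume n: "negligible L A B (A, B, ?F)"
    obtain e where e: "snd A = matrix ?X ?X e" "T.mtp ?X ?X e"
      by (rule AE_arrE[of "snd A"]) (use A'[unfolded A.KC_ob] in auto)
    obtain e' where e': "snd B = matrix ?Y ?Y e'" "T.mtp ?Y ?Y e'"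
      by (rule AE_arrE[of "snd B"]) (use B'[unfolded A.KC_ob] in auto)
    have ee: "Comp AE (snd A) (snd A) = snd A" "Comp AE (snd B) (snd B) = snd B"
      using A' B' A.KC_ob by auto
    have eF: "Comp AE (snd B) ?F = ?F" "Comp AE ?F (snd A) = ?F"
      using F(1) A.KC_hom[OF A' B'] unfolding TL_eq by auto
    have arrs [simp]: "A.arr (snd A)" "A.dm (snd A) = ?X" "A.cd (snd A) = ?X"
      "A.arr (snd B)" "A.dm (snd B) = ?Y" "A.cd (snd B) = ?Y" "A.arr ?F" "A.dm ?F = ?X" "A.cd ?F = ?Y"
      using AE_arrI[OF F(2)] AE_arrI[OF e(2)] AE_arrI[OF e'(2)] e(1) e'(1) by simp_all
    show "mneg ?X ?Y f"
      unfolding mneg_def T.tneg_def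
    proof (intro allI impI conjI)
      fix i0 j0 assume ij: "i0 < length ?Y" "j0 < length ?X"
      note f0 = mtp_arr[OF F(2) ij]
      show "T.arr (f i0 j0)" by (rule f0)
      fix g assume g: "T.arr g" "T.dm g = T.cd (f i0 j0)" "T.cd g = T.dm (f i0 j0)"
      \<comment> \<open>The elementary matrix with \<open>g\<close> at place
        \<open>(j0, i0)\<close>, whose pairing with \<open>f\<close> isolates the entry
        \<open>f i0 j0\<close>.\<close>
      let ?e = "\<lambda>j i. if j = j0 \<and> i = i0 then g else HZero T (?Y ! i) (?X ! j)"
      let ?E = "matrix ?Y ?X ?e"
      have E: "T.mtp ?Y ?X ?e" using g f0 by (auto simp: T.mtp_def)
      note [simp] = AE_arrI[OF E, THEN conjunct1] AE_arrI[OF E, THEN conjunct2, THEN conjunct1]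
        AE_arrI[OF E, THEN conjunct2, THEN conjunct2]
      \<comment> \<open>The elementary matrix need not be a morphism from \<open>B\<close> to
        \<open>A\<close>; compressing it between the idempotents makes it one.\<close>
      let ?G = "Comp AE (snd A) (Comp AE ?E (snd B))"
      obtain h where h: "?G = matrix ?Y ?X h" "T.mtp ?Y ?X h"
        using AE_arr_ex[of ?G ?Y ?X] by auto
      have "(B, A, ?G) \<in> Hom L B A"
        unfolding TL_eq A.KC_hom[OF B' A'] using ee by (simp add: A.absorb A.a_comp_assoc)
      then have "qtrace AE ?X (Comp AE ?G ?F) = matrix [0] [0] (\<lambda>_ _. HZero T 0 0)"
        using n h unfolding L_negligible_iff[OF A B] by (simp add: AE_arr_iff)
      moreover have "Comp AE ?G ?F = Comp AE (snd A) (Comp AE ?E ?F)"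
        using eF by (simp add: A.a_comp_assoc)
      ultimately have 1: "qtrace AE ?X (Comp AE (snd A) (Comp AE ?E ?F)) = matrix [0] [0] (\<lambda>_ _. HZero T 0 0)"
        by simp
      define m where "m = (\<lambda>i j. hom_sum T (?X ! j) (?X ! i) (\<lambda>k. Comp T (?e i k) (f k j)) (length ?Y))"
      have m: "T.mtp ?X ?X m" "Comp AE ?E ?F = matrix ?X ?X m"
        unfolding m_def by (rule mtp_comp[OF F(2) E]) (rule T.AE_comp)
      \<comment> \<open>Cyclicity carries the remaining idempotent around to the other side of the
        product, where \<open>?F\<close> absorbs it.\<close>
      have "qtrace AE ?X (Comp AE (snd A) (matrix ?X ?X m)) = qtrace AE ?X (Comp AE (matrix ?X ?X m) (snd A))"
        unfolding e(1) T.AE_comp AE_qtrace[OF mtp_comp[OF m(1) e(2)]] AE_qtrace[OF mtp_comp[OF e(2) m(1)]]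
        by (simp only: mtr_cyclic[OF m(1) e(2)])
      also have "Comp AE (matrix ?X ?X m) (snd A) = matrix ?X ?X m"
        unfolding m(2)[symmetric] using eF by (simp add: A.a_comp_assoc)
      also have "qtrace AE ?X (matrix ?X ?X m) = matrix [0] [0] (\<lambda>_ _. mtr ?X m)"
        by (rule AE_qtrace[OF m(1)])
      finally have "matrix [0::nat] [0] (\<lambda>_ _. mtr ?X m) = matrix [0] [0] (\<lambda>_ _. HZero T 0 0)"
        by (rule HOL.trans[OF HOL.sym 1[unfolded m(2)]])
      then have mt: "mtr ?X m = HZero T 0 0" using matrix_inj[of "[0::nat]" "[0]" _ _ 0 0] by simp
      have "T.tr (?X ! j0) (Comp T g (f i0 j0)) = mtr ?X m"
      proof -
        have mm: "m j j = (if j = j0 then Comp T g (f i0 j0) else HZero T (?X ! j) (?X ! j))" if j: "j < length ?X" for j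
        proof (cases "j = j0")
          case True
          have "m j0 j0 = Comp T (?e j0 i0) (f i0 j0)" unfolding m_def
            by (rule T.hsum_single[where l = i0 and f = "\<lambda>k. Comp T (?e j0 k) (f k j0)"])
              (use ij g f0 mtp_arr[OF F(2)] in simp_all)
          then show ?thesis using True by simp
        next
          case False
          have "m j j = hom_sum T (?X ! j) (?X ! j) (\<lambda>k. HZero T (?X ! j) (?X ! j)) (length ?Y)" unfolding m_def
            by (rule T.hsum_cong) (use j False mtp_arr[OF F(2)] in simp)
          then show ?thesis using False by simp
        qed
        have "mtr ?X m = T.tr (?X ! j0) (m j0 j0)" unfolding mtr_def
          by (rule T.hsum_single[where l = j0 and f = "\<lambda>i. T.tr (?X ! i) (m i i)"])
            (use ij g f0 mm in simp_all)
        then show ?thesis using mm[OF ij(2)] by simp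
      qed
      then show "T.tr (T.dm (f i0 j0)) (Comp T g (f i0 j0)) = HZero T 0 0" using mt f0 by simp
    qed
  qed
qed

lemma L_arrE:
  assumes "L.arr F"
  obtains f where "F = (L.dm F, L.cd F, matrix (fst (L.dm F)) (fst (L.cd F)) f)"
    "T.mtp (fst (L.dm F)) (fst (L.cd F)) f"
  by (rule TL_homE[OF L.arrD[OF assms]]) (rule that)

lemma L_arr_cases:
  assumes "L.arr F"
  obtains A B f where "F = (A, B, matrix (fst A) (fst B) f)" "T.mtp (fst A) (fst B) f" "L.dm F = A" "L.cd F = B"
  by (rule L_arrE[OF assms]) (rule that; simp)

lemma L_ops:
  "Comp L (B, D, matrix Y Z g) (A, B, matrix X Y f) =
    (A, D, matrix X Z (\<lambda>i j. hom_sum T (X ! j) (Z ! i) (\<lambda>k. Comp T (g i k) (f k j)) (length Y)))"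
  "TMor L (A, B, matrix X Y f) (A', B', matrix X' Y' f') = (kar_tensor AE A A', kar_tensor AE B B',
    matrix (list_tensor T X X') (list_tensor T Y Y')
      (\<lambda>i j. TMor T (f (i div length Y') (j div length X')) (f' (i mod length Y') (j mod length X'))))"
  "HAdd L (A, B, matrix X Y f) (A, B, matrix X Y g) = (A, B, matrix X Y (\<lambda>i j. HAdd T (f i j) (g i j)))"
  "Scal L c (A, B, matrix X Y f) = (A, B, matrix X Y (\<lambda>i j. Scal T c (f i j)))"
  "HZero L A B = (A, B, matrix (fst A) (fst B) (\<lambda>i j. HZero T (fst A ! j) (fst B ! i)))"
  unfolding TL_eq by (simp_all add: A.KC_ops T.AE_comp T.AE_tmor T.AE_add T.AE_scal T.AE_zero)

text \<open>All presentations of \<open>F\<close> by an entry function are quantified over, since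
  \<open>matrix\<close> remembers the function only within the index range; \<open>lneg_iff\<close>
  shows that one presentation suffices.\<close>

definition lneg :: "'k tlmor \<Rightarrow> bool" where
  "lneg F \<longleftrightarrow> L.arr F \<and> (\<forall>A B X Y f. F = (A, B, matrix X Y f) \<longrightarrow> mneg X Y f)"

lemma lneg_iff: "lneg (A, B, matrix X Y f) \<longleftrightarrow> L.arr (A, B, matrix X Y f) \<and> mneg X Y f"
proof
  assume "lneg (A, B, matrix X Y f)"
  then show "L.arr (A, B, matrix X Y f) \<and> mneg X Y f" unfolding lneg_def by blast
next
  assume "L.arr (A, B, matrix X Y f) \<and> mneg X Y f"
  then show "lneg (A, B, matrix X Y f)" unfolding lneg_def prod.inject matrix_eq_iff mneg_def by metis
qed

lemma negligible_lneg:
  assumes "L.arr F" "L.dm F = A" "L.cd F = B"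
  shows "negligible L A B F \<longleftrightarrow> lneg F"
proof -
  obtain f where f: "F = (A, B, matrix (fst A) (fst B) f)" "T.mtp (fst A) (fst B) f"
    using L_arrE[OF assms(1)] assms by metis
  have "A \<in> Ob L" "B \<in> Ob L" using L.arrD[OF assms(1)] assms by auto
  moreover have "F \<in> Hom L A B" using L.arrD(1)[OF assms(1)] assms by simp
  ultimately show ?thesis
    using negligible_mneg[of A B f] f assms(1) by (simp add: lneg_iff)
qed

lemma lneg_congruence: "monoidal_congruence K L
    {(f, g). L.arr f \<and> L.arr g \<and> L.dm g = L.dm f \<and> L.cd g = L.cd f \<and> lneg (L.hdiff f g)}"
proof (rule L.ideal_congruence)
  show "L.arr F" if "lneg F" for F using that by (simp add: lneg_def)
  show "lneg (HZero L A B)" if "A \<in> Ob L" "B \<in> Ob L" for A B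
    using L.arr_zero(1)[OF that] unfolding L_ops by (simp add: lneg_iff mneg_def T.tneg_zero)
  show "lneg (HAdd L F G)" if FG: "lneg F" "lneg G" "L.dm G = L.dm F" "L.cd G = L.cd F" for F G
  proof -
    have arr: "L.arr F" "L.arr G" "L.arr (HAdd L F G)" using FG by (auto simp: lneg_def)
    obtain A B f where f: "F = (A, B, matrix (fst A) (fst B) f)" "T.mtp (fst A) (fst B) f"
      "L.dm F = A" "L.cd F = B" by (rule L_arr_cases[OF arr(1)])
    obtain g where g: "G = (A, B, matrix (fst A) (fst B) g)" "T.mtp (fst A) (fst B) g"
      by (rule L_arrE[OF arr(2), unfolded FG f(3,4)])
    have n: "mneg (fst A) (fst B) f" "mneg (fst A) (fst B) g"
      using FG(1,2) unfolding f(1) g(1) lneg_iff by auto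
    show ?thesis using arr(3) n mtp_arr[OF f(2)] mtp_arr[OF g(2)]
      unfolding f(1) g(1) L_ops lneg_iff by (simp add: mneg_def T.tneg_add)
  qed
  show "lneg (Scal L c F)" if F: "c \<in> carrier K" "lneg F" for c F
  proof -
    have arr: "L.arr F" "L.arr (Scal L c F)" using F by (auto simp: lneg_def)
    obtain A B f where f: "F = (A, B, matrix (fst A) (fst B) f)" "T.mtp (fst A) (fst B) f"
      "L.dm F = A" "L.cd F = B" by (rule L_arr_cases[OF arr(1)])
    show ?thesis using arr(2) F unfolding f(1) L_ops lneg_iff by (simp add: mneg_def T.tneg_scal)
  qed
  show "lneg (Comp L G F)" if FG: "lneg F" "L.arr G" "L.cd F = L.dm G" for F G
  proof -
    have arr: "L.arr F" "L.arr (Comp L G F)" using FG by (auto simp: lneg_def)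
    obtain A B f where f: "F = (A, B, matrix (fst A) (fst B) f)" "T.mtp (fst A) (fst B) f"
      "L.dm F = A" "L.cd F = B" by (rule L_arr_cases[OF arr(1)])
    obtain D g where g: "G = (B, D, matrix (fst B) (fst D) g)" "T.mtp (fst B) (fst D) g"
      by (rule L_arrE[OF FG(2), folded FG(3), unfolded f(4)])
    show ?thesis using arr(2) FG(1) mneg_comp_left[OF f(2) _ g(2)] unfolding f(1) g(1) L_ops lneg_iff by simp
  qed
  show "lneg (Comp L G F)" if FG: "L.arr F" "lneg G" "L.cd F = L.dm G" for F G
  proof -
    have arr: "L.arr G" "L.arr (Comp L G F)" using FG by (auto simp: lneg_def)
    obtain A B f where f: "F = (A, B, matrix (fst A) (fst B) f)" "T.mtp (fst A) (fst B) f"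
      "L.dm F = A" "L.cd F = B" by (rule L_arr_cases[OF FG(1)])
    obtain D g where g: "G = (B, D, matrix (fst B) (fst D) g)" "T.mtp (fst B) (fst D) g"
      by (rule L_arrE[OF arr(1), folded FG(3), unfolded f(4)])
    show ?thesis using arr(2) FG(2) mneg_comp_right[OF f(2) g(2)] unfolding f(1) g(1) L_ops lneg_iff by simp
  qed
  show "lneg (TMor L F G)" if FG: "lneg F" "L.arr G" for F G
  proof -
    have arr: "L.arr F" "L.arr (TMor L F G)" using FG by (auto simp: lneg_def)
    obtain A B f where f: "F = (A, B, matrix (fst A) (fst B) f)" "T.mtp (fst A) (fst B) f"
      "L.dm F = A" "L.cd F = B" by (rule L_arr_cases[OF arr(1)])
    obtain A' B' g where g: "G = (A', B', matrix (fst A') (fst B') g)" "T.mtp (fst A') (fst B') g"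
      "L.dm G = A'" "L.cd G = B'" by (rule L_arr_cases[OF FG(2)])
    show ?thesis using arr(2) FG(1) mtp_arr(1)[OF g(2)] unfolding f(1) g(1) L_ops lneg_iff
      by (simp add: mneg_def div_less_index mod_less_index T.tneg_tmor(1))
  qed
  show "lneg (TMor L F G)" if FG: "L.arr F" "lneg G" for F G
  proof -
    have arr: "L.arr G" "L.arr (TMor L F G)" using FG by (auto simp: lneg_def)
    obtain A B f where f: "F = (A, B, matrix (fst A) (fst B) f)" "T.mtp (fst A) (fst B) f"
      "L.dm F = A" "L.cd F = B" by (rule L_arr_cases[OF FG(1)])
    obtain A' B' g where g: "G = (A', B', matrix (fst A') (fst B') g)" "T.mtp (fst A') (fst B') g"
      "L.dm G = A'" "L.cd G = B'" by (rule L_arr_cases[OF arr(1)])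
    show ?thesis using arr(2) FG(2) mtp_arr(1)[OF f(2)] unfolding f(1) g(1) L_ops lneg_iff
      by (simp add: mneg_def div_less_index mod_less_index T.tneg_tmor(2))
  qed
qed

lemma negligible_rel_eq: "negligible_rel L =
    {(f, g). L.arr f \<and> L.arr g \<and> L.dm g = L.dm f \<and> L.cd g = L.cd f \<and> lneg (L.hdiff f g)}"
proof -
  have "(\<exists>A\<in>Ob L. \<exists>B\<in>Ob L. F \<in> Hom L A B \<and> G \<in> Hom L A B \<and>
      negligible L A B (F \<ominus>\<^bsub>hom_module L A B\<^esub> G)) \<longleftrightarrow>
    L.arr F \<and> L.arr G \<and> L.dm G = L.dm F \<and> L.cd G = L.cd F \<and> lneg (L.hdiff F G)" (is "?l \<longleftrightarrow> ?r") for F G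
  proof
    assume ?l
    then obtain A B where "F \<in> Hom L A B" "G \<in> Hom L A B" "A \<in> Ob L" "B \<in> Ob L"
      "negligible L A B (F \<ominus>\<^bsub>hom_module L A B\<^esub> G)" by blast
    then show ?r
      using L.homD[of F A B] L.homD[of G A B] negligible_lneg[of "L.hdiff F G" A B] by (simp add: L.a_hminus)
  next
    assume r: ?r
    then have "negligible L (L.dm F) (L.cd F) (F \<ominus>\<^bsub>hom_module L (L.dm F) (L.cd F)\<^esub> G)"
      using negligible_lneg[of "L.hdiff F G"] by (simp add: L.a_hminus)
    then show ?l using r L.arrD[of F] L.arrD[of G] by (intro bexI[of _ "L.dm F"] bexI[of _ "L.cd F"]) auto
  qed
  then show ?thesis unfolding negligible_rel_def by (simp only:)
qed

sublocale F: monoidal_congruence K L "negligible_rel L"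
  unfolding negligible_rel_eq by (rule lneg_congruence)

abbreviation FQ where "FQ \<equiv> fusion_quotient K q"

lemma FQ_eq: "FQ = quot_cat L (negligible_rel L)"
  by (simp add: fusion_quotient_def semisimplification_def)

end

section \<open>The generic complex parameter\<close>

lemma complex_field_sel [simp]:
  "carrier complex_field = UNIV" "\<zero>\<^bsub>complex_field\<^esub> = 0" "\<one>\<^bsub>complex_field\<^esub> = 1"
  "monoid.mult complex_field = (*)" "ring.add complex_field = (+)"
  by (simp_all add: ring_of_type_algebra_def)

lemma complex_cring: "cring complex_field"
  by (rule cring_from_type_algebra)

lemma complex_ops:
  "x \<noteq> 0 \<Longrightarrow> x \<in> Units complex_field" "x \<noteq> 0 \<Longrightarrow> inv\<^bsub>complex_field\<^esub> x = inverse x"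
  "\<ominus>\<^bsub>complex_field\<^esub> x = - x"
proof -
  interpret cring complex_field by (rule complex_cring)
  show "x \<noteq> 0 \<Longrightarrow> x \<in> Units complex_field"
    by (auto simp: Units_def intro!: exI[of _ "inverse x"])
  show "x \<noteq> 0 \<Longrightarrow> inv\<^bsub>complex_field\<^esub> x = inverse x"
    using inv_unique'[of x "inverse x"] by simp
  show "\<ominus>\<^bsub>complex_field\<^esub> x = - x"
    using minus_equality[of "- x" x] by simp
qed

locale tl_complex =
  fixes q :: complex
  assumes q_nonzero: "q \<noteq> 0" and q_generic: "\<forall>n>0. q ^ n \<noteq> 1"
begin

sublocale tl_param complex_field q
  using complex_cring q_nonzero by (auto intro!: tl_param.intro tl_param_axioms.intro complex_ops)

text \<open>The quantum integer \<open>[n]\<close> without its denominator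
  \<open>q - inverse q\<close>, which cancels in every ratio formed below.\<close>

definition qn :: "nat \<Rightarrow> complex" where
  "qn n = q ^ n - inverse q ^ n"

text \<open>A zero would give \<open>q ^ (n + n) = 1\<close>. It is here that \<open>q\<close> not
  being a root of unity enters.\<close>

lemma qn_nonzero: "0 < n \<Longrightarrow> qn n \<noteq> 0"
proof
  assume "0 < n" "qn n = 0"
  then have "q ^ n * q ^ n = 1"
    using q_nonzero by (simp add: qn_def power_inverse field_simps)
  then have "q ^ (n + n) = 1" by (simp add: power_add)
  then show False using q_generic \<open>0 < n\<close> by (metis add_pos_pos)
qed

lemma qn_rec: "qn (Suc (Suc n)) = (q + inverse q) * qn (Suc n) - qn n"
proof -
  define i a b where iab: "i = inverse q" "a = q ^ n" "b = inverse q ^ n"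
  have qi: "q * i = 1" using q_nonzero by (simp add: iab)
  have "(q + i) * (q * a - i * b) = q * (q * a) - i * (i * b) + (q * i) * a - (q * i) * b"
    by (simp add: algebra_simps)
  then have "q * (q * a) - i * (i * b) = (q + i) * (q * a - i * b) - (a - b)"
    unfolding qi by simp
  then show ?thesis by (simp only: qn_def power_Suc iab)
qed

text \<open>For loop value \<open>-[2]\<close> the projector on \<open>n\<close> strands has trace
  \<open>(-1)^n [n+1]\<close>, so consecutive traces have ratio \<open>-[n+2]/[n+1]\<close>. Both
  recursions for the ratios come from \<open>qn_rec\<close>.\<close>

sublocale T: tl_generic complex_field T "cl TCup" "cl TCap" "\<ominus>\<^bsub>complex_field\<^esub> (q \<oplus>\<^bsub>complex_field\<^esub> inv\<^bsub>complex_field\<^esub> q)"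
  "\<lambda>n. - qn (n + 2) / qn (n + 1)" "\<lambda>n. - qn (n + 1) / qn (n + 2)"
proof (intro tl_generic.intro T.tl_cat_axioms tl_generic_axioms.intro)
  fix n
  show "(- qn (n + 1) / qn (n + 2)) \<otimes>\<^bsub>complex_field\<^esub> (- qn (n + 2) / qn (n + 1)) = \<one>\<^bsub>complex_field\<^esub>"
    using qn_nonzero[of "n + 1"] qn_nonzero[of "n + 2"] by simp
  show "- qn (0 + 2) / qn (0 + 1) = \<ominus>\<^bsub>complex_field\<^esub> (q \<oplus>\<^bsub>complex_field\<^esub> inv\<^bsub>complex_field\<^esub> q)"
  proof -
    have "qn 2 = (q + inverse q) * qn 1" using qn_rec[of 0] by (simp add: qn_def[of 0] numeral_2_eq_2)
    then have "- qn 2 / qn 1 = - (q + inverse q)" using qn_nonzero[of 1] by simp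
    then show ?thesis using q_nonzero by (simp add: complex_ops numeral_2_eq_2)
  qed
  show "- qn (Suc n + 2) / qn (Suc n + 1) = \<ominus>\<^bsub>complex_field\<^esub> (q \<oplus>\<^bsub>complex_field\<^esub> inv\<^bsub>complex_field\<^esub> q)
      \<oplus>\<^bsub>complex_field\<^esub> (\<ominus>\<^bsub>complex_field\<^esub> (- qn (n + 1) / qn (n + 2)))"
  proof -
    have "- qn (Suc n + 2) / qn (Suc n + 1) = - ((q + inverse q) * qn (n + 2) - qn (n + 1)) / qn (n + 2)"
      using qn_rec[of "Suc n"] by simp
    also have "\<dots> = - (q + inverse q) + qn (n + 1) / qn (n + 2)"
      using qn_nonzero[of "n + 2"] by (simp add: diff_divide_distrib)
    finally show ?thesis using q_nonzero by (simp add: complex_ops)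
  qed
qed simp_all

end

section \<open>Equivalences and full subcategories\<close>

text \<open>The quasi-inverse is built by choice: objects together with isomorphisms onto the given
  ones, and for a morphism the lift of its conjugate by these isomorphisms. Identities in
  \<open>C\<close> are checked after applying the faithful functor.\<close>

lemma equivalenceI:
  assumes "typed_lmc R C" "typed_lmc S D"
    and func: "is_functor C D F M"
    and full: "\<And>X Y g. \<lbrakk>X \<in> Ob C; Y \<in> Ob C; g \<in> Hom D (F X) (F Y)\<rbrakk> \<Longrightarrow> \<exists>f\<in>Hom C X Y. M f = g"
    and faithful: "\<And>X Y f f'. \<lbrakk>X \<in> Ob C; Y \<in> Ob C; f \<in> Hom C X Y; f' \<in> Hom C X Y; M f = M f'\<rbrakk> \<Longrightarrow> f = f'"
    and surj: "\<And>Y. Y \<in> Ob D \<Longrightarrow> \<exists>X\<in>Ob C. \<exists>i. is_iso D (F X) Y i"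
  shows "is_equivalence C D F M"
proof -
  interpret C: typed_lmc R C by fact
  interpret D: typed_lmc S D by fact
  have F_ob [simp]: "X \<in> Ob C \<Longrightarrow> F X \<in> Ob D" for X
    using func by (simp add: is_functor_def)
  have M_hom: "\<lbrakk>X \<in> Ob C; Y \<in> Ob C; f \<in> Hom C X Y\<rbrakk> \<Longrightarrow> M f \<in> Hom D (F X) (F Y)" for X Y f
    using func by (simp add: is_functor_def)
  have M_arr [simp]: "D.arr (M f)" "D.dm (M f) = F (C.dm f)" "D.cd (M f) = F (C.cd f)" if "C.arr f" for f
    using M_hom[OF C.arrD(2,3,1)[OF that]] D.homD that by auto
  have M_id [simp]: "X \<in> Ob C \<Longrightarrow> M (Id C X) = Id D (F X)" for X
    using func by (simp add: is_functor_def)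
  have M_comp [simp]: "M (g \<cdot>\<^bsub>C\<^esub> f) = M g \<cdot>\<^bsub>D\<^esub> M f" if "C.arr f" "C.arr g" "C.cd f = C.dm g" for f g
    using func C.arrD[OF that(1)] C.arrD[OF that(2)] that unfolding is_functor_def by metis
  have "\<exists>X i j. X \<in> Ob C \<and> i \<in> Hom D (F X) Y \<and> j \<in> Hom D Y (F X) \<and> j \<cdot>\<^bsub>D\<^esub> i = Id D (F X) \<and> i \<cdot>\<^bsub>D\<^esub> j = Id D Y"
    if "Y \<in> Ob D" for Y
    using surj[OF that] unfolding is_iso_def by blast
  then obtain G \<epsilon> \<epsilon>' where G: "\<And>Y. Y \<in> Ob D \<Longrightarrow> G Y \<in> Ob C \<and> \<epsilon> Y \<in> Hom D (F (G Y)) Y \<and> \<epsilon>' Y \<in> Hom D Y (F (G Y)) \<and>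
      \<epsilon>' Y \<cdot>\<^bsub>D\<^esub> \<epsilon> Y = Id D (F (G Y)) \<and> \<epsilon> Y \<cdot>\<^bsub>D\<^esub> \<epsilon>' Y = Id D Y"
    by metis
  have G_ob [simp]: "Y \<in> Ob D \<Longrightarrow> G Y \<in> Ob C" for Y using G by blast
  have \<epsilon> [simp]: "D.arr (\<epsilon> Y)" "D.dm (\<epsilon> Y) = F (G Y)" "D.cd (\<epsilon> Y) = Y"
      "D.arr (\<epsilon>' Y)" "D.dm (\<epsilon>' Y) = Y" "D.cd (\<epsilon>' Y) = F (G Y)"
      "\<epsilon>' Y \<cdot>\<^bsub>D\<^esub> \<epsilon> Y = Id D (F (G Y))" "\<epsilon> Y \<cdot>\<^bsub>D\<^esub> \<epsilon>' Y = Id D Y" if "Y \<in> Ob D" for Y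
    using G[OF that] D.homD that by auto
  have cancel: "\<epsilon> Y \<cdot>\<^bsub>D\<^esub> (\<epsilon>' Y \<cdot>\<^bsub>D\<^esub> g) = g" if "Y \<in> Ob D" "D.arr g" "D.cd g = Y" for Y g
    using that by (simp flip: D.a_comp_assoc)
  have lift: "\<exists>f. C.arr f \<and> C.dm f = X \<and> C.cd f = Y \<and> M f = g"
    if "X \<in> Ob C" "Y \<in> Ob C" "D.arr g" "D.dm g = F X" "D.cd g = F Y" for X Y g
    using full[of X Y g] that C.homD D.hom_iff by force
  define P where "P g f \<longleftrightarrow> C.arr f \<and> C.dm f = G (D.dm g) \<and> C.cd f = G (D.cd g) \<and>
      M f = \<epsilon>' (D.cd g) \<cdot>\<^bsub>D\<^esub> (g \<cdot>\<^bsub>D\<^esub> \<epsilon> (D.dm g))" for g f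
  define N where "N g = (SOME f. P g f)" for g
  have "\<exists>f. P g f" if "D.arr g" for g
    unfolding P_def using that by (intro lift) auto
  then have N: "P g (N g)" if "D.arr g" for g
    unfolding N_def using that by (blast intro: someI_ex)
  have N_arr [simp]: "C.arr (N g)" "C.dm (N g) = G (D.dm g)" "C.cd (N g) = G (D.cd g)"
    and MN: "M (N g) = \<epsilon>' (D.cd g) \<cdot>\<^bsub>D\<^esub> (g \<cdot>\<^bsub>D\<^esub> \<epsilon> (D.dm g))" if "D.arr g" for g
    using N[OF that] by (auto simp: P_def)
  have eqI: "f = f'" if "C.arr f" "C.arr f'" "C.dm f = C.dm f'" "C.cd f = C.cd f'" "M f = M f'" for f f'
    using faithful[of "C.dm f" "C.cd f" f f'] that C.arrD[of f] C.arrD[of f'] by simp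
  have "is_functor D C G N"
    unfolding is_functor_def
  proof (intro conjI ballI)
    show "N (Id D X) = Id C (G X)" if "X \<in> Ob D" for X
      using that by (intro eqI) (simp_all add: MN)
    fix X Y Z f g assume "X \<in> Ob D" "Y \<in> Ob D" "Z \<in> Ob D" "f \<in> Hom D X Y" "g \<in> Hom D Y Z"
    then show "N (g \<cdot>\<^bsub>D\<^esub> f) = N g \<cdot>\<^bsub>C\<^esub> N f"
      using D.homD[of f X Y] D.homD[of g Y Z]
      by (intro eqI) (simp_all add: MN D.a_comp_assoc cancel)
  qed (auto simp: D.hom_iff C.hom_iff)
  moreover have "\<exists>\<eta>. natural_iso C C id id (G \<circ> F) (N \<circ> M) \<eta>"
  proof -
    have "\<exists>u. C.arr u \<and> C.dm u = X \<and> C.cd u = G (F X) \<and> M u = \<epsilon>' (F X)" if "X \<in> Ob C" for X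
      using that by (intro lift) auto
    then obtain \<eta> where \<eta>: "\<And>X. X \<in> Ob C \<Longrightarrow> C.arr (\<eta> X) \<and> C.dm (\<eta> X) = X \<and> C.cd (\<eta> X) = G (F X) \<and> M (\<eta> X) = \<epsilon>' (F X)"
      by metis
    have "is_iso C X (G (F X)) (\<eta> X)" if X: "X \<in> Ob C" for X
    proof -
      obtain v where v: "C.arr v" "C.dm v = G (F X)" "C.cd v = X" "M v = \<epsilon> (F X)"
        using lift[of "G (F X)" X "\<epsilon> (F X)"] X by auto
      have "v \<cdot>\<^bsub>C\<^esub> \<eta> X = Id C X" "\<eta> X \<cdot>\<^bsub>C\<^esub> v = Id C (G (F X))"
        using v \<eta>[OF X] X by (auto intro!: eqI)
      then show ?thesis using v \<eta>[OF X] X unfolding is_iso_def by (auto simp: C.hom_iff)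
    qed
    moreover have "\<eta> Y \<cdot>\<^bsub>C\<^esub> f = N (M f) \<cdot>\<^bsub>C\<^esub> \<eta> X" if "X \<in> Ob C" "Y \<in> Ob C" "f \<in> Hom C X Y" for X Y f
      using that \<eta>[of X] \<eta>[of Y] C.homD[of f X Y]
      by (intro eqI) (simp_all add: MN D.a_comp_assoc)
    ultimately have "natural_iso C C id id (G \<circ> F) (N \<circ> M) \<eta>" by (simp add: natural_iso_def)
    then show "\<exists>\<eta>. natural_iso C C id id (G \<circ> F) (N \<circ> M) \<eta>" by (intro exI[of _ \<eta>])
  qed
  moreover have "natural_iso D D (F \<circ> G) (M \<circ> N) id id \<epsilon>"
  proof -
    have "is_iso D (F (G Y)) Y (\<epsilon> Y)" if "Y \<in> Ob D" for Y
      using G[OF that] unfolding is_iso_def by blast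
    moreover have "\<epsilon> Y' \<cdot>\<^bsub>D\<^esub> M (N g) = g \<cdot>\<^bsub>D\<^esub> \<epsilon> Y" if "Y \<in> Ob D" "Y' \<in> Ob D" "g \<in> Hom D Y Y'" for Y Y' g
      using that D.homD[of g Y Y'] by (simp add: MN cancel)
    ultimately show ?thesis by (auto simp: natural_iso_def)
  qed
  ultimately show ?thesis unfolding is_equivalence_def using func by blast
qed

lemma full_subcategory_sel [simp]:
  "Ob (full_subcategory C S) = S" "Hom (full_subcategory C S) = Hom C" "Id (full_subcategory C S) = Id C"
  "Comp (full_subcategory C S) = Comp C" "Unt (full_subcategory C S) = Unt C" "TOb (full_subcategory C S) = TOb C"
  "TMor (full_subcategory C S) = TMor C" "HZero (full_subcategory C S) = HZero C"
  "HAdd (full_subcategory C S) = HAdd C" "Scal (full_subcategory C S) = Scal C"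
  "hom_module (full_subcategory C S) = hom_module C"
  by (simp_all add: full_subcategory_def hom_module_def fun_eq_iff)

lemma full_subcategory_lmc:
  assumes "linear_monoidal_category R C" and sub: "S \<subseteq> Ob C"
    and unt: "Unt C \<in> S" and tob: "\<And>X Y. \<lbrakk>X \<in> S; Y \<in> S\<rbrakk> \<Longrightarrow> TOb C X Y \<in> S"
  shows "linear_monoidal_category R (full_subcategory C S)"
proof -
  interpret linear_monoidal_category R C by fact
  note s = subsetD[OF sub]
  show ?thesis
    by (rule linear_monoidal_category.intro; simp only: full_subcategory_sel)
      (rule unt tob tob_assoc tob_unt id_hom comp_hom comp_id comp_assoc tmor_hom tmor_id interchange tmor_assoc
        tmor_unt hom_is_module comp_add comp_scal tmor_add tmor_scal; (assumption | erule s))+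
qed

section \<open>Ultraproducts of linear monoidal categories\<close>

lemma ulim_cong: "eventually (\<lambda>k. a k = b k) U \<Longrightarrow> ulim U A a = ulim U A b"
  unfolding ulim_def by (intro Collect_cong conj_cong HOL.refl) (auto elim: eventually_elim2)

text \<open>Members of a class lie in \<open>A k\<close> at every index, whereas constructions
  deliver this only almost everywhere. The sequence is repaired on the exceptional set, which
  requires each \<open>A k\<close> to have an element.\<close>

lemma ulim_fix:
  assumes "\<And>k. A k \<noteq> {}" "eventually (\<lambda>k. a k \<in> A k) U"
  obtains b where "\<And>k. b k \<in> A k" "eventually (\<lambda>k. b k = a k) U" "ulim U A a = ulim U A b"
proof -
  define b where "b k = (if a k \<in> A k then a k else (SOME x. x \<in> A k))" for k
  have "b k \<in> A k" for k using assms(1)[of k] by (auto simp: b_def some_in_eq)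
  moreover have "eventually (\<lambda>k. b k = a k) U"
    using assms(2) by eventually_elim (simp add: b_def)
  moreover have "ulim U A b = ulim U A a" using calculation(2) by (rule ulim_cong)
  ultimately show thesis using that by metis
qed

lemma ulim_nonempty: "\<lbrakk>\<And>k. A k \<noteq> {}; eventually (\<lambda>k. a k \<in> A k) U\<rbrakk> \<Longrightarrow> \<exists>b. b \<in> ulim U A a"
  by (rule ulim_fix[of A a U]) (auto simp: ulim_def)

text \<open>A common member of the two classes forces almost everywhere agreement; that the class is
  nonempty is what the first two assumptions secure.\<close>

lemma ulim_eqD:
  assumes "\<And>k. A k \<noteq> {}" "eventually (\<lambda>k. a k \<in> A k) U" "ulim U A a = ulim U A b"
  shows "eventually (\<lambda>k. a k = b k) U"
proof -
  obtain c where "c \<in> ulim U A a" using ulim_nonempty assms by blast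
  then have "eventually (\<lambda>k. c k = a k) U" "eventually (\<lambda>k. c k = b k) U"
    using assms(3) by (auto simp: ulim_def)
  then show ?thesis by eventually_elim simp
qed

lemma ulim_in_ultraproduct: "\<lbrakk>\<And>k. A k \<noteq> {}; eventually (\<lambda>k. a k \<in> A k) U\<rbrakk> \<Longrightarrow> ulim U A a \<in> ultraproduct U A"
  by (rule ulim_fix[of A a U]) (auto simp: ultraproduct_def)

lemma umap1_ulim:
  assumes "\<And>k. A k \<noteq> {}" "eventually (\<lambda>k. a k \<in> A k) U"
  shows "umap1 U B h (ulim U A a) = ulim U B (\<lambda>k. h k (a k))"
proof -
  obtain c where c: "c \<in> ulim U A a" using ulim_nonempty assms by blast
  show ?thesis unfolding umap1_def
    by (rule UN_constant_eq[OF c]) (auto simp: ulim_def[of U A] intro!: ulim_cong elim: eventually_mono)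
qed

lemma umap2_ulim:
  assumes "\<And>k. A k \<noteq> {}" "eventually (\<lambda>k. a k \<in> A k) U"
    and "\<And>k. A' k \<noteq> {}" "eventually (\<lambda>k. b k \<in> A' k) U"
  shows "umap2 U B h (ulim U A a) (ulim U A' b) = ulim U B (\<lambda>k. h k (a k) (b k))"
proof -
  obtain c d where c: "c \<in> ulim U A a" "d \<in> ulim U A' b" using ulim_nonempty assms by metis
  show ?thesis unfolding umap2_def
    by (rule UN2_const[OF c]) (auto simp: ulim_def[of U A] ulim_def[of U A'] intro!: ulim_cong elim: eventually_elim2)
qed

text \<open>\<open>\<rho> c\<close> is a sequence representing the scalar \<open>\<psi> c\<close>; as a function of \<open>c\<close> it is a ring
  homomorphism up to \<open>U\<close>-null sets of indices.\<close>

locale ultra_lmc =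
  fixes U :: "'i filter" and K :: "'i \<Rightarrow> ('k, 'r) ring_scheme" and C :: "'i \<Rightarrow> ('k, 'o, 'm) lmcat"
    and R :: "('l, 's) ring_scheme" and \<psi> :: "'l \<Rightarrow> ('i \<Rightarrow> 'k) set" and \<rho> :: "'l \<Rightarrow> 'i \<Rightarrow> 'k"
  assumes lmc: "\<And>k. typed_lmc (K k) (C k)"
    and R: "cring R"
    and \<rho>_carrier: "c \<in> carrier R \<Longrightarrow> \<rho> c k \<in> carrier (K k)"
    and \<psi>_eq: "c \<in> carrier R \<Longrightarrow> \<psi> c = ulim U (\<lambda>k. carrier (K k)) (\<rho> c)"
    and \<rho>_zero: "eventually (\<lambda>k. \<rho> \<zero>\<^bsub>R\<^esub> k = \<zero>\<^bsub>K k\<^esub>) U"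
    and \<rho>_one: "eventually (\<lambda>k. \<rho> \<one>\<^bsub>R\<^esub> k = \<one>\<^bsub>K k\<^esub>) U"
    and \<rho>_add: "\<lbrakk>c \<in> carrier R; d \<in> carrier R\<rbrakk> \<Longrightarrow> eventually (\<lambda>k. \<rho> (c \<oplus>\<^bsub>R\<^esub> d) k = \<rho> c k \<oplus>\<^bsub>K k\<^esub> \<rho> d k) U"
    and \<rho>_mult: "\<lbrakk>c \<in> carrier R; d \<in> carrier R\<rbrakk> \<Longrightarrow> eventually (\<lambda>k. \<rho> (c \<otimes>\<^bsub>R\<^esub> d) k = \<rho> c k \<otimes>\<^bsub>K k\<^esub> \<rho> d k) U"
begin

interpretation C: typed_lmc "K k" "C k" for k by (rule lmc)

abbreviation D where "D \<equiv> change_scalars \<psi> (ultraproduct_cat U C)"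
abbreviation uo where "uo X \<equiv> ulim U (\<lambda>k. Ob (C k)) X"
abbreviation um where "um f \<equiv> ulim U (\<lambda>k. Arr (C k)) f"

definition obs :: "('i \<Rightarrow> 'o) \<Rightarrow> bool" where
  "obs X \<longleftrightarrow> eventually (\<lambda>k. X k \<in> Ob (C k)) U"

text \<open>Membership of source and target is included, so that a single \<open>eventually\<close>
  fact supplies all typing at an index.\<close>

definition homs :: "('i \<Rightarrow> 'm) \<Rightarrow> ('i \<Rightarrow> 'o) \<Rightarrow> ('i \<Rightarrow> 'o) \<Rightarrow> bool" where
  "homs f X Y \<longleftrightarrow> eventually (\<lambda>k. X k \<in> Ob (C k) \<and> Y k \<in> Ob (C k) \<and> f k \<in> Hom (C k) (X k) (Y k)) U"

lemma ob_ne: "Ob (C k) \<noteq> {}" using C.unt_ob by blast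
lemma arr_ne: "Arr (C k) \<noteq> {}" using C.id_hom[OF C.unt_ob] C.unt_ob unfolding Arr_def by blast
lemma carrier_ne: "carrier (K k) \<noteq> {}"
proof -
  interpret cring "K k" by (rule C.cring_R)
  show ?thesis by blast
qed

lemma homs_arr: "homs f X Y \<Longrightarrow> eventually (\<lambda>k. f k \<in> Arr (C k)) U"
  unfolding homs_def by (erule eventually_mono) (auto simp: Arr_def)

lemma homs_obs: "homs f X Y \<Longrightarrow> obs X \<and> obs Y"
  unfolding homs_def obs_def by (auto elim: eventually_mono)

lemma D_ob: "P \<in> Ob D \<longleftrightarrow> (\<exists>X. obs X \<and> P = uo X)"
proof
  assume "P \<in> Ob D"
  then obtain X where "\<forall>k. X k \<in> Ob (C k)" "P = uo X"
    by (auto simp: change_scalars_def ultraproduct_cat_def Let_def ultraproduct_def)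
  then show "\<exists>X. obs X \<and> P = uo X" by (intro exI[of _ X]) (simp add: obs_def)
next
  assume "\<exists>X. obs X \<and> P = uo X"
  then show "P \<in> Ob D" using ulim_in_ultraproduct[OF ob_ne]
    by (auto simp: change_scalars_def ultraproduct_cat_def Let_def obs_def)
qed

text \<open>Any representatives of the two objects agree with \<open>X\<close> and \<open>Y\<close>
  almost everywhere, so the existential choice of representatives in the hom sets of the
  ultraproduct can be replaced by the given ones.\<close>

lemma D_hom:
  assumes X: "obs X" and Y: "obs Y"
  shows "F \<in> Hom D (uo X) (uo Y) \<longleftrightarrow> (\<exists>f. homs f X Y \<and> F = um f)"
proof
  assume "F \<in> Hom D (uo X) (uo Y)"
  then obtain f X' Y' where f: "F = um f" "X' \<in> uo X" "Y' \<in> uo Y"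
    "eventually (\<lambda>k. f k \<in> Hom (C k) (X' k) (Y' k)) U"
    by (auto simp: change_scalars_def ultraproduct_cat_def Let_def)
  then have "eventually (\<lambda>k. X' k = X k) U" "eventually (\<lambda>k. Y' k = Y k) U" by (auto simp: ulim_def)
  then have "homs f X Y" using f(4) X Y unfolding homs_def obs_def
    by eventually_elim auto
  then show "\<exists>f. homs f X Y \<and> F = um f" using f by blast
next
  assume "\<exists>f. homs f X Y \<and> F = um f"
  then obtain f where f: "homs f X Y" "F = um f" by blast
  obtain g where g: "\<And>k. g k \<in> Arr (C k)" "eventually (\<lambda>k. g k = f k) U" "um f = um g"
    using ulim_fix[OF arr_ne homs_arr[OF f(1)]] by metis
  obtain X' Y' where XY: "X' \<in> uo X" "Y' \<in> uo Y"
    using ulim_nonempty[OF ob_ne X[unfolded obs_def]] ulim_nonempty[OF ob_ne Y[unfolded obs_def]] by blast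
  have "eventually (\<lambda>k. g k \<in> Hom (C k) (X' k) (Y' k)) U"
  proof -
    have "eventually (\<lambda>k. X' k = X k) U" "eventually (\<lambda>k. Y' k = Y k) U" using XY by (auto simp: ulim_def)
    then show ?thesis using f(1) g(2) unfolding homs_def by eventually_elim auto
  qed
  then have "F = um g \<and> (\<forall>k. g k \<in> Arr (C k)) \<and>
      (\<exists>X\<in>uo X. \<exists>Y\<in>uo Y. eventually (\<lambda>k. g k \<in> Hom (C k) (X k) (Y k)) U)"
    using g f XY by blast
  then show "F \<in> Hom D (uo X) (uo Y)"
    unfolding change_scalars_def ultraproduct_cat_def Let_def lmcat.simps by blast
qed

lemma D_id: "obs X \<Longrightarrow> Id D (uo X) = um (\<lambda>k. Id (C k) (X k))"
  using umap1_ulim[OF ob_ne] by (simp add: change_scalars_def ultraproduct_cat_def Let_def obs_def)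

lemma D_unt: "Unt D = uo (\<lambda>k. Unt (C k))"
  by (simp add: change_scalars_def ultraproduct_cat_def Let_def)

lemma D_tob: "\<lbrakk>obs X; obs Y\<rbrakk> \<Longrightarrow> TOb D (uo X) (uo Y) = uo (\<lambda>k. TOb (C k) (X k) (Y k))"
  using umap2_ulim[OF ob_ne _ ob_ne] by (simp add: change_scalars_def ultraproduct_cat_def Let_def obs_def)

lemma D_comp: "\<lbrakk>homs f X Y; homs g Y' Z\<rbrakk> \<Longrightarrow> Comp D (um g) (um f) = um (\<lambda>k. g k \<cdot>\<^bsub>C k\<^esub> f k)"
  using umap2_ulim[OF arr_ne homs_arr arr_ne homs_arr]
  by (simp add: change_scalars_def ultraproduct_cat_def Let_def)

lemma D_tmor: "\<lbrakk>homs f X Y; homs g X' Y'\<rbrakk> \<Longrightarrow> TMor D (um f) (um g) = um (\<lambda>k. f k \<boxtimes>\<^bsub>C k\<^esub> g k)"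
  using umap2_ulim[OF arr_ne homs_arr arr_ne homs_arr]
  by (simp add: change_scalars_def ultraproduct_cat_def Let_def)

lemma D_add: "\<lbrakk>homs f X Y; homs g X' Y'\<rbrakk> \<Longrightarrow> HAdd D (um f) (um g) = um (\<lambda>k. HAdd (C k) (f k) (g k))"
  using umap2_ulim[OF arr_ne homs_arr arr_ne homs_arr]
  by (simp add: change_scalars_def ultraproduct_cat_def Let_def)

lemma D_zero: "\<lbrakk>obs X; obs Y\<rbrakk> \<Longrightarrow> HZero D (uo X) (uo Y) = um (\<lambda>k. HZero (C k) (X k) (Y k))"
  using umap2_ulim[OF ob_ne _ ob_ne] by (simp add: change_scalars_def ultraproduct_cat_def Let_def obs_def)

lemma D_scal: "\<lbrakk>c \<in> carrier R; homs f X Y\<rbrakk> \<Longrightarrow> Scal D c (um f) = um (\<lambda>k. Scal (C k) (\<rho> c k) (f k))"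
  using umap2_ulim[where A = "\<lambda>k. carrier (K k)" and a = "\<rho> c", OF carrier_ne _ arr_ne homs_arr]
  by (simp add: change_scalars_def ultraproduct_cat_def Let_def \<psi>_eq \<rho>_carrier)

lemma obs_unt: "obs (\<lambda>k. Unt (C k))"
  by (simp add: obs_def C.unt_ob)

lemma obs_tob: assumes "obs X" "obs Y" shows "obs (\<lambda>k. TOb (C k) (X k) (Y k))"
  using assms unfolding obs_def by eventually_elim (rule C.tob_ob)

lemma homs_ops:
  "obs X \<Longrightarrow> homs (\<lambda>k. Id (C k) (X k)) X X"
  "\<lbrakk>homs f X Y; homs g Y Z\<rbrakk> \<Longrightarrow> homs (\<lambda>k. g k \<cdot>\<^bsub>C k\<^esub> f k) X Z"
  "\<lbrakk>homs f X Y; homs g X' Y'\<rbrakk>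
    \<Longrightarrow> homs (\<lambda>k. f k \<boxtimes>\<^bsub>C k\<^esub> g k) (\<lambda>k. TOb (C k) (X k) (X' k)) (\<lambda>k. TOb (C k) (Y k) (Y' k))"
  "\<lbrakk>obs X; obs Y\<rbrakk> \<Longrightarrow> homs (\<lambda>k. HZero (C k) (X k) (Y k)) X Y"
  "\<lbrakk>homs f X Y; homs g X Y\<rbrakk> \<Longrightarrow> homs (\<lambda>k. HAdd (C k) (f k) (g k)) X Y"
  "\<lbrakk>c \<in> carrier R; homs f X Y\<rbrakk> \<Longrightarrow> homs (\<lambda>k. Scal (C k) (\<rho> c k) (f k)) X Y"
proof -
  show "homs (\<lambda>k. Id (C k) (X k)) X X"
    if "obs X"
    using that unfolding obs_def homs_def by eventually_elim (simp add: C.id_hom)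
  show "homs (\<lambda>k. g k \<cdot>\<^bsub>C k\<^esub> f k) X Z"
    if "homs f X Y" "homs g Y Z"
    using that unfolding homs_def by eventually_elim (auto intro: C.comp_hom)
  show "homs (\<lambda>k. f k \<boxtimes>\<^bsub>C k\<^esub> g k) (\<lambda>k. TOb (C k) (X k) (X' k)) (\<lambda>k. TOb (C k) (Y k) (Y' k))"
    if "homs f X Y" "homs g X' Y'"
    using that unfolding homs_def by eventually_elim (auto intro: C.tmor_hom C.tob_ob)
  show "homs (\<lambda>k. HZero (C k) (X k) (Y k)) X Y"
    if "obs X" "obs Y"
    using that unfolding obs_def homs_def by eventually_elim simp
  show "homs (\<lambda>k. HAdd (C k) (f k) (g k)) X Y"
    if "homs f X Y" "homs g X Y"
    using that unfolding homs_def by eventually_elim simp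
  show "homs (\<lambda>k. Scal (C k) (\<rho> c k) (f k)) X Y"
    if "c \<in> carrier R" "homs f X Y"
    using that(2) unfolding homs_def by eventually_elim (simp add: \<rho>_carrier that(1))
qed

lemma um_eqI: "eventually (\<lambda>k. f k = g k) U \<Longrightarrow> um f = um g"
  by (rule ulim_cong)

lemma D_module:
  assumes X: "obs X" and Y: "obs Y"
  shows "module R (hom_module D (uo X) (uo Y))"
proof -
  have R01: "\<zero>\<^bsub>R\<^esub> \<in> carrier R" "\<one>\<^bsub>R\<^esub> \<in> carrier R"
    using R by (auto simp: cring_def ring.ring_simprules)
  show ?thesis
proof (rule hom_moduleI[OF R])
  note H = D_hom[OF X Y]
  show "HZero D (uo X) (uo Y) \<in> Hom D (uo X) (uo Y)"
    unfolding H D_zero[OF X Y] using homs_ops(4)[OF X Y] by blast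
  fix F assume "F \<in> Hom D (uo X) (uo Y)"
  then obtain f where f: "homs f X Y" "F = um f" unfolding H by blast
  show "HAdd D (HZero D (uo X) (uo Y)) F = F"
    unfolding f(2) D_zero[OF X Y] D_add[OF homs_ops(4)[OF X Y] f(1)]
    by (rule um_eqI, use f(1)[unfolded homs_def]  in eventually_elim, simp add: C.hzero_add)
  show "Scal D \<zero>\<^bsub>R\<^esub> F = HZero D (uo X) (uo Y)"
    unfolding f(2) D_zero[OF X Y] D_scal[OF R01(1) f(1)]
    by (rule um_eqI, use f(1)[unfolded homs_def] \<rho>_zero in eventually_elim, simp add: C.scal_zero)
  show "Scal D \<one>\<^bsub>R\<^esub> F = F"
    unfolding f(2) D_scal[OF R01(2) f(1)]
    by (rule um_eqI, use f(1)[unfolded homs_def] \<rho>_one in eventually_elim, auto intro: C.scal_one)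
  fix c assume c: "c \<in> carrier R"
  show "Scal D c F \<in> Hom D (uo X) (uo Y)"
    unfolding H f(2) D_scal[OF c f(1)] using homs_ops(6)[OF c f(1)] by blast
  fix d assume d: "d \<in> carrier R"
  have cd: "c \<otimes>\<^bsub>R\<^esub> d \<in> carrier R" "c \<oplus>\<^bsub>R\<^esub> d \<in> carrier R"
    using c d R by (auto simp: cring_def ring.ring_simprules)
  show "Scal D (c \<otimes>\<^bsub>R\<^esub> d) F = Scal D c (Scal D d F)"
    unfolding f(2) D_scal[OF cd(1) f(1)] D_scal[OF d f(1)] D_scal[OF c homs_ops(6)[OF d f(1)]]
    by (rule um_eqI, use f(1)[unfolded homs_def] \<rho>_mult[OF c d] in eventually_elim, auto simp: \<rho>_carrier c d intro: C.scal_mult)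
  show "Scal D (c \<oplus>\<^bsub>R\<^esub> d) F = HAdd D (Scal D c F) (Scal D d F)"
    unfolding f(2) D_scal[OF cd(2) f(1)] D_scal[OF d f(1)] D_scal[OF c f(1)]
      D_add[OF homs_ops(6)[OF c f(1)] homs_ops(6)[OF d f(1)]]
    by (rule um_eqI, use f(1)[unfolded homs_def] \<rho>_add[OF c d] in eventually_elim, auto simp: \<rho>_carrier c d intro: C.scal_add_left)
next
  note H = D_hom[OF X Y]
  fix F G assume "F \<in> Hom D (uo X) (uo Y)" "G \<in> Hom D (uo X) (uo Y)"
  then obtain f g where f: "homs f X Y" "F = um f" and g: "homs g X Y" "G = um g" unfolding H by blast
  show "HAdd D F G \<in> Hom D (uo X) (uo Y)"
    unfolding H f(2) g(2) D_add[OF f(1) g(1)] using homs_ops(5)[OF f(1) g(1)] by blast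
  show "HAdd D F G = HAdd D G F"
    unfolding f(2) g(2) D_add[OF f(1) g(1)] D_add[OF g(1) f(1)]
    by (rule um_eqI, use f(1)[unfolded homs_def] g(1)[unfolded homs_def]  in eventually_elim, auto intro: C.hadd_comm)
  show "Scal D c (HAdd D F G) = HAdd D (Scal D c F) (Scal D c G)" if c: "c \<in> carrier R" for c
    unfolding f(2) g(2) D_add[OF f(1) g(1)] D_scal[OF c f(1)] D_scal[OF c g(1)] D_scal[OF c homs_ops(5)[OF f(1) g(1)]]
      D_add[OF homs_ops(6)[OF c f(1)] homs_ops(6)[OF c g(1)]]
    by (rule um_eqI, use f(1)[unfolded homs_def] g(1)[unfolded homs_def]  in eventually_elim, auto simp: \<rho>_carrier c intro: C.scal_add_right)
  fix E assume "E \<in> Hom D (uo X) (uo Y)"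
  then obtain e where e: "homs e X Y" "E = um e" unfolding H by blast
  show "HAdd D (HAdd D F G) E = HAdd D F (HAdd D G E)"
    unfolding f(2) g(2) e(2) D_add[OF f(1) g(1)] D_add[OF g(1) e(1)]
      D_add[OF homs_ops(5)[OF f(1) g(1)] e(1)] D_add[OF f(1) homs_ops(5)[OF g(1) e(1)]]
    by (rule um_eqI, use f(1)[unfolded homs_def] g(1)[unfolded homs_def] e(1)[unfolded homs_def]  in eventually_elim, auto intro: C.hadd_assoc)
qed
qed

lemma D_obE:
  assumes "P \<in> Ob D" obtains X where "obs X" "P = uo X"
  using assms unfolding D_ob by blast

lemma D_homE:
  assumes "F \<in> Hom D (uo X) (uo Y)" "obs X" "obs Y" obtains f where "homs f X Y" "F = um f"
  using assms D_hom by blast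

lemma D_homI: "homs f X Y \<Longrightarrow> um f \<in> Hom D (uo X) (uo Y)"
  using homs_obs D_hom by blast

text \<open>Each law compares two sequences of morphisms. At an index where the chosen
  representatives are well typed it is the law of \<open>C k\<close>, and finitely many typing
  conditions hold together for almost all indices.\<close>

lemma D_lmc: "linear_monoidal_category R D"
proof (rule linear_monoidal_category.intro)
  show "Unt D \<in> Ob D" unfolding D_ob D_unt using obs_unt by blast
  fix P1 assume "P1 \<in> Ob D"
  then obtain X1 where X1: "obs X1" "P1 = uo X1" by (rule D_obE)
  show "TOb D (Unt D) P1 = P1" "TOb D P1 (Unt D) = P1"
    unfolding X1(2) D_unt D_tob[OF obs_unt X1(1)] D_tob[OF X1(1) obs_unt]
    by (rule ulim_cong, use X1(1)[unfolded obs_def] in eventually_elim, simp add: C.tob_unt)+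
  show "Id D P1 \<in> Hom D P1 P1"
    unfolding X1(2) D_id[OF X1(1)] by (rule D_homI[OF homs_ops(1)[OF X1(1)]])
  fix P2 assume "P2 \<in> Ob D"
  then obtain X2 where X2: "obs X2" "P2 = uo X2" by (rule D_obE)
  show "TOb D P1 P2 \<in> Ob D"
    unfolding D_ob X1(2) X2(2) D_tob[OF X1(1) X2(1)] using obs_tob[OF X1(1) X2(1)] by blast
  show "module R (hom_module D P1 P2)"
    unfolding X1(2) X2(2) by (rule D_module[OF X1(1) X2(1)])
  show "TMor D (Id D P1) (Id D P2) = Id D (TOb D P1 P2)"
    unfolding X1(2) X2(2) D_id[OF X1(1)] D_id[OF X2(1)] D_tob[OF X1(1) X2(1)] D_id[OF obs_tob[OF X1(1) X2(1)]]
      D_tmor[OF homs_ops(1)[OF X1(1)] homs_ops(1)[OF X2(1)]]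
    by (rule um_eqI, use X1(1)[unfolded obs_def] X2(1)[unfolded obs_def] in eventually_elim, simp add: C.tmor_id)
  { fix F assume "F \<in> Hom D P1 P2"
    then obtain f where f: "homs f X1 X2" "F = um f"
      unfolding X1(2) X2(2) by (rule D_homE[OF _ X1(1) X2(1)])
    show "Comp D F (Id D P1) = F" "Comp D (Id D P2) F = F"
      unfolding X1(2) X2(2) f(2) D_id[OF X1(1)] D_id[OF X2(1)] D_comp[OF homs_ops(1)[OF X1(1)] f(1)]
        D_comp[OF f(1) homs_ops(1)[OF X2(1)]]
      by (rule um_eqI, use f(1)[unfolded homs_def] in eventually_elim, fastforce intro: C.comp_id)+
    show "TMor D (Id D (Unt D)) F = F" "TMor D F (Id D (Unt D)) = F"
      unfolding D_unt f(2) D_id[OF obs_unt] D_tmor[OF homs_ops(1)[OF obs_unt] f(1)]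
        D_tmor[OF f(1) homs_ops(1)[OF obs_unt]]
      by (rule um_eqI, use f(1)[unfolded homs_def] in eventually_elim, fastforce intro: C.tmor_unt)+
  }
  fix P3 assume "P3 \<in> Ob D"
  then obtain X3 where X3: "obs X3" "P3 = uo X3" by (rule D_obE)
  show "TOb D (TOb D P1 P2) P3 = TOb D P1 (TOb D P2 P3)"
    unfolding X1(2) X2(2) X3(2) D_tob[OF X1(1) X2(1)] D_tob[OF X2(1) X3(1)]
      D_tob[OF obs_tob[OF X1(1) X2(1)] X3(1)] D_tob[OF X1(1) obs_tob[OF X2(1) X3(1)]]
    by (rule ulim_cong, use X1(1)[unfolded obs_def] X2(1)[unfolded obs_def] X3(1)[unfolded obs_def]
        in eventually_elim, simp add: C.tob_assoc)
  { fix F F' G G'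
    assume FG: "F \<in> Hom D P1 P2" "G \<in> Hom D P2 P3"
    obtain f where f: "homs f X1 X2" "F = um f"
      by (rule D_homE[OF FG(1)[unfolded X1(2) X2(2)] X1(1) X2(1)])
    obtain g where g: "homs g X2 X3" "G = um g"
      by (rule D_homE[OF FG(2)[unfolded X2(2) X3(2)] X2(1) X3(1)])
    show "Comp D G F \<in> Hom D P1 P3"
      unfolding X1(2) X3(2) f(2) g(2) D_comp[OF f(1) g(1)] by (rule D_homI[OF homs_ops(2)[OF f(1) g(1)]])
    show "Comp D G (Scal D c F) = Scal D c (Comp D G F)" "Comp D (Scal D c G) F = Scal D c (Comp D G F)"
      if c: "c \<in> carrier R" for c
      unfolding f(2) g(2) D_scal[OF c f(1)] D_scal[OF c g(1)] D_comp[OF f(1) g(1)]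
        D_comp[OF homs_ops(6)[OF c f(1)] g(1)] D_comp[OF f(1) homs_ops(6)[OF c g(1)]]
        D_scal[OF c homs_ops(2)[OF f(1) g(1)]]
      by (rule um_eqI, use f(1)[unfolded homs_def] g(1)[unfolded homs_def] in eventually_elim,
        fastforce simp: \<rho>_carrier c intro: C.comp_scal)+
    show "Comp D G (HAdd D F F') = HAdd D (Comp D G F) (Comp D G F')" if extra: "F' \<in> Hom D P1 P2"
    proof -
      obtain f' where f': "homs f' X1 X2" "F' = um f'"
        by (rule D_homE[OF extra[unfolded X1(2) X2(2)] X1(1) X2(1)])
      show ?thesis
        unfolding f(2) f'(2) g(2) D_add[OF f(1) f'(1)] D_comp[OF f(1) g(1)] D_comp[OF f'(1) g(1)]
          D_comp[OF homs_ops(5)[OF f(1) f'(1)] g(1)] D_add[OF homs_ops(2)[OF f(1) g(1)] homs_ops(2)[OF f'(1) g(1)]]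
        by (rule um_eqI, use f(1)[unfolded homs_def] f'(1)[unfolded homs_def] g(1)[unfolded homs_def]
          in eventually_elim, auto intro: C.comp_add)
    qed
    show "Comp D (HAdd D G G') F = HAdd D (Comp D G F) (Comp D G' F)" if extra: "G' \<in> Hom D P2 P3"
    proof -
      obtain g' where g': "homs g' X2 X3" "G' = um g'"
        by (rule D_homE[OF extra[unfolded X2(2) X3(2)] X2(1) X3(1)])
      show ?thesis
        unfolding f(2) g'(2) g(2) D_add[OF g(1) g'(1)] D_comp[OF f(1) g(1)] D_comp[OF f(1) g'(1)]
          D_comp[OF f(1) homs_ops(5)[OF g(1) g'(1)]] D_add[OF homs_ops(2)[OF f(1) g(1)] homs_ops(2)[OF f(1) g'(1)]]
        by (rule um_eqI, use f(1)[unfolded homs_def] g'(1)[unfolded homs_def] g(1)[unfolded homs_def]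
          in eventually_elim, auto intro: C.comp_add)
    qed
  }
  fix P4 assume "P4 \<in> Ob D"
  then obtain X4 where X4: "obs X4" "P4 = uo X4" by (rule D_obE)
  show "Comp D (Comp D H G) F = Comp D H (Comp D G F)"
    if FGH: "F \<in> Hom D P1 P2" "G \<in> Hom D P2 P3" "H \<in> Hom D P3 P4" for F G H
  proof -
    obtain f where f: "homs f X1 X2" "F = um f"
      by (rule D_homE[OF FGH(1)[unfolded X1(2) X2(2)] X1(1) X2(1)])
    obtain g where g: "homs g X2 X3" "G = um g"
      by (rule D_homE[OF FGH(2)[unfolded X2(2) X3(2)] X2(1) X3(1)])
    obtain h where h: "homs h X3 X4" "H = um h"
      by (rule D_homE[OF FGH(3)[unfolded X3(2) X4(2)] X3(1) X4(1)])
    show ?thesis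
      unfolding f(2) g(2) h(2) D_comp[OF f(1) g(1)] D_comp[OF g(1) h(1)]
        D_comp[OF f(1) homs_ops(2)[OF g(1) h(1)]] D_comp[OF homs_ops(2)[OF f(1) g(1)] h(1)]
      by (rule um_eqI, use f(1)[unfolded homs_def] g(1)[unfolded homs_def] h(1)[unfolded homs_def]
          in eventually_elim, auto intro: C.comp_assoc)
  qed
  { fix F G
    assume FG: "F \<in> Hom D P1 P2" "G \<in> Hom D P3 P4"
    obtain f where f: "homs f X1 X2" "F = um f"
      by (rule D_homE[OF FG(1)[unfolded X1(2) X2(2)] X1(1) X2(1)])
    obtain g where g: "homs g X3 X4" "G = um g"
      by (rule D_homE[OF FG(2)[unfolded X3(2) X4(2)] X3(1) X4(1)])
    show "TMor D F G \<in> Hom D (TOb D P1 P3) (TOb D P2 P4)"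
      unfolding X1(2) X2(2) X3(2) X4(2) f(2) g(2) D_tmor[OF f(1) g(1)] D_tob[OF X1(1) X3(1)] D_tob[OF X2(1) X4(1)]
      by (rule D_homI[OF homs_ops(3)[OF f(1) g(1)]])
    show "TMor D F (Scal D c G) = Scal D c (TMor D F G)" "TMor D (Scal D c F) G = Scal D c (TMor D F G)"
      if c: "c \<in> carrier R" for c
      unfolding f(2) g(2) D_scal[OF c f(1)] D_scal[OF c g(1)] D_tmor[OF f(1) g(1)]
        D_tmor[OF homs_ops(6)[OF c f(1)] g(1)] D_tmor[OF f(1) homs_ops(6)[OF c g(1)]]
        D_scal[OF c homs_ops(3)[OF f(1) g(1)]]
      by (rule um_eqI, use f(1)[unfolded homs_def] g(1)[unfolded homs_def] in eventually_elim,
        fastforce simp: \<rho>_carrier c intro: C.tmor_scal)+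
    show "TMor D F (HAdd D G G') = HAdd D (TMor D F G) (TMor D F G')" if extra: "G' \<in> Hom D P3 P4" for G'
    proof -
      obtain g' where g': "homs g' X3 X4" "G' = um g'"
        by (rule D_homE[OF extra[unfolded X3(2) X4(2)] X3(1) X4(1)])
      show ?thesis
        unfolding f(2) g'(2) g(2) D_add[OF g(1) g'(1)] D_tmor[OF f(1) g(1)] D_tmor[OF f(1) g'(1)]
          D_tmor[OF f(1) homs_ops(5)[OF g(1) g'(1)]] D_add[OF homs_ops(3)[OF f(1) g(1)] homs_ops(3)[OF f(1) g'(1)]]
        by (rule um_eqI, use f(1)[unfolded homs_def] g'(1)[unfolded homs_def] g(1)[unfolded homs_def]
          in eventually_elim, auto intro: C.tmor_add)
    qed
    show "TMor D (HAdd D F F') G = HAdd D (TMor D F G) (TMor D F' G)" if extra: "F' \<in> Hom D P1 P2" for F'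
    proof -
      obtain f' where f': "homs f' X1 X2" "F' = um f'"
        by (rule D_homE[OF extra[unfolded X1(2) X2(2)] X1(1) X2(1)])
      show ?thesis
        unfolding f(2) f'(2) g(2) D_add[OF f(1) f'(1)] D_tmor[OF f(1) g(1)] D_tmor[OF f'(1) g(1)]
          D_tmor[OF homs_ops(5)[OF f(1) f'(1)] g(1)] D_add[OF homs_ops(3)[OF f(1) g(1)] homs_ops(3)[OF f'(1) g(1)]]
        by (rule um_eqI, use f(1)[unfolded homs_def] f'(1)[unfolded homs_def] g(1)[unfolded homs_def]
          in eventually_elim, auto intro: C.tmor_add)
    qed
  }
  fix P5 P6 assume "P5 \<in> Ob D" "P6 \<in> Ob D"
  then obtain X5 X6 where X5: "obs X5" "P5 = uo X5" and X6: "obs X6" "P6 = uo X6" unfolding D_ob by blast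
  show "TMor D (Comp D G F) (Comp D G' F') = Comp D (TMor D G G') (TMor D F F')"
    if FG: "F \<in> Hom D P1 P2" "G \<in> Hom D P2 P3" "F' \<in> Hom D P4 P5" "G' \<in> Hom D P5 P6" for F G F' G'
  proof -
    obtain f where f: "homs f X1 X2" "F = um f"
      by (rule D_homE[OF FG(1)[unfolded X1(2) X2(2)] X1(1) X2(1)])
    obtain g where g: "homs g X2 X3" "G = um g"
      by (rule D_homE[OF FG(2)[unfolded X2(2) X3(2)] X2(1) X3(1)])
    obtain f' where f': "homs f' X4 X5" "F' = um f'"
      by (rule D_homE[OF FG(3)[unfolded X4(2) X5(2)] X4(1) X5(1)])
    obtain g' where g': "homs g' X5 X6" "G' = um g'"
      by (rule D_homE[OF FG(4)[unfolded X5(2) X6(2)] X5(1) X6(1)])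
    show ?thesis
      unfolding f(2) g(2) f'(2) g'(2) D_comp[OF f(1) g(1)] D_comp[OF f'(1) g'(1)] D_tmor[OF f(1) f'(1)] D_tmor[OF g(1) g'(1)]
        D_tmor[OF homs_ops(2)[OF f(1) g(1)] homs_ops(2)[OF f'(1) g'(1)]]
        D_comp[OF homs_ops(3)[OF f(1) f'(1)] homs_ops(3)[OF g(1) g'(1)]]
    proof (rule um_eqI, use f(1)[unfolded homs_def] g(1)[unfolded homs_def] f'(1)[unfolded homs_def]
        g'(1)[unfolded homs_def] in eventually_elim)
      case (elim k)
      then show ?case
        using C.interchange[where k = k and X = "X1 k" and Y = "X2 k" and Z = "X3 k" and X' = "X4 k" and Y' = "X5 k"
          and Z' = "X6 k" and f = "f k" and g = "g k" and f' = "f' k" and g' = "g' k"] by simp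
    qed
  qed
  show "TMor D (TMor D F G) H = TMor D F (TMor D G H)"
    if FG: "F \<in> Hom D P1 P2" "G \<in> Hom D P3 P4" "H \<in> Hom D P5 P6" for F G H
  proof -
    obtain f where f: "homs f X1 X2" "F = um f"
      by (rule D_homE[OF FG(1)[unfolded X1(2) X2(2)] X1(1) X2(1)])
    obtain g where g: "homs g X3 X4" "G = um g"
      by (rule D_homE[OF FG(2)[unfolded X3(2) X4(2)] X3(1) X4(1)])
    obtain h where h: "homs h X5 X6" "H = um h"
      by (rule D_homE[OF FG(3)[unfolded X5(2) X6(2)] X5(1) X6(1)])
    show ?thesis
      unfolding f(2) g(2) h(2) D_tmor[OF f(1) g(1)] D_tmor[OF g(1) h(1)]
        D_tmor[OF f(1) homs_ops(3)[OF g(1) h(1)]] D_tmor[OF homs_ops(3)[OF f(1) g(1)] h(1)]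
    proof (rule um_eqI, use f(1)[unfolded homs_def] g(1)[unfolded homs_def] h(1)[unfolded homs_def] in eventually_elim)
      case (elim k)
      then show ?case
        using C.tmor_assoc[where k = k and X = "X1 k" and Y = "X2 k" and X' = "X3 k" and Y' = "X4 k" and X'' = "X5 k"
          and Y'' = "X6 k" and f = "f k" and f' = "g k" and f'' = "h k"] by simp
    qed
  qed
qed

lemma D_typed: "typed_lmc R D"
proof (rule typed_lmcI[OF D_lmc])
  fix P Q P' Q' F
  assume "P \<in> Ob D" "Q \<in> Ob D" "P' \<in> Ob D" "Q' \<in> Ob D" and F: "F \<in> Hom D P Q" "F \<in> Hom D P' Q'"
  then obtain X Y X' Y' where X: "obs X" "P = uo X" "obs Y" "Q = uo Y" "obs X'" "P' = uo X'" "obs Y'" "Q' = uo Y'"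
    unfolding D_ob by blast
  obtain f where f: "homs f X Y" "F = um f" using F(1) unfolding X by (rule D_homE[OF _ X(1,3)])
  obtain g where g: "homs g X' Y'" "F = um g" using F(2) unfolding X by (rule D_homE[OF _ X(5,7)])
  have "eventually (\<lambda>k. f k = g k) U"
    using ulim_eqD[OF arr_ne homs_arr[OF f(1)]] f(2) g(2) by simp
  then have "eventually (\<lambda>k. X k = X' k \<and> Y k = Y' k) U"
    using f(1) g(1) unfolding homs_def
  proof eventually_elim
    case (elim k)
    then show ?case
      using C.hom_disjoint[where k = k and X = "X k" and Y = "Y k" and X' = "X' k" and Y' = "Y' k" and f = "f k"] by simp
  qed
  then show "P = P' \<and> Q = Q'"
    unfolding X by (auto intro!: ulim_cong elim: eventually_mono)
qed

end

section \<open>Lifting Temperley--Lieb morphisms to the approximating parameters\<close>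

locale tl_approx = Q: tl_complex q for q :: complex +
  fixes U :: "'i filter" and K :: "'i \<Rightarrow> 'a ring" and qs :: "'i \<Rightarrow> 'a" and \<rho> :: "complex \<Rightarrow> 'i \<Rightarrow> 'a"
  assumes par: "\<And>k. tl_param (K k) (qs k)"
    and \<rho>_carrier [simp]: "\<And>c k. \<rho> c k \<in> carrier (K k)"
    and \<rho>_zero: "eventually (\<lambda>k. \<rho> 0 k = \<zero>\<^bsub>K k\<^esub>) U"
    and \<rho>_one: "eventually (\<lambda>k. \<rho> 1 k = \<one>\<^bsub>K k\<^esub>) U"
    and \<rho>_add: "\<And>c d. eventually (\<lambda>k. \<rho> (c + d) k = \<rho> c k \<oplus>\<^bsub>K k\<^esub> \<rho> d k) U"
    and \<rho>_mult: "\<And>c d. eventually (\<lambda>k. \<rho> (c * d) k = \<rho> c k \<otimes>\<^bsub>K k\<^esub> \<rho> d k) U"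
    and \<rho>_q: "eventually (\<lambda>k. \<rho> q k = qs k) U"
    and \<rho>_surj: "\<And>a. (\<And>k. a k \<in> carrier (K k)) \<Longrightarrow> \<exists>c. eventually (\<lambda>k. \<rho> c k = a k) U"
    and \<rho>_inj: "\<And>c. eventually (\<lambda>k. \<rho> c k = \<zero>\<^bsub>K k\<^esub>) U \<Longrightarrow> c = 0"
begin

sublocale P: tl_param "K k" "qs k" for k
  by (rule par)

lemma \<rho>_minus: "eventually (\<lambda>k. \<rho> (- c) k = \<ominus>\<^bsub>K k\<^esub> \<rho> c k) U"
  using \<rho>_add[of "- c" c] \<rho>_zero
proof eventually_elim
  case (elim k)
  then have "\<rho> (- c) k \<oplus>\<^bsub>K k\<^esub> \<rho> c k = \<zero>\<^bsub>K k\<^esub>" by simp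
  then show ?case using P.K.minus_equality[where k = k and y = "\<rho> (- c) k" and x = "\<rho> c k"] by simp
qed

lemma \<rho>_inverse: "eventually (\<lambda>k. \<rho> (inverse q) k = inv\<^bsub>K k\<^esub> qs k) U"
  using \<rho>_mult[of q "inverse q"] \<rho>_one \<rho>_q
proof eventually_elim
  case (elim k)
  then have "qs k \<otimes>\<^bsub>K k\<^esub> \<rho> (inverse q) k = \<one>\<^bsub>K k\<^esub>" using Q.q_nonzero by simp
  then show ?case
    using P.K.inv_unique'[where k = k and x = "qs k" and y = "\<rho> (inverse q) k"] P.q_closed(1)[where k = k]
      P.K.m_comm[where k = k and x = "qs k" and y = "\<rho> (inverse q) k"] by simp
qed

lemma \<rho>_loop: "eventually (\<lambda>k. \<rho> (- (q + inverse q)) k = \<ominus>\<^bsub>K k\<^esub> (qs k \<oplus>\<^bsub>K k\<^esub> inv\<^bsub>K k\<^esub> qs k)) U"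
  using \<rho>_minus[of "q + inverse q"] \<rho>_add[of q "inverse q"] \<rho>_q \<rho>_inverse
  by eventually_elim simp

abbreviation lt :: "'i \<Rightarrow> complex tl_term \<Rightarrow> 'a tl_term" where
  "lt k \<equiv> map_tl_term (\<lambda>c. \<rho> c k)"

lemma lt_hom: "tl_hom complex_field t m n \<Longrightarrow> tl_hom (K k) (lt k t) m n"
  by (induction rule: tl_hom.induct) (auto intro: tl_hom.intros)

text \<open>A derivation is finite and invokes finitely many identities between scalars. Each of
  them lifts off a null set, so the lifted derivation is valid for almost all
  \<open>k\<close>.\<close>

lemma los: "tl_eq complex_field q f g \<Longrightarrow> eventually (\<lambda>k. tl_eq (K k) (qs k) (lt k f) (lt k g)) U"
proof (induction rule: tl_eq.induct)
  case (sym f g)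
  from sym(2) show ?case by eventually_elim (rule tl_eq.sym)
next
  case (trans f g h)
  from trans(3,4) show ?case by eventually_elim (rule tl_eq.trans)
next
  case (cong_comp g m n f l g' f')
  from cong_comp(5,6) show ?case
    by eventually_elim (simp add: tl_eq.cong_comp[OF lt_hom[OF cong_comp(1)] lt_hom[OF cong_comp(2)]])
next
  case (cong_tens f f' g g')
  from cong_tens(3,4) show ?case by eventually_elim (simp add: tl_eq.cong_tens)
next
  case (cong_add f m n g f' g')
  from cong_add(5,6) show ?case
    by eventually_elim (simp add: tl_eq.cong_add[OF lt_hom[OF cong_add(1)] lt_hom[OF cong_add(2)]])
next
  case (cong_scal c f f')
  from cong_scal(3) show ?case by eventually_elim (simp add: tl_eq.cong_scal)
next
  case (scal_zero f m n)
  from \<rho>_zero show ?case by eventually_elim (simp add: tl_eq.scal_zero[OF lt_hom[OF scal_zero]])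
next
  case (scal_one f m n)
  from \<rho>_one show ?case by eventually_elim (simp add: tl_eq.scal_one[OF lt_hom[OF scal_one]])
next
  case (scal_mult a b f m n)
  from \<rho>_mult[of a b] show ?case
    by eventually_elim (simp add: tl_eq.scal_mult[OF _ _ lt_hom[OF scal_mult(3)]])
next
  case (scal_add_left a b f m n)
  from \<rho>_add[of a b] show ?case
    by eventually_elim (simp add: tl_eq.scal_add_left[OF _ _ lt_hom[OF scal_add_left(3)]])
next
  case loop
  have "\<ominus>\<^bsub>complex_field\<^esub> (q \<oplus>\<^bsub>complex_field\<^esub> inv\<^bsub>complex_field\<^esub> q) = - (q + inverse q)"
    using Q.q_nonzero by (simp add: complex_ops)
  then show ?case
    using \<rho>_loop by (auto intro!: tl_eq.loop elim!: eventually_mono simp del: minus_add_distrib)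
qed (auto intro!: always_eventually tl_eq.intros(1,8-) tl_eq.zigzag1[unfolded One_nat_def]
    tl_eq.zigzag2[unfolded One_nat_def] intro: lt_hom)

text \<open>At a single index the value depends on the chosen term, since equivalent terms may lift
  to inequivalent ones; by \<open>M_cl\<close> the choice is invisible for almost all
  \<open>k\<close>.\<close>

definition M :: "'i \<Rightarrow> complex tl_term set \<Rightarrow> 'a tl_term set" where
  "M k F = P.cl k (lt k (SOME t. t \<in> F))"

lemma M_repr:
  assumes "tl_hom complex_field t m n"
  shows "tl_eq complex_field q t (SOME s. s \<in> Q.cl t)"
  using someI[of "\<lambda>s. s \<in> Q.cl t", OF Q.cl_self[OF assms]] by (simp add: Q.mem_cl)

lemma M_cl:
  assumes "tl_hom complex_field t m n"
  shows "eventually (\<lambda>k. M k (Q.cl t) = P.cl k (lt k t)) U"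
  using los[OF M_repr[OF assms]] by eventually_elim (simp add: M_def P.cl_eq)

lemma M_arr [simp]:
  assumes "Q.T.arr F"
  shows "P.T.arr k (M k F)" "P.T.dm k (M k F) = Q.T.dm F" "P.T.cd k (M k F) = Q.T.cd F"
proof -
  obtain t where t: "F = Q.cl t" "tl_hom complex_field t (Q.T.dm F) (Q.T.cd F)"
    by (rule Q.T_arrE[OF assms])
  have "tl_hom complex_field (SOME s. s \<in> F) (Q.T.dm F) (Q.T.cd F)"
    using Q.tl_eq_hom[OF M_repr[OF t(2)]] t tl_hom_unique by metis
  then have "tl_hom (K k) (lt k (SOME s. s \<in> F)) (Q.T.dm F) (Q.T.cd F)" by (rule lt_hom)
  from P.T_arr_cls[OF this] show "P.T.arr k (M k F)" "P.T.dm k (M k F) = Q.T.dm F" "P.T.cd k (M k F) = Q.T.cd F"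
    by (simp_all add: M_def)
qed

lemma M_id: "eventually (\<lambda>k. M k (Id Q.T n) = Id (P.T k) n) U"
  using M_cl[OF tl_hom.intros(1)[of complex_field n]] by (simp add: Q.T_sel(4) P.T_sel(4))

lemma M_cup: "eventually (\<lambda>k. M k (Q.cl TCup) = P.cl k TCup) U"
  using M_cl[OF tl_hom.intros(2)] by simp

lemma M_cap: "eventually (\<lambda>k. M k (Q.cl TCap) = P.cl k TCap) U"
  using M_cl[OF tl_hom.intros(3)] by simp

lemma M_zero: "eventually (\<lambda>k. M k (HZero Q.T m n) = HZero (P.T k) m n) U"
  using M_cl[OF tl_hom.intros(6)[of complex_field m n]] by (simp add: Q.T_sel(5) P.T_sel(5))

lemma M_comp:
  assumes "Q.T.arr f" "Q.T.arr g" "Q.T.cd f = Q.T.dm g"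
  shows "eventually (\<lambda>k. M k (Comp Q.T g f) = Comp (P.T k) (M k g) (M k f)) U"
proof -
  obtain s where s: "f = Q.cl s" "tl_hom complex_field s (Q.T.dm f) (Q.T.dm g)"
    using Q.T_arrE[OF assms(1)] assms(3) by metis
  obtain t where t: "g = Q.cl t" "tl_hom complex_field t (Q.T.dm g) (Q.T.cd g)"
    by (rule Q.T_arrE[OF assms(2)])
  show ?thesis
    using M_cl[OF s(2)] M_cl[OF t(2)] M_cl[OF tl_hom.intros(4)[OF t(2) s(2)]]
  proof eventually_elim
    case (elim k)
    then show ?case
      using Q.T_ops(1)[OF s(2) t(2)] P.T_ops(1)[OF lt_hom[OF s(2)] lt_hom[OF t(2)]] s(1) t(1) by simp
  qed
qed

lemma M_tmor:
  assumes "Q.T.arr f" "Q.T.arr g"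
  shows "eventually (\<lambda>k. M k (TMor Q.T f g) = TMor (P.T k) (M k f) (M k g)) U"
proof -
  obtain s where s: "f = Q.cl s" "tl_hom complex_field s (Q.T.dm f) (Q.T.cd f)"
    by (rule Q.T_arrE[OF assms(1)])
  obtain t where t: "g = Q.cl t" "tl_hom complex_field t (Q.T.dm g) (Q.T.cd g)"
    by (rule Q.T_arrE[OF assms(2)])
  show ?thesis
    using M_cl[OF s(2)] M_cl[OF t(2)] M_cl[OF tl_hom.intros(5)[OF s(2) t(2)]]
  proof eventually_elim
    case (elim k)
    then show ?case
      using Q.T_ops(2)[OF s(2) t(2)] P.T_ops(2)[OF lt_hom[OF s(2)] lt_hom[OF t(2)]] s(1) t(1) by simp
  qed
qed

lemma M_add:
  assumes "Q.T.arr f" "Q.T.arr g" "Q.T.dm g = Q.T.dm f" "Q.T.cd g = Q.T.cd f"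
  shows "eventually (\<lambda>k. M k (HAdd Q.T f g) = HAdd (P.T k) (M k f) (M k g)) U"
proof -
  obtain s where s: "f = Q.cl s" "tl_hom complex_field s (Q.T.dm f) (Q.T.cd f)"
    by (rule Q.T_arrE[OF assms(1)])
  obtain t where t: "g = Q.cl t" "tl_hom complex_field t (Q.T.dm f) (Q.T.cd f)"
    using Q.T_arrE[OF assms(2)] assms(3,4) by metis
  show ?thesis
    using M_cl[OF s(2)] M_cl[OF t(2)] M_cl[OF tl_hom.intros(7)[OF s(2) t(2)]]
  proof eventually_elim
    case (elim k)
    then show ?case
      using Q.T_ops(3)[OF s(2) t(2)] P.T_ops(3)[OF lt_hom[OF s(2)] lt_hom[OF t(2)]] s(1) t(1) by simp
  qed
qed

lemma M_scal:
  assumes "Q.T.arr f"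
  shows "eventually (\<lambda>k. M k (Scal Q.T c f) = Scal (P.T k) (\<rho> c k) (M k f)) U"
proof -
  obtain s where s: "f = Q.cl s" "tl_hom complex_field s (Q.T.dm f) (Q.T.cd f)"
    by (rule Q.T_arrE[OF assms(1)])
  have c: "c \<in> carrier complex_field" by simp
  show ?thesis
    using M_cl[OF s(2)] M_cl[OF tl_hom.intros(8)[OF c s(2)]]
  proof eventually_elim
    case (elim k)
    then show ?case
      using Q.T_ops(4)[OF c s(2)] P.T_ops(4)[OF \<rho>_carrier lt_hom[OF s(2)]] s(1) by simp
  qed
qed

lemma M_wh:
  assumes "Q.T.arr f"
  shows "eventually (\<lambda>k. M k (Q.T.wh a f b) = P.T.wh k a (M k f) b) U"
proof -
  have "eventually (\<lambda>k. M k (TMor Q.T (Id Q.T a) f) = TMor (P.T k) (M k (Id Q.T a)) (M k f)) U"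
    by (rule M_tmor) (use assms in simp_all)
  moreover have "eventually (\<lambda>k. M k (TMor Q.T (TMor Q.T (Id Q.T a) f) (Id Q.T b)) =
      TMor (P.T k) (M k (TMor Q.T (Id Q.T a) f)) (M k (Id Q.T b))) U"
    by (rule M_tmor) (use assms in simp_all)
  ultimately show ?thesis
    using M_id[of a] M_id[of b] unfolding Q.T.wh_def P.T.wh_def by eventually_elim simp
qed

lemma M_cupn: "eventually (\<lambda>k. M k (Q.T.cupn n) = P.T.cupn k n) U"
proof (induction n)
  case 0
  show ?case using M_id[of 0] by simp
next
  case (Suc n)
  have "eventually (\<lambda>k. M k (Comp Q.T (Q.T.wh n (Q.cl TCup) n) (Q.T.cupn n)) =
      Comp (P.T k) (M k (Q.T.wh n (Q.cl TCup) n)) (M k (Q.T.cupn n))) U"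
    by (rule M_comp) simp_all
  with Suc M_cup M_wh[of "Q.cl TCup" n n, OF Q.T.cup_cap_arr(1)]
  show ?case by eventually_elim (simp add: Q.T.cupn_Suc P.T.cupn_Suc)
qed

lemma M_capn: "eventually (\<lambda>k. M k (Q.T.capn n) = P.T.capn k n) U"
proof (induction n)
  case 0
  show ?case using M_id[of 0] by simp
next
  case (Suc n)
  have "eventually (\<lambda>k. M k (Comp Q.T (Q.T.capn n) (Q.T.wh n (Q.cl TCap) n)) =
      Comp (P.T k) (M k (Q.T.capn n)) (M k (Q.T.wh n (Q.cl TCap) n))) U"
    by (rule M_comp) simp_all
  with Suc M_cap M_wh[of "Q.cl TCap" n n, OF Q.T.cup_cap_arr(4)]
  show ?case by eventually_elim (simp add: Q.T.capn_Suc P.T.capn_Suc)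
qed

lemma M_hsum:
  assumes "\<And>i. i < n \<Longrightarrow> Q.T.arr (f i)" "\<And>i. i < n \<Longrightarrow> Q.T.dm (f i) = a" "\<And>i. i < n \<Longrightarrow> Q.T.cd (f i) = b"
  shows "eventually (\<lambda>k. M k (hom_sum Q.T a b f n) = hom_sum (P.T k) a b (\<lambda>i. M k (f i)) n) U"
  using assms
proof (induction n)
  case 0
  show ?case using M_zero[of a b] by simp
next
  case (Suc n)
  have "eventually (\<lambda>k. M k (HAdd Q.T (hom_sum Q.T a b f n) (f n)) =
      HAdd (P.T k) (M k (hom_sum Q.T a b f n)) (M k (f n))) U"
    by (rule M_add) (use Suc.prems in simp_all)
  moreover have "eventually (\<lambda>k. M k (hom_sum Q.T a b f n) = hom_sum (P.T k) a b (\<lambda>i. M k (f i)) n) U"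
    by (rule Suc.IH) (use Suc.prems in simp_all)
  ultimately show ?case by eventually_elim simp
qed

lemma M_tr:
  assumes "Q.T.arr f" "Q.T.dm f = n" "Q.T.cd f = n"
  shows "eventually (\<lambda>k. M k (Q.T.tr n f) = P.T.tr k n (M k f)) U"
proof -
  have "eventually (\<lambda>k. M k (Comp Q.T (Q.T.capn n) (Q.T.wh 0 f n)) = Comp (P.T k) (M k (Q.T.capn n)) (M k (Q.T.wh 0 f n))) U"
    by (rule M_comp) (use assms in simp_all)
  moreover have "eventually (\<lambda>k. M k (Comp Q.T (Comp Q.T (Q.T.capn n) (Q.T.wh 0 f n)) (Q.T.cupn n)) =
      Comp (P.T k) (M k (Comp Q.T (Q.T.capn n) (Q.T.wh 0 f n))) (M k (Q.T.cupn n))) U"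
    by (rule M_comp) (use assms in simp_all)
  ultimately show ?thesis
    using M_cupn[of n] M_capn[of n] M_wh[OF assms(1), of 0 n]
    by eventually_elim (simp add: Q.T.tr_def P.T.tr_def)
qed

text \<open>Morphisms to \<open>0\<close> are sums of diagrams whose number does not depend on the parameter, so a sequence
  of such morphisms lifts coefficientwise.\<close>

lemma M_full_0:
  assumes "\<And>k. P.T.arr k (g k) \<and> P.T.dm k (g k) = n \<and> P.T.cd k (g k) = 0"
  shows "\<exists>f. Q.T.arr f \<and> Q.T.dm f = n \<and> Q.T.cd f = 0 \<and> eventually (\<lambda>k. M k f = g k) U"
  using assms
proof (induction n arbitrary: g rule: less_induct)
  case (less n)
  consider "n = 0" | "n = 1" | m where "n = Suc (Suc m)"
    by (metis One_nat_def not0_implies_Suc)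
  then show ?case
  proof cases
    case 1
    have "\<exists>a\<in>carrier (K k). g k = Scal (P.T k) a (Id (P.T k) 0)" for k
      using P.T.hom_0_0[of k "g k"] less.prems[of k] 1 by simp
    then obtain a where a: "\<And>k. a k \<in> carrier (K k)" "\<And>k. g k = Scal (P.T k) (a k) (Id (P.T k) 0)"
      by metis
    obtain c where "eventually (\<lambda>k. \<rho> c k = a k) U" using \<rho>_surj[of a] a(1) by blast
    then have "eventually (\<lambda>k. M k (Scal Q.T c (Id Q.T 0)) = g k) U"
      using M_scal[of "Id Q.T 0" c, simplified] M_id[of 0]
      by eventually_elim (simp add: a(2))
    then show ?thesis using 1 by (intro exI[of _ "Scal Q.T c (Id Q.T 0)"]) simp
  next
    case 2
    have "g k = HZero (P.T k) 1 0" for k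
      using P.T.hom_1_0[of k "g k"] less.prems[of k] 2 by simp
    then show ?thesis using M_zero[of 1 0] 2 by (intro exI[of _ "HZero Q.T 1 0"]) simp
  next
    case (3 m)
    define R where "R k s \<longleftrightarrow> (\<forall>p\<le>m. P.T.arr k (s p) \<and> P.T.dm k (s p) = m \<and> P.T.cd k (s p) = 0) \<and>
        g k = hom_sum (P.T k) (Suc (Suc m)) 0 (\<lambda>p. Comp (P.T k) (s p) (P.T.wh k p (P.cl k TCap) (m - p))) (Suc m)" for k s
    have "\<exists>s. R k s" for k
      unfolding R_def using less.prems[of k] 3 by (intro P.T.hom_SS_0) simp_all
    then obtain s where "\<And>k. R k (s k)" by metis
    then have s: "\<And>k p. p \<le> m \<Longrightarrow> P.T.arr k (s k p) \<and> P.T.dm k (s k p) = m \<and> P.T.cd k (s k p) = 0"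
      "\<And>k. g k = hom_sum (P.T k) (Suc (Suc m)) 0 (\<lambda>p. Comp (P.T k) (s k p) (P.T.wh k p (P.cl k TCap) (m - p))) (Suc m)"
      unfolding R_def by blast+
    have "\<exists>f. Q.T.arr f \<and> Q.T.dm f = m \<and> Q.T.cd f = 0 \<and> eventually (\<lambda>k. M k f = s k p) U" if "p \<le> m" for p
      using less.IH[of m "\<lambda>k. s k p"] s(1)[OF that] 3 by simp
    then have "\<forall>p. \<exists>f. p \<le> m \<longrightarrow> Q.T.arr f \<and> Q.T.dm f = m \<and> Q.T.cd f = 0 \<and> eventually (\<lambda>k. M k f = s k p) U"
      by blast
    from choice[OF this] obtain f where f: "\<And>p. p \<le> m \<Longrightarrow>
        Q.T.arr (f p) \<and> Q.T.dm (f p) = m \<and> Q.T.cd (f p) = 0 \<and> eventually (\<lambda>k. M k (f p) = s k p) U"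
      by blast
    let ?h = "\<lambda>p. Comp Q.T (f p) (Q.T.wh p (Q.cl TCap) (m - p))"
    have h: "Q.T.arr (?h p)" "Q.T.dm (?h p) = Suc (Suc m)" "Q.T.cd (?h p) = 0" if "p < Suc m" for p
      using f[of p] that by simp_all
    have ev: "eventually (\<lambda>k. M k (?h p) = Comp (P.T k) (s k p) (P.T.wh k p (P.cl k TCap) (m - p))) U" if "p < Suc m" for p
    proof -
      have p: "p \<le> m" using that by simp
      have "eventually (\<lambda>k. M k (?h p) = Comp (P.T k) (M k (f p)) (M k (Q.T.wh p (Q.cl TCap) (m - p)))) U"
        by (rule M_comp) (use f[OF p] p in simp_all)
      with f[OF p, THEN conjunct2, THEN conjunct2, THEN conjunct2] M_cap M_wh[of "Q.cl TCap" p "m - p", OF Q.T.cup_cap_arr(4)]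
      show ?thesis by eventually_elim simp
    qed
    \<comment> \<open>Finitely many positions of the cap are involved, so one large set of indices
      serves all of them.\<close>
    have "eventually (\<lambda>k. \<forall>p\<in>{..<Suc m}. M k (?h p) = Comp (P.T k) (s k p) (P.T.wh k p (P.cl k TCap) (m - p))) U"
      using ev by (intro eventually_ball_finite) auto
    moreover have "eventually (\<lambda>k. M k (hom_sum Q.T (Suc (Suc m)) 0 ?h (Suc m)) =
        hom_sum (P.T k) (Suc (Suc m)) 0 (\<lambda>p. M k (?h p)) (Suc m)) U"
      by (rule M_hsum) (rule h, assumption)+
    ultimately have "eventually (\<lambda>k. M k (hom_sum Q.T (Suc (Suc m)) 0 ?h (Suc m)) = g k) U"
    proof eventually_elim
      case (elim k)
      show ?case unfolding elim(2) s(2) by (rule P.T.hsum_cong) (use elim(1) in blast)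
    qed
    moreover have "Q.T.arr (hom_sum Q.T (Suc (Suc m)) 0 ?h (Suc m))" "Q.T.dm (hom_sum Q.T (Suc (Suc m)) 0 ?h (Suc m)) = n"
      "Q.T.cd (hom_sum Q.T (Suc (Suc m)) 0 ?h (Suc m)) = 0"
      unfolding 3 by (rule Q.T.hsum_arr; (rule h)?; simp)+
    ultimately show ?thesis by blast
  qed
qed

text \<open>Bending moves the problem to target \<open>0\<close>, and unbending uses only operations
  that commute with \<open>M\<close> almost everywhere.\<close>

lemma M_full:
  assumes g: "\<And>k. P.T.arr k (g k)" "\<And>k. P.T.dm k (g k) = m" "\<And>k. P.T.cd k (g k) = n"
  obtains f where "Q.T.arr f" "Q.T.dm f = m" "Q.T.cd f = n" "eventually (\<lambda>k. M k f = g k) U"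
proof -
  have "P.T.arr k (P.T.bend k n (g k)) \<and> P.T.dm k (P.T.bend k n (g k)) = m + n \<and> P.T.cd k (P.T.bend k n (g k)) = 0" for k
    using g[of k] by simp
  from M_full_0[of "\<lambda>k. P.T.bend k n (g k)", OF this]
  obtain h where h: "Q.T.arr h" "Q.T.dm h = m + n" "Q.T.cd h = 0" "eventually (\<lambda>k. M k h = P.T.bend k n (g k)) U"
    by blast
  have "eventually (\<lambda>k. M k (Comp Q.T (Q.T.wh 0 h n) (Q.T.wh m (Q.T.cupn n) 0)) =
      Comp (P.T k) (M k (Q.T.wh 0 h n)) (M k (Q.T.wh m (Q.T.cupn n) 0))) U"
    by (rule M_comp) (use h in simp_all)
  then have "eventually (\<lambda>k. M k (Q.T.unbend m n h) = g k) U"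
    using h(4) M_cupn[of n] M_wh[OF h(1), of 0 n] M_wh[OF Q.T.cupn_arr(1), of m n 0]
  proof eventually_elim
    case (elim k)
    then have "M k (Q.T.unbend m n h) = P.T.unbend k m n (P.T.bend k n (g k))"
      by (simp add: Q.T.unbend_def P.T.unbend_def)
    then show ?case using P.T.unbend_bend g by simp
  qed
  then show thesis using that[of "Q.T.unbend m n h"] h by simp
qed

text \<open>A trace of \<open>f\<close> against a test morphism \<open>g\<close> at \<open>q\<close>
  is \<open>c\<close> times the identity of \<open>0\<close>, and testing with the lift of
  \<open>g\<close> makes \<open>\<rho> c k\<close> times the identity vanish. The bit-stream model
  turns this into \<open>\<rho> c k\<close> being zero, hence \<open>c = 0\<close>.\<close>

lemma M_faithful:
  assumes f: "Q.T.arr f" and neg: "eventually (\<lambda>k. P.T.tneg k (M k f)) U"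
  shows "f = HZero Q.T (Q.T.dm f) (Q.T.cd f)"
proof (rule Q.T.tneg_eq_zero, unfold Q.T.tneg_def, intro conjI allI impI)
  show "Q.T.arr f" by fact
  fix g assume g: "Q.T.arr g" "Q.T.dm g = Q.T.cd f" "Q.T.cd g = Q.T.dm f"
  let ?t = "Q.T.tr (Q.T.dm f) (Comp Q.T g f)"
  have gf: "Q.T.arr (Comp Q.T g f)" "Q.T.dm (Comp Q.T g f) = Q.T.dm f" "Q.T.cd (Comp Q.T g f) = Q.T.dm f"
    using f g by simp_all
  have t: "Q.T.arr ?t" "Q.T.dm ?t = 0" "Q.T.cd ?t = 0" using gf by (simp_all add: Q.T.tr_def)
  then obtain c where c: "?t = Scal Q.T c (Id Q.T 0)" using Q.T.hom_0_0[of ?t] by blast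
  have "eventually (\<lambda>k. M k ?t = HZero (P.T k) 0 0) U"
    using neg M_tr[OF gf] M_comp[OF f g(1) g(2)[symmetric]]
  proof eventually_elim
    case (elim k)
    then show ?case using f g unfolding P.T.tneg_def by simp
  qed
  moreover have "eventually (\<lambda>k. M k (Scal Q.T c (Id Q.T 0)) = Scal (P.T k) (\<rho> c k) (M k (Id Q.T 0))) U"
    by (rule M_scal) simp
  ultimately have "eventually (\<lambda>k. \<rho> c k = \<zero>\<^bsub>K k\<^esub>) U"
    using M_id[of 0] 
  proof eventually_elim
    case (elim k)
    then show ?case using P.scal_id0_zero[of "\<rho> c k" k] c by (simp)
  qed
  then have "c = 0" by (rule \<rho>_inj)
  then show "?t = HZero Q.T 0 0" using c Q.T.a_scal_zero[of "Id Q.T 0"] by simp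
qed

end

section \<open>Classes of morphisms in the fusion quotient\<close>

context tl_param
begin

definition fcl :: "'k tlmor \<Rightarrow> 'k tlmor set" where
  "fcl F = F.cls F"

lemma FQ_sel [simp]: "Ob FQ = Ob L" "Unt FQ = Unt L" "TOb FQ = TOb L" "Id FQ A = fcl (Id L A)"
  "HZero FQ A B = fcl (HZero L A B)"
  unfolding FQ_eq fcl_def by (simp_all only: F.quot_sel)

lemma FQ_typed: "typed_lmc K FQ"
  unfolding FQ_eq by (rule typed_lmcI[OF F.quot_lmc]) (rule F.quot_disjoint)

lemma fcl_ops:
  "\<lbrakk>L.arr f; L.arr g; L.cd f = L.dm g\<rbrakk> \<Longrightarrow> Comp FQ (fcl g) (fcl f) = fcl (Comp L g f)"
  "\<lbrakk>L.arr f; L.arr g\<rbrakk> \<Longrightarrow> TMor FQ (fcl f) (fcl g) = fcl (TMor L f g)"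
  "\<lbrakk>L.arr f; L.arr g; L.dm g = L.dm f; L.cd g = L.cd f\<rbrakk> \<Longrightarrow> HAdd FQ (fcl f) (fcl g) = fcl (HAdd L f g)"
  "\<lbrakk>c \<in> carrier K; L.arr f\<rbrakk> \<Longrightarrow> Scal FQ c (fcl f) = fcl (Scal L c f)"
  unfolding FQ_eq fcl_def by (rule F.quot_comp F.quot_tmor F.quot_add F.quot_scal; assumption)+

lemma fcl_hom: "\<lbrakk>L.arr f; L.dm f = A; L.cd f = B\<rbrakk> \<Longrightarrow> fcl f \<in> Hom FQ A B"
  unfolding FQ_eq fcl_def by (rule F.quot_homI)

lemma fcl_homE:
  assumes "F \<in> Hom FQ A B" "A \<in> Ob L" "B \<in> Ob L"
  obtains f where "F = fcl f" "L.arr f" "L.dm f = A" "L.cd f = B"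
  using F.quot_homD[of F A B] assms unfolding FQ_eq fcl_def by blast

lemma fcl_eqD: "\<lbrakk>fcl f = fcl g; L.arr f\<rbrakk> \<Longrightarrow> lneg (L.hdiff f g)"
  using F.cls_eq_iff[of f g] unfolding fcl_def negligible_rel_eq by (simp del: Image_singleton)

lemma L_homI: "\<lbrakk>A \<in> Ob L; B \<in> Ob L; A.arr f; A.dm f = fst A; A.cd f = fst B; Comp AE (snd B) f = f; Comp AE f (snd A) = f\<rbrakk>
    \<Longrightarrow> (A, B, f) \<in> Hom L A B"
  unfolding TL_eq by (simp only: A.KC_hom) blast

end

lemma ev_matrix:
  assumes "\<And>i j. \<lbrakk>i < length Y; j < length X\<rbrakk> \<Longrightarrow> eventually (\<lambda>k. a k i j = b k i j) U"
  shows "eventually (\<lambda>k. matrix X Y (a k) = matrix X Y (b k)) U"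
proof -
  have "eventually (\<lambda>k. \<forall>i\<in>{..<length Y}. \<forall>j\<in>{..<length X}. a k i j = b k i j) U"
    using assms by (intro eventually_ball_finite ballI) auto
  then show ?thesis by eventually_elim (simp add: matrix_eq_iff)
qed

section \<open>Lifting matrices and Karoubi objects\<close>

context tl_approx
begin

definition Mm :: "'i \<Rightarrow> (nat, complex tl_term set) matmor \<Rightarrow> (nat, 'a tl_term set) matmor" where
  "Mm k = (\<lambda>(X, Y, f). matrix X Y (\<lambda>i j. M k (f i j)))"

lemma Mm_matrix: "Mm k (matrix X Y f) = matrix X Y (\<lambda>i j. M k (f i j))"
  unfolding Mm_def by (simp add: matrix_eq_iff matrix_def[of X Y f])

lemma M_mtp: "Q.T.mtp X Y f \<Longrightarrow> P.T.mtp k X Y (\<lambda>i j. M k (f i j))"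
  by (simp add: Q.T.mtp_def P.T.mtp_def)

lemma Mm_arr [simp]:
  assumes "Q.A.arr F"
  shows "P.A.arr k (Mm k F)" "P.A.dm k (Mm k F) = Q.A.dm F" "P.A.cd k (Mm k F) = Q.A.cd F"
proof -
  obtain f where f: "F = matrix (Q.A.dm F) (Q.A.cd F) f" "Q.T.mtp (Q.A.dm F) (Q.A.cd F) f"
    by (rule Q.AE_arrE[OF assms])
  show "P.A.arr k (Mm k F)" "P.A.dm k (Mm k F) = Q.A.dm F" "P.A.cd k (Mm k F) = Q.A.cd F"
    using P.AE_arrI[OF M_mtp[OF f(2)]] f(1) by (simp_all add: Mm_matrix[symmetric])
qed

text \<open>Words and their tensor products do not involve the parameter, so a lifted matrix has the
  same shape at every index.\<close>

lemma list_tensor_TL: "list_tensor (P.T k) X Y = list_tensor Q.T X Y"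
  by (simp add: list_tensor_def)

lemma Mm_id: "eventually (\<lambda>k. Mm k (Id Q.AE X) = Id (P.AE k) X) U"
  unfolding Q.T.AE_id P.T.AE_id Mm_matrix
proof (rule ev_matrix)
  fix i j
  show "eventually (\<lambda>k. M k (if i = j then Id Q.T (X ! i) else HZero Q.T (X ! j) (X ! i)) =
      (if i = j then Id (P.T k) (X ! i) else HZero (P.T k) (X ! j) (X ! i))) U"
    using M_id M_zero by (cases "i = j") simp_all
qed

lemma Mm_zero: "eventually (\<lambda>k. Mm k (HZero Q.AE X Y) = HZero (P.AE k) X Y) U"
  unfolding Q.T.AE_zero P.T.AE_zero Mm_matrix by (rule ev_matrix) (rule M_zero)

lemma Mm_comp:
  assumes F: "Q.A.arr F" and G: "Q.A.arr G" and FG: "Q.A.cd F = Q.A.dm G"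
  shows "eventually (\<lambda>k. Mm k (Comp Q.AE G F) = Comp (P.AE k) (Mm k G) (Mm k F)) U"
proof -
  obtain X Y f where f: "F = matrix X Y f" "Q.T.mtp X Y f" "Q.A.cd F = Y" using Q.AE_arrE[OF F] by metis
  obtain Z g where g: "G = matrix Y Z g" "Q.T.mtp Y Z g" using Q.AE_arrE[OF G] FG f(3) by metis
  note ff = Q.mtp_arr[OF f(2)] and gg = Q.mtp_arr[OF g(2)]
  show ?thesis
    unfolding f(1) g(1) Q.T.AE_comp P.T.AE_comp Mm_matrix
  proof (rule ev_matrix)
    fix i j assume ij: "i < length Z" "j < length X"
    have "eventually (\<lambda>k. \<forall>l\<in>{..<length Y}. M k (Comp Q.T (g i l) (f l j)) = Comp (P.T k) (M k (g i l)) (M k (f l j))) U"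
      using ff gg ij by (intro eventually_ball_finite ballI M_comp) auto
    moreover have "eventually (\<lambda>k. M k (hom_sum Q.T (X ! j) (Z ! i) (\<lambda>l. Comp Q.T (g i l) (f l j)) (length Y)) =
        hom_sum (P.T k) (X ! j) (Z ! i) (\<lambda>l. M k (Comp Q.T (g i l) (f l j))) (length Y)) U"
      by (rule M_hsum) (use ff gg ij in simp_all)
    ultimately show "eventually (\<lambda>k. M k (hom_sum Q.T (X ! j) (Z ! i) (\<lambda>l. Comp Q.T (g i l) (f l j)) (length Y)) =
        hom_sum (P.T k) (X ! j) (Z ! i) (\<lambda>l. Comp (P.T k) (M k (g i l)) (M k (f l j))) (length Y)) U"
    proof eventually_elim
      case (elim k)
      show ?case unfolding elim(2) by (rule P.T.hsum_cong) (use elim(1) in blast)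
    qed
  qed
qed

lemma Mm_tmor:
  assumes F: "Q.A.arr F" and G: "Q.A.arr G"
  shows "eventually (\<lambda>k. Mm k (TMor Q.AE F G) = TMor (P.AE k) (Mm k F) (Mm k G)) U"
proof -
  obtain X Y f where f: "F = matrix X Y f" "Q.T.mtp X Y f" using Q.AE_arrE[OF F] by metis
  obtain X' Y' g where g: "G = matrix X' Y' g" "Q.T.mtp X' Y' g" using Q.AE_arrE[OF G] by metis
  show ?thesis
    unfolding f(1) g(1) Mm_matrix Q.T.AE_tmor P.T.AE_tmor list_tensor_TL
    by (rule ev_matrix, rule M_tmor)
      (use Q.mtp_arr(1)[OF f(2)] Q.mtp_arr(1)[OF g(2)] in \<open>simp_all add: div_less_index mod_less_index\<close>)
qed

lemma Mm_add:
  assumes F: "Q.A.arr F" and G: "Q.A.arr G" "Q.A.dm G = Q.A.dm F" "Q.A.cd G = Q.A.cd F"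
  shows "eventually (\<lambda>k. Mm k (HAdd Q.AE F G) = HAdd (P.AE k) (Mm k F) (Mm k G)) U"
proof -
  obtain X Y f where f: "F = matrix X Y f" "Q.T.mtp X Y f" "X = Q.A.dm F" "Y = Q.A.cd F"
    using Q.AE_arrE[OF F] by metis
  obtain g where g: "G = matrix X Y g" "Q.T.mtp X Y g"
    using Q.AE_arrE[OF G(1)] f(3,4) G(2,3) by metis
  show ?thesis
    unfolding f(1) g(1) Mm_matrix Q.T.AE_add P.T.AE_add
    by (rule ev_matrix, rule M_add) (use Q.mtp_arr[OF f(2)] Q.mtp_arr[OF g(2)] in simp_all)
qed

lemma Mm_scal:
  assumes F: "Q.A.arr F"
  shows "eventually (\<lambda>k. Mm k (Scal Q.AE c F) = Scal (P.AE k) (\<rho> c k) (Mm k F)) U"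
proof -
  obtain X Y f where f: "F = matrix X Y f" "Q.T.mtp X Y f" using Q.AE_arrE[OF F] by metis
  show ?thesis
    unfolding f(1) Mm_matrix Q.T.AE_scal P.T.AE_scal
    by (rule ev_matrix, rule M_scal) (use Q.mtp_arr[OF f(2)] in simp_all)
qed

lemma Mm_full:
  assumes G: "eventually (\<lambda>k. P.A.arr k (G k) \<and> P.A.dm k (G k) = X \<and> P.A.cd k (G k) = Y) U"
  obtains F where "Q.A.arr F" "Q.A.dm F = X" "Q.A.cd F = Y" "eventually (\<lambda>k. Mm k F = G k) U"
proof -
  \<comment> \<open>Entrywise fullness expects well-typed morphisms at every index, so ill-typed
    values on the exceptional set are replaced by zero.\<close>
  define H where "H k = (if P.A.arr k (G k) \<and> P.A.dm k (G k) = X \<and> P.A.cd k (G k) = Y then G k else HZero (P.AE k) X Y)" for k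
  have H: "eventually (\<lambda>k. H k = G k) U" using G by eventually_elim (simp add: H_def)
  have "P.A.arr k (H k) \<and> P.A.dm k (H k) = X \<and> P.A.cd k (H k) = Y" for k
    by (simp add: H_def)
  then have "\<exists>h. H k = matrix X Y h \<and> P.T.mtp k X Y h" for k
    using P.AE_arr_ex[where k = k and F = "H k"] by blast
  then obtain h where h: "\<And>k. H k = matrix X Y (h k)" "\<And>k. P.T.mtp k X Y (h k)" by metis
  define R where "R i j f \<longleftrightarrow> Q.T.arr f \<and> Q.T.dm f = X ! j \<and> Q.T.cd f = Y ! i \<and> eventually (\<lambda>k. M k f = h k i j) U" for i j f
  have "\<exists>f. R i j f" if ij: "i < length Y" "j < length X" for i j
  proof -
    obtain f where "Q.T.arr f" "Q.T.dm f = X ! j" "Q.T.cd f = Y ! i" "eventually (\<lambda>k. M k f = h k i j) U"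
      by (rule M_full[of "\<lambda>k. h k i j" "X ! j" "Y ! i"]) (use P.mtp_arr[OF h(2) ij] in simp_all)
    then show ?thesis unfolding R_def by blast
  qed
  then obtain f where "\<And>i j. \<lbrakk>i < length Y; j < length X\<rbrakk> \<Longrightarrow> R i j (f i j)" by metis
  then have f: "\<And>i j. \<lbrakk>i < length Y; j < length X\<rbrakk> \<Longrightarrow> Q.T.arr (f i j) \<and> Q.T.dm (f i j) = X ! j \<and>
      Q.T.cd (f i j) = Y ! i \<and> eventually (\<lambda>k. M k (f i j) = h k i j) U"
    unfolding R_def .
  then have "Q.T.mtp X Y f" by (simp add: Q.T.mtp_def)
  moreover have "eventually (\<lambda>k. Mm k (matrix X Y f) = H k) U"
    unfolding Mm_matrix h(1) by (rule ev_matrix) (use f in blast)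
  then have "eventually (\<lambda>k. Mm k (matrix X Y f) = G k) U" using H by eventually_elim simp
  ultimately show thesis using that Q.AE_arrI by blast
qed

lemma Mm_faithful:
  assumes f: "Q.T.mtp X Y f" and neg: "eventually (\<lambda>k. P.mneg k X Y (\<lambda>i j. M k (f i j))) U"
  shows "matrix X Y f = HZero Q.AE X Y"
  unfolding Q.T.AE_zero matrix_eq_iff
proof (intro conjI allI impI HOL.refl)
  fix i j assume ij: "i < length Y" "j < length X"
  have "eventually (\<lambda>k. P.T.tneg k (M k (f i j))) U"
    using neg by eventually_elim (use ij in \<open>simp add: P.mneg_def\<close>)
  then show "f i j = HZero Q.T (X ! j) (Y ! i)"
    using M_faithful[of "f i j"] Q.mtp_arr[OF f ij] by simp
qed

text \<open>The lifted matrix is idempotent only for almost all \<open>k\<close>; elsewhere the pair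
  need not be an object, which the class in the ultraproduct does not notice.\<close>

definition MO :: "'i \<Rightarrow> complex tlob \<Rightarrow> 'a tlob" where
  "MO k A = (fst A, Mm k (snd A))"

definition MF :: "'i \<Rightarrow> complex tlmor \<Rightarrow> 'a tlmor" where
  "MF k F = (MO k (fst F), MO k (fst (snd F)), Mm k (snd (snd F)))"

lemma L_ob: "A \<in> Ob Q.L \<Longrightarrow> Q.A.arr (snd A) \<and> Q.A.dm (snd A) = fst A \<and> Q.A.cd (snd A) = fst A \<and>
    Comp Q.AE (snd A) (snd A) = snd A"
  unfolding Q.TL_eq Q.A.KC_ob by simp

lemma L_arr: 
  assumes "Q.L.arr F"
  shows "F = (Q.L.dm F, Q.L.cd F, snd (snd F))" "Q.A.arr (snd (snd F))"
    "Q.A.dm (snd (snd F)) = fst (Q.L.dm F)" "Q.A.cd (snd (snd F)) = fst (Q.L.cd F)"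
    "Comp Q.AE (snd (Q.L.cd F)) (snd (snd F)) = snd (snd F)" "Comp Q.AE (snd (snd F)) (snd (Q.L.dm F)) = snd (snd F)"
proof -
  have "\<exists>f. F = (Q.L.dm F, Q.L.cd F, f) \<and> Q.A.arr f \<and> Q.A.dm f = fst (Q.L.dm F) \<and> Q.A.cd f = fst (Q.L.cd F) \<and>
      Comp Q.AE (snd (Q.L.cd F)) f = f \<and> Comp Q.AE f (snd (Q.L.dm F)) = f"
    using Q.L.arrD[OF assms] Q.A.KC_hom unfolding Q.TL_eq by blast
  then obtain f where f: "F = (Q.L.dm F, Q.L.cd F, f)" "Q.A.arr f" "Q.A.dm f = fst (Q.L.dm F)" "Q.A.cd f = fst (Q.L.cd F)"
      "Comp Q.AE (snd (Q.L.cd F)) f = f" "Comp Q.AE f (snd (Q.L.dm F)) = f" by blast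
  have "snd (snd F) = f" by (subst f(1)) simp
  then show "F = (Q.L.dm F, Q.L.cd F, snd (snd F))" "Q.A.arr (snd (snd F))"
    "Q.A.dm (snd (snd F)) = fst (Q.L.dm F)" "Q.A.cd (snd (snd F)) = fst (Q.L.cd F)"
    "Comp Q.AE (snd (Q.L.cd F)) (snd (snd F)) = snd (snd F)" "Comp Q.AE (snd (snd F)) (snd (Q.L.dm F)) = snd (snd F)"
    using f by simp_all
qed

lemma MF_triple: "MF k (A, B, f) = (MO k A, MO k B, Mm k f)"
  by (simp add: MF_def)

lemma MO_ob:
  assumes "A \<in> Ob Q.L"
  shows "eventually (\<lambda>k. MO k A \<in> Ob (P.L k)) U"
proof -
  have e: "Q.A.arr (snd A)" "Q.A.dm (snd A) = fst A" "Q.A.cd (snd A) = fst A" "Comp Q.AE (snd A) (snd A) = snd A"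
    using L_ob[OF assms] by auto
  have "eventually (\<lambda>k. Mm k (Comp Q.AE (snd A) (snd A)) = Comp (P.AE k) (Mm k (snd A)) (Mm k (snd A))) U"
    by (rule Mm_comp) (use e in simp_all)
  then show ?thesis
    by eventually_elim (use e in \<open>simp add: MO_def P.TL_eq P.A.KC_ob\<close>)
qed

lemma MF_arr:
  assumes F: "Q.L.arr F"
  shows "eventually (\<lambda>k. P.L.arr k (MF k F) \<and> P.L.dm k (MF k F) = MO k (Q.L.dm F) \<and> P.L.cd k (MF k F) = MO k (Q.L.cd F)) U"
proof -
  note f = L_arr[OF F]
  have A: "Q.L.dm F \<in> Ob Q.L" "Q.L.cd F \<in> Ob Q.L" using F by simp_all
  have "eventually (\<lambda>k. Mm k (Comp Q.AE (snd (Q.L.cd F)) (snd (snd F))) = Comp (P.AE k) (Mm k (snd (Q.L.cd F))) (Mm k (snd (snd F)))) U"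
    "eventually (\<lambda>k. Mm k (Comp Q.AE (snd (snd F)) (snd (Q.L.dm F))) = Comp (P.AE k) (Mm k (snd (snd F))) (Mm k (snd (Q.L.dm F)))) U"
    by (rule Mm_comp; use f L_ob[OF A(1)] L_ob[OF A(2)] in simp)+
  then show ?thesis using MO_ob[OF A(1)] MO_ob[OF A(2)]
  proof eventually_elim
    case (elim k)
    have "MF k F = (MO k (Q.L.dm F), MO k (Q.L.cd F), Mm k (snd (snd F)))"
      using MF_triple f(1) by metis
    then have "MF k F \<in> Hom (P.L k) (MO k (Q.L.dm F)) (MO k (Q.L.cd F))"
      using elim f by (simp only:) (rule P.L_homI, simp_all add: MO_def)
    then show ?case using P.L.homD elim(3,4) by blast
  qed
qed

lemma MO_unt: "eventually (\<lambda>k. MO k (Unt Q.L) = Unt (P.L k)) U"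
  using Mm_id[of "[0]"] by eventually_elim (simp add: MO_def Q.TL_eq P.TL_eq)

lemma MO_tob:
  assumes "A \<in> Ob Q.L" "B \<in> Ob Q.L"
  shows "eventually (\<lambda>k. MO k (TOb Q.L A B) = TOb (P.L k) (MO k A) (MO k B)) U"
proof -
  have "eventually (\<lambda>k. Mm k (TMor Q.AE (snd A) (snd B)) = TMor (P.AE k) (Mm k (snd A)) (Mm k (snd B))) U"
    by (rule Mm_tmor) (use L_ob[OF assms(1)] L_ob[OF assms(2)] in simp_all)
  then show ?thesis
    by eventually_elim (simp add: MO_def Q.TL_eq P.TL_eq kar_tensor_def list_tensor_TL)
qed

lemma MF_id: "MF k (Id Q.L A) = Id (P.L k) (MO k A)"
  by (simp add: Q.TL_eq P.TL_eq MF_triple MO_def)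

lemma MF_zero: "eventually (\<lambda>k. MF k (HZero Q.L A B) = HZero (P.L k) (MO k A) (MO k B)) U"
  using Mm_zero[of "fst A" "fst B"] by eventually_elim (simp add: Q.TL_eq P.TL_eq MF_triple MO_def)

lemma MF_comp:
  assumes "Q.L.arr F" "Q.L.arr G" "Q.L.cd F = Q.L.dm G"
  shows "eventually (\<lambda>k. MF k (Comp Q.L G F) = Comp (P.L k) (MF k G) (MF k F)) U"
proof -
  note f = L_arr[OF assms(1)] and g = L_arr[OF assms(2)]
  have "eventually (\<lambda>k. Mm k (Comp Q.AE (snd (snd G)) (snd (snd F))) = Comp (P.AE k) (Mm k (snd (snd G))) (Mm k (snd (snd F)))) U"
    by (rule Mm_comp) (use f g assms in simp_all)
  then show ?thesis
    by eventually_elim (subst (1 2) f(1), subst (1 2) g(1), simp add: Q.TL_eq P.TL_eq Q.A.KC_ops P.A.KC_ops MF_triple)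
qed

lemma MF_tmor:
  assumes "Q.L.arr F" "Q.L.arr G"
  shows "eventually (\<lambda>k. MF k (TMor Q.L F G) = TMor (P.L k) (MF k F) (MF k G)) U"
proof -
  note f = L_arr[OF assms(1)] and g = L_arr[OF assms(2)]
  have "eventually (\<lambda>k. Mm k (TMor Q.AE (snd (snd F)) (snd (snd G))) = TMor (P.AE k) (Mm k (snd (snd F))) (Mm k (snd (snd G)))) U"
    by (rule Mm_tmor) (use f g assms in simp_all)
  moreover have "Q.L.dm F \<in> Ob Q.L" "Q.L.cd F \<in> Ob Q.L" "Q.L.dm G \<in> Ob Q.L" "Q.L.cd G \<in> Ob Q.L"
    using assms by simp_all
  then have "eventually (\<lambda>k. MO k (TOb Q.L (Q.L.dm F) (Q.L.dm G)) = TOb (P.L k) (MO k (Q.L.dm F)) (MO k (Q.L.dm G))) U"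
    "eventually (\<lambda>k. MO k (TOb Q.L (Q.L.cd F) (Q.L.cd G)) = TOb (P.L k) (MO k (Q.L.cd F)) (MO k (Q.L.cd G))) U"
    by (simp_all only: MO_tob)
  ultimately show ?thesis
    by eventually_elim (subst (1 2) f(1), subst (1 2) g(1), simp add: Q.TL_eq P.TL_eq Q.A.KC_ops P.A.KC_ops MF_triple)
qed

lemma MF_add:
  assumes "Q.L.arr F" "Q.L.arr G" "Q.L.dm G = Q.L.dm F" "Q.L.cd G = Q.L.cd F"
  shows "eventually (\<lambda>k. MF k (HAdd Q.L F G) = HAdd (P.L k) (MF k F) (MF k G)) U"
proof -
  note f = L_arr[OF assms(1)] and g = L_arr[OF assms(2)]
  have "eventually (\<lambda>k. Mm k (HAdd Q.AE (snd (snd F)) (snd (snd G))) = HAdd (P.AE k) (Mm k (snd (snd F))) (Mm k (snd (snd G)))) U"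
    by (rule Mm_add) (use f g assms in simp_all)
  then show ?thesis
    by eventually_elim (subst (1 2) f(1), subst (1 2) g(1), simp add: Q.TL_eq P.TL_eq Q.A.KC_ops P.A.KC_ops MF_triple)
qed

lemma MF_scal:
  assumes "Q.L.arr F"
  shows "eventually (\<lambda>k. MF k (Scal Q.L c F) = Scal (P.L k) (\<rho> c k) (MF k F)) U"
proof -
  note f = L_arr[OF assms(1)]
  have "eventually (\<lambda>k. Mm k (Scal Q.AE c (snd (snd F))) = Scal (P.AE k) (\<rho> c k) (Mm k (snd (snd F)))) U"
    by (rule Mm_scal) (use f in simp_all)
  then show ?thesis
    by eventually_elim (subst (1 2) f(1), simp add: Q.TL_eq P.TL_eq Q.A.KC_ops P.A.KC_ops MF_triple)
qed

lemma MF_full: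
  assumes A: "A \<in> Ob Q.L" and B: "B \<in> Ob Q.L"
    and G: "eventually (\<lambda>k. G k \<in> Hom (P.L k) (MO k A) (MO k B)) U"
  obtains F where "F \<in> Hom Q.L A B" "eventually (\<lambda>k. MF k F = G k) U"
proof -
  note a = L_ob[OF A] and b = L_ob[OF B]
  have ev: "eventually (\<lambda>k. \<exists>g. G k = (MO k A, MO k B, g) \<and> P.A.arr k g \<and> P.A.dm k g = fst A \<and> P.A.cd k g = fst B \<and>
      Comp (P.AE k) (Mm k (snd B)) g = g \<and> Comp (P.AE k) g (Mm k (snd A)) = g) U"
    using G MO_ob[OF A] MO_ob[OF B]
  proof eventually_elim
    case (elim k)
    then show ?case using P.A.KC_hom[OF elim(2,3)[unfolded P.TL_eq]] unfolding P.TL_eq by (simp add: MO_def)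
  qed
  define g where "g k = snd (snd (G k))" for k
  have g: "eventually (\<lambda>k. G k = (MO k A, MO k B, g k) \<and> P.A.arr k (g k) \<and> P.A.dm k (g k) = fst A \<and> P.A.cd k (g k) = fst B \<and>
      Comp (P.AE k) (Mm k (snd B)) (g k) = g k \<and> Comp (P.AE k) (g k) (Mm k (snd A)) = g k) U"
    using ev by eventually_elim (auto simp: g_def)
  have "eventually (\<lambda>k. P.A.arr k (g k) \<and> P.A.dm k (g k) = fst A \<and> P.A.cd k (g k) = fst B) U"
    using g by eventually_elim blast
  then obtain f where f: "Q.A.arr f" "Q.A.dm f = fst A" "Q.A.cd f = fst B" "eventually (\<lambda>k. Mm k f = g k) U"
    by (rule Mm_full)
  \<comment> \<open>The matrix lifting \<open>g\<close> need not absorb the idempotents at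
    \<open>q\<close>, so it is compressed. Its lift stays \<open>g k\<close> almost everywhere,
    because \<open>g k\<close> already absorbs the lifted idempotents.\<close>
  let ?f = "Comp Q.AE (snd B) (Comp Q.AE f (snd A))"
  have "(A, B, ?f) \<in> Hom Q.L A B"
    by (rule Q.L_homI[OF A B]) (use a b f in \<open>simp_all add: Q.A.absorb Q.A.a_comp_assoc\<close>)
  moreover have "eventually (\<lambda>k. Mm k (Comp Q.AE f (snd A)) = Comp (P.AE k) (Mm k f) (Mm k (snd A))) U"
    "eventually (\<lambda>k. Mm k ?f = Comp (P.AE k) (Mm k (snd B)) (Mm k (Comp Q.AE f (snd A)))) U"
    by (rule Mm_comp; use a b f in simp)+
  then have "eventually (\<lambda>k. MF k (A, B, ?f) = G k) U"
    using f(4) g by eventually_elim (simp add: MF_triple)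
  ultimately show thesis by (rule that)
qed

lemma MF_faithful:
  assumes F: "Q.L.arr F" and neg: "eventually (\<lambda>k. P.lneg k (MF k F)) U"
  shows "F = HZero Q.L (Q.L.dm F) (Q.L.cd F)"
proof -
  obtain A B f where f: "F = (A, B, matrix (fst A) (fst B) f)" "Q.T.mtp (fst A) (fst B) f"
      "Q.L.dm F = A" "Q.L.cd F = B" by (rule Q.L_arr_cases[OF F])
  have "eventually (\<lambda>k. P.mneg k (fst A) (fst B) (\<lambda>i j. M k (f i j))) U"
    using neg unfolding f(1) MF_triple Mm_matrix P.lneg_iff by eventually_elim blast
  then have "matrix (fst A) (fst B) f = HZero Q.AE (fst A) (fst B)" by (rule Mm_faithful[OF f(2)])
  then show ?thesis unfolding f(3,4) unfolding f(1) Q.TL_eq by simp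
qed

end

section \<open>The comparison functor\<close>

locale tl_ultra = tl_approx q U K qs \<rho>
  for q :: complex and U :: "'i filter" and K :: "'i \<Rightarrow> 'a ring" and qs :: "'i \<Rightarrow> 'a"
    and \<rho> :: "complex \<Rightarrow> 'i \<Rightarrow> 'a" +
  fixes \<psi> :: "complex \<Rightarrow> ('i \<Rightarrow> 'a) set"
  assumes \<psi>_eq: "\<And>c. \<psi> c = ulim U (\<lambda>k. carrier (K k)) (\<rho> c)"
begin

sublocale V: ultra_lmc U K "\<lambda>k. fusion_quotient (K k) (qs k)" complex_field \<psi> \<rho>
  using P.FQ_typed complex_cring \<psi>_eq \<rho>_zero \<rho>_one \<rho>_add \<rho>_mult
  by (intro ultra_lmc.intro) simp_all

abbreviation D where "D \<equiv> change_scalars \<psi> (ultraproduct_cat U (\<lambda>k. fusion_quotient (K k) (qs k)))"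

sublocale D: typed_lmc complex_field D
  by (rule V.D_typed)

definition EO :: "complex tlob \<Rightarrow> ('i \<Rightarrow> 'a tlob) set" where
  "EO A = V.uo (\<lambda>k. MO k A)"

definition EM :: "complex tlmor \<Rightarrow> ('i \<Rightarrow> 'a tlmor set) set" where
  "EM F = V.um (\<lambda>k. P.fcl k (MF k F))"

lemma obs_MO: "A \<in> Ob Q.L \<Longrightarrow> V.obs (\<lambda>k. MO k A)"
  using MO_ob by (simp add: V.obs_def)

lemma homs_MF:
  assumes "Q.L.arr F"
  shows "V.homs (\<lambda>k. P.fcl k (MF k F)) (\<lambda>k. MO k (Q.L.dm F)) (\<lambda>k. MO k (Q.L.cd F))"
  unfolding V.homs_def using MF_arr[OF assms] MO_ob[OF Q.L.arrD(2)[OF assms]] MO_ob[OF Q.L.arrD(3)[OF assms]]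
proof eventually_elim
  case (elim k)
  then show ?case using P.fcl_hom[where k = k and f = "MF k F"] by simp
qed

lemma EO_ob [simp]: "A \<in> Ob Q.L \<Longrightarrow> EO A \<in> Ob D"
  unfolding V.D_ob EO_def using obs_MO by blast

lemma EM_arr [simp]:
  assumes "Q.L.arr F"
  shows "D.arr (EM F)" "D.dm (EM F) = EO (Q.L.dm F)" "D.cd (EM F) = EO (Q.L.cd F)"
proof -
  have "EM F \<in> Hom D (EO (Q.L.dm F)) (EO (Q.L.cd F))"
    unfolding EM_def EO_def by (rule V.D_homI[OF homs_MF[OF assms]])
  then show "D.arr (EM F)" "D.dm (EM F) = EO (Q.L.dm F)" "D.cd (EM F) = EO (Q.L.cd F)"
    using D.homD assms by simp_all
qed

lemma EO_unt [simp]: "EO (Unt Q.L) = Unt D"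
  unfolding EO_def V.D_unt by (rule ulim_cong) (use MO_unt in \<open>simp add: P.FQ_sel\<close>)

lemma EO_tob [simp]: "\<lbrakk>A \<in> Ob Q.L; B \<in> Ob Q.L\<rbrakk> \<Longrightarrow> EO (TOb Q.L A B) = TOb D (EO A) (EO B)"
  unfolding EO_def by (subst V.D_tob) (auto intro!: ulim_cong simp: obs_MO MO_tob)

lemma EM_id [simp]: "A \<in> Ob Q.L \<Longrightarrow> EM (Id Q.L A) = Id D (EO A)"
  unfolding EO_def EM_def V.D_id[OF obs_MO] by (rule V.um_eqI) (simp add: MF_id)

lemma EM_comp:
  assumes "Q.L.arr F" "Q.L.arr G" "Q.L.cd F = Q.L.dm G"
  shows "EM (Comp Q.L G F) = Comp D (EM G) (EM F)"
  unfolding EM_def V.D_comp[OF homs_MF[OF assms(1)] homs_MF[OF assms(2)]]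
proof (rule V.um_eqI, use MF_comp[OF assms] MF_arr[OF assms(1)] MF_arr[OF assms(2)] in eventually_elim)
  case (elim k)
  then show ?case using P.fcl_ops(1)[where k = k and f = "MF k F" and g = "MF k G"] assms by simp
qed

lemma EM_tmor:
  assumes "Q.L.arr F" "Q.L.arr G"
  shows "EM (TMor Q.L F G) = TMor D (EM F) (EM G)"
  unfolding EM_def V.D_tmor[OF homs_MF[OF assms(1)] homs_MF[OF assms(2)]]
proof (rule V.um_eqI, use MF_tmor[OF assms] MF_arr[OF assms(1)] MF_arr[OF assms(2)] in eventually_elim)
  case (elim k)
  then show ?case using P.fcl_ops(2)[where k = k and f = "MF k F" and g = "MF k G"] assms by simp
qed

lemma EM_add:
  assumes "Q.L.arr F" "Q.L.arr G" "Q.L.dm G = Q.L.dm F" "Q.L.cd G = Q.L.cd F"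
  shows "EM (HAdd Q.L F G) = HAdd D (EM F) (EM G)"
  unfolding EM_def V.D_add[OF homs_MF[OF assms(1)] homs_MF[OF assms(2)]]
proof (rule V.um_eqI, use MF_add[OF assms] MF_arr[OF assms(1)] MF_arr[OF assms(2)] in eventually_elim)
  case (elim k)
  then show ?case using P.fcl_ops(3)[where k = k and f = "MF k F" and g = "MF k G"] assms by simp
qed

lemma EM_scal:
  assumes "Q.L.arr F"
  shows "EM (Scal Q.L c F) = Scal D c (EM F)"
proof -
  have c: "c \<in> carrier complex_field" by simp
  show ?thesis
    unfolding EM_def V.D_scal[OF c homs_MF[OF assms(1)]]
  proof (rule V.um_eqI, use MF_scal[OF assms, of c] MF_arr[OF assms(1)] in eventually_elim)
    case (elim k)
    then show ?case using P.fcl_ops(4)[where k = k and f = "MF k F" and c = "\<rho> c k"] by simp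
  qed
qed

lemma EM_zero:
  assumes "A \<in> Ob Q.L" "B \<in> Ob Q.L"
  shows "EM (HZero Q.L A B) = HZero D (EO A) (EO B)"
  unfolding EM_def EO_def V.D_zero[OF obs_MO[OF assms(1)] obs_MO[OF assms(2)]]
  by (rule V.um_eqI, use MF_zero[of A B] in eventually_elim) simp

lemma EM_full:
  assumes A: "A \<in> Ob Q.L" and B: "B \<in> Ob Q.L" and G: "D.arr G" "D.dm G = EO A" "D.cd G = EO B"
  obtains F where "Q.L.arr F" "Q.L.dm F = A" "Q.L.cd F = B" "EM F = G"
proof -
  have "G \<in> Hom D (EO A) (EO B)" using D.arrD(1)[OF G(1)] G by simp
  then obtain g where g: "V.homs g (\<lambda>k. MO k A) (\<lambda>k. MO k B)" "G = V.um g"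
    unfolding EO_def by (rule V.D_homE[OF _ obs_MO[OF A] obs_MO[OF B]])
  define P where "P k h \<longleftrightarrow> g k = P.fcl k h \<and> h \<in> Hom (P.L k) (MO k A) (MO k B)" for k h
  have "eventually (\<lambda>k. \<exists>h. P k h) U"
    using g(1)[unfolded V.homs_def]
  proof eventually_elim
    case (elim k)
    then have k: "MO k A \<in> Ob (P.L k)" "MO k B \<in> Ob (P.L k)" by simp_all
    obtain h where "g k = P.fcl k h" "P.L.arr k h" "P.L.dm k h = MO k A" "P.L.cd k h = MO k B"
      by (rule P.fcl_homE[OF _ k]) (use elim in blast)
    then show ?case unfolding P_def using P.L.arrD(1)[where k = k and f = h] by (intro exI[of _ h]) simp
  qed
  then have h: "eventually (\<lambda>k. P k (SOME h. P k h)) U"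
    by eventually_elim (rule someI_ex)
  have "eventually (\<lambda>k. (SOME h. P k h) \<in> Hom (P.L k) (MO k A) (MO k B)) U"
    using h by eventually_elim (simp add: P_def)
  then obtain F where F: "F \<in> Hom Q.L A B" "eventually (\<lambda>k. MF k F = (SOME h. P k h)) U"
    by (rule MF_full[OF A B])
  have "EM F = G"
    unfolding EM_def g(2)
    by (rule V.um_eqI, use h F(2) in eventually_elim) (simp add: P_def)
  then show thesis using that Q.L.homD[OF F(1) A B] by blast
qed

lemma EM_faithful:
  assumes FG: "Q.L.arr F" "Q.L.arr G" "Q.L.dm G = Q.L.dm F" "Q.L.cd G = Q.L.cd F" and eq: "EM F = EM G"
  shows "F = G"
proof -
  have arr: "eventually (\<lambda>k. P.fcl k (MF k F) \<in> Arr (fusion_quotient (K k) (qs k))) U"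
    by (rule V.homs_arr[OF homs_MF[OF FG(1)]])
  have 1: "eventually (\<lambda>k. P.fcl k (MF k F) = P.fcl k (MF k G)) U"
    by (rule ulim_eqD[OF V.arr_ne arr]) (use eq in \<open>simp add: EM_def\<close>)
  let ?m = "Scal Q.L (\<ominus>\<^bsub>complex_field\<^esub> \<one>\<^bsub>complex_field\<^esub>) G"
  have m: "Q.L.arr ?m" "Q.L.dm ?m = Q.L.dm F" "Q.L.cd ?m = Q.L.cd F"
    using FG(2-4) Q.L.arr_scal[OF Q.L.R_minus_one FG(2)] by simp_all
  have "eventually (\<lambda>k. P.lneg k (MF k (Q.L.hdiff F G))) U"
    using 1 MF_arr[OF FG(1)] MF_add[OF FG(1) m] MF_scal[OF FG(2), of "\<ominus>\<^bsub>complex_field\<^esub> \<one>\<^bsub>complex_field\<^esub>"]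
      \<rho>_minus[of 1] \<rho>_one
  proof eventually_elim
    case (elim k)
    \<comment> \<open>The lift of a difference is the difference of the lifts, once
      \<open>\<rho>\<close> of \<open>-1\<close> is known to be \<open>-1\<close> at this
      index.\<close>
    then have "MF k (Q.L.hdiff F G) = P.L.hdiff k (MF k F) (MF k G)"
      unfolding Q.L.hdiff_def P.L.hdiff_def by (simp add: complex_ops)
    then show ?case using P.fcl_eqD[where k = k and f = "MF k F" and g = "MF k G"] elim by simp
  qed
  then have "Q.L.hdiff F G = HZero Q.L (Q.L.dm F) (Q.L.cd F)"
    using MF_faithful[of "Q.L.hdiff F G"] FG by simp
  then show ?thesis by (rule Q.L.hdiff_eqD) (use FG in simp_all)
qed

end

section \<open>Direct sums and idempotents\<close>

lemma is_direct_sumI: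
  "\<lbrakk>i \<in> Hom C X Z; j \<in> Hom C Y Z; p \<in> Hom C Z X; q \<in> Hom C Z Y; p \<cdot>\<^bsub>C\<^esub> i = Id C X; q \<cdot>\<^bsub>C\<^esub> j = Id C Y;
    p \<cdot>\<^bsub>C\<^esub> j = HZero C Y X; q \<cdot>\<^bsub>C\<^esub> i = HZero C X Y; HAdd C (i \<cdot>\<^bsub>C\<^esub> p) (j \<cdot>\<^bsub>C\<^esub> q) = Id C Z\<rbrakk>
    \<Longrightarrow> is_direct_sum C X Y Z"
  unfolding is_direct_sum_def by blast

context typed_lmc
begin

definition isoc :: "'o \<Rightarrow> 'o \<Rightarrow> bool" where
  "isoc X Y \<longleftrightarrow> (\<exists>u v. arr u \<and> dm u = X \<and> cd u = Y \<and> arr v \<and> dm v = Y \<and> cd v = X \<and> v \<cdot> u = Id C X \<and> u \<cdot> v = Id C Y)"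

lemma isoc_refl: "X \<in> Ob C \<Longrightarrow> isoc X X"
  unfolding isoc_def by (intro exI[of _ "Id C X"]) simp

lemma isoc_ob: "isoc X Y \<Longrightarrow> X \<in> Ob C \<and> Y \<in> Ob C"
  unfolding isoc_def by auto

lemma isoc_is_iso: "isoc X Y \<Longrightarrow> \<exists>u. is_iso C X Y u"
  using isoc_ob[of X Y] unfolding isoc_def is_iso_def Bex_def by (simp add: hom_iff)

lemma is_iso_id: "X \<in> Ob C \<Longrightarrow> is_iso C X X (Id C X)"
  unfolding is_iso_def by (auto simp: hom_iff intro!: exI[of _ "Id C X"])

lemma comp_cancel: "\<lbrakk>p \<cdot> i = Id C X; arr i; arr p; cd i = dm p; cd p = X; arr w; cd w = X; dm i = X\<rbrakk> \<Longrightarrow> p \<cdot> (i \<cdot> w) = w"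
  by (simp flip: a_comp_assoc)

lemma comp_cancel_zero: "\<lbrakk>p \<cdot> i = HZero C X Y; arr i; arr p; cd i = dm p; cd p = Y; arr w; cd w = X; dm i = X\<rbrakk>
    \<Longrightarrow> p \<cdot> (i \<cdot> w) = HZero C (dm w) Y"
  using arrD(3)[of p] by (simp flip: a_comp_assoc)

lemma comp_cancel_idem: "\<lbrakk>e \<cdot> e = e; arr e; dm e = cd e; arr w; cd w = cd e\<rbrakk> \<Longrightarrow> e \<cdot> (e \<cdot> w) = e \<cdot> w"
  by (simp flip: a_comp_assoc)

lemma isoc_tensor: assumes "isoc X Y" "isoc X' Y'" shows "isoc (TOb C X X') (TOb C Y Y')"
proof -
  obtain u v where u: "arr u" "dm u = X" "cd u = Y" "arr v" "dm v = Y" "cd v = X" "v \<cdot> u = Id C X" "u \<cdot> v = Id C Y"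
    using assms(1) unfolding isoc_def by blast
  obtain u' v' where u': "arr u'" "dm u' = X'" "cd u' = Y'" "arr v'" "dm v' = Y'" "cd v' = X'" "v' \<cdot> u' = Id C X'" "u' \<cdot> v' = Id C Y'"
    using assms(2) unfolding isoc_def by blast
  show ?thesis
    unfolding isoc_def using u u' isoc_ob[OF assms(1)] isoc_ob[OF assms(2)]
    by (intro exI[of _ "u \<boxtimes> u'"] exI[of _ "v \<boxtimes> v'"]) (simp add: a_interchange a_tmor_id)
qed

definition biproduct :: "'o \<Rightarrow> 'o \<Rightarrow> 'o \<Rightarrow> 'm \<Rightarrow> 'm \<Rightarrow> 'm \<Rightarrow> 'm \<Rightarrow> bool" where
  "biproduct X Y Z i j p q \<longleftrightarrow> arr i \<and> dm i = X \<and> cd i = Z \<and> arr j \<and> dm j = Y \<and> cd j = Z \<and>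
    arr p \<and> dm p = Z \<and> cd p = X \<and> arr q \<and> dm q = Z \<and> cd q = Y \<and>
    p \<cdot> i = Id C X \<and> q \<cdot> j = Id C Y \<and> p \<cdot> j = HZero C Y X \<and> q \<cdot> i = HZero C X Y \<and>
    HAdd C (i \<cdot> p) (j \<cdot> q) = Id C Z"

lemma direct_sum_iff:
  "\<lbrakk>X \<in> Ob C; Y \<in> Ob C; Z \<in> Ob C\<rbrakk> \<Longrightarrow> is_direct_sum C X Y Z \<longleftrightarrow> (\<exists>i j p q. biproduct X Y Z i j p q)"
  unfolding is_direct_sum_def biproduct_def Bex_def by (simp add: hom_iff)

text \<open>The generated class admits every object that is a direct sum of two members, so such a
  sum has to be compared with one constructed in the image.\<close>

lemma biproduct_iso:
  assumes b: "biproduct X Y Z i j p q" and b': "biproduct X' Y' Z' i' j' p' q'" and "isoc X X'" "isoc Y Y'"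
  shows "isoc Z Z'"
proof -
  obtain u u' where u: "arr u" "dm u = X" "cd u = X'" "arr u'" "dm u' = X'" "cd u' = X" "u' \<cdot> u = Id C X" "u \<cdot> u' = Id C X'"
    using assms(3) unfolding isoc_def by blast
  obtain v v' where v: "arr v" "dm v = Y" "cd v = Y'" "arr v'" "dm v' = Y'" "cd v' = Y" "v' \<cdot> v = Id C Y" "v \<cdot> v' = Id C Y'"
    using assms(4) unfolding isoc_def by blast
  note b = b[unfolded biproduct_def] and b' = b'[unfolded biproduct_def]
  have [simp]: "X \<in> Ob C" "Y \<in> Ob C" "X' \<in> Ob C" "Y' \<in> Ob C"
    using isoc_ob[OF assms(3)] isoc_ob[OF assms(4)] by simp_all
  have [simp]: "Z \<in> Ob C" "Z' \<in> Ob C" using b b' by auto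
  have eqs: "p \<cdot> i = Id C X" "q \<cdot> j = Id C Y" "p \<cdot> j = HZero C Y X" "q \<cdot> i = HZero C X Y"
     "p' \<cdot> i' = Id C X'" "q' \<cdot> j' = Id C Y'" "p' \<cdot> j' = HZero C Y' X'" "q' \<cdot> i' = HZero C X' Y'"
    using b b' by simp_all
  note c = comp_cancel[OF eqs(1)] comp_cancel[OF eqs(2)] comp_cancel_zero[OF eqs(3)] comp_cancel_zero[OF eqs(4)]
    comp_cancel[OF eqs(5)] comp_cancel[OF eqs(6)] comp_cancel_zero[OF eqs(7)] comp_cancel_zero[OF eqs(8)]
    comp_cancel[OF u(7)] comp_cancel[OF u(8)] comp_cancel[OF v(7)] comp_cancel[OF v(8)]
  show ?thesis
    unfolding isoc_def using b b' u v
    by - (rule exI[of _ "HAdd C (i' \<cdot> (u \<cdot> p)) (j' \<cdot> (v \<cdot> q))"],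
      rule exI[of _ "HAdd C (i \<cdot> (u' \<cdot> p')) (j \<cdot> (v' \<cdot> q'))"], simp add: a_comp_add a_comp_assoc c)
qed

end

section \<open>Summands, sums and splittings in the completions\<close>

context typed_piv
begin

text \<open>The complementary summand is cut out by \<open>1 - e\<close>.\<close>

lemma KC_summand:
  assumes A: "A \<in> Ob KC"
  shows "\<exists>B\<in>Ob KC. is_direct_sum KC A B (fst A, Id C (fst A))"
proof -
  obtain X e where [simp]: "A = (X, e)" by (cases A)
  have e [simp]: "X \<in> Ob C" "arr e" "dm e = X" "cd e = X" "e \<cdot> e = e" using A by (auto simp: KC_ob)
  define f where "f = hdiff (Id C X) e"
  have f [simp]: "arr f" "dm f = X" "cd f = X" by (simp_all add: f_def)
  have ef [simp]: "e \<cdot> f = HZero C X X" "f \<cdot> e = HZero C X X"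
    using hdiff_self[of e] unfolding f_def hdiff_def by (simp_all add: a_comp_add a_comp_scal)
  have sum: "HAdd C e f = Id C X"
  proof -
    have "HAdd C e f = HAdd C (Id C X) (hdiff e e)"
      unfolding f_def hdiff_def by (simp add: a_hadd_ac)
    then show ?thesis by simp
  qed
  have ff [simp]: "f \<cdot> f = f"
  proof -
    have "f = HAdd C e f \<cdot> f" unfolding sum by simp
    also have "\<dots> = f \<cdot> f" by (subst a_comp_add) simp_all
    finally show ?thesis by simp
  qed
  let ?B = "(X, f)" and ?Z = "(X, Id C X)"
  have ob: "(X, e) \<in> Ob KC" "?B \<in> Ob KC" "?Z \<in> Ob KC" by (simp_all add: KC_ob)
  have "is_direct_sum KC A ?B ?Z"
    by (rule is_direct_sumI[where i = "(A, ?Z, e)" and j = "(?B, ?Z, f)" and p = "(?Z, A, e)" and q = "(?Z, ?B, f)"])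
      (simp_all add: KC_ops KC_hom[OF ob(1,3)] KC_hom[OF ob(2,3)] KC_hom[OF ob(3,1)] KC_hom[OF ob(3,2)] sum del: split_paired_Ex)
  then show ?thesis using ob by (intro bexI[of _ ?B]) simp_all
qed

text \<open>The sum is cut out of the direct sum of the underlying objects by the block-diagonal
  idempotent with blocks \<open>e\<close> and \<open>f\<close>.\<close>

lemma KC_sum:
  assumes A: "A \<in> Ob KC" and B: "B \<in> Ob KC" and Z: "Z \<in> Ob C" "is_direct_sum C (fst A) (fst B) Z"
  shows "\<exists>S\<in>Ob KC. is_direct_sum KC A B S"
proof -
  obtain X e where [simp]: "A = (X, e)" by (cases A)
  obtain Y f where [simp]: "B = (Y, f)" by (cases B)
  have e [simp]: "X \<in> Ob C" "arr e" "dm e = X" "cd e = X" "e \<cdot> e = e" using A by (auto simp: KC_ob)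
  have f [simp]: "Y \<in> Ob C" "arr f" "dm f = Y" "cd f = Y" "f \<cdot> f = f" using B by (auto simp: KC_ob)
  obtain i j p q where b: "biproduct X Y Z i j p q" using Z direct_sum_iff by auto
  have b' [simp]: "arr i" "dm i = X" "cd i = Z" "arr j" "dm j = Y" "cd j = Z" "arr p" "dm p = Z" "cd p = X"
    "arr q" "dm q = Z" "cd q = Y" using b by (simp_all add: biproduct_def)
  have eqs: "p \<cdot> i = Id C X" "q \<cdot> j = Id C Y" "p \<cdot> j = HZero C Y X" "q \<cdot> i = HZero C X Y"
    using b by (simp_all add: biproduct_def)
  note c = eqs comp_cancel[OF eqs(1)] comp_cancel[OF eqs(2)] comp_cancel_zero[OF eqs(3)] comp_cancel_zero[OF eqs(4)]
    comp_cancel_idem[OF e(5)] comp_cancel_idem[OF f(5)]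
  note [simp] = Z(1)
  let ?S = "(Z, HAdd C (i \<cdot> (e \<cdot> p)) (j \<cdot> (f \<cdot> q)))"
  have ob: "(X, e) \<in> Ob KC" "(Y, f) \<in> Ob KC" "?S \<in> Ob KC"
    using Z by (simp_all add: KC_ob a_comp_add a_comp_assoc c)
  have "is_direct_sum KC A B ?S"
    by (rule is_direct_sumI[where i = "(A, ?S, i \<cdot> e)" and j = "(B, ?S, j \<cdot> f)" and p = "(?S, A, e \<cdot> p)" and q = "(?S, B, f \<cdot> q)"])
      (simp_all add: KC_ops KC_hom[OF ob(1,3)] KC_hom[OF ob(2,3)] KC_hom[OF ob(3,1)] KC_hom[OF ob(3,2)]
        a_comp_add a_comp_assoc c del: split_paired_Ex)
  then show ?thesis using ob(3) by (intro bexI[of _ ?S])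
qed

lemma KC_sum_id:
  assumes ob [simp]: "X \<in> Ob C" "Y \<in> Ob C" "Z \<in> Ob C" and ds: "is_direct_sum C X Y Z"
  shows "is_direct_sum KC (X, Id C X) (Y, Id C Y) (Z, Id C Z)"
proof -
  obtain i j p q where b: "biproduct X Y Z i j p q" using ds direct_sum_iff[OF ob] by blast
  let ?A = "(X, Id C X)" and ?B = "(Y, Id C Y)" and ?S = "(Z, Id C Z)"
  have ob: "?A \<in> Ob KC" "?B \<in> Ob KC" "?S \<in> Ob KC"
    by (simp_all add: KC_ob)
  show ?thesis
    by (rule is_direct_sumI[where i = "(?A, ?S, i)" and j = "(?B, ?S, j)" and p = "(?S, ?A, p)" and q = "(?S, ?B, q)"])
      (use b in \<open>simp_all add: biproduct_def KC_ops KC_hom[OF ob(1,3)] KC_hom[OF ob(2,3)] KC_hom[OF ob(3,1)] KC_hom[OF ob(3,2)]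
        del: split_paired_Ex\<close>)
qed

lemma KC_split:
  assumes A: "A \<in> Ob KC" and E: "(A, A, e) \<in> Hom KC A A" "e \<cdot> e = e"
  shows "(fst A, e) \<in> Ob KC" "((fst A, e), A, e) \<in> Hom KC (fst A, e) A" "(A, (fst A, e), e) \<in> Hom KC A (fst A, e)"
proof -
  have e: "arr e" "dm e = fst A" "cd e = fst A" "snd A \<cdot> e = e" "e \<cdot> snd A = e" "fst A \<in> Ob C"
    using E(1) A KC_hom[OF A A] by (auto simp: KC_ob)
  show ob: "(fst A, e) \<in> Ob KC" using e E(2) by (simp add: KC_ob)
  show "((fst A, e), A, e) \<in> Hom KC (fst A, e) A" "(A, (fst A, e), e) \<in> Hom KC A (fst A, e)"
    using e E(2) by (simp_all add: KC_hom[OF ob A] KC_hom[OF A ob] del: split_paired_Ex)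
qed

lemma AE_sum:
  assumes X [simp]: "set X \<subseteq> Ob C" and Y [simp]: "set Y \<subseteq> Ob C"
  shows "is_direct_sum AE X Y (X @ Y)"
proof -
  let ?n = "length X" and ?Z = "X @ Y"
  \<comment> \<open>The inclusions and projections are the block columns and block rows of the
    identity matrix of \<open>X @ Y\<close>.\<close>
  define i where "i = (\<lambda>a b. if a = b then Id C (X ! b) else HZero C (X ! b) (?Z ! a))"
  define j where "j = (\<lambda>a b. if a = ?n + b then Id C (Y ! b) else HZero C (Y ! b) (?Z ! a))"
  define p where "p = (\<lambda>a b. if a = b then Id C (X ! a) else HZero C (?Z ! b) (X ! a))"
  define q where "q = (\<lambda>a b. if b = ?n + a then Id C (Y ! a) else HZero C (?Z ! b) (Y ! a))"
  have Z [simp]: "set ?Z \<subseteq> Ob C" by simp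
  have nth [simp]: "a < ?n + length Y \<Longrightarrow> ?Z ! a \<in> Ob C" for a using nth_ob[OF Z, of a] by simp
  have nX [simp]: "a < ?n \<Longrightarrow> ?Z ! a = X ! a" for a by (simp add: nth_append)
  have nY [simp]: "?Z ! (?n + a) = Y ! a" for a by (simp add: nth_append)
  have t: "mtp X ?Z i" "mtp Y ?Z j" "mtp ?Z X p" "mtp ?Z Y q"
    by (auto simp: mtp_def i_def j_def p_def q_def)
  have hom: "matrix X ?Z i \<in> Hom AE X ?Z" "matrix Y ?Z j \<in> Hom AE Y ?Z" "matrix ?Z X p \<in> Hom AE ?Z X"
    "matrix ?Z Y q \<in> Hom AE ?Z Y"
    by (rule AE_homI[OF t(1) X Z] AE_homI[OF t(2) Y Z] AE_homI[OF t(3) Z X] AE_homI[OF t(4) Z Y])+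
  have arr: "\<lbrakk>a < ?n + length Y; b < ?n\<rbrakk> \<Longrightarrow> arr (i a b) \<and> dm (i a b) = X ! b \<and> cd (i a b) = ?Z ! a"
    "\<lbrakk>a < ?n + length Y; b < length Y\<rbrakk> \<Longrightarrow> arr (j a b) \<and> dm (j a b) = Y ! b \<and> cd (j a b) = ?Z ! a"
    "\<lbrakk>a < ?n; b < ?n + length Y\<rbrakk> \<Longrightarrow> arr (p a b) \<and> dm (p a b) = ?Z ! b \<and> cd (p a b) = X ! a"
    "\<lbrakk>a < length Y; b < ?n + length Y\<rbrakk> \<Longrightarrow> arr (q a b) \<and> dm (q a b) = ?Z ! b \<and> cd (q a b) = Y ! a" for a b
    using t by (simp_all add: mtp_def)
  \<comment> \<open>Multiplication by a column with a single identity entry, in row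
    \<open>l\<close>, selects the \<open>l\<close>-th entry of the row it is paired with.\<close>
  have col: "hom_sum C (W ! b) V (\<lambda>k. g k \<cdot> f k b) n = g l"
    if "l < n" "\<And>k. k < n \<Longrightarrow> arr (g k)" "\<And>k. k < n \<Longrightarrow> dm (g k) = D k" "\<And>k. k < n \<Longrightarrow> cd (g k) = V"
      "f l b = Id C (W ! b)" "D l = W ! b" "W ! b \<in> Ob C" "\<And>k. \<lbrakk>k < n; k \<noteq> l\<rbrakk> \<Longrightarrow> f k b = HZero C (W ! b) (D k)"
    for W b V g f n l and D :: "nat \<Rightarrow> 'o"
  proof -
    have V: "V \<in> Ob C" using arrD(3)[of "g l"] that(1,2,4) by auto
    have "hom_sum C (W ! b) V (\<lambda>k. g k \<cdot> f k b) n = g l \<cdot> f l b"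
      by (rule hsum_single[where l = l and f = "\<lambda>k. g k \<cdot> f k b"]) (use that V in \<open>simp_all\<close>)
    then show ?thesis using that by simp
  qed
  have col0: "hom_sum C (W ! b) V (\<lambda>k. g k \<cdot> f k b) n = HZero C (W ! b) V"
    if "\<And>k. k < n \<Longrightarrow> arr (g k)" "\<And>k. k < n \<Longrightarrow> dm (g k) = D k" "\<And>k. k < n \<Longrightarrow> cd (g k) = V" "W ! b \<in> Ob C" "V \<in> Ob C"
      "\<And>k. k < n \<Longrightarrow> f k b = HZero C (W ! b) (D k)"
    for W b V g f n and D :: "nat \<Rightarrow> 'o"
    by (subst hsum_cong[of _ _ "\<lambda>k. HZero C (W ! b) V"]) (use that in simp_all)
  have pi: "hom_sum C (X ! b) (X ! a) (\<lambda>k. p a k \<cdot> i k b) (length ?Z) = p a b" if "a < ?n" "b < ?n" for a b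
    by (rule col[where D = "\<lambda>k. ?Z ! k"]) (use arr(3)[OF that(1)] that in \<open>simp_all add: i_def\<close>)
  have qj: "hom_sum C (Y ! b) (Y ! a) (\<lambda>k. q a k \<cdot> j k b) (length ?Z) = q a (?n + b)" if "a < length Y" "b < length Y" for a b
    by (rule col[where D = "\<lambda>k. ?Z ! k"]) (use arr(4)[OF that(1)] that in \<open>simp_all add: j_def\<close>)
  have pj: "hom_sum C (Y ! b) (X ! a) (\<lambda>k. p a k \<cdot> j k b) (length ?Z) = p a (?n + b)" if "a < ?n" "b < length Y" for a b
    by (rule col[where D = "\<lambda>k. ?Z ! k"]) (use arr(3)[OF that(1)] that in \<open>simp_all add: j_def\<close>)
  have qi: "hom_sum C (X ! b) (Y ! a) (\<lambda>k. q a k \<cdot> i k b) (length ?Z) = q a b" if "a < length Y" "b < ?n" for a b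
    by (rule col[where D = "\<lambda>k. ?Z ! k"]) (use arr(4)[OF that(1)] that in \<open>simp_all add: i_def\<close>)
  have ip: "hom_sum C (?Z ! b) (?Z ! a) (\<lambda>k. i a k \<cdot> p k b) ?n = (if b < ?n then i a b else HZero C (?Z ! b) (?Z ! a))"
    if a: "a < ?n + length Y" and b: "b < ?n + length Y" for a b
  proof (cases "b < ?n")
    case True
    have "hom_sum C (?Z ! b) (?Z ! a) (\<lambda>k. i a k \<cdot> p k b) ?n = i a b"
      by (rule col[where D = "\<lambda>k. X ! k"]) (use arr(1)[OF a] b True in \<open>simp_all add: p_def\<close>)
    then show ?thesis using True by simp
  next
    case False
    have "hom_sum C (?Z ! b) (?Z ! a) (\<lambda>k. i a k \<cdot> p k b) ?n = HZero C (?Z ! b) (?Z ! a)"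
      by (rule col0[where D = "\<lambda>k. X ! k"]) (use arr(1)[OF a] a b False in \<open>simp_all add: p_def\<close>)
    then show ?thesis using False by simp
  qed
  have jq: "hom_sum C (?Z ! b) (?Z ! a) (\<lambda>k. j a k \<cdot> q k b) (length Y) =
      (if b < ?n then HZero C (?Z ! b) (?Z ! a) else j a (b - ?n))"
    if a: "a < ?n + length Y" and b: "b < ?n + length Y" for a b
  proof (cases "b < ?n")
    case True
    have "hom_sum C (?Z ! b) (?Z ! a) (\<lambda>k. j a k \<cdot> q k b) (length Y) = HZero C (?Z ! b) (?Z ! a)"
      by (rule col0[where D = "\<lambda>k. Y ! k"]) (use arr(2)[OF a] a b True in \<open>simp_all add: q_def\<close>)
    then show ?thesis using True by simp
  next
    case False
    then have b': "b = ?n + (b - ?n)" "b - ?n < length Y" using b by simp_all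
    have "?Z ! b = Y ! (b - ?n)" using b'(1) nY by metis
    then have "hom_sum C (?Z ! b) (?Z ! a) (\<lambda>k. j a k \<cdot> q k b) (length Y) = j a (b - ?n)"
      by (intro col[where D = "\<lambda>k. Y ! k"]) (use arr(2)[OF a] b b' False in \<open>auto simp: q_def\<close>)
    then show ?thesis using False by simp
  qed
  show ?thesis
    unfolding is_direct_sum_def
  proof (intro bexI[OF _ hom(1)] bexI[OF _ hom(2)] bexI[OF _ hom(3)] bexI[OF _ hom(4)] conjI)
    show "Comp AE (matrix ?Z X p) (matrix X ?Z i) = Id AE X"
      unfolding AE_comp AE_id matrix_eq_iff by (simp del: length_append add: pi) (simp add: p_def)
    show "Comp AE (matrix ?Z Y q) (matrix Y ?Z j) = Id AE Y"
      unfolding AE_comp AE_id matrix_eq_iff by (simp del: length_append add: qj) (simp add: q_def eq_commute)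
    show "Comp AE (matrix ?Z X p) (matrix Y ?Z j) = HZero AE Y X"
      unfolding AE_comp AE_zero matrix_eq_iff by (simp del: length_append add: pj) (simp add: p_def)
    show "Comp AE (matrix ?Z Y q) (matrix X ?Z i) = HZero AE X Y"
      unfolding AE_comp AE_zero matrix_eq_iff by (simp del: length_append add: qi) (simp add: q_def)
    show "HAdd AE (Comp AE (matrix X ?Z i) (matrix ?Z X p)) (Comp AE (matrix Y ?Z j) (matrix ?Z Y q)) = Id AE ?Z"
      unfolding AE_comp AE_add AE_id matrix_eq_iff
    proof (intro conjI allI impI HOL.refl)
      fix a b assume "a < length ?Z" "b < length ?Z"
      then have ab: "a < ?n + length Y" "b < ?n + length Y" by simp_all
      show "HAdd C (hom_sum C (?Z ! b) (?Z ! a) (\<lambda>k. i a k \<cdot> p k b) ?n) (hom_sum C (?Z ! b) (?Z ! a) (\<lambda>k. j a k \<cdot> q k b) (length Y)) =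
          (if a = b then Id C (?Z ! a) else HZero C (?Z ! b) (?Z ! a))"
      proof (cases "b < ?n")
        case True
        then show ?thesis unfolding ip[OF ab] jq[OF ab] using arr(1)[OF ab(1) True] by (simp add: i_def)
      next
        case False
        then have b': "b = ?n + (b - ?n)" "b - ?n < length Y" using ab by simp_all
        have "?Z ! b = Y ! (b - ?n)" using b'(1) nY by metis
        then show ?thesis unfolding ip[OF ab] jq[OF ab] using False b' arr(2)[OF ab(1) b'(2)] by (auto simp: j_def)
      qed
    qed
  qed
qed

end

section \<open>The generated subcategory\<close>

context tl_ultra
begin

abbreviation word :: "nat list \<Rightarrow> complex tlob" where
  "word X \<equiv> (X, Id Q.AE X)"

abbreviation G where "G \<equiv> generated D (EO (word [1]))"

lemma word_ob [simp]: "word X \<in> Ob Q.L"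
  by (simp add: Q.TL_eq Q.A.KC_ob)

lemma EM_direct_sum:
  assumes ob [simp]: "A \<in> Ob Q.L" "B \<in> Ob Q.L" "S \<in> Ob Q.L" and ds: "is_direct_sum Q.L A B S"
  obtains i j p r where "D.biproduct (EO A) (EO B) (EO S) i j p r"
proof -
  obtain i j p r where b: "Q.L.biproduct A B S i j p r" using ds Q.L.direct_sum_iff[OF ob] by blast
  have "D.biproduct (EO A) (EO B) (EO S) (EM i) (EM j) (EM p) (EM r)"
    using b unfolding D.biproduct_def Q.L.biproduct_def
    by (simp add: EM_comp[symmetric] EM_add[symmetric] EM_zero[symmetric])
  then show thesis by (rule that)
qed

lemma EM_is_direct_sum:
  assumes ob: "A \<in> Ob Q.L" "B \<in> Ob Q.L" "S \<in> Ob Q.L" and ds: "is_direct_sum Q.L A B S"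
  shows "is_direct_sum D (EO A) (EO B) (EO S)"
  by (rule EM_direct_sum[OF assms]) (use D.direct_sum_iff ob EO_ob in blast)

lemma word_append: "is_direct_sum Q.L (word X) (word Y) (word (X @ Y))"
  unfolding Q.TL_eq by (rule Q.A.KC_sum_id) (simp_all add: Q.T.AE_sum)

lemma gen_letter: "EO (word [n]) \<in> G"
proof (induction n)
  case 0
  have "word [0] = Unt Q.L" by (simp add: Q.TL_eq)
  then show ?case using generated.unt[of D "EO (word [1])"] by simp
next
  case (Suc n)
  have "word [Suc n] = TOb Q.L (word [n]) (word [1])"
    by (simp add: Q.TL_eq kar_tensor_def Q.A.a_tmor_id)
  then have "EO (word [Suc n]) = TOb D (EO (word [n])) (EO (word [1]))"
    by (simp only: EO_tob[OF word_ob word_ob])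
  then show ?case using generated.tens[OF Suc generated.gen[OF EO_ob[OF word_ob]]] by simp
qed

lemma gen_word: "EO (word X) \<in> G"
proof (induction X)
  case Nil
  \<comment> \<open>The empty word is a zero object. It is reached as a summand because
    \<open>[] @ [0]\<close> is \<open>[0]\<close>.\<close>
  have "is_direct_sum D (EO (word [])) (EO (word [0])) (EO (word [0]))"
    using EM_is_direct_sum[OF word_ob word_ob word_ob word_append, of "[]" "[0]"] by simp
  then show ?case by (rule generated.summand[OF gen_letter EO_ob[OF word_ob] EO_ob[OF word_ob]])
next
  case (Cons n X)
  have "is_direct_sum D (EO (word [n])) (EO (word X)) (EO (word (n # X)))"
    using EM_is_direct_sum[OF word_ob word_ob word_ob word_append, of "[n]" X] by simp
  then show ?case by (rule generated.sum[OF gen_letter Cons EO_ob[OF word_ob]])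
qed

text \<open>A Karoubi object is a summand of its underlying word, and a word is a direct sum of
  letters, each a tensor power of the letter \<open>1\<close>.\<close>

lemma EO_gen:
  assumes A: "A \<in> Ob Q.L"
  shows "EO A \<in> G"
proof -
  obtain B where B: "B \<in> Ob Q.L" "is_direct_sum Q.L A B (word (fst A))"
    using Q.A.KC_summand[OF A[unfolded Q.TL_eq]] unfolding Q.TL_eq by blast
  have "is_direct_sum D (EO A) (EO B) (EO (word (fst A)))"
    by (rule EM_is_direct_sum[OF A B(1) word_ob B(2)])
  then show ?thesis by (rule generated.summand[OF gen_word EO_ob[OF A] EO_ob[OF B(1)]])
qed

lemma L_sum:
  assumes A: "A \<in> Ob Q.L" and B: "B \<in> Ob Q.L"
  obtains S where "S \<in> Ob Q.L" "is_direct_sum Q.L A B S"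
proof -
  have "\<exists>S\<in>Ob Q.A.KC. is_direct_sum Q.A.KC A B S"
    by (rule Q.A.KC_sum[OF A[unfolded Q.TL_eq] B[unfolded Q.TL_eq], of "fst A @ fst B"])
      (simp_all add: Q.T.AE_sum)
  then show thesis using that unfolding Q.TL_eq by blast
qed

text \<open>Idempotents of the ultraproduct on objects in the image lift to idempotents, which split in the
  Cauchy completion.\<close>

lemma summand_in_image:
  assumes C: "C \<in> Ob Q.L" "D.isoc (EO C) Z" and b: "D.biproduct A B Z i j p r"
  shows "\<exists>A'\<in>Ob Q.L. D.isoc (EO A') A"
proof -
  obtain u v where u: "D.arr u" "D.dm u = EO C" "D.cd u = Z" "D.arr v" "D.dm v = Z" "D.cd v = EO C"
    "Comp D v u = Id D (EO C)" "Comp D u v = Id D Z" using C(2) unfolding D.isoc_def by blast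
  have ip: "D.arr i" "D.dm i = A" "D.cd i = Z" "D.arr p" "D.dm p = Z" "D.cd p = A" "Comp D p i = Id D A"
    using b by (simp_all add: D.biproduct_def)
  have [simp]: "A \<in> Ob D" "Z \<in> Ob D" using ip by auto
  note c = D.comp_cancel[OF u(7)] D.comp_cancel[OF u(8)] D.comp_cancel[OF ip(7)] ip(7) u(7,8) D.a_comp_assoc
  \<comment> \<open>The idempotent of \<open>Z\<close> that cuts out \<open>A\<close>, transported
    to \<open>EO C\<close> along the isomorphism.\<close>
  let ?\<epsilon> = "Comp D v (Comp D i (Comp D p u))"
  obtain F where F: "Q.L.arr F" "Q.L.dm F = C" "Q.L.cd F = C" "EM F = ?\<epsilon>"
    by (rule EM_full[OF C(1) C(1), of ?\<epsilon>]) (use u ip C in simp_all)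
  have idem: "Comp Q.L F F = F"
    by (rule EM_faithful) (use F u ip in \<open>simp_all add: EM_comp c\<close>)
  obtain e where e: "F = (C, C, e)" using L_arr(1)[OF F(1)] F(2,3) by metis
  have "Comp Q.AE e e = e" using idem unfolding e Q.TL_eq by (simp add: Q.A.KC_ops)
  moreover have "(C, C, e) \<in> Hom Q.L C C" using Q.L.arrD(1)[OF F(1)] F(2,3) unfolding e by simp
  ultimately have s: "(fst C, e) \<in> Ob Q.L" "((fst C, e), C, e) \<in> Hom Q.L (fst C, e) C" "(C, (fst C, e), e) \<in> Hom Q.L C (fst C, e)"
    using Q.A.KC_split[OF C(1)[unfolded Q.TL_eq], of e] unfolding Q.TL_eq by blast+
  define A' where "A' = (fst C, e)"
  define \<iota> where "\<iota> = (A', C, e)"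
  define \<pi> where "\<pi> = (C, A', e)"
  note s = s[folded A'_def, folded \<iota>_def \<pi>_def]
  have h: "Q.L.arr \<iota>" "Q.L.dm \<iota> = A'" "Q.L.cd \<iota> = C" "Q.L.arr \<pi>" "Q.L.dm \<pi> = C" "Q.L.cd \<pi> = A'"
    using Q.L.homD[OF s(2)] Q.L.homD[OF s(3)] s(1) C(1) by simp_all
  have eq: "Comp Q.L \<pi> \<iota> = Id Q.L A'" "Comp Q.L \<iota> \<pi> = F"
    using \<open>Comp Q.AE e e = e\<close> unfolding Q.TL_eq \<iota>_def \<pi>_def e A'_def by (simp_all add: Q.A.KC_ops)
  have E1: "Comp D (EM \<pi>) (EM \<iota>) = Id D (EO A')"
    using eq(1) h s(1) by (simp flip: EM_comp)
  have E2: "Comp D (EM \<iota>) (EM \<pi>) = ?\<epsilon>"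
    using eq(2) h F(4) by (simp flip: EM_comp)
  let ?a = "Comp D p (Comp D u (EM \<iota>))" and ?b = "Comp D (EM \<pi>) (Comp D v i)"
  have 1: "Comp D ?b ?a = Id D (EO A')"
  proof -
    have "Comp D ?b ?a = Comp D (EM \<pi>) (Comp D ?\<epsilon> (EM \<iota>))"
      using h u ip s(1) by (simp add: D.a_comp_assoc)
    also have "\<dots> = Comp D (Comp D (EM \<pi>) (EM \<iota>)) (Comp D (EM \<pi>) (EM \<iota>))"
      unfolding E2[symmetric] using h s(1) C(1) by (simp add: D.a_comp_assoc del: E2)
    finally show ?thesis using s(1) by (simp add: E1)
  qed
  have 2: "Comp D ?a ?b = Id D A"
  proof -
    have "Comp D ?a ?b = Comp D p (Comp D u (Comp D (Comp D (EM \<iota>) (EM \<pi>)) (Comp D v i)))"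
      using h u ip s(1) by (simp add: D.a_comp_assoc)
    also have "\<dots> = Id D A"
      unfolding E2 using u ip by (simp add: c)
    finally show ?thesis .
  qed
  have "D.isoc (EO A') A"
    unfolding D.isoc_def using 1 2 h u ip s(1)
    by - (rule exI[of _ ?a], rule exI[of _ ?b], simp)
  then show ?thesis using s(1) by blast
qed

text \<open>Membership in \<open>Ob D\<close> is carried along because the rules for the unit and
  for tensor products do not state it.\<close>

lemma gen_image: "P \<in> G \<Longrightarrow> P \<in> Ob D \<and> (\<exists>A\<in>Ob Q.L. D.isoc (EO A) P)"
proof (induction rule: generated.induct)
  case gen
  then show ?case using D.isoc_refl word_ob by blast
next
  case unt
  have "D.isoc (EO (Unt Q.L)) (Unt D)" using D.isoc_refl by simp
  then show ?case using Q.L.t_unt D.t_unt by blast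
next
  case (tens P P')
  then obtain A A' where A: "A \<in> Ob Q.L" "A' \<in> Ob Q.L" "D.isoc (EO A) P" "D.isoc (EO A') P'" by blast
  have "D.isoc (EO (TOb Q.L A A')) (TOb D P P')"
    using D.isoc_tensor[OF A(3,4)] A(1,2) by simp
  then show ?case using D.isoc_ob[of _ "TOb D P P'"] Q.L.t_tob[OF A(1,2)] by (intro conjI bexI[of _ "TOb Q.L A A'"]) simp_all
next
  case (sum P P' Z)
  then obtain A A' where A: "A \<in> Ob Q.L" "A' \<in> Ob Q.L" "D.isoc (EO A) P" "D.isoc (EO A') P'" by blast
  obtain S where S: "S \<in> Ob Q.L" "is_direct_sum Q.L A A' S" by (rule L_sum[OF A(1,2)])
  obtain i j p r where b: "D.biproduct (EO A) (EO A') (EO S) i j p r"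
    by (rule EM_direct_sum[OF A(1,2) S])
  obtain i' j' p' r' where b': "D.biproduct P P' Z i' j' p' r'"
    using D.direct_sum_iff[of P P' Z] sum.IH sum.hyps by blast
  have "D.isoc (EO S) Z" by (rule D.biproduct_iso[OF b b' A(3,4)])
  then show ?case using S(1) D.isoc_ob by (intro conjI bexI[of _ S]) simp_all
next
  case (summand Z A B)
  then obtain C where C: "C \<in> Ob Q.L" "D.isoc (EO C) Z" by blast
  obtain i j p r where b: "D.biproduct A B Z i j p r"
    using D.direct_sum_iff[of A B Z] summand.IH summand.hyps by blast
  show ?case using summand_in_image[OF C b] summand.hyps by simp
qed

abbreviation A_inf where "A_inf \<equiv> full_subcategory D G"

lemma A_inf_lmc: "linear_monoidal_category complex_field A_inf"
  using gen_image by (intro full_subcategory_lmc[OF V.D_lmc]) (auto intro: generated.intros)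

lemma A_inf_typed: "typed_lmc complex_field A_inf"
proof (rule typed_lmcI[OF A_inf_lmc])
  fix X Y X' Y' f
  assume "X \<in> Ob A_inf" "Y \<in> Ob A_inf" "X' \<in> Ob A_inf" "Y' \<in> Ob A_inf"
    and f: "f \<in> Hom A_inf X Y" "f \<in> Hom A_inf X' Y'"
  then have "X \<in> Ob D" "Y \<in> Ob D" "X' \<in> Ob D" "Y' \<in> Ob D" using gen_image by simp_all
  then show "X = X' \<and> Y = Y'" using f by (intro D.hom_disjoint[of X Y X' Y' f]) simp_all
qed

lemma EM_hom: "\<lbrakk>F \<in> Hom Q.L A B; A \<in> Ob Q.L; B \<in> Ob Q.L\<rbrakk> \<Longrightarrow> EM F \<in> Hom D (EO A) (EO B)"
  using Q.L.homD[of F A B] by (simp add: D.hom_iff)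

lemma E_functor: "is_functor Q.L A_inf EO EM"
  unfolding is_functor_def full_subcategory_sel
proof (intro conjI ballI)
  fix X Y Z f g
  assume "X \<in> Ob Q.L" "Y \<in> Ob Q.L" "Z \<in> Ob Q.L" "f \<in> Hom Q.L X Y" "g \<in> Hom Q.L Y Z"
  then show "EM (Comp Q.L g f) = Comp D (EM g) (EM f)"
    using Q.L.homD[of f X Y] Q.L.homD[of g Y Z] by (simp add: EM_comp)
qed (simp_all only: EO_gen EM_id EM_hom)

lemma E_linear: "is_linear complex_field Q.L A_inf EM"
  unfolding is_linear_def full_subcategory_sel
proof (intro conjI ballI)
  fix X Y f assume X: "X \<in> Ob Q.L" "Y \<in> Ob Q.L" "f \<in> Hom Q.L X Y"
  note f = Q.L.homD[OF X(3,1,2)]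
  show "EM (Scal Q.L c f) = Scal D c (EM f)" for c using f by (simp add: EM_scal)
  show "EM (HAdd Q.L f g) = HAdd D (EM f) (EM g)" if "g \<in> Hom Q.L X Y" for g
    using f Q.L.homD[OF that X(1,2)] by (simp add: EM_add)
qed

lemma E_equivalence: "is_equivalence Q.L A_inf EO EM"
proof (rule equivalenceI[OF Q.L.typed_lmc_axioms A_inf_typed E_functor]; (unfold full_subcategory_sel)?)
  show "\<exists>f\<in>Hom Q.L X Y. EM f = g" if g: "X \<in> Ob Q.L" "Y \<in> Ob Q.L" "g \<in> Hom D (EO X) (EO Y)" for X Y g
  proof -
    have "D.arr g" "D.dm g = EO X" "D.cd g = EO Y" using D.homD[OF g(3)] g by simp_all
    then obtain F where "Q.L.arr F" "Q.L.dm F = X" "Q.L.cd F = Y" "EM F = g"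
      by (rule EM_full[OF g(1,2)])
    then show ?thesis using Q.L.arrD(1)[of F] by (intro bexI[of _ F]) simp_all
  qed
  show "f = f'" if "X \<in> Ob Q.L" "Y \<in> Ob Q.L" "f \<in> Hom Q.L X Y" "f' \<in> Hom Q.L X Y" "EM f = EM f'" for X Y f f'
    using that Q.L.homD[of f X Y] Q.L.homD[of f' X Y] by (intro EM_faithful) simp_all
  show "\<exists>X\<in>Ob Q.L. \<exists>i. is_iso A_inf (EO X) Y i" if Y: "Y \<in> G" for Y
  proof -
    obtain A where A: "A \<in> Ob Q.L" "D.isoc (EO A) Y" using gen_image[OF Y] by blast
    obtain i where "is_iso D (EO A) Y i" using D.isoc_is_iso[OF A(2)] by blast
    then show ?thesis using A(1) unfolding is_iso_def full_subcategory_sel by blast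
  qed
qed

text \<open>\<open>EO\<close> preserves tensor products and the unit as equalities of classes, which
  is why identities can serve as coherence isomorphisms.\<close>

definition E where
  "E = \<lparr>FOb = EO, FMor = EM, FTens = (\<lambda>X Y. Id D (TOb D (EO X) (EO Y))), FUnt = Id D (Unt D)\<rparr>"

theorem E_monoidal_equivalence: "monoidal_equivalence complex_field Q.L A_inf E"
proof -
  have iso: "is_iso A_inf X X (Id D X)" if "X \<in> Ob D" for X
    using D.is_iso_id[OF that] unfolding is_iso_def full_subcategory_sel by blast
  have "monoidal_functor complex_field Q.L A_inf E"
    unfolding monoidal_functor_def Let_def E_def monfun.simps full_subcategory_sel
  proof (intro conjI ballI)
    show "linear_monoidal_category complex_field Q.L" by (rule Q.L.linear_monoidal_category_axioms)
    fix X X' Y Y' f g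
    assume "X \<in> Ob Q.L" "X' \<in> Ob Q.L" "Y \<in> Ob Q.L" "Y' \<in> Ob Q.L" "f \<in> Hom Q.L X X'" "g \<in> Hom Q.L Y Y'"
    then show "Comp D (EM (TMor Q.L f g)) (Id D (TOb D (EO X) (EO Y))) =
        Comp D (Id D (TOb D (EO X') (EO Y'))) (TMor D (EM f) (EM g))"
      using Q.L.homD[of f X X'] Q.L.homD[of g Y Y'] by (simp add: EM_tmor)
  qed (use A_inf_lmc E_functor E_linear in
      \<open>simp_all add: iso[simplified] D.a_tmor_id D.tob_assoc D.tob_unt Q.L.t_unt\<close>)
  then show ?thesis using E_equivalence by (simp add: monoidal_equivalence_def E_def)
qed

end

lemma (in approximating_data) K_cring: "cring (K k)"
proof -
  have "field (K k)"
  proof (cases "algebraic q")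
    case True
    then obtain p where "is_closure_of_prime_field (p k) (K k)" using algebraic_case by blast
    then show ?thesis by (auto simp: is_closure_of_prime_field_def algebraic_closure_def)
  qed (use transcendental_case in blast)
  then show ?thesis by (simp add: field_def domain_def)
qed

lemma ultraproduct_ring_sel:
  "carrier (ultraproduct_ring U K) = ultraproduct U (\<lambda>k. carrier (K k))"
  "monoid.mult (ultraproduct_ring U K) = umap2 U (\<lambda>k. carrier (K k)) (\<lambda>k. monoid.mult (K k))"
  "add (ultraproduct_ring U K) = umap2 U (\<lambda>k. carrier (K k)) (\<lambda>k. add (K k))"
  "one (ultraproduct_ring U K) = ulim U (\<lambda>k. carrier (K k)) (\<lambda>k. \<one>\<^bsub>K k\<^esub>)"
  by (simp_all add: ultraproduct_ring_def Let_def)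

theorem corollary4p7:
  fixes q :: complex and U :: "nat filter" and K :: "nat \<Rightarrow> 'a ring"
    and qs :: "nat \<Rightarrow> 'a" and \<kappa> :: "nat \<Rightarrow> nat" and \<phi> :: "(nat \<Rightarrow> 'a) set \<Rightarrow> complex"
  assumes "q \<noteq> 0"
    and "\<forall>n>0. q ^ n \<noteq> 1"
    and "nonprincipal_ultrafilter U"
    and "approximating_data q U K qs \<kappa> \<phi>"
  shows "\<exists>E. monoidal_equivalence complex_field (TL complex_field q) (A_infinity U K qs \<phi>) E"
proof -
  interpret approximating_data q U K qs \<kappa> \<phi> by fact
  interpret Kk: cring "K k" for k by (rule K_cring)
  let ?C = "\<lambda>k. carrier (K k)" and ?R = "ultraproduct_ring U K"
  define \<psi> where "\<psi> = inv_into (carrier ?R) \<phi>"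
  have ne: "?C k \<noteq> {}" for k by blast
  have bij: "bij_betw \<phi> (carrier ?R) UNIV"
    using ring_iso_memE(5)[OF iso] by simp
  have \<psi>: "\<psi> c \<in> ultraproduct U ?C" "\<phi> (\<psi> c) = c" for c
    using bij_betw_inv_into[OF bij] bij_betw_inv_into_right[OF bij, of c]
    by (auto simp: \<psi>_def ultraproduct_ring_sel bij_betw_def)
  have "\<exists>a. (\<forall>k. a k \<in> ?C k) \<and> \<psi> c = ulim U ?C a" for c
    using \<psi>(1)[of c] by (auto simp: ultraproduct_def)
  then obtain \<rho> where \<rho>: "\<And>c k. \<rho> c k \<in> ?C k" "\<And>c. \<psi> c = ulim U ?C (\<rho> c)" by metis
  have \<phi>\<rho>: "\<phi> (ulim U ?C (\<rho> c)) = c" for c using \<psi>(2) \<rho>(2) by simp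
  have in_U: "ulim U ?C a \<in> carrier ?R" if "\<And>k. a k \<in> ?C k" for a
    using that by (auto simp: ultraproduct_ring_sel ultraproduct_def)
  \<comment> \<open>Injectivity of \<open>\<phi>\<close> turns an identity between complex numbers
    into agreement of representing sequences almost everywhere; all the conditions on
    \<open>\<rho>\<close> except injectivity come from this principle.\<close>
  have ev: "eventually (\<lambda>k. a k = b k) U"
    if a: "\<And>k. a k \<in> ?C k" "\<And>k. b k \<in> ?C k" "\<phi> (ulim U ?C a) = \<phi> (ulim U ?C b)" for a b
  proof -
    have "ulim U ?C a = ulim U ?C b"
      using bij a(3) in_U[OF a(1)] in_U[OF a(2)] by (auto simp: bij_betw_def inj_on_def)
    then show ?thesis using a by (intro ulim_eqD[OF ne]) simp_all
  qed
  have add: "\<phi> (ulim U ?C (\<lambda>k. a k \<oplus>\<^bsub>K k\<^esub> b k)) = \<phi> (ulim U ?C a) + \<phi> (ulim U ?C b)"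
    if a: "\<And>k. a k \<in> ?C k" "\<And>k. b k \<in> ?C k" for a b
    using ring_iso_memE(3)[OF iso in_U[OF a(1)] in_U[OF a(2)]] a
    by (simp add: ultraproduct_ring_sel umap2_ulim[OF ne _ ne])
  have mult: "\<phi> (ulim U ?C (\<lambda>k. a k \<otimes>\<^bsub>K k\<^esub> b k)) = \<phi> (ulim U ?C a) * \<phi> (ulim U ?C b)"
    if a: "\<And>k. a k \<in> ?C k" "\<And>k. b k \<in> ?C k" for a b
    using ring_iso_memE(2)[OF iso in_U[OF a(1)] in_U[OF a(2)]] a
    by (simp add: ultraproduct_ring_sel umap2_ulim[OF ne _ ne])
  have one: "\<phi> (ulim U ?C (\<lambda>k. \<one>\<^bsub>K k\<^esub>)) = 1"
    using ring_iso_memE(4)[OF iso] by (simp add: ultraproduct_ring_sel)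
  \<comment> \<open>Zero plus zero is zero at every index, so the image under \<open>\<phi>\<close>
    equals its own double.\<close>
  have zero: "\<phi> (ulim U ?C (\<lambda>k. \<zero>\<^bsub>K k\<^esub>)) = 0"
    using add[of "\<lambda>k. \<zero>\<^bsub>K k\<^esub>" "\<lambda>k. \<zero>\<^bsub>K k\<^esub>"] by simp
  have qs: "qs k \<in> ?C k" for k using root_of_unity(1)[of k] by (rule Kk.Units_closed)
  interpret tl_ultra q U K qs \<rho> \<psi>
  proof (intro tl_ultra.intro tl_approx.intro tl_approx_axioms.intro tl_ultra_axioms.intro)
    show "tl_complex q" using assms(1,2) by (rule tl_complex.intro)
    show "tl_param (K k) (qs k)" for k
      using K_cring root_of_unity(1) by (intro tl_param.intro tl_param_axioms.intro)
    show "\<rho> c k \<in> carrier (K k)" "\<psi> c = ulim U ?C (\<rho> c)" for c k by (rule \<rho>)+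
    show "eventually (\<lambda>k. \<rho> 0 k = \<zero>\<^bsub>K k\<^esub>) U" "eventually (\<lambda>k. \<rho> 1 k = \<one>\<^bsub>K k\<^esub>) U"
      "eventually (\<lambda>k. \<rho> q k = qs k) U"
      by (rule ev; simp add: \<rho>(1) \<phi>\<rho> zero one qs iso_q)+
    show "eventually (\<lambda>k. \<rho> (c + d) k = \<rho> c k \<oplus>\<^bsub>K k\<^esub> \<rho> d k) U"
      "eventually (\<lambda>k. \<rho> (c * d) k = \<rho> c k \<otimes>\<^bsub>K k\<^esub> \<rho> d k) U" for c d
      by (rule ev; simp add: \<rho>(1) \<phi>\<rho> add mult)+
    show "\<exists>c. eventually (\<lambda>k. \<rho> c k = a k) U" if "\<And>k. a k \<in> carrier (K k)" for a
      by (intro exI[of _ "\<phi> (ulim U ?C a)"] ev) (simp_all add: \<rho>(1) \<phi>\<rho> that)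
    show "c = 0" if z: "eventually (\<lambda>k. \<rho> c k = \<zero>\<^bsub>K k\<^esub>) U" for c
    proof -
      have "ulim U ?C (\<rho> c) = ulim U ?C (\<lambda>k. \<zero>\<^bsub>K k\<^esub>)" using z by (rule ulim_cong)
      then show ?thesis using \<phi>\<rho>[of c] zero by simp
    qed
  qed
  \<comment> \<open>The idempotent of \<open>L1\<close> at index \<open>k\<close> is the identity
    matrix there, whereas \<open>EO\<close> lifts the identity matrix at \<open>q\<close>; the two
    agree only for almost all \<open>k\<close>, which suffices for equality of classes.\<close>
  have "X1 U K qs = EO (word [1])"
    unfolding X1_def EO_def
  proof (rule ulim_cong, use Mm_id[of "[1]"] in eventually_elim)
    case (elim k)
    then show ?case by (simp add: L1_def cauchy_embed_def MO_def)
  qed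
  then have "A_infinity U K qs \<phi> = A_inf"
    unfolding A_infinity_def fusion_ultraproduct_def \<psi>_def by simp
  then show ?thesis using E_monoidal_equivalence by metis
qed

end
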